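(* Let $\mathcal D\subset\mathbb R^d$ be a bounded domain satisfying the standing assumptions in the context and let $(X_t,V_t)_{t\ge0}$ be the stochastic billiard with reflection density $\bar\gamma$. There exist a probability measure $\chi$ on $\mathcal D\times\mathbb S^{d-1}$ and positive constants $\beta_0',\beta_1'$, not depending on the initial distribution of position and direction, such that $$\|\mathbf P[X_t\in\cdot\,,V_t\in\cdot\,]-\chi\|_{\mathsf v}\le\beta_0'e^{-\beta_1't}$$ for all $t\ge0$, where $\|\cdot\|_{\mathsf v}$ is the total variation norm.
   Context: Notation: $d\ge 2$; $\|\cdot\|$ is the Euclidean norm, $\mathcal B(x,\varepsilon)$ the open ball, $\mathbb S^{d-1}$ the unit sphere, $e=(1,0,\dots,0)$, and $\mathbb S_v=\{w\in\mathbb S^{d-1}:v\cdot w>0\}$. On $\mathbb S^{d-1}$ we integrate with respect to (unnormalized) surface measure, and $\partial\mathcal D$ carries $(d-1)$-dimensional Hausdorff measure. Standing assumptions on the domain: $\mathcal D\subset\mathbb R^d$ is open and connected, and (Lipschitz condition) for every $x\in\partial\mathcal D$ there exist $\varepsilon_x>0$, an affine isometry $\mathfrak I_x:\mathbb R^d\to\mathbb R^d$ with $\mathfrak I_x x=0$ and a Lipschitz function $f_x:\mathbb R^{d-1}\to\mathbb R$ with $f_x(0)=0$ such that $\mathfrak I_x(\mathcal D\cap\mathcal B(x,\varepsilon_x))=\{z\in\mathcal B(0,\varepsilon_x):z^{(d)}>f_x(z^{(1)},\dots,z^{(d-1)})\}$. Moreover there is a relatively open set $\tilde{\mathcal R}\subset\partial\mathcal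 D$, with $\partial\mathcal D\setminus\tilde{\mathcal R}$ of Hausdorff measure zero, such that $\partial\mathcal D$ has a local $C^1$ parametrization at each point of $\tilde{\mathcal R}$. For $x\in\tilde{\mathcal R}$, $\mathbf n(x)$ is the unit normal vector pointing into $\mathcal D$. Reflection law: $\bar\gamma$ is a probability density on $\mathbb S_e$ with $\inf_{u\in B}\bar\gamma(u)>0$ for every compact $B\subset\mathbb S_e$. $(U_x,x\in\partial\mathcal D)$ is a measurable family of orthogonal linear operators of $\mathbb R^d$ with $U_xe=\mathbf n(x)$ for all $x\in\tilde{\mathcal R}$. Case 1: $\bar\gamma(u)$ depends only on $u\cdot e$; then $\mathcal R:=\tilde{\mathcal R}$. Case 2: otherwise; then $x\mapsto U_x$ is assumed continuous at almost every $x\in\partial\mathcal D$ and $\mathcal R:=\{x\in\tilde{\mathcal R}: x\mapsto U_x\text{ is continuous at }x\}$. Stochastic billiard: for $x\in\tilde{\mathcal R},u\in\mathbb S_{\mathbf n(x)}$ or $x\in\mathcal D,u\in\mathbb S^{d-1}$ let $\mathsf r_x(u)=\inf\{t>0:x+tu\in\partial\mathcal D\}$ and $\mathsf h_x(u)=x+u\,\mathsf r_x(u)$. Let $\eta_0,\eta_1,\dots$ be i.i.d. with density $\bar\gamma$. Started from $\xi_0\in\mathcal R$: $\xi_{n+1}=\mathsf h_{\xi_n}(U_{\xi_n}\eta_n)$, $\tau_0=0$, $\tau_n=\sum_{i=0}^{n-1}\mathsf r_{\xi_i}(U_{\xi_i}\eta_i)$, and for $t\in[\tau_n,\tau_{n+1})$,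 $X_t=\xi_n+(t-\tau_n)U_{\xi_n}\eta_n$ and $V_t=U_{\xi_n}\eta_n$ (almost surely $\xi_n\in\mathcal R$ for all $n$ and $\tau_n\to\infty$). Started from $(x_0,v_0)\in\mathcal D\times\mathbb S^{d-1}$: the particle moves as $X_t=x_0+tv_0$, $V_t=v_0$ up to time $\mathsf r_{x_0}(v_0)$ and then continues as the process just described started from $\mathsf h_{x_0}(v_0)$. The initial condition may be random (independent of the $\eta$'s), provided the first boundary point visited lies in $\mathcal R$ almost surely. *)

theory Defs
  imports "HOL-Probability.Probability"
begin

text \<open>
  The space of dimension \<open>d\<close> is \<^typ>\<open>(real ^ 'm) \<times> real\<close>, so that
  \<open>d = CARD('m) + 1 \<ge> 2\<close>. For \<open>z\<close> in it, \<open>fst z\<close> collects the first \<open>d - 1\<close> coordinates and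
  \<open>snd z\<close> is the last one. The norm of the product type is the Euclidean norm.
\<close>

type_synonym 'm space = "(real ^ 'm) \<times> real"

text \<open>\<open>i\<close> is the index of the first coordinate.\<close>

definition e_vec :: "'m::finite \<Rightarrow> 'm space" where
  "e_vec i = (axis i 1, 0)"

definition half_sphere :: "'a::euclidean_space \<Rightarrow> 'a set" where
  "half_sphere v = {w \<in> sphere 0 1. v \<bullet> w > 0}"

text \<open>
  The outer measure \<open>H\<^sup>s\<close>, for a dimension \<open>s \<ge> 1\<close>, without the
  constant that makes it agree with Lebesgue measure; only its null sets are used.
  Covering sets are required to be bounded because \<^const>\<open>diameter\<close> is unspecified otherwise.
\<close>

definition hausdorff_premeasure :: "nat \<Rightarrow> real \<Rightarrow> 'a::metric_space set \<Rightarrow> ennreal" where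
  "hausdorff_premeasure s \<delta> A =
     (INF C \<in> {C :: nat \<Rightarrow> 'a set. A \<subseteq> (\<Union>k. C k) \<and> (\<forall>k. bounded (C k) \<and> diameter (C k) \<le> \<delta>)}.
        \<Sum>k. ennreal (diameter (C k) ^ s))"

definition hausdorff_measure :: "nat \<Rightarrow> 'a::metric_space set \<Rightarrow> ennreal" where
  "hausdorff_measure s A = (SUP \<delta> \<in> {0<..}. hausdorff_premeasure s \<delta> A)"

text \<open>
  Unnormalized surface measure of the unit sphere, as a Borel measure on the ambient space: the
  measure of \<open>A\<close> is \<open>d\<close> times the Lebesgue measure of the cone over \<open>A\<close> in the unit ball
  (integration in polar coordinates).
\<close>

definition sphere_measure :: "'a::euclidean_space measure" where
  "sphere_measure =
     distr (density lborel (\<lambda>x. ennreal (DIM('a)) * indicator (ball 0 1) x)) borel sgn"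

text \<open>
  The total variation norm of a finite signed measure \<open>f\<close> on the measurable space \<open>M\<close>, where
  \<open>f\<close> is given as a set function.
\<close>

definition total_variation_norm :: "'a measure \<Rightarrow> ('a set \<Rightarrow> real) \<Rightarrow> real" where
  "total_variation_norm M f =
     (SUP P \<in> {P. finite P \<and> P \<subseteq> sets M \<and> disjoint P \<and> \<Union>P = space M}. \<Sum>B\<in>P. \<bar>f B\<bar>)"

definition affine_isometry :: "('a::euclidean_space \<Rightarrow> 'a) \<Rightarrow> bool" where
  "affine_isometry I \<longleftrightarrow> (\<exists>T c. orthogonal_transformation T \<and> I = (\<lambda>z. T z + c))"

definition lipschitz_boundary :: "'m::finite space set \<Rightarrow> bool" where
  "lipschitz_boundary D \<longleftrightarrow>
     (\<forall>x \<in> frontier D. \<exists>\<epsilon> > 0. \<exists>I. \<exists>f :: real ^ 'm \<Rightarrow> real. \<exists>L.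
        affine_isometry I \<and> I x = 0 \<and> L-lipschitz_on UNIV f \<and> f 0 = 0 \<and>
        I ` (D \<inter> ball x \<epsilon>) = {z \<in> ball 0 \<epsilon>. snd z > f (fst z)})"

text \<open>
  \<open>\<phi>\<close>, with derivative \<open>\<phi>'\<close>, is a regular parametrization of class \<open>C\<^sup>1\<close> of a relative
  neighbourhood of \<open>x\<close> in \<open>S\<close>, and \<open>p\<close> is the parameter of \<open>x\<close>.
\<close>

definition C1_chart ::
  "'m::finite space set \<Rightarrow> 'm space \<Rightarrow> (real ^ 'm \<Rightarrow> 'm space) \<Rightarrow>
   (real ^ 'm \<Rightarrow> (real ^ 'm) \<Rightarrow>\<^sub>L 'm space) \<Rightarrow> real ^ 'm \<Rightarrow> bool" where
  "C1_chart S x \<phi> \<phi>' p \<longleftrightarrow>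
     (\<exists>G W \<psi>. open G \<and> open W \<and> p \<in> G \<and> x \<in> W \<and> \<phi> p = x \<and>
        homeomorphism G (S \<inter> W) \<phi> \<psi> \<and>
        (\<forall>q \<in> G. (\<phi> has_derivative blinfun_apply (\<phi>' q)) (at q)) \<and>
        continuous_on G \<phi>' \<and>
        (\<forall>q \<in> G. inj (blinfun_apply (\<phi>' q))))"

definition billiard_domain :: "'m::finite space set \<Rightarrow> 'm space set \<Rightarrow> bool" where
  "billiard_domain D Rt \<longleftrightarrow>
     open D \<and> connected D \<and> D \<noteq> {} \<and> lipschitz_boundary D \<and>
     openin (top_of_set (frontier D)) Rt \<and>
     hausdorff_measure (CARD('m)) (frontier D - Rt) = 0 \<and>
     (\<forall>x \<in> Rt. \<exists>\<phi> \<phi>' p. C1_chart (frontier D) x \<phi> \<phi>' p)"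

definition inner_normal :: "'m::finite space set \<Rightarrow> 'm space \<Rightarrow> 'm space" where
  "inner_normal D x =
     (THE v. norm v = 1 \<and>
        (\<exists>\<phi> \<phi>' p. C1_chart (frontier D) x \<phi> \<phi>' p \<and> (\<forall>w. v \<bullet> blinfun_apply (\<phi>' p) w = 0)) \<and>
        (\<exists>\<epsilon> > 0. \<forall>t. 0 < t \<and> t < \<epsilon> \<longrightarrow> x + t *\<^sub>R v \<in> D))"

definition reflection_density :: "'a::euclidean_space \<Rightarrow> ('a \<Rightarrow> real) \<Rightarrow> bool" where
  "reflection_density e \<gamma> \<longleftrightarrow>
     \<gamma> \<in> borel_measurable (restrict_space borel (half_sphere e)) \<and>
     (\<forall>u \<in> half_sphere e. 0 \<le> \<gamma> u) \<and>
     (\<integral>\<^sup>+u \<in> half_sphere e. ennreal (\<gamma> u) \<partial>sphere_measure) = 1 \<and>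
     (\<forall>B. compact B \<and> B \<noteq> {} \<and> B \<subseteq> half_sphere e \<longrightarrow> 0 < (INF u\<in>B. \<gamma> u))"

definition reflection_measure :: "'a::euclidean_space \<Rightarrow> ('a \<Rightarrow> real) \<Rightarrow> 'a measure" where
  "reflection_measure e \<gamma> =
     density sphere_measure (\<lambda>u. ennreal (\<gamma> u) * indicator (half_sphere e) u)"

definition axially_symmetric :: "'a::euclidean_space \<Rightarrow> ('a \<Rightarrow> real) \<Rightarrow> bool" where
  "axially_symmetric e \<gamma> \<longleftrightarrow> (\<exists>g. \<forall>u \<in> half_sphere e. \<gamma> u = g (u \<bullet> e))"

text \<open>
  The family is indexed by the boundary; \<open>U x\<close> is unconstrained elsewhere.
\<close>

definition reflection_frame ::
  "'m::finite space set \<Rightarrow> 'm space set \<Rightarrow> 'm space \<Rightarrow> ('m space \<Rightarrow> real) \<Rightarrow>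
   ('m space \<Rightarrow> 'm space \<Rightarrow>\<^sub>L 'm space) \<Rightarrow> bool" where
  "reflection_frame D Rt e \<gamma> U \<longleftrightarrow>
     (\<forall>x \<in> frontier D. orthogonal_transformation (blinfun_apply (U x))) \<and>
     U \<in> borel_measurable (restrict_space borel (frontier D)) \<and>
     (\<forall>x \<in> Rt. blinfun_apply (U x) e = inner_normal D x) \<and>
     (\<not> axially_symmetric e \<gamma> \<longrightarrow>
        hausdorff_measure (CARD('m)) {x \<in> frontier D. \<not> continuous (at x within frontier D) U} = 0)"

definition regular_points ::
  "'m::finite space set \<Rightarrow> 'm space set \<Rightarrow> 'm space \<Rightarrow> ('m space \<Rightarrow> real) \<Rightarrow>
   ('m space \<Rightarrow> 'm space \<Rightarrow>\<^sub>L 'm space) \<Rightarrow> 'm space set" where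
  "regular_points D Rt e \<gamma> U =
     (if axially_symmetric e \<gamma> then Rt
      else {x \<in> Rt. continuous (at x within frontier D) U})"

text \<open>
  The set in \<open>hit_time\<close> is nonempty for bounded \<open>D\<close>, starting points in \<open>D\<close> and any direction, or
  starting points in \<open>Rt\<close> and directions pointing into \<open>D\<close>.
\<close>

definition hit_time :: "'a::euclidean_space set \<Rightarrow> 'a \<Rightarrow> 'a \<Rightarrow> real" where
  "hit_time D x u = Inf {t. 0 < t \<and> x + t *\<^sub>R u \<in> frontier D}"

definition hit_point :: "'a::euclidean_space set \<Rightarrow> 'a \<Rightarrow> 'a \<Rightarrow> 'a" where
  "hit_point D x u = x + hit_time D x u *\<^sub>R u"

primrec bounce_point ::
  "'a::euclidean_space set \<Rightarrow> ('a \<Rightarrow> 'a \<Rightarrow>\<^sub>L 'a) \<Rightarrow> 'a \<Rightarrow> (nat \<Rightarrow> 'a) \<Rightarrow> nat \<Rightarrow> 'a" where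
  "bounce_point D U x \<eta> 0 = x"
| "bounce_point D U x \<eta> (Suc n) =
     hit_point D (bounce_point D U x \<eta> n) (blinfun_apply (U (bounce_point D U x \<eta> n)) (\<eta> n))"

definition bounce_dir ::
  "'a::euclidean_space set \<Rightarrow> ('a \<Rightarrow> 'a \<Rightarrow>\<^sub>L 'a) \<Rightarrow> 'a \<Rightarrow> (nat \<Rightarrow> 'a) \<Rightarrow> nat \<Rightarrow> 'a" where
  "bounce_dir D U x \<eta> n = blinfun_apply (U (bounce_point D U x \<eta> n)) (\<eta> n)"

definition bounce_time ::
  "'a::euclidean_space set \<Rightarrow> ('a \<Rightarrow> 'a \<Rightarrow>\<^sub>L 'a) \<Rightarrow> 'a \<Rightarrow> (nat \<Rightarrow> 'a) \<Rightarrow> nat \<Rightarrow> real" where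
  "bounce_time D U x \<eta> n =
     (\<Sum>k<n. hit_time D (bounce_point D U x \<eta> k) (bounce_dir D U x \<eta> k))"

definition boundary_billiard ::
  "'a::euclidean_space set \<Rightarrow> ('a \<Rightarrow> 'a \<Rightarrow>\<^sub>L 'a) \<Rightarrow> 'a \<Rightarrow> (nat \<Rightarrow> 'a) \<Rightarrow> real \<Rightarrow> 'a \<times> 'a" where
  "boundary_billiard D U x \<eta> t =
     (let n = (THE n. bounce_time D U x \<eta> n \<le> t \<and> t < bounce_time D U x \<eta> (Suc n))
      in (bounce_point D U x \<eta> n + (t - bounce_time D U x \<eta> n) *\<^sub>R bounce_dir D U x \<eta> n,
          bounce_dir D U x \<eta> n))"

text \<open>
  A starting state \<open>(x, v)\<close> is either in \<open>D \<times> S\<close>, with \<open>S\<close> the unit sphere, or it has \<open>x\<close> on the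
  boundary. In the latter case \<open>v\<close> is not used: the first direction is drawn from the reflection law.
\<close>

definition first_time :: "'a::euclidean_space set \<Rightarrow> 'a \<times> 'a \<Rightarrow> real" where
  "first_time D s = (if fst s \<in> D then hit_time D (fst s) (snd s) else 0)"

definition first_point :: "'a::euclidean_space set \<Rightarrow> 'a \<times> 'a \<Rightarrow> 'a" where
  "first_point D s = (if fst s \<in> D then hit_point D (fst s) (snd s) else fst s)"

definition billiard ::
  "'a::euclidean_space set \<Rightarrow> ('a \<Rightarrow> 'a \<Rightarrow>\<^sub>L 'a) \<Rightarrow> 'a \<times> 'a \<Rightarrow> (nat \<Rightarrow> 'a) \<Rightarrow> real \<Rightarrow> 'a \<times> 'a" where
  "billiard D U s \<eta> t =
     (if t < first_time D s then (fst s + t *\<^sub>R snd s, snd s)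
      else boundary_billiard D U (first_point D s) \<eta> (t - first_time D s))"

definition initial_law ::
  "'m::finite space set \<Rightarrow> 'm space set \<Rightarrow> ('m space \<times> 'm space) measure \<Rightarrow> bool" where
  "initial_law D R \<mu> \<longleftrightarrow>
     prob_space \<mu> \<and> sets \<mu> = sets borel \<and>
     (AE s in \<mu>. (fst s \<in> D \<and> norm (snd s) = 1 \<or> fst s \<in> frontier D) \<and> first_point D s \<in> R)"

text \<open>
  The law of position and direction at time \<open>t\<close> when the starting state has law \<open>\<mu>\<close> and is
  independent of the i.i.d. sequence \<open>\<eta>\<close>. The trajectory is defined only almost surely, hence the
  completion.
\<close>

definition billiard_law ::
  "'a::euclidean_space set \<Rightarrow> 'a \<Rightarrow> ('a \<Rightarrow> real) \<Rightarrow> ('a \<Rightarrow> 'a \<Rightarrow>\<^sub>L 'a) \<Rightarrow>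
   ('a \<times> 'a) measure \<Rightarrow> real \<Rightarrow> ('a \<times> 'a) measure" where
  "billiard_law D e \<gamma> U \<mu> t =
     distr (completion (\<mu> \<Otimes>\<^sub>M (\<Pi>\<^sub>M n \<in> (UNIV :: nat set). reflection_measure e \<gamma>))) borel
       (\<lambda>(s, \<eta>). billiard D U s \<eta> t)"

end

theory Submission
  imports Defs
begin

text \<open>
  For a set \<open>A\<close> of states put \<open>f x s = P(state at time s is in A)\<close> for the billiard started at the
  boundary point \<open>x\<close>. Conditioning on the first flight shows that \<open>f x s\<close> is, for
  \<open>s \<ge> diam\<close>, the mean of \<open>f y (s - l)\<close> over the next boundary point \<open>y\<close> and the flight
  length \<open>l\<close>. It therefore suffices to prove that the oscillation of any such \<open>f\<close> on \<open>s \<ge> t\<close>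
  contracts by a constant factor when \<open>t\<close> increases by a constant; uniformity in \<open>A\<close> then yields the
  limit law and the rate in total variation.

  The contraction follows from a Doeblin condition for the pair (next point, elapsed time): from
  every regular boundary point, after boundedly many reflections, the pair dominates a multiple of a
  product of a fixed measure on the boundary with Lebesgue measure on a time interval. It is obtained
  near a regular point \<open>z\<close> facing another regular point \<open>w\<close>: in two flights, from near \<open>z\<close>
  to near \<open>w\<close> and back, the choice of the intermediate point spreads the elapsed time because the
  flight time to the boundary near \<open>w\<close> is not locally constant. Iteration makes the time
  interval as long as desired. All boundary points can reach \<open>z\<close>, since by the Lipschitz condition
  neighbouring boundary points see a common transversal point and \<open>D\<close> is connected.
\<close>

section \<open>Lipschitz images and the surface measure of the sphere\<close>

text \<open>The obstacle is that reflections happen at random times while the claim concerns a fixed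
  real time: mixing of the chain of reflection points alone says nothing if the flight times are
  lattice-like. So the minorization is joint in point and elapsed time, and its time interval has to
  be long. Two losses are paid out of that length: the approach to \<open>z\<close> takes an unknown
  time of up to \<open>N * diam\<close>, and the bound has to hold at once for all times in a window
  of length \<open>diam\<close>, from which it extends to all later times. The product form comes
  from one exchange. Given the intermediate point, the law of the return point dominates a multiple
  of a fixed measure \<open>lam\<close>; once it is replaced by \<open>lam\<close>, the return point
  no longer depends on the first direction, and for each fixed return point that direction alone
  spreads the total length. The boundary need not be connected, as \<open>D\<close> may have holes;
  far parts of it are linked by a ball inside \<open>D\<close> that touches both. Bad directions
  (end point outside \<open>Rt\<close>, or tangential arrival) form a null set, by a
  Hausdorff-measure and a Sard argument, so rays can be perturbed to generic ones.\<close>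

text \<open>Uniqueness of translation-invariant measure, without determinants: the unit ball
  \<open>B\<close> is invariant under \<open>- T\<close>, and translations together with two
  exchanges of a double integral turn the measure of \<open>B\<close> times that of the preimage of
  \<open>A\<close> into the measure of \<open>B\<close> times that of \<open>A\<close>.\<close>

lemma lborel_distr_orthogonal:
  fixes T :: "'a::euclidean_space \<Rightarrow> 'a"
  assumes T: "orthogonal_transformation T"
  shows "distr lborel borel T = lborel"
proof (rule measure_eqI)
  fix A :: "'a set" assume "A \<in> sets (distr lborel borel T)"
  then have A[measurable]: "A \<in> sets borel" by simp
  have [measurable]: "T \<in> borel_measurable borel"
    using T by (intro borel_measurable_continuous_onI linear_continuous_on)
      (simp add: orthogonal_transformation_linear linear_conv_bounded_linear[symmetric])
  have add: "T (x + y) = T x + T y" for x y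
    using T by (simp add: linear_add orthogonal_transformation_linear)
  have trans: "(\<integral>\<^sup>+x. f (c + x) \<partial>lborel) = (\<integral>\<^sup>+x. f x \<partial>lborel)"
    if [measurable]: "f \<in> borel_measurable borel" for c and f :: "'a \<Rightarrow> ennreal"
    by (subst (2) lborel_distr_plus[symmetric, of c]) (simp add: nn_integral_distr)
  define B where "B = ball (0::'a) 1"
  have [measurable]: "B \<in> sets borel" by (simp add: B_def)
  have TB: "indicator B (- T x) = (indicator B x :: ennreal)" for x
    using T by (auto simp: B_def indicator_def orthogonal_transformation_norm)
  have "emeasure lborel B * emeasure (distr lborel borel T) A =
      (\<integral>\<^sup>+x. \<integral>\<^sup>+y. indicator A (T x) * indicator B y \<partial>lborel \<partial>lborel)"
    by (simp add: nn_integral_cmult nn_integral_multc mult.commute nn_integral_distr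
        flip: nn_integral_indicator)
  also have "\<dots> = (\<integral>\<^sup>+x. \<integral>\<^sup>+y. indicator A (T x) * indicator B (- T x + y) \<partial>lborel \<partial>lborel)"
  proof (rule nn_integral_cong)
    fix x show "(\<integral>\<^sup>+y. indicator A (T x) * indicator B y \<partial>lborel) =
        (\<integral>\<^sup>+y. indicator A (T x) * indicator B (- T x + y) \<partial>lborel)"
      by (subst trans[where f="\<lambda>y. indicator A (T x) * indicator B y" and c="- T x", symmetric]) simp_all
  qed
  also have "\<dots> = (\<integral>\<^sup>+y. \<integral>\<^sup>+x. indicator A (T x) * indicator B (- T x + y) \<partial>lborel \<partial>lborel)"
    by (intro lborel_pair.Fubini') simp
  also have "\<dots> = (\<integral>\<^sup>+y. \<integral>\<^sup>+x. indicator A (y + T x) * indicator B (- T x) \<partial>lborel \<partial>lborel)"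
  proof (rule nn_integral_cong)
    fix y :: 'a
    obtain z where z: "T z = y" using orthogonal_transformation_surj[OF T] by (metis surjD)
    have "(\<integral>\<^sup>+x. indicator A (T x) * indicator B (- T x + y) \<partial>lborel) =
        (\<integral>\<^sup>+x. indicator A (T (z + x)) * indicator B (- T (z + x) + y) \<partial>lborel)"
      by (subst trans[where f="\<lambda>x. indicator A (T x) * indicator B (- T x + y)" and c=z, symmetric]) simp_all
    then show "(\<integral>\<^sup>+x. indicator A (T x) * indicator B (- T x + y) \<partial>lborel) =
        (\<integral>\<^sup>+x. indicator A (y + T x) * indicator B (- T x) \<partial>lborel)"
      by (simp add: add z)
  qed
  also have "\<dots> = (\<integral>\<^sup>+x. \<integral>\<^sup>+y. indicator A (y + T x) * indicator B (- T x) \<partial>lborel \<partial>lborel)"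
    by (intro lborel_pair.Fubini') simp
  also have "\<dots> = (\<integral>\<^sup>+x. \<integral>\<^sup>+y. indicator A y * indicator B x \<partial>lborel \<partial>lborel)"
  proof (rule nn_integral_cong)
    fix x show "(\<integral>\<^sup>+y. indicator A (y + T x) * indicator B (- T x) \<partial>lborel) =
        (\<integral>\<^sup>+y. indicator A y * indicator B x \<partial>lborel)"
      by (subst trans[where f="\<lambda>y. indicator A y * indicator B x" and c="T x", symmetric])
         (simp_all add: TB add.commute)
  qed
  also have "\<dots> = emeasure lborel B * emeasure lborel A"
    by (simp add: nn_integral_cmult nn_integral_multc mult.commute flip: nn_integral_indicator)
  finally have "emeasure lborel B * emeasure (distr lborel borel T) A = emeasure lborel B * emeasure lborel A" .
  moreover have "emeasure lborel B \<noteq> 0"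
    unfolding B_def using unit_ball_vol_pos[of "real DIM('a)"] by (simp add: emeasure_ball del: unit_ball_vol_pos)
  moreover have "emeasure lborel B \<noteq> \<infinity>"
    unfolding B_def using emeasure_lborel_ball_finite by (metis less_irrefl)
  ultimately show "emeasure (distr lborel borel T) A = emeasure lborel A"
    by (metis ennreal_mult_cancel_left infinity_ennreal_def)
qed simp

text \<open>Cover \<open>S\<close> by dyadic cubes whose total volume exceeds that of
  \<open>S\<close> by at most \<open>e\<close>. A cube of side \<open>h\<close> has diameter at most
  \<open>sqrt n * h\<close>, so its image lies in a ball of volume \<open>C * h ^ n\<close>. The
  bound is for any \<open>V\<close> inside the image because the image itself may fail to be
  Borel.\<close>

lemma emeasure_lipschitz_image_le:
  fixes f :: "'a::euclidean_space \<Rightarrow> 'a"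
  assumes f: "L-lipschitz_on S f" and S: "S \<in> sets borel" "bounded S"
    and V: "V \<subseteq> f ` S"
  shows "emeasure lborel V \<le>
    ennreal (unit_ball_vol (DIM('a)) * (sqrt (DIM('a)) * L) ^ DIM('a)) * emeasure lborel S"
proof (cases "V \<in> sets borel")
  case False
  then show ?thesis by (simp add: emeasure_notin_sets)
next
  case Vb: True
  define n where "n = DIM('a)"
  define C where "C = unit_ball_vol n * (sqrt n * L) ^ n"
  have L: "0 \<le> L" using f by (rule lipschitz_on_nonneg)
  have C0: "0 \<le> C" using L by (simp add: C_def)
  have Sl: "S \<in> lmeasurable" using S by (simp add: bounded_set_imp_lmeasurable)
  have Sfin: "emeasure lborel S < \<infinity>" by (rule emeasure_bounded_finite[OF S(2)])
  obtain c where c: "S \<subseteq> cbox (- c) c" using bounded_subset_cbox_symmetric[OF S(2)] by auto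
  obtain r where r: "r > 0" "S \<subseteq> ball 0 r" using S(2) bounded_subset_ballD by blast
  \<comment> \<open>The enclosing box is a cube, so the dyadic pieces below are cubes as well and
    their volume controls their diameter.\<close>
  define a :: 'a where "a = (\<Sum>i\<in>Basis. (- r) *\<^sub>R i)"
  define b :: 'a where "b = (\<Sum>i\<in>Basis. r *\<^sub>R i)"
  have ab: "a \<bullet> i = - r" "b \<bullet> i = r" if "i \<in> Basis" for i
    using that by (auto simp: a_def b_def inner_sum_left_Basis simp del: sum_negf scaleR_minus_left)
  have Sab: "S \<subseteq> cbox a b"
  proof
    fix x assume "x \<in> S"
    then have "norm x < r" using r by auto
    then show "x \<in> cbox a b"
      by (auto simp: mem_box ab) (smt (verit) Basis_le_norm)+
  qed
  have ge: "emeasure lborel V \<le> ennreal C * (emeasure lborel S + ennreal e)" if e0: "e > 0" for e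
  proof -
    obtain \<D> where D: "countable \<D>"
      "\<And>K. K \<in> \<D> \<Longrightarrow> K \<subseteq> cbox a b \<and> K \<noteq> {} \<and> (\<exists>c d. K = cbox c d)"
      "pairwise (\<lambda>A B. interior A \<inter> interior B = {}) \<D>"
      "\<And>u v. cbox u v \<in> \<D> \<Longrightarrow> \<exists>n. \<forall>i \<in> Basis. v \<bullet> i - u \<bullet> i = (b \<bullet> i - a \<bullet> i)/2^n"
      "S \<subseteq> \<Union>\<D>" "\<Union>\<D> \<in> lmeasurable" "measure lebesgue (\<Union>\<D>) \<le> measure lebesgue S + e"
      by (rule measurable_outer_intervals_bounded[OF Sl Sab e0]) blast
    have Kb: "K \<in> sets borel" if "K \<in> \<D>" for K using D(2)[OF that] by auto
    \<comment> \<open>Distinct pieces overlap only in their faces; comparing with interiors makes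
      the volumes add up exactly.\<close>
    have piece: "\<exists>B\<in>sets borel. f ` (S \<inter> K) \<subseteq> B \<and> emeasure lborel B \<le> ennreal C * emeasure lborel (interior K)"
      if K: "K \<in> \<D>" for K
    proof -
      obtain u v where uv: "K = cbox u v" using D(2)[OF K] by auto
      obtain m where m: "\<forall>i \<in> Basis. v \<bullet> i - u \<bullet> i = (b \<bullet> i - a \<bullet> i)/2^m" using D(4) K uv by blast
      define h where "h = 2 * r / 2^m"
      have h: "\<forall>i\<in>Basis. (v - u) \<bullet> i = h" using m by (simp add: h_def ab inner_diff_left)
      have h0: "h > 0" using r by (simp add: h_def)
      have int: "emeasure lborel (interior K) = ennreal (h ^ n)"
      proof -
        have "u \<bullet> i \<le> v \<bullet> i" if "i \<in> Basis" for i
          using h h0 that by (auto simp: inner_diff_left dest!: bspec)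
        then have "emeasure lborel (box u v) = ennreal (\<Prod>i\<in>Basis. (v - u) \<bullet> i)"
          by (rule emeasure_lborel_box)
        also have "(\<Prod>i\<in>Basis. (v - u) \<bullet> i) = h ^ n" using h by (simp add: n_def)
        finally show ?thesis by (simp add: uv interior_cbox)
      qed
      have diam: "dist x y \<le> sqrt n * h" if "x \<in> K" "y \<in> K" for x y
      proof -
        have "\<bar>(x - y) \<bullet> i\<bar> \<le> h" if "i \<in> Basis" for i
          using \<open>x \<in> K\<close> \<open>y \<in> K\<close> h that unfolding uv mem_box inner_diff_left by (smt (verit))
        then have "(\<Sum>i\<in>Basis. ((x - y) \<bullet> i)\<^sup>2) \<le> (\<Sum>i\<in>(Basis::'a set). h\<^sup>2)"
          by (intro sum_mono) (metis abs_le_square_iff abs_of_pos h0)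
        then have "(norm (x - y))\<^sup>2 \<le> (sqrt n * h)\<^sup>2"
          by (simp add: euclidean_inner[of "x - y" "x - y"] power2_norm_eq_inner power_mult_distrib n_def flip: power2_eq_square)
        then show ?thesis using h0 by (simp add: dist_norm abs_le_square_iff[symmetric])
      qed
      show ?thesis
      proof (cases "S \<inter> K = {}")
        case True then show ?thesis by (intro bexI[of _ "{}"]) auto
      next
        case False
        then obtain x where x: "x \<in> S" "x \<in> K" by auto
        have "f ` (S \<inter> K) \<subseteq> cball (f x) (L * (sqrt n * h))"
        proof clarsimp
          fix y assume y: "y \<in> S" "y \<in> K"
          have "dist (f x) (f y) \<le> L * dist x y" using f x y by (auto dest: lipschitz_onD)
          also have "\<dots> \<le> L * (sqrt n * h)" using diam x y L by (intro mult_left_mono) auto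
          finally show "dist (f x) (f y) \<le> L * (sqrt n * h)" .
        qed
        moreover have "emeasure lborel (cball (f x) (L * (sqrt n * h))) = ennreal C * ennreal (h ^ n)"
          using L h0 C0 by (simp add: emeasure_cball C_def n_def power_mult_distrib ac_simps flip: ennreal_mult)
        ultimately show ?thesis using int by (intro bexI[of _ "cball (f x) (L * (sqrt n * h))"]) auto
      qed
    qed
    obtain B where B: "\<And>K. K \<in> \<D> \<Longrightarrow> B K \<in> sets borel \<and> f ` (S \<inter> K) \<subseteq> B K \<and>
         emeasure lborel (B K) \<le> ennreal C * emeasure lborel (interior K)" using bchoice[OF ballI[OF piece[unfolded Bex_def]], of \<D> "\<lambda>x. x"] by auto
    have VB: "V \<subseteq> (\<Union>K\<in>\<D>. B K)" using V D(5) B by blast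
    have "emeasure lborel V = (\<integral>\<^sup>+x. indicator V x \<partial>lborel)" using Vb by simp
    also have "\<dots> \<le> (\<integral>\<^sup>+x. \<integral>\<^sup>+K. indicator (B K) x \<partial>count_space \<D> \<partial>lborel)"
    proof (rule nn_integral_mono)
      fix x
      show "indicator V x \<le> (\<integral>\<^sup>+K. indicator (B K) x \<partial>count_space \<D>)"
      proof (cases "x \<in> V")
        case True
        then obtain K where K: "K \<in> \<D>" "x \<in> B K" using VB by auto
        have "(1::ennreal) = (\<integral>\<^sup>+J. indicator {K} J \<partial>count_space \<D>)" using K by simp
        also have "\<dots> \<le> (\<integral>\<^sup>+K. indicator (B K) x \<partial>count_space \<D>)"
          using K by (intro nn_integral_mono) (auto simp: indicator_def)
        finally show ?thesis using True by simp
      qed simp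
    qed
    also have "\<dots> = (\<integral>\<^sup>+K. \<integral>\<^sup>+x. indicator (B K) x \<partial>lborel \<partial>count_space \<D>)"
      using B D(1) by (intro nn_integral_count_space_nn_integral borel_measurable_indicator) auto
    also have "\<dots> = (\<integral>\<^sup>+K. emeasure lborel (B K) \<partial>count_space \<D>)"
      using B by (intro nn_integral_cong) auto
    also have "\<dots> \<le> (\<integral>\<^sup>+K. ennreal C * emeasure lborel (interior K) \<partial>count_space \<D>)"
      using B by (intro nn_integral_mono) auto
    also have "\<dots> = ennreal C * (\<integral>\<^sup>+K. emeasure lborel (interior K) \<partial>count_space \<D>)"
      by (intro nn_integral_cmult) auto
    also have "(\<integral>\<^sup>+K. emeasure lborel (interior K) \<partial>count_space \<D>) = emeasure lborel (\<Union>K\<in>\<D>. interior K)"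
      using D(1,3) by (intro emeasure_UN_countable[symmetric]) (auto simp: disjoint_family_on_def pairwise_def)
    also have "\<dots> \<le> emeasure lebesgue (\<Union>\<D>)"
    proof -
      have "emeasure lborel (\<Union>K\<in>\<D>. interior K) = emeasure lebesgue (\<Union>K\<in>\<D>. interior K)"
      proof -
        have "(\<Union>K\<in>\<D>. interior K) \<in> sets lborel" by (auto intro!: borel_open)
        then show ?thesis by simp
      qed
      also have "\<dots> \<le> emeasure lebesgue (\<Union>\<D>)"
        using D(6) interior_subset by (intro emeasure_mono UN_least) (auto dest: fmeasurableD)
      finally show ?thesis .
    qed
    also have "\<dots> \<le> emeasure lborel S + ennreal e"
    proof -
      have "emeasure lebesgue (\<Union>\<D>) = ennreal (measure lebesgue (\<Union>\<D>))"
        using D(6) by (simp add: emeasure_eq_measure2)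
      also have "\<dots> \<le> ennreal (measure lebesgue S + e)" using D(7) by (rule ennreal_leI)
      also have "\<dots> = emeasure lebesgue S + ennreal e"
        using Sl e0 by (simp add: emeasure_eq_ennreal_measure fmeasurable_def less_top)
      finally show ?thesis using S by simp
    qed
    finally show ?thesis by (simp add: mult_left_mono)
  qed
  have "emeasure lborel V \<le> ennreal C * emeasure lborel S"
  proof (rule ennreal_le_epsilon)
    fix e :: real assume e: "e > 0"
    have "emeasure lborel V \<le> ennreal C * (emeasure lborel S + ennreal (e / (C + 1)))"
      using e C0 by (intro ge) auto
    also have "\<dots> = ennreal C * emeasure lborel S + ennreal (C * (e / (C + 1)))"
      using C0 e by (subst distrib_left, subst ennreal_mult) auto
    also have "\<dots> \<le> ennreal C * emeasure lborel S + ennreal e"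
      using C0 e by (intro add_left_mono ennreal_leI) (simp add: field_simps)
    finally show "emeasure lborel V \<le> ennreal C * emeasure lborel S + ennreal e" .
  qed
  then show ?thesis by (simp add: C_def n_def)
qed

lemma emeasure_real_lipschitz_image_le:
  fixes f :: "real \<Rightarrow> real"
  assumes "L-lipschitz_on S f" "S \<in> sets borel" "bounded S" "V \<subseteq> f ` S"
  shows "emeasure lborel V \<le> ennreal (2 * L) * emeasure lborel S"
  using emeasure_lipschitz_image_le[OF assms] by (simp add: unit_ball_vol_1)

text \<open>A coarea-type inequality. On the segment from a point of the first ball to its translate
  in the second, \<open>G\<close> takes every value in \<open>{\<alpha>..\<beta>}\<close>, so by the
  one-dimensional Lipschitz bound the levels in \<open>I\<close> occupy a proportional set of
  parameters \<open>t\<close>. Integrate over all these parallel segments and exchange: for each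
  fixed \<open>t\<close> the translates contribute at most the measure of the preimage of
  \<open>I\<close>.\<close>

lemma lipschitz_preimage_measure_ge:
  fixes G :: "'a::euclidean_space \<Rightarrow> real"
  assumes X: "convex X" "X \<in> sets borel" and G: "L-lipschitz_on X G" "0 < L"
    and x12: "ball x1 \<rho> \<subseteq> X" "ball x2 \<rho> \<subseteq> X" "0 < \<rho>" "x1 \<noteq> x2"
    and le: "\<And>x. x \<in> ball x1 \<rho> \<Longrightarrow> G x \<le> \<alpha>" and ge: "\<And>x. x \<in> ball x2 \<rho> \<Longrightarrow> \<beta> \<le> G x"
    and I: "I \<in> sets borel"
  shows "emeasure lborel (ball x1 \<rho>) * emeasure lborel (I \<inter> {\<alpha>..\<beta>}) \<le>
    ennreal (2 * (L * norm (x2 - x1))) * emeasure lborel {x \<in> X. G x \<in> I}"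
proof -
  define v where "v = x2 - x1"
  define W where "W = {x \<in> X. G x \<in> I}"
  have contG: "continuous_on X G" using G(1) by (rule lipschitz_on_continuous_on)
  have W[measurable]: "W \<in> sets borel"
  proof -
    have "G \<in> borel_measurable (restrict_space borel X)"
      using contG by (rule borel_measurable_continuous_on_restrict)
    then have "G -` I \<inter> space (restrict_space borel X) \<in> sets (restrict_space borel X)"
      using I by (rule measurable_sets)
    moreover have "G -` I \<inter> space (restrict_space borel X) = W"
      by (auto simp: W_def space_restrict_space)
    ultimately show ?thesis using X(2) by (auto simp: sets_restrict_space)
  qed
  have seg: "x + t *\<^sub>R v \<in> X" if "x \<in> ball x1 \<rho>" "t \<in> {0..1}" for x t
  proof -
    have "x + v \<in> ball x2 \<rho>" using that(1) by (simp add: v_def dist_norm algebra_simps)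
    then have "x \<in> X" "x + v \<in> X" using that(1) x12 by auto
    then have "(1 - t) *\<^sub>R x + t *\<^sub>R (x + v) \<in> X" using that X(1) by (auto simp: convex_alt)
    then show ?thesis by (simp add: algebra_simps)
  qed
  have one: "emeasure lborel (I \<inter> {\<alpha>..\<beta>}) \<le>
     ennreal (2 * (L * norm v)) * (\<integral>\<^sup>+t. indicator {0..1} t * indicator W (x + t *\<^sub>R v) \<partial>lborel)"
    if x: "x \<in> ball x1 \<rho>" for x
  proof -
    define S where "S = {t \<in> {0..1}. x + t *\<^sub>R v \<in> W}"
    have S: "S \<in> sets borel"
    proof -
      have "S = {0..1} \<inter> (\<lambda>t. x + t *\<^sub>R v) -` W" by (auto simp: S_def)
      then show ?thesis by simp
    qed
    have lip: "(L * norm v)-lipschitz_on {0..1} (\<lambda>t. G (x + t *\<^sub>R v))"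
    proof (rule lipschitz_onI)
      fix s t :: real assume "s \<in> {0..1}" "t \<in> {0..1}"
      then have "dist (G (x + s *\<^sub>R v)) (G (x + t *\<^sub>R v)) \<le> L * dist (x + s *\<^sub>R v) (x + t *\<^sub>R v)"
        using seg[OF x] G(1) by (intro lipschitz_onD)
      also have "dist (x + s *\<^sub>R v) (x + t *\<^sub>R v) = norm v * dist s t"
        by (simp add: dist_norm flip: scaleR_diff_left)
      finally show "dist (G (x + s *\<^sub>R v)) (G (x + t *\<^sub>R v)) \<le> L * norm v * dist s t"
        by (simp add: ac_simps)
    qed (use G in auto)
    have "I \<inter> {\<alpha>..\<beta>} \<subseteq> (\<lambda>t. G (x + t *\<^sub>R v)) ` S"
    proof
      fix y assume y: "y \<in> I \<inter> {\<alpha>..\<beta>}"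
      have "x + v \<in> ball x2 \<rho>" using x by (simp add: v_def dist_norm algebra_simps)
      then have "G (x + 0 *\<^sub>R v) \<le> y" "y \<le> G (x + 1 *\<^sub>R v)"
        using y le[OF x] ge by force+
      from IVT'[OF this _ lipschitz_on_continuous_on[OF lip]]
      obtain t where "0 \<le> t" "t \<le> 1" "G (x + t *\<^sub>R v) = y" by auto
      then show "y \<in> (\<lambda>t. G (x + t *\<^sub>R v)) ` S" using y seg[OF x, of t] by (auto simp: S_def W_def)
    qed
    moreover have "(L * norm v)-lipschitz_on S (\<lambda>t. G (x + t *\<^sub>R v))"
      by (rule lipschitz_on_subset[OF lip]) (auto simp: S_def)
    moreover have "bounded S" by (rule bounded_subset[of "{0..1}"]) (auto simp: S_def)
    ultimately have "emeasure lborel (I \<inter> {\<alpha>..\<beta>}) \<le> ennreal (2 * (L * norm v)) * emeasure lborel S"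
      using S by (intro emeasure_real_lipschitz_image_le)
    also have "emeasure lborel S = (\<integral>\<^sup>+t. indicator S t \<partial>lborel)" using S by simp
    also have "\<dots> = (\<integral>\<^sup>+t. indicator {0..1} t * indicator W (x + t *\<^sub>R v) \<partial>lborel)"
      by (intro nn_integral_cong) (auto simp: S_def indicator_def)
    finally show ?thesis .
  qed
  have b: "ball x1 \<rho> \<in> sets borel" by simp
  have [measurable]: "(\<lambda>x. indicator (ball x1 \<rho>) x :: ennreal) \<in> borel_measurable borel"
    using b by (rule borel_measurable_indicator)
  have [measurable]: "(\<lambda>x. indicator W x :: ennreal) \<in> borel_measurable borel"
    using W by (rule borel_measurable_indicator)
  have "emeasure lborel (ball x1 \<rho>) * emeasure lborel (I \<inter> {\<alpha>..\<beta>}) =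
     (\<integral>\<^sup>+x. emeasure lborel (I \<inter> {\<alpha>..\<beta>}) * indicator (ball x1 \<rho>) x \<partial>lborel)"
    using b by (subst nn_integral_cmult_indicator) (simp_all add: mult.commute)
  also have "\<dots> \<le> (\<integral>\<^sup>+x. ennreal (2 * (L * norm v)) *
      (\<integral>\<^sup>+t. indicator {0..1} t * indicator W (x + t *\<^sub>R v) \<partial>lborel) * indicator (ball x1 \<rho>) x \<partial>lborel)"
    using one by (intro nn_integral_mono) (auto simp: indicator_def)
  also have "\<dots> = ennreal (2 * (L * norm v)) *
      (\<integral>\<^sup>+x. \<integral>\<^sup>+t. indicator {0..1} t * indicator W (x + t *\<^sub>R v) * indicator (ball x1 \<rho>) x \<partial>lborel \<partial>lborel)"
    by (subst nn_integral_cmult[symmetric], simp)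
       (intro nn_integral_cong, subst nn_integral_multc, simp_all add: mult.assoc)
  also have "(\<integral>\<^sup>+x. \<integral>\<^sup>+t. indicator {0..1} t * indicator W (x + t *\<^sub>R v) * indicator (ball x1 \<rho>) x \<partial>lborel \<partial>lborel)
     = (\<integral>\<^sup>+t. \<integral>\<^sup>+x. indicator {0..1} t * indicator W (x + t *\<^sub>R v) * indicator (ball x1 \<rho>) x \<partial>lborel \<partial>lborel)"
    by (intro lborel_pair.Fubini') simp
  also have "\<dots> \<le> (\<integral>\<^sup>+t. emeasure lborel W * indicator {0..1::real} t \<partial>lborel)"
  proof (rule nn_integral_mono)
    fix t :: real
    have "(\<integral>\<^sup>+x. indicator {0..1} t * indicator W (x + t *\<^sub>R v) * indicator (ball x1 \<rho>) x \<partial>lborel) \<le>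
       (\<integral>\<^sup>+x. indicator {0..1} t * indicator W (t *\<^sub>R v + x) \<partial>lborel)"
      by (intro nn_integral_mono) (auto simp: indicator_def add.commute)
    also have "\<dots> = indicator {0..1} t * (\<integral>\<^sup>+x. indicator W (t *\<^sub>R v + x) \<partial>lborel)"
      by (intro nn_integral_cmult) simp
    also have "(\<integral>\<^sup>+x. indicator W (t *\<^sub>R v + x) \<partial>lborel) = (\<integral>\<^sup>+x. indicator W x \<partial>lborel)"
    proof -
      have "(\<integral>\<^sup>+x. indicator W x \<partial>distr lborel borel ((+) (t *\<^sub>R v))) = (\<integral>\<^sup>+x. indicator W (t *\<^sub>R v + x) \<partial>lborel)"
        by (rule nn_integral_distr) simp_all
      then show ?thesis by (simp only: lborel_distr_plus)
    qed
    finally show "(\<integral>\<^sup>+x. indicator {0..1} t * indicator W (x + t *\<^sub>R v) * indicator (ball x1 \<rho>) x \<partial>lborel) \<le>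
       emeasure lborel W * indicator {0..1::real} t" by (simp add: mult.commute)
  qed
  also have "\<dots> = emeasure lborel W" by (simp add: nn_integral_cmult)
  finally show ?thesis by (simp add: mult_left_mono W_def v_def)
qed

section \<open>Surface measure of the unit sphere\<close>

lemma sets_sphere_measure[measurable_cong, simp]: "sets sphere_measure = sets borel"
  and space_sphere_measure[simp]: "space sphere_measure = UNIV"
  by (auto simp: sphere_measure_def)

lemma nn_integral_sphere_measure:
  assumes [measurable]: "f \<in> borel_measurable borel"
  shows "(\<integral>\<^sup>+u. f u \<partial>sphere_measure) =
    of_nat DIM('a) * (\<integral>\<^sup>+x. indicator (ball 0 1) x * f (sgn x) \<partial>(lborel :: 'a::euclidean_space measure))"
  unfolding sphere_measure_def
proof -
  have b: "ball (0::'a) 1 \<in> sets borel" by simp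
  have [measurable]: "(\<lambda>x. indicator (ball (0::'a) 1) x :: ennreal) \<in> borel_measurable borel"
    using b by (rule borel_measurable_indicator)
  have "(\<integral>\<^sup>+u. f u \<partial>distr (density lborel (\<lambda>x. ennreal (real DIM('a)) * indicator (ball 0 1) x)) borel sgn)
     = (\<integral>\<^sup>+x. ennreal (real DIM('a)) * (indicator (ball 0 1) x * f (sgn x)) \<partial>lborel)"
    by (subst nn_integral_distr; simp add: nn_integral_density mult.assoc)
  also have "\<dots> = of_nat DIM('a) * (\<integral>\<^sup>+x. indicator (ball 0 1) x * f (sgn x) \<partial>lborel)"
    by (subst nn_integral_cmult) (simp_all add: ennreal_of_nat_eq_real_of_nat)
  finally show "(\<integral>\<^sup>+u. f u \<partial>distr (density lborel (\<lambda>x. ennreal (real DIM('a)) * indicator (ball 0 1) x)) borel sgn)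
     = of_nat DIM('a) * (\<integral>\<^sup>+x. indicator (ball 0 1) x * f (sgn x) \<partial>lborel)" .
qed

lemma emeasure_sphere_measure:
  assumes [measurable]: "A \<in> sets borel"
  shows "emeasure sphere_measure A =
    of_nat DIM('a) * emeasure lborel {x :: 'a::euclidean_space. x \<in> ball 0 1 \<and> sgn x \<in> A}"
proof -
  have [measurable]: "{x :: 'a. x \<in> ball 0 1 \<and> sgn x \<in> A} \<in> sets borel"
  proof -
    have "{x :: 'a. x \<in> ball 0 1 \<and> sgn x \<in> A} = ball 0 1 \<inter> sgn -` A" by auto
    then show ?thesis using measurable_sets_borel[OF borel_measurable_sgn assms] by simp
  qed
  have "emeasure sphere_measure A = (\<integral>\<^sup>+u. indicator A u \<partial>sphere_measure)" by simp
  also have "\<dots> = of_nat DIM('a) * (\<integral>\<^sup>+x. indicator {x :: 'a. x \<in> ball 0 1 \<and> sgn x \<in> A} x \<partial>lborel)"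
    by (subst nn_integral_sphere_measure, simp)
       (intro arg_cong[where f="\<lambda>x. _ * x"] nn_integral_cong, auto simp: indicator_def)
  finally show ?thesis by simp
qed

lemma nn_integral_sphere_measure_orthogonal:
  fixes T :: "'a::euclidean_space \<Rightarrow> 'a"
  assumes [measurable]: "f \<in> borel_measurable borel" and T: "orthogonal_transformation T"
  shows "(\<integral>\<^sup>+u. f (T u) \<partial>sphere_measure) = (\<integral>\<^sup>+u. f u \<partial>sphere_measure)"
proof -
  have [measurable]: "T \<in> borel_measurable borel"
    using T by (intro borel_measurable_continuous_onI linear_continuous_on)
      (simp add: orthogonal_transformation_linear linear_conv_bounded_linear[symmetric])
  have b: "ball (0::'a) 1 \<in> sets borel" by simp
  have [measurable]: "(\<lambda>x. indicator (ball (0::'a) 1) x :: ennreal) \<in> borel_measurable borel"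
    using b by (rule borel_measurable_indicator)
  have "(\<integral>\<^sup>+x. indicator (ball 0 1) x * f (sgn x) \<partial>lborel) =
     (\<integral>\<^sup>+x. indicator (ball 0 1) (T x) * f (sgn (T x)) \<partial>lborel)"
    by (subst lborel_distr_orthogonal[OF T, symmetric]) (simp add: nn_integral_distr)
  also have "\<dots> = (\<integral>\<^sup>+x. indicator (ball 0 1) x * f (T (sgn x)) \<partial>lborel)"
    using T by (intro nn_integral_cong)
      (simp add: sgn_div_norm orthogonal_transformation_norm orthogonal_transformation_scaleR indicator_def)
  finally show ?thesis by (simp add: nn_integral_sphere_measure)
qed

lemma AE_sphere_measure_norm: "AE u in sphere_measure. norm (u :: 'a::euclidean_space) = 1"
proof -
  have "emeasure sphere_measure {u :: 'a. norm u \<noteq> 1} = 0"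
  proof -
    have "{u :: 'a. norm u \<noteq> 1} = - sphere 0 1" by auto
    then have m: "{u :: 'a. norm u \<noteq> 1} \<in> sets borel" by simp
    have "{x :: 'a. x \<in> ball 0 1 \<and> norm (sgn x) \<noteq> 1} \<subseteq> {0}" by (auto simp: norm_sgn split: if_splits)
    then have "emeasure lborel {x :: 'a. x \<in> ball 0 1 \<and> norm (sgn x) \<noteq> 1} \<le> emeasure lborel {0::'a}"
      by (intro emeasure_mono) auto
    then show ?thesis by (simp add: emeasure_sphere_measure[OF m])
  qed
  then show ?thesis by (intro AE_I[where N="{u. norm u \<noteq> 1}"]) auto
qed

text \<open>The cone over the cap contains an open neighbourhood of
  \<open>(1/2) *\<^sub>R u\<close>.\<close>

lemma emeasure_sphere_measure_ball_pos:
  fixes u :: "'a::euclidean_space"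
  assumes "norm u = 1" "0 < \<rho>"
  shows "0 < emeasure sphere_measure (ball u \<rho>)"
proof -
  define X where "X = {x :: 'a. x \<in> ball 0 1 \<and> x \<noteq> 0 \<and> sgn x \<in> ball u \<rho>}"
  have "continuous_on (ball 0 1 - {0}) (sgn :: 'a \<Rightarrow> 'a)"
    by (intro continuous_on_sgn continuous_on_id) auto
  then have "open ((ball 0 1 - {0}) \<inter> sgn -` ball u \<rho>)"
    by (intro continuous_open_preimage) auto
  then have op: "open X" by (auto simp: X_def Int_def vimage_def Diff_eq conj_ac)
  have "(1/2) *\<^sub>R u \<in> X" using assms by (auto simp: X_def sgn_div_norm)
  then have "emeasure lborel X \<noteq> 0"
  proof -
    assume x: "(1/2) *\<^sub>R u \<in> X"
    obtain e where e: "e > 0" "ball ((1/2) *\<^sub>R u) e \<subseteq> X" using op x open_contains_ball by blast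
    have "emeasure lborel (ball ((1/2) *\<^sub>R u) e) \<le> emeasure lborel X"
      using e op by (intro emeasure_mono) auto
    moreover have "emeasure lborel (ball ((1/2) *\<^sub>R u) e) > 0"
      using e unit_ball_vol_pos[of "real DIM('a)"]
      by (simp add: emeasure_ball ennreal_zero_less_mult_iff del: unit_ball_vol_pos)
    ultimately show "emeasure lborel X \<noteq> 0" by auto
  qed
  moreover have "emeasure lborel X \<le> emeasure lborel {x :: 'a. x \<in> ball 0 1 \<and> sgn x \<in> ball u \<rho>}"
  proof (intro emeasure_mono)
    have "{x :: 'a. x \<in> ball 0 1 \<and> sgn x \<in> ball u \<rho>} = ball 0 1 \<inter> sgn -` ball u \<rho>" by auto
    then show "{x :: 'a. x \<in> ball 0 1 \<and> sgn x \<in> ball u \<rho>} \<in> sets lborel"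
      using measurable_sets_borel[OF borel_measurable_sgn, of "ball u \<rho>"] by simp
  qed (auto simp: X_def)
  ultimately have "0 < emeasure lborel {x :: 'a. x \<in> ball 0 1 \<and> sgn x \<in> ball u \<rho>}"
    by (metis le_zero_eq zero_less_iff_neq_zero)
  then show ?thesis by (simp add: emeasure_sphere_measure ennreal_zero_less_mult_iff)
qed

lemma finite_measure_sphere_measure: "finite_measure (sphere_measure :: 'a::euclidean_space measure)"
proof
  have "emeasure lborel {x :: 'a. x \<in> ball 0 1 \<and> sgn x \<in> UNIV} \<noteq> \<infinity>"
    using emeasure_lborel_ball_finite[of "0::'a" 1] by (simp add: ball_def)
  then show "emeasure (sphere_measure :: 'a measure) (space sphere_measure) \<noteq> (\<infinity> :: ennreal)"
    using emeasure_sphere_measure[of "UNIV :: 'a set"]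
    by (simp only: space_sphere_measure) (simp add: ennreal_mult_eq_top_iff ennreal_of_nat_eq_real_of_nat)
qed

section \<open>Cone conditions at the boundary\<close>

text \<open>
  A two-sided uniform cone condition at the boundary points near \<open>y\<close>, with common axis \<open>a\<close>.
  At a point with a tangent plane \<open>a\<close> is the inner normal and \<open>\<kappa>\<close> can be taken arbitrarily small.
\<close>

definition cone_patch :: "'a::euclidean_space set \<Rightarrow> 'a \<Rightarrow> 'a \<Rightarrow> real \<Rightarrow> real \<Rightarrow> bool" where
  "cone_patch D y a \<kappa> \<delta> \<longleftrightarrow> norm a = 1 \<and> 0 \<le> \<kappa> \<and> \<kappa> < 1 \<and> 0 < \<delta> \<and>
     (\<forall>z \<in> frontier D \<inter> ball y \<delta>. \<forall>v. v \<noteq> 0 \<longrightarrow> norm v < \<delta> \<longrightarrow> \<kappa> * norm v < a \<bullet> v \<longrightarrow>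
        z + v \<in> D \<and> z - v \<notin> closure D)"

lemma cone_patchD:
  assumes "cone_patch D y a \<kappa> \<delta>" "z \<in> frontier D" "dist y z < \<delta>" "v \<noteq> 0" "norm v < \<delta>" "\<kappa> * norm v < a \<bullet> v"
  shows "z + v \<in> D" "z - v \<notin> closure D"
  using assms by (auto simp: cone_patch_def)

lemma cone_patch_shift:
  assumes "cone_patch D y a \<kappa> \<delta>" "dist y y' < \<delta>"
  shows "cone_patch D y' a \<kappa> (\<delta> - dist y y')"
  unfolding cone_patch_def
proof (intro conjI ballI allI impI)
  fix z v assume z: "z \<in> frontier D \<inter> ball y' (\<delta> - dist y y')" and v: "v \<noteq> 0" "norm v < \<delta> - dist y y'" "\<kappa> * norm v < a \<bullet> v"
  have "dist y z < \<delta>" using z dist_triangle[of y z y'] by auto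
  moreover have "norm v < \<delta>" using v(2) zero_le_dist[of y y'] by linarith
  ultimately show "z + v \<in> D" "z - v \<notin> closure D" using cone_patchD[OF assms(1)] z v by auto
qed (use assms in \<open>auto simp: cone_patch_def\<close>)

text \<open>In the chart the boundary is the graph of an \<open>L\<close>-Lipschitz function, and a
  displacement steeper than slope \<open>L\<close> cannot cross the graph.\<close>

lemma lipschitz_boundary_imp_cone_patch:
  fixes D :: "'m::finite space set"
  assumes D: "lipschitz_boundary D" "open D" and y: "y \<in> frontier D"
  obtains a \<kappa> \<delta> where "cone_patch D y a \<kappa> \<delta>"
proof -
  obtain \<epsilon> I f L0 where \<epsilon>: "\<epsilon> > 0" and I: "affine_isometry I" "I y = 0"
    and f0: "L0-lipschitz_on UNIV (f :: real ^ 'm \<Rightarrow> real)"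
    and eq: "I ` (D \<inter> ball y \<epsilon>) = {z \<in> ball 0 \<epsilon>. snd z > f (fst z)}"
  proof -
    from bspec[OF D(1)[unfolded lipschitz_boundary_def] y] show ?thesis
      by (elim exE conjE) (rule that; assumption)
  qed
  obtain T c where T: "orthogonal_transformation T" and Ic: "I = (\<lambda>z. T z + c)"
    using I(1) by (auto simp: affine_isometry_def)
  have lin: "linear T" using T by (rule orthogonal_transformation_linear)
  have IT: "I z = T (z - y)" for z
    using I(2) lin by (simp add: Ic linear_diff eq_neg_iff_add_eq_0 add.commute)
  have contT: "continuous_on UNIV T" using lin by (simp add: linear_continuous_on linear_conv_bounded_linear)
  define L where "L = max L0 1"
  have L: "1 \<le> L" and f: "L-lipschitz_on UNIV f" using f0 by (auto simp: L_def intro: lipschitz_on_le)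
  \<comment> \<open>The cosine of the half-angle of the cone above slope \<open>L\<close>: for a
    displacement with horizontal part \<open>q\<close> and height \<open>s\<close>, the cone
    condition implies \<open>L * norm q < s\<close>.\<close>
  define \<kappa> where "\<kappa> = L / sqrt (1 + L\<^sup>2)"
  have sq: "sqrt (1 + L\<^sup>2) > 0" "L < sqrt (1 + L\<^sup>2)"
    using L by (auto simp: real_less_rsqrt add_pos_nonneg)
  have \<kappa>: "0 \<le> \<kappa>" "\<kappa> < 1" using L sq by (auto simp: \<kappa>_def)
  obtain a where a: "T a = (0, 1)" using orthogonal_transformation_surj[OF T] by (metis surjD)
  have na: "norm a = 1" using orthogonal_transformation_norm[OF T, of a] by (simp add: a norm_Pair)
  have inD: "p \<in> D \<longleftrightarrow> snd (I p) > f (fst (I p))" if "p \<in> ball y \<epsilon>" for p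
  proof
    assume "p \<in> D" then show "snd (I p) > f (fst (I p))" using eq that by blast
  next
    assume s: "snd (I p) > f (fst (I p))"
    have "norm (I p) < \<epsilon>" using that T by (simp add: IT orthogonal_transformation_norm dist_norm norm_minus_commute)
    then have "I p \<in> I ` (D \<inter> ball y \<epsilon>)" using s eq by auto
    then obtain q where q: "q \<in> D" "I p = I q" by auto
    then have "T p = T q" by (simp add: Ic)
    then have "p = q" using orthogonal_transformation_inj[OF T] by (simp add: injD)
    then show "p \<in> D" using q by simp
  qed
  have contf: "continuous_on UNIV f" using f by (rule lipschitz_on_continuous_on)
  have below: "p \<notin> closure D" if p: "p \<in> ball y \<epsilon>" "snd (I p) < f (fst (I p))" for p
  proof -
    define W where "W = {p. snd (I p) < f (fst (I p))}"
    have "open W" unfolding W_def Ic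
      by (intro open_Collect_less continuous_intros continuous_on_compose2[OF contf] continuous_on_subset[OF contT]) auto
    then have "open (W \<inter> ball y \<epsilon>)" by auto
    moreover have "(W \<inter> ball y \<epsilon>) \<inter> D = {}" using inD by (fastforce simp: W_def)
    ultimately have "(W \<inter> ball y \<epsilon>) \<inter> closure D = {}" using open_Int_closure_eq_empty by blast
    then show ?thesis using p by (auto simp: W_def)
  qed
  have fr: "snd (I p) = f (fst (I p))" if "p \<in> frontier D" "p \<in> ball y \<epsilon>" for p
    using that below inD D(2) unfolding frontier_def by (metis DiffE interior_open linorder_less_linear)
  \<comment> \<open>Half the chart radius keeps \<open>z + v\<close> and \<open>z - v\<close> inside
    the chart ball.\<close>
  have "cone_patch D y a \<kappa> (\<epsilon> / 2)"
    unfolding cone_patch_def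
  proof (intro conjI ballI allI impI)
    fix z v assume z: "z \<in> frontier D \<inter> ball y (\<epsilon> / 2)" and v: "v \<noteq> 0" "norm v < \<epsilon> / 2" "\<kappa> * norm v < a \<bullet> v"
    define s where "s = snd (T v)"
    define q where "q = fst (T v)"
    have s: "a \<bullet> v = s"
    proof -
      have "a \<bullet> v = T a \<bullet> T v" using T by (metis orthogonal_transformation_def)
      then show ?thesis by (simp add: a inner_prod_def s_def)
    qed
    have nv: "(norm v)\<^sup>2 = (norm q)\<^sup>2 + s\<^sup>2"
      using orthogonal_transformation_norm[OF T, of v] by (simp add: s_def q_def norm_prod_def flip: power2_eq_square)
    have sL: "L * norm q < s"
    proof -
      have "0 \<le> \<kappa> * norm v" using \<kappa> by simp
      then have s0: "0 < s" using v s by linarith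
      have "(\<kappa> * norm v)\<^sup>2 < s\<^sup>2" using v(3) s \<kappa> by (intro power_strict_mono) auto
      then have "\<kappa>\<^sup>2 * ((norm q)\<^sup>2 + s\<^sup>2) < s\<^sup>2" by (simp add: power_mult_distrib nv)
      moreover have "\<kappa>\<^sup>2 = L\<^sup>2 / (1 + L\<^sup>2)" by (simp add: \<kappa>_def power_divide)
      moreover have "0 < 1 + L\<^sup>2" by (simp add: add_pos_nonneg)
      ultimately have "L\<^sup>2 * ((norm q)\<^sup>2 + s\<^sup>2) < s\<^sup>2 * (1 + L\<^sup>2)" by (simp add: field_simps)
      then have "(L * norm q)\<^sup>2 < s\<^sup>2" by (simp add: algebra_simps power_mult_distrib)
      then show ?thesis using s0 by (simp add: power2_less_imp_less)
    qed
    have zb: "z \<in> ball y \<epsilon>" using z \<epsilon> by auto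
    have pb: "z + v \<in> ball y \<epsilon>" "z - v \<in> ball y \<epsilon>"
      using z v dist_triangle[of y "z + v" z] dist_triangle[of y "z - v" z] by (auto simp: dist_norm)
    have Ip: "I (z + v) = I z + T v" "I (z - v) = I z - T v"
      using lin by (auto simp: Ic linear_add linear_diff)
    have "\<bar>f (fst (I z) + q) - f (fst (I z))\<bar> \<le> L * norm q" "\<bar>f (fst (I z) - q) - f (fst (I z))\<bar> \<le> L * norm q"
      using lipschitz_onD[OF f, of "fst (I z) + q" "fst (I z)"] lipschitz_onD[OF f, of "fst (I z) - q" "fst (I z)"]
      by (auto simp: dist_norm)
    then have "f (fst (I z) + q) < snd (I z) + s" "snd (I z) - s < f (fst (I z) - q)"
      using sL fr[of z] z zb by (auto simp: abs_le_iff)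
    then show "z + v \<in> D" "z - v \<notin> closure D"
      using inD[OF pb(1)] below[OF pb(2)] by (auto simp: Ip s_def q_def)
  qed (use na \<kappa> \<epsilon> in auto)
  then show ?thesis by (rule that)
qed

section \<open>The inner normal at points with a \<open>C^1\<close> chart\<close>

text \<open>Since \<open>\<phi>'\<close> is continuous, the linearization at \<open>p\<close> has a
  small relative error for all pairs of nearby parameters. The vector \<open>v\<close> annihilates
  the linear part, and injectivity of the derivative bounds \<open>\<phi> q - \<phi> q'\<close>
  below by a multiple of \<open>q - q'\<close>. Having the estimate for pairs \<open>z\<close>,
  \<open>z'\<close>, not only for \<open>y\<close>, is what yields cones at all neighbouring
  boundary points.\<close>

lemma C1_chart_flat:
  assumes ch: "C1_chart S y \<phi> \<phi>' p" and v: "norm v = 1" "\<And>w. v \<bullet> blinfun_apply (\<phi>' p) w = 0" and \<kappa>: "0 < \<kappa>"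
  obtains \<delta> where "0 < \<delta>"
    "\<And>z z'. z \<in> S \<inter> ball y \<delta> \<Longrightarrow> z' \<in> S \<inter> ball y \<delta> \<Longrightarrow> \<bar>v \<bullet> (z - z')\<bar> \<le> \<kappa> * norm (z - z')"
proof -
  obtain G W \<psi> where G: "open G" "open W" "p \<in> G" "y \<in> W" "\<phi> p = y" "homeomorphism G (S \<inter> W) \<phi> \<psi>"
    "\<And>q. q \<in> G \<Longrightarrow> (\<phi> has_derivative blinfun_apply (\<phi>' q)) (at q)" "continuous_on G \<phi>'"
    "\<And>q. q \<in> G \<Longrightarrow> inj (blinfun_apply (\<phi>' q))"
    using ch unfolding C1_chart_def by blast
  obtain c where c: "c > 0" "\<And>w. c * norm w \<le> norm (blinfun_apply (\<phi>' p) w)"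
    using linear_inj_bounded_below_pos[OF bounded_linear.linear[OF blinfun.bounded_linear_right] G(9)[OF G(3)]] by metis
  \<comment> \<open>The first term preserves half of the lower bound \<open>c\<close>; the second
    makes the error at most \<open>\<kappa>\<close> times that half.\<close>
  define \<eta> where "\<eta> = min (c / 2) (\<kappa> * c / 2)"
  have \<eta>: "\<eta> > 0" "\<eta> \<le> c / 2" "\<eta> \<le> \<kappa> * c / 2" using c \<kappa> by (auto simp: \<eta>_def)
  have "continuous (at p) \<phi>'" using G(1,3,8) by (simp add: continuous_on_eq_continuous_at)
  then obtain r1 where r1: "r1 > 0" "\<And>q. dist q p < r1 \<Longrightarrow> dist (\<phi>' q) (\<phi>' p) < \<eta>"
    using \<eta>(1) unfolding continuous_at_eps_delta by metis
  obtain r2 where r2: "r2 > 0" "ball p r2 \<subseteq> G" using G(1,3) open_contains_ball by blast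
  define r where "r = min r1 r2"
  have r: "r > 0" "ball p r \<subseteq> G" using r1 r2 by (auto simp: r_def)
  have lin: "norm (\<phi> q - \<phi> q' - blinfun_apply (\<phi>' p) (q - q')) \<le> norm (q - q') * \<eta>"
    if "q \<in> ball p r" "q' \<in> ball p r" for q q'
  proof (rule differentiable_bound_linearization[where S="ball p r" and f'="\<lambda>q. blinfun_apply (\<phi>' q)"])
    show "q' + t *\<^sub>R (q - q') \<in> ball p r" if "t \<in> {0..1}" for t
    proof -
      have "(1 - t) *\<^sub>R q' + t *\<^sub>R q \<in> ball p r"
        using convex_ball[of p r] \<open>q \<in> ball p r\<close> \<open>q' \<in> ball p r\<close> that unfolding convex_alt by auto
      then show ?thesis by (simp add: algebra_simps)
    qed
    show "(\<phi> has_derivative blinfun_apply (\<phi>' x)) (at x within ball p r)" if "x \<in> ball p r" for x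
      using G(7) r that by (blast intro: has_derivative_at_withinI)
    show "onorm (blinfun_apply (\<phi>' x) - blinfun_apply (\<phi>' p)) \<le> \<eta>" if "x \<in> ball p r" for x
    proof -
      have "norm (\<phi>' x - \<phi>' p) < \<eta>" using r1(2)[of x] that by (auto simp: r_def dist_norm norm_minus_commute)
      then show ?thesis by (simp add: norm_blinfun.rep_eq minus_blinfun.rep_eq fun_diff_def)
    qed
  qed (use r in auto)
  have flat: "\<bar>v \<bullet> (\<phi> q - \<phi> q')\<bar> \<le> \<kappa> * norm (\<phi> q - \<phi> q')" if "q \<in> ball p r" "q' \<in> ball p r" for q q'
  proof -
    let ?e = "\<phi> q - \<phi> q' - blinfun_apply (\<phi>' p) (q - q')"
    have "c * norm (q - q') \<le> norm (blinfun_apply (\<phi>' p) (q - q'))" by (rule c)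
    also have "\<dots> \<le> norm (\<phi> q - \<phi> q') + norm ?e"
      using norm_triangle_ineq4[of "\<phi> q - \<phi> q'" ?e] by simp
    finally have "c * norm (q - q') \<le> norm (\<phi> q - \<phi> q') + norm (q - q') * \<eta>" using lin[OF that] by linarith
    moreover have "norm (q - q') * \<eta> \<le> norm (q - q') * (c / 2)" using \<eta> by (intro mult_left_mono) auto
    ultimately have ge: "(c / 2) * norm (q - q') \<le> norm (\<phi> q - \<phi> q')" by (simp add: algebra_simps)
    have "v \<bullet> (\<phi> q - \<phi> q') = v \<bullet> ?e" using v(2)[of "q - q'"] by (simp add: inner_diff_right)
    also have "\<bar>\<dots>\<bar> \<le> norm v * norm ?e" by (rule Cauchy_Schwarz_ineq2)
    also have "\<dots> \<le> norm (q - q') * \<eta>" using lin[OF that] v(1) by simp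
    also have "\<dots> \<le> norm (q - q') * (\<kappa> * c / 2)" using \<eta> by (intro mult_left_mono) auto
    also have "\<dots> = \<kappa> * ((c / 2) * norm (q - q'))" by simp
    also have "\<dots> \<le> \<kappa> * norm (\<phi> q - \<phi> q')" using ge \<kappa> by (intro mult_left_mono) auto
    finally show ?thesis by simp
  qed
  have psi: "continuous_on (S \<inter> W) \<psi>" "\<And>z. z \<in> S \<inter> W \<Longrightarrow> \<phi> (\<psi> z) = z" and psiy: "\<psi> y = p" and yS: "y \<in> S \<inter> W"
    using G(3,5,6) unfolding homeomorphism_def by auto
  obtain d1 where d1: "d1 > 0" "\<And>z. z \<in> S \<inter> W \<Longrightarrow> dist z y < d1 \<Longrightarrow> dist (\<psi> z) p < r"
    using psi(1) yS r(1) unfolding continuous_on_iff psiy[symmetric] by metis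
  obtain d2 where d2: "d2 > 0" "ball y d2 \<subseteq> W" using G(2,4) open_contains_ball by blast
  show ?thesis
  proof (rule that[of "min d1 d2"])
    fix z z' assume "z \<in> S \<inter> ball y (min d1 d2)" "z' \<in> S \<inter> ball y (min d1 d2)"
    then have "z \<in> S \<inter> W" "z' \<in> S \<inter> W" "\<psi> z \<in> ball p r" "\<psi> z' \<in> ball p r"
      using d1(2)[of z] d1(2)[of z'] subsetD[OF d2(2), of z] subsetD[OF d2(2), of z']
      by (auto simp: dist_commute)
    then show "\<bar>v \<bullet> (z - z')\<bar> \<le> \<kappa> * norm (z - z')"
      using flat[of "\<psi> z" "\<psi> z'"] psi(2) by simp
  qed (use d1 d2 in auto)
qed

lemma segment_crosses_frontier:
  fixes p q :: "'a::real_normed_vector"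
  assumes "p \<in> D" "q \<notin> D"
  obtains z where "z \<in> closed_segment p q" "z \<in> frontier D"
  using connected_Int_frontier[of "closed_segment p q" D] assms by blast

text \<open>If \<open>v\<close> were orthogonal to \<open>a\<close>, the segment in direction
  \<open>a\<close> through \<open>y + t *\<^sub>R v\<close> would run from \<open>D\<close> to the
  exterior and meet the boundary at a point displaced by \<open>t\<close> in direction
  \<open>v\<close>, which flatness forbids. If \<open>v\<close> makes an acute angle with
  \<open>a\<close>, the narrow cones \<open>z + K\<close> and \<open>z - K\<close> miss the boundary
  by flatness, are connected, and contain \<open>z + t *\<^sub>R a\<close> and
  \<open>z - t *\<^sub>R a\<close>, which tells on which side each of them lies.\<close>

lemma flat_axis_cone_patch:
  fixes D :: "'a::euclidean_space set"
  assumes D: "open D" and y: "y \<in> frontier D" and patch: "cone_patch D y a \<kappa>0 \<delta>0" and v: "norm v = 1"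
    and flat: "\<And>\<kappa>. 0 < \<kappa> \<Longrightarrow> \<exists>\<delta>>0. \<forall>z \<in> frontier D \<inter> ball y \<delta>. \<forall>z' \<in> frontier D \<inter> ball y \<delta>.
        \<bar>v \<bullet> (z - z')\<bar> \<le> \<kappa> * norm (z - z')"
  shows "v \<bullet> a \<noteq> 0" and "\<And>\<kappa>. 0 < v \<bullet> a \<Longrightarrow> 0 < \<kappa> \<Longrightarrow> \<kappa> < 1 \<Longrightarrow> \<exists>\<delta>. cone_patch D y v \<kappa> \<delta>"
proof -
  have \<kappa>0: "0 \<le> \<kappa>0" "\<kappa>0 < 1" "0 < \<delta>0" and na: "norm a = 1" using patch by (auto simp: cone_patch_def)
  show "v \<bullet> a \<noteq> 0"
  proof
    assume va: "v \<bullet> a = 0"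
    have k1: "0 < 1 - \<kappa>0\<^sup>2" using \<kappa>0 by (simp add: power_less_one_iff abs_square_less_1)
    \<comment> \<open>Steep enough for \<open>t *\<^sub>R v + (M * t) *\<^sub>R a\<close> and its
      mirror image to lie in the cone with parameter \<open>\<kappa>0\<close>: this needs
      \<open>\<kappa>0\<^sup>2 * (1 + M\<^sup>2) < M\<^sup>2\<close>.\<close>
    define M where "M = 1 / sqrt (1 - \<kappa>0\<^sup>2)"
    have M0: "M > 0" using k1 by (simp add: M_def)
    have M: "M\<^sup>2 * (1 - \<kappa>0\<^sup>2) = 1" using k1 by (simp add: M_def power_divide)
    have k2: "\<kappa>0\<^sup>2 < 1" using k1 by simp
    obtain \<delta> where \<delta>: "\<delta> > 0" "\<And>z z'. z \<in> frontier D \<inter> ball y \<delta> \<Longrightarrow> z' \<in> frontier D \<inter> ball y \<delta> \<Longrightarrow>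
        \<bar>v \<bullet> (z - z')\<bar> \<le> 1 / (2 * (1 + M)) * norm (z - z')"
      using flat[of "1 / (2 * (1 + M))"] M0 by auto
    define t where "t = min \<delta> \<delta>0 / (2 * (1 + M))"
    have t: "t > 0" "t * (1 + M) < \<delta>" "t * (1 + M) < \<delta>0"
    proof -
      have m: "0 < min \<delta> \<delta>0" using \<delta> \<kappa>0 by simp
      then show "t > 0" using M0 by (simp add: t_def)
      have "b / (2 * c) * c = b / 2" if "c > 0" for b c :: real using that by simp
      from this[of "1 + M"] have "t * (1 + M) = min \<delta> \<delta>0 / 2" unfolding t_def using M0 by simp
      then show "t * (1 + M) < \<delta>" "t * (1 + M) < \<delta>0" using m by linarith+
    qed
    have nle: "norm (t *\<^sub>R v + s *\<^sub>R a) \<le> t * (1 + M)" "norm (t *\<^sub>R v - s *\<^sub>R a) \<le> t * (1 + M)" if "\<bar>s\<bar> \<le> M * t" for s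
      using norm_triangle_ineq[of "t *\<^sub>R v" "s *\<^sub>R a"] norm_triangle_ineq4[of "t *\<^sub>R v" "s *\<^sub>R a"] that v na t
      by (auto simp: algebra_simps)
    have cone: "\<kappa>0 * norm (\<sigma> *\<^sub>R t *\<^sub>R v + (M * t) *\<^sub>R a) < M * t" if "\<sigma> = 1 \<or> \<sigma> = -1" for \<sigma> :: real
    proof -
      have "(norm (\<sigma> *\<^sub>R t *\<^sub>R v + (M * t) *\<^sub>R a))\<^sup>2 =
          (\<sigma> * t)\<^sup>2 * (v \<bullet> v) + 2 * (\<sigma> * t * (M * t)) * (v \<bullet> a) + (M * t)\<^sup>2 * (a \<bullet> a)"
        unfolding power2_norm_eq_inner
        by (simp add: inner_simps inner_commute[of a v] power2_eq_square algebra_simps)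
      also have "\<dots> = t\<^sup>2 + (M * t)\<^sup>2"
        using va v na that by (auto simp: norm_eq_1)
      finally have "(norm (\<sigma> *\<^sub>R t *\<^sub>R v + (M * t) *\<^sub>R a))\<^sup>2 = t\<^sup>2 + (M * t)\<^sup>2" .
      then have "(\<kappa>0 * norm (\<sigma> *\<^sub>R t *\<^sub>R v + (M * t) *\<^sub>R a))\<^sup>2 = \<kappa>0\<^sup>2 * (1 + M\<^sup>2) * t\<^sup>2"
        by (simp add: power_mult_distrib algebra_simps)
      also have "\<dots> < M\<^sup>2 * t\<^sup>2"
      proof -
        have "\<kappa>0\<^sup>2 * (1 + M\<^sup>2) < M\<^sup>2" using M k2 by (simp add: algebra_simps)
        then show ?thesis using t by (intro mult_strict_right_mono) auto
      qed
      finally have "(\<kappa>0 * norm (\<sigma> *\<^sub>R t *\<^sub>R v + (M * t) *\<^sub>R a))\<^sup>2 < (M * t)\<^sup>2" by (simp add: power_mult_distrib)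
      then show ?thesis using M0 t by (simp add: power2_less_imp_less)
    qed
    have ip: "a \<bullet> (\<sigma> *\<^sub>R t *\<^sub>R v + (M * t) *\<^sub>R a) = M * t" for \<sigma>
      using va na by (simp add: inner_simps inner_commute[of a v] norm_eq_1)
    have Mt: "M * t > 0" using M0 t by simp
    have nz: "\<sigma> *\<^sub>R t *\<^sub>R v + (M * t) *\<^sub>R a \<noteq> 0" for \<sigma> using ip[of \<sigma>] Mt by (metis inner_zero_right less_irrefl)
    have up: "y + (t *\<^sub>R v + (M * t) *\<^sub>R a) \<in> D"
      using cone_patchD(1)[OF patch y, of "1 *\<^sub>R t *\<^sub>R v + (M * t) *\<^sub>R a"] cone[of 1] ip[of 1] nz[of 1] nle(1)[of "M * t"] t \<kappa>0 Mt
      by auto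
    have dn: "y - ((-1) *\<^sub>R t *\<^sub>R v + (M * t) *\<^sub>R a) \<notin> closure D"
    proof (rule cone_patchD(2)[OF patch y])
      have "norm ((-1) *\<^sub>R t *\<^sub>R v + (M * t) *\<^sub>R a) = norm (t *\<^sub>R v - (M * t) *\<^sub>R a)"
        by (metis add.commute minus_diff_eq norm_minus_cancel scaleR_minus1_left uminus_add_conv_diff)
      then show "norm ((-1) *\<^sub>R t *\<^sub>R v + (M * t) *\<^sub>R a) < \<delta>0" using nle(2)[of "M * t"] t Mt by auto
      show "\<kappa>0 * norm ((- 1) *\<^sub>R t *\<^sub>R v + (M * t) *\<^sub>R a) < a \<bullet> ((- 1) *\<^sub>R t *\<^sub>R v + (M * t) *\<^sub>R a)"
        using cone[of "-1"] ip[of "-1"] by simp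
    qed (use nz[of "-1"] \<kappa>0 in auto)
    then have dn': "y + (t *\<^sub>R v + (- M * t) *\<^sub>R a) \<notin> D" using closure_subset by (auto simp: algebra_simps)
    obtain z where z: "z \<in> closed_segment (y + (t *\<^sub>R v + (M * t) *\<^sub>R a)) (y + (t *\<^sub>R v + (- M * t) *\<^sub>R a))" "z \<in> frontier D"
      using segment_crosses_frontier[OF up dn'] .
    then obtain u where u: "0 \<le> u" "u \<le> 1"
      "z = (1 - u) *\<^sub>R (y + (t *\<^sub>R v + (M * t) *\<^sub>R a)) + u *\<^sub>R (y + (t *\<^sub>R v + (- M * t) *\<^sub>R a))"
      by (auto simp: closed_segment_def)
    define s where "s = (1 - 2 * u) * (M * t)"
    have zs: "z = y + (t *\<^sub>R v + s *\<^sub>R a)" unfolding u s_def by (simp add: scaleR_add_right scaleR_diff_left scaleR_add_left algebra_simps flip: scaleR_add_left)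
    have s: "\<bar>s\<bar> \<le> M * t"
    proof -
      have "\<bar>1 - 2 * u\<bar> * (M * t) \<le> 1 * (M * t)" using u Mt by (intro mult_right_mono) auto
      then show ?thesis using Mt M0 t by (simp add: s_def abs_mult)
    qed
    have "t = v \<bullet> (z - y)" using va v by (simp add: zs inner_simps norm_eq_1)
    also have "\<dots> \<le> 1 / (2 * (1 + M)) * norm (z - y)"
    proof -
      have "norm (z - y) \<le> t * (1 + M)" using nle(1)[OF s] by (simp add: zs)
      then have "z \<in> ball y \<delta>" using t by (simp add: dist_norm norm_minus_commute)
      then show ?thesis using \<delta>(2)[of z y] z y \<delta>(1) by (meson IntI abs_le_D1 centre_in_ball)
    qed
    also have "\<dots> \<le> 1 / (2 * (1 + M)) * (t * (1 + M))"
      using nle(1)[OF s] M0 by (intro mult_left_mono) (auto simp: zs)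
    also have "\<dots> = t / 2" using M0 by (simp add: field_simps)
    finally show False using t by simp
  qed
  fix \<kappa> :: real assume va: "0 < v \<bullet> a" and \<kappa>: "0 < \<kappa>" "\<kappa> < 1"
  \<comment> \<open>Below \<open>v \<bullet> a\<close>, so that multiples of the old axis
    \<open>a\<close> belong to the new cone \<open>K\<close>.\<close>
  define \<kappa>1 where "\<kappa>1 = min \<kappa> (v \<bullet> a / 2)"
  have \<kappa>1: "0 < \<kappa>1" "\<kappa>1 \<le> \<kappa>" "\<kappa>1 < v \<bullet> a" using va \<kappa> by (auto simp: \<kappa>1_def)
  obtain \<delta>1 where \<delta>1: "\<delta>1 > 0" "\<And>z z'. z \<in> frontier D \<inter> ball y \<delta>1 \<Longrightarrow> z' \<in> frontier D \<inter> ball y \<delta>1 \<Longrightarrow>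
        \<bar>v \<bullet> (z - z')\<bar> \<le> \<kappa>1 * norm (z - z')"
    using flat[OF \<kappa>1(1)] by auto
  define \<delta> where "\<delta> = min \<delta>1 \<delta>0 / 2"
  have \<delta>: "\<delta> > 0" "2 * \<delta> \<le> \<delta>1" "2 * \<delta> \<le> \<delta>0" using \<delta>1 \<kappa>0 by (auto simp: \<delta>_def)
  define K where "K = {u. norm u < \<delta> \<and> \<kappa>1 * norm u < v \<bullet> u}"
  have "convex K"
  proof -
    have "convex {u. \<kappa>1 * norm u < v \<bullet> u}"
      unfolding convex_def
    proof (clarify)
      fix x w :: 'a and s t :: real
      assume xw: "\<kappa>1 * norm x < v \<bullet> x" "\<kappa>1 * norm w < v \<bullet> w" and st: "0 \<le> s" "0 \<le> t" "s + t = 1"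
      have "\<kappa>1 * norm (s *\<^sub>R x + t *\<^sub>R w) \<le> \<kappa>1 * (s * norm x + t * norm w)"
        using norm_triangle_ineq[of "s *\<^sub>R x" "t *\<^sub>R w"] st \<kappa>1 by (intro mult_left_mono) auto
      also have "\<dots> = s * (\<kappa>1 * norm x) + t * (\<kappa>1 * norm w)" by (simp add: algebra_simps)
      also have "\<dots> < s * (v \<bullet> x) + t * (v \<bullet> w)"
      proof (cases "s = 0")
        case True then show ?thesis using st xw by simp
      next
        case False
        then show ?thesis using st xw by (intro add_less_le_mono mult_strict_left_mono mult_left_mono) auto
      qed
      finally show "\<kappa>1 * norm (s *\<^sub>R x + t *\<^sub>R w) < v \<bullet> (s *\<^sub>R x + t *\<^sub>R w)" by (simp add: inner_simps)
    qed
    moreover have "K = {u. \<kappa>1 * norm u < v \<bullet> u} \<inter> ball 0 \<delta>" by (auto simp: K_def)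
    ultimately show ?thesis by (simp add: convex_Int)
  qed
  have "cone_patch D y v \<kappa> \<delta>"
    unfolding cone_patch_def
  proof (intro conjI ballI allI impI)
    fix z u assume z: "z \<in> frontier D \<inter> ball y \<delta>" and u: "u \<noteq> 0" "norm u < \<delta>" "\<kappa> * norm u < v \<bullet> u"
    have "\<kappa>1 * norm u \<le> \<kappa> * norm u" using \<kappa>1 by (intro mult_right_mono) auto
    then have "\<kappa>1 * norm u < v \<bullet> u" using u by linarith
    then have uK: "u \<in> K" using u by (auto simp: K_def)
    have nf: "z + w \<notin> frontier D \<and> z - w \<notin> frontier D" if w: "w \<in> K" for w
    proof -
      have b: "z \<in> ball y \<delta>1" "z + w \<in> ball y \<delta>1" "z - w \<in> ball y \<delta>1"
        using z w \<delta> dist_triangle[of y "z + w" z] dist_triangle[of y "z - w" z] by (auto simp: K_def dist_norm)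
      have "\<not> \<bar>v \<bullet> w\<bar> \<le> \<kappa>1 * norm w" using w by (auto simp: K_def)
      then show ?thesis using \<delta>1(2)[of "z + w" z] \<delta>1(2)[of "z - w" z] b z by auto
    qed
    define t where "t = \<delta> / 2"
    have t: "0 < t" "t < \<delta>" using \<delta> by (auto simp: t_def)
    have taK: "t *\<^sub>R a \<in> K" using t \<kappa>1 na by (auto simp: K_def)
    have ta: "z + t *\<^sub>R a \<in> D" "z - t *\<^sub>R a \<notin> closure D"
      using cone_patchD[OF patch, of z "t *\<^sub>R a"] z t \<delta> na \<kappa>0 norm_eq_1[of a] norm_eq_zero[of a] by auto
    have "connected ((\<lambda>w. z + w) ` K)" "connected ((\<lambda>w. z - w) ` K)"
      by (intro connected_continuous_image continuous_intros convex_connected[OF \<open>convex K\<close>])+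
    then have "(+) z ` K \<subseteq> D" "(\<lambda>w. z - w) ` K \<inter> D = {}"
      using connected_Int_frontier[of "(+) z ` K" D] connected_Int_frontier[of "(\<lambda>w. z - w) ` K" D]
        nf ta taK closure_subset[of D] by blast+
    then show "z + u \<in> D" "z - u \<notin> closure D"
      using uK nf[OF uK] D by (auto simp: frontier_def interior_open)
  qed (use v \<kappa> \<delta> in auto)
  then show "\<exists>\<delta>. cone_patch D y v \<kappa> \<delta>" by blast
qed

text \<open>The definite description in \<open>inner_normal\<close> is justified here. Existence: a
  unit vector orthogonal to the range of the chart derivative exists by dimension, and its sign is
  fixed by the cone axis \<open>a\<close>. Uniqueness makes the vector independent of the chart,
  hence the last conclusion for every chart at \<open>x\<close>.\<close>

lemma inner_normal:
  fixes D :: "'m::finite space set"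
  assumes D: "lipschitz_boundary D" "open D" and x: "x \<in> frontier D"
    and ch0: "\<exists>\<phi> \<phi>' p. C1_chart (frontier D) x \<phi> \<phi>' p"
  shows "norm (inner_normal D x) = 1"
    and "\<And>\<kappa>. 0 < \<kappa> \<Longrightarrow> \<kappa> < 1 \<Longrightarrow> \<exists>\<delta>. cone_patch D x (inner_normal D x) \<kappa> \<delta>"
    and "\<And>\<phi> \<phi>' p w. C1_chart (frontier D) x \<phi> \<phi>' p \<Longrightarrow> inner_normal D x \<bullet> blinfun_apply (\<phi>' p) w = 0"
proof -
  obtain a \<kappa>0 \<delta>0 where patch: "cone_patch D x a \<kappa>0 \<delta>0" using lipschitz_boundary_imp_cone_patch[OF D x] .
  define good where "good v \<longleftrightarrow> norm v = 1 \<and> (\<exists>\<phi> \<phi>' p. C1_chart (frontier D) x \<phi> \<phi>' p \<and> (\<forall>w. v \<bullet> blinfun_apply (\<phi>' p) w = 0)) \<and>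
        (\<exists>\<epsilon> > 0. \<forall>t. 0 < t \<and> t < \<epsilon> \<longrightarrow> x + t *\<^sub>R v \<in> D)" for v
  have flat: "v \<bullet> a \<noteq> 0 \<and> (0 < v \<bullet> a \<longrightarrow> (\<forall>\<kappa>. 0 < \<kappa> \<longrightarrow> \<kappa> < 1 \<longrightarrow> (\<exists>\<delta>. cone_patch D x v \<kappa> \<delta>)))"
    if ch: "C1_chart (frontier D) x \<phi> \<phi>' p" and v: "norm v = 1" "\<And>w. v \<bullet> blinfun_apply (\<phi>' p) w = 0" for v \<phi> \<phi>' p
  proof -
    have "\<exists>\<delta>>0. \<forall>z \<in> frontier D \<inter> ball x \<delta>. \<forall>z' \<in> frontier D \<inter> ball x \<delta>. \<bar>v \<bullet> (z - z')\<bar> \<le> \<kappa> * norm (z - z')"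
      if "0 < \<kappa>" for \<kappa>
      by (rule C1_chart_flat[OF ch v that]) blast
    from flat_axis_cone_patch[OF D(2) x patch v(1) this] show ?thesis by blast
  qed
  have pos: "\<exists>\<epsilon> > 0. \<forall>t. 0 < t \<and> t < \<epsilon> \<longrightarrow> x + t *\<^sub>R v \<in> D \<and> x - t *\<^sub>R v \<notin> closure D" if p: "cone_patch D x v (1/2) \<delta>" for v \<delta>
  proof (intro exI[of _ \<delta>] conjI allI impI)
    show "\<delta> > 0" using p by (simp add: cone_patch_def)
    have nv: "norm v = 1" using p by (simp add: cone_patch_def)
    fix t assume t: "0 < t \<and> t < \<delta>"
    show "x + t *\<^sub>R v \<in> D" "x - t *\<^sub>R v \<notin> closure D"
      using cone_patchD[OF p x, of "t *\<^sub>R v"] t nv nv[THEN norm_eq_1[THEN iffD1]] norm_eq_zero[of v] by auto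
  qed
  have ex: "\<exists>v. good v \<and> v \<bullet> a > 0 \<and> (\<forall>w. v \<bullet> blinfun_apply (\<phi>' p) w = 0)" if ch: "C1_chart (frontier D) x \<phi> \<phi>' p" for \<phi> \<phi>' p
  proof -
    have lin: "linear (blinfun_apply (\<phi>' p))" by (rule bounded_linear.linear[OF blinfun.bounded_linear_right])
    have "dim (range (blinfun_apply (\<phi>' p))) \<le> dim (UNIV :: (real ^ 'm) set)"
      by (rule dim_image_le[OF lin])
    also have "\<dots> < DIM('m space)" by simp
    finally obtain v0 where v0: "v0 \<noteq> 0" "\<And>w. w \<in> span (range (blinfun_apply (\<phi>' p))) \<Longrightarrow> orthogonal v0 w"
      using orthogonal_to_subspace_exists[of "range (blinfun_apply (\<phi>' p))"] by auto
    define v1 where "v1 = sgn v0"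
    have v1: "norm v1 = 1" "\<And>w. v1 \<bullet> blinfun_apply (\<phi>' p) w = 0"
      using v0 span_base[of _ "range (blinfun_apply (\<phi>' p))"] by (auto simp: v1_def norm_sgn sgn_div_norm orthogonal_def)
    \<comment> \<open>The choice of sign that makes \<open>v\<close> point to the same side as
      \<open>a\<close>.\<close>
    define v where "v = sgn (v1 \<bullet> a) *\<^sub>R v1"
    have va: "v1 \<bullet> a \<noteq> 0" using flat[OF ch v1] by blast
    have v: "norm v = 1" "\<And>w. v \<bullet> blinfun_apply (\<phi>' p) w = 0" "v \<bullet> a > 0"
      using v1 va by (auto simp: v_def sgn_if)
    obtain \<delta> where "cone_patch D x v (1/2) \<delta>" using flat[OF ch v(1,2)] v(3) by fastforce
    from pos[OF this] have "good v" using v ch unfolding good_def by blast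
    then show ?thesis using v by blast
  qed
  have cp: "v \<bullet> a > 0 \<and> (\<forall>\<kappa>. 0 < \<kappa> \<longrightarrow> \<kappa> < 1 \<longrightarrow> (\<exists>\<delta>. cone_patch D x v \<kappa> \<delta>))" if g: "good v" for v
  proof -
    obtain \<phi> \<phi>' p \<epsilon> where ch: "C1_chart (frontier D) x \<phi> \<phi>' p" and v: "norm v = 1" "\<And>w. v \<bullet> blinfun_apply (\<phi>' p) w = 0"
      and \<epsilon>: "\<epsilon> > 0" "\<And>t. 0 < t \<Longrightarrow> t < \<epsilon> \<Longrightarrow> x + t *\<^sub>R v \<in> D" using g unfolding good_def by blast
    have "\<not> v \<bullet> a < 0"
    proof
      assume "v \<bullet> a < 0"
      then obtain \<delta> where "cone_patch D x (- v) (1/2) \<delta>" using flat[OF ch, of "- v"] v by fastforce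
      from pos[OF this] obtain \<epsilon>' where \<epsilon>': "\<epsilon>' > 0" "\<And>t. 0 < t \<Longrightarrow> t < \<epsilon>' \<Longrightarrow> x + t *\<^sub>R v \<notin> closure D" by auto
      define t where "t = min \<epsilon> \<epsilon>' / 2"
      have "0 < t" "t < \<epsilon>" "t < \<epsilon>'" using \<epsilon> \<epsilon>' by (auto simp: t_def)
      then show False using \<epsilon>(2) \<epsilon>'(2) closure_subset by blast
    qed
    then show ?thesis using flat[OF ch v] by (meson linorder_neqE_linordered_idom)
  qed
  \<comment> \<open>Two candidates are both axes of arbitrarily wide cones. Their difference
    \<open>u\<close> makes an acute angle with \<open>v\<close> and \<open>- u\<close> one with
    \<open>v'\<close>, so a small step along \<open>u\<close> would end both in \<open>D\<close> and
    outside its closure.\<close>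
  have uniq: "v = v'" if g: "good v" "good v'" for v v'
  proof (rule ccontr)
    assume ne: "v \<noteq> v'"
    have nv: "norm v = 1" "norm v' = 1" using g by (auto simp: good_def)
    define u where "u = v - v'"
    have u0: "u \<noteq> 0" using ne by (simp add: u_def)
    have sq: "v \<bullet> u = (norm u)\<^sup>2 / 2" "v' \<bullet> u = - (norm u)\<^sup>2 / 2"
      using nv by (simp_all add: u_def power2_norm_eq_inner inner_simps norm_eq_1 inner_commute)
    define \<kappa> where "\<kappa> = min (1/2) (norm u / 4)"
    have \<kappa>: "0 < \<kappa>" "\<kappa> < 1" "\<kappa> < norm u / 2" using u0 by (auto simp: \<kappa>_def min_def)
    obtain \<delta> \<delta>' where p: "cone_patch D x v \<kappa> \<delta>" "cone_patch D x v' \<kappa> \<delta>'" using cp g \<kappa> by blast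
    define t where "t = min \<delta> \<delta>' / (2 * norm u)"
    have d: "\<delta> > 0" "\<delta>' > 0" using p by (auto simp: cone_patch_def)
    then have t: "0 < t" "t * norm u < \<delta>" "t * norm u < \<delta>'" using u0 by (auto simp: t_def)
    have k: "\<kappa> * (t * norm u) < t * ((norm u)\<^sup>2 / 2)"
      using t \<kappa> u0 by (simp add: power2_eq_square)
    have "x + t *\<^sub>R u \<in> D" using cone_patchD(1)[OF p(1) x, of "t *\<^sub>R u"] t k u0 d sq by auto
    moreover have "x - t *\<^sub>R (- u) \<notin> closure D"
      using cone_patchD(2)[OF p(2) x, of "t *\<^sub>R (- u)"] t k u0 d sq by auto
    ultimately show False using closure_subset by auto
  qed
  obtain v0 where v0: "good v0" using ch0 ex by blast
  have eq: "inner_normal D x = v" if "good v" for v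
    unfolding inner_normal_def
    using that uniq by (intro the_equality) (auto simp: good_def)
  show "norm (inner_normal D x) = 1" using eq[OF v0] v0 by (simp add: good_def)
  show "\<exists>\<delta>. cone_patch D x (inner_normal D x) \<kappa> \<delta>" if "0 < \<kappa>" "\<kappa> < 1" for \<kappa> using eq[OF v0] cp[OF v0] that by auto
  show "inner_normal D x \<bullet> blinfun_apply (\<phi>' p) w = 0" if ch: "C1_chart (frontier D) x \<phi> \<phi>' p" for \<phi> \<phi>' p w
    using ex[OF ch] eq by auto
qed

section \<open>Hitting the boundary\<close>

text \<open>The infimum in \<open>hit_time\<close> is attained because hitting times cannot
  accumulate at 0: the ray is inside \<open>D\<close> up to \<open>\<delta>\<close>.\<close>

lemma hit_time_props:
  fixes x u :: "'a::euclidean_space"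
  assumes D: "open D" and \<delta>: "0 < \<delta>" and start: "\<And>t. 0 < t \<Longrightarrow> t < \<delta> \<Longrightarrow> x + t *\<^sub>R u \<in> D"
    and T: "0 < T" "x + T *\<^sub>R u \<notin> D"
  shows "\<delta> \<le> hit_time D x u" "hit_time D x u \<le> T" "hit_point D x u \<in> frontier D"
    "\<And>t. 0 < t \<Longrightarrow> t < hit_time D x u \<Longrightarrow> x + t *\<^sub>R u \<in> D"
proof -
  define H where "H = {t. 0 < t \<and> x + t *\<^sub>R u \<in> frontier D}"
  have nf: "p \<notin> frontier D" if "p \<in> D" for p using that D by (auto simp: frontier_def interior_open)
  have H\<delta>: "\<delta> \<le> t" if "t \<in> H" for t using that start nf by (force simp: H_def not_less[symmetric])
  have cross: "\<exists>t\<in>H. s < t \<and> t \<le> t1" if s: "0 < s" "s < t1" "x + s *\<^sub>R u \<in> D" and t1: "x + t1 *\<^sub>R u \<notin> D" for s t1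
  proof -
    obtain z where z: "z \<in> closed_segment (x + s *\<^sub>R u) (x + t1 *\<^sub>R u)" "z \<in> frontier D"
      using segment_crosses_frontier[OF s(3) t1] .
    obtain k where k: "0 \<le> k" "k \<le> 1" "z = (1 - k) *\<^sub>R (x + s *\<^sub>R u) + k *\<^sub>R (x + t1 *\<^sub>R u)"
      using z(1) by (auto simp: closed_segment_def)
    define t where "t = s + k * (t1 - s)"
    have zt: "z = x + t *\<^sub>R u" unfolding k(3) t_def by (simp add: algebra_simps)
    have "k * (t1 - s) \<le> 1 * (t1 - s)" "0 \<le> k * (t1 - s)" using k s by (intro mult_right_mono, auto)
    then have st: "s \<le> t" "t \<le> t1" by (auto simp: t_def)
    have "t \<noteq> s" using zt z(2) nf s(3) by auto
    then show ?thesis using st zt z(2) s(1) by (intro bexI[of _ t]) (auto simp: H_def)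
  qed
  have \<delta>T: "\<delta> \<le> T" using start[of T] T by force
  obtain t0 where t0: "t0 \<in> H" "t0 \<le> T"
    using cross[of "\<delta> / 2" T] start[of "\<delta> / 2"] \<delta> \<delta>T T by auto
  \<comment> \<open>Cutting off at \<open>\<delta>\<close> replaces the open condition
    \<open>0 < t\<close> by a closed one, so \<open>H\<close> is closed.\<close>
  have Heq: "H = {\<delta>..} \<inter> (\<lambda>t. x + t *\<^sub>R u) -` frontier D"
    using H\<delta> \<delta> by (auto simp: H_def)
  have bdd: "bdd_below H" using H\<delta> by (rule bdd_belowI)
  have "closed H" unfolding Heq
    by (intro closed_Int closed_atLeast closed_vimage[OF frontier_closed]) (intro continuous_intros)
  then have "Inf H \<in> H" using t0 bdd by (intro closed_contains_Inf) auto
  moreover have r: "hit_time D x u = Inf H" by (simp add: hit_time_def H_def)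
  moreover have low: "Inf H \<le> t" if "t \<in> H" for t using that bdd by (intro cInf_lower)
  ultimately show "\<delta> \<le> hit_time D x u" "hit_time D x u \<le> T" "hit_point D x u \<in> frontier D"
    using H\<delta> low[OF t0(1)] t0(2) by (auto simp: hit_point_def H_def)
  show "x + t *\<^sub>R u \<in> D" if t: "0 < t" "t < hit_time D x u" for t
  proof (rule ccontr)
    assume nD: "x + t *\<^sub>R u \<notin> D"
    then have "\<delta> \<le> t" using start t by force
    then obtain t' where "t' \<in> H" "t' \<le> t"
      using cross[of "\<delta> / 2" t] start[of "\<delta> / 2"] \<delta> nD by auto
    then show False using low t r by force
  qed
qed

section \<open>Stability of hitting points under perturbation of the ray\<close>

text \<open>A common departure time for all rays close to the given one. \<open>X\<close> is the
  whole space when \<open>y\<close> is interior and the boundary when \<open>y\<close> lies on it,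
  which lets the results below treat both cases together.\<close>

definition starts_in :: "'a::euclidean_space set \<Rightarrow> 'a set \<Rightarrow> 'a \<Rightarrow> 'a \<Rightarrow> bool" where
  "starts_in D X y u0 \<longleftrightarrow> (\<exists>\<delta>>0. \<exists>\<eta>>0. \<forall>x\<in>X. dist y x < \<eta> \<longrightarrow> (\<forall>u. norm u = 1 \<longrightarrow> dist u0 u < \<eta> \<longrightarrow>
     (\<forall>t. 0 < t \<longrightarrow> t < \<delta> \<longrightarrow> x + t *\<^sub>R u \<in> D)))"

definition hits :: "'a::euclidean_space set \<Rightarrow> 'a \<Rightarrow> 'a \<Rightarrow> 'a \<Rightarrow> real \<Rightarrow> bool" where
  "hits D x u w \<epsilon> \<longleftrightarrow> 0 < hit_time D x u \<and> (\<forall>t. 0 < t \<longrightarrow> t < hit_time D x u \<longrightarrow> x + t *\<^sub>R u \<in> D) \<and>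
     hit_point D x u \<in> frontier D \<and> dist w (hit_point D x u) < \<epsilon>"

lemma starts_in_interior:
  assumes "open D" "y \<in> D"
  shows "starts_in D UNIV y u0"
proof -
  obtain e where e: "e > 0" "ball y e \<subseteq> D" using assms open_contains_ball by blast
  show ?thesis
    unfolding starts_in_def
  proof (intro exI[of _ "e/2"] conjI ballI allI impI)
    fix x u t assume "dist y x < e/2" "norm u = 1" "dist u0 u < e/2" "0 < t" "t < e/2"
    then have "dist y (x + t *\<^sub>R u) < e"
      using dist_triangle[of y "x + t *\<^sub>R u" x] by (simp add: dist_norm)
    then show "x + t *\<^sub>R u \<in> D" using e by auto
  qed (use e in auto)
qed

lemma inner_dist_le:
  fixes a :: "'a::real_inner"
  assumes "norm a = 1"
  shows "\<bar>a \<bullet> u - a \<bullet> u'\<bar> \<le> dist u u'"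
  using Cauchy_Schwarz_ineq2[of a "u - u'"] assms by (simp add: inner_diff_right dist_norm)

lemma starts_in_patch:
  assumes p: "cone_patch D y a \<kappa> \<delta>" and u0: "\<kappa> < a \<bullet> u0"
  shows "starts_in D (frontier D) y u0"
proof -
  have na: "norm a = 1" and \<delta>: "\<delta> > 0" using p by (auto simp: cone_patch_def)
  show ?thesis
    unfolding starts_in_def
  proof (rule exI[of _ \<delta>], rule conjI[OF \<delta>], rule exI[of _ "min \<delta> (a \<bullet> u0 - \<kappa>)"], intro conjI ballI allI impI)
    fix x u t assume x: "x \<in> frontier D" "dist y x < min \<delta> (a \<bullet> u0 - \<kappa>)"
      and u: "norm u = 1" "dist u0 u < min \<delta> (a \<bullet> u0 - \<kappa>)" and t: "0 < t" "t < \<delta>"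
    have "\<kappa> < a \<bullet> u" using inner_dist_le[OF na, of u0 u] u by auto
    then have "\<kappa> * norm (t *\<^sub>R u) < a \<bullet> (t *\<^sub>R u)" using t u by simp
    moreover have "t *\<^sub>R u \<noteq> 0" using t u by auto
    ultimately show "x + t *\<^sub>R u \<in> D" using cone_patchD(1)[OF p, of x "t *\<^sub>R u"] x u t by auto
  qed (use \<delta> u0 in auto)
qed

text \<open>Up to time \<open>r - \<epsilon>1\<close> a perturbed ray stays in \<open>D\<close>: at
  first by \<open>starts_in\<close>, then because the compact rest of the segment has a
  neighbourhood in \<open>D\<close>. That it stops soon after is imposed through the point
  \<open>x + T *\<^sub>R u\<close> outside \<open>D\<close>; this form serves targets in the
  exterior as well as targets on the boundary.\<close>

lemma hits_near_segment:
  fixes y u0 :: "'a::euclidean_space"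
  assumes D: "open D" and start: "starts_in D X y u0" and u0: "norm u0 = 1"
    and r: "0 < r" "\<And>t. 0 < t \<Longrightarrow> t < r \<Longrightarrow> y + t *\<^sub>R u0 \<in> D" and \<epsilon>: "0 < \<epsilon>"
  obtains \<eta> where "0 < \<eta>" "\<And>x u T. x \<in> X \<Longrightarrow> dist y x < \<eta> \<Longrightarrow> norm u = 1 \<Longrightarrow> dist u0 u < \<eta> \<Longrightarrow> \<bar>T - r\<bar> < \<eta> \<Longrightarrow>
      x + T *\<^sub>R u \<notin> D \<Longrightarrow> r - \<epsilon> < hit_time D x u \<and> hit_time D x u \<le> T \<and> hits D x u (y + r *\<^sub>R u0) \<epsilon>"
proof -
  obtain \<delta>0 \<eta>0 where s: "\<delta>0 > 0" "\<eta>0 > 0" "\<And>x u t. x \<in> X \<Longrightarrow> dist y x < \<eta>0 \<Longrightarrow> norm u = 1 \<Longrightarrow> dist u0 u < \<eta>0 \<Longrightarrow>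
     0 < t \<Longrightarrow> t < \<delta>0 \<Longrightarrow> x + t *\<^sub>R u \<in> D" using start unfolding starts_in_def by metis
  define \<epsilon>1 where "\<epsilon>1 = min (\<epsilon> / 4) (r / 2)"
  have \<epsilon>1: "0 < \<epsilon>1" "\<epsilon>1 \<le> \<epsilon> / 4" "\<epsilon>1 \<le> r / 2" using \<epsilon> r by (auto simp: \<epsilon>1_def simp del: le_divide_eq_numeral1)
  define K where "K = (\<lambda>t. y + t *\<^sub>R u0) ` {\<delta>0 / 2..r - \<epsilon>1}"
  have "compact K" unfolding K_def by (intro compact_continuous_image continuous_intros compact_Icc)
  moreover have "K \<subseteq> D" using r(2) s(1) \<epsilon>1 by (auto simp: K_def)
  ultimately obtain \<beta> where \<beta>: "\<beta> > 0" "(\<Union>p\<in>K. ball p \<beta>) \<subseteq> D"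
    using compact_subset_open_imp_ball_epsilon_subset D by blast
  \<comment> \<open>The factor \<open>1 + r\<close> bounds the drift of the two rays up to time
    \<open>r\<close>: one \<open>\<eta>\<close> from the starting points and
    \<open>r * \<eta>\<close> from the directions.\<close>
  define \<eta> where "\<eta> = Min {\<eta>0, \<epsilon>1, \<beta> / (2 * (1 + r)), \<epsilon> / (4 * (1 + r))}"
  have \<eta>: "0 < \<eta>" "\<eta> \<le> \<eta>0" "\<eta> \<le> \<epsilon>1" "\<eta> \<le> \<beta> / (2 * (1 + r))" "\<eta> \<le> \<epsilon> / (4 * (1 + r))"
    using s \<epsilon>1 \<beta> \<epsilon> r by (auto simp: \<eta>_def simp del: le_divide_eq_numeral1)
  have \<eta>': "\<eta> * (1 + r) \<le> \<beta> / 2" "\<eta> * (1 + r) \<le> \<epsilon> / 4" using \<eta>(4,5) r by (auto simp: field_simps)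
  show ?thesis
  proof (rule that[OF \<eta>(1)])
    fix x u T assume x: "x \<in> X" "dist y x < \<eta>" and u: "norm u = 1" "dist u0 u < \<eta>"
      and T: "\<bar>T - r\<bar> < \<eta>" "x + T *\<^sub>R u \<notin> D"
    have near: "dist (y + t *\<^sub>R u0) (x + t *\<^sub>R u) < \<eta> * (1 + r)" if "0 \<le> t" "t \<le> r" for t
    proof -
      have "dist (y + t *\<^sub>R u0) (x + t *\<^sub>R u) = norm ((y - x) + t *\<^sub>R (u0 - u))" by (simp add: dist_norm algebra_simps)
      also have "\<dots> \<le> norm (y - x) + t * norm (u0 - u)" using that norm_triangle_ineq[of "y - x" "t *\<^sub>R (u0 - u)"] by simp
      also have "\<dots> < \<eta> + r * \<eta>"
        using x u that by (intro add_less_le_mono mult_mono) (auto simp: dist_norm)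
      finally show ?thesis by (simp add: algebra_simps)
    qed
    have inD: "x + t *\<^sub>R u \<in> D" if t: "0 < t" "t < r - \<epsilon>1" for t
    proof (cases "t < \<delta>0")
      case True then show ?thesis using s(3)[of x u t] x u t \<eta> by auto
    next
      case False
      then have "y + t *\<^sub>R u0 \<in> K" using t s(1) by (auto simp: K_def)
      moreover have "dist (y + t *\<^sub>R u0) (x + t *\<^sub>R u) < \<beta>" using near[of t] t \<epsilon>1 \<eta>' \<beta> by auto
      ultimately show ?thesis using \<beta>(2) by (meson UN_I mem_ball subsetD)
    qed
    have T0: "0 < T" using T(1) \<eta> \<epsilon>1 r by linarith
    have pos: "0 < r - \<epsilon>1" using \<epsilon>1 r by linarith
    note h = hit_time_props[OF D pos inD T0 T(2)]
    define h' where "h' = hit_time D x u"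
    have "r - \<epsilon>1 \<le> h'" "h' \<le> T" using h(1,2) by (auto simp: h'_def)
    then have hr: "\<bar>r - h'\<bar> \<le> \<epsilon> / 4" using T(1) \<epsilon>1 \<eta>(3) by linarith
    have "dist (y + r *\<^sub>R u0) (hit_point D x u) \<le> dist (y + r *\<^sub>R u0) (x + r *\<^sub>R u) + dist (x + r *\<^sub>R u) (hit_point D x u)"
      by (rule dist_triangle)
    also have "dist (x + r *\<^sub>R u) (hit_point D x u) = \<bar>r - h'\<bar>"
      using u by (simp add: hit_point_def dist_norm h'_def flip: scaleR_diff_left)
    finally have "dist (y + r *\<^sub>R u0) (hit_point D x u) < \<epsilon>"
      using near[of r] r hr \<eta>'(2) \<epsilon> by linarith
    then show "r - \<epsilon> < hit_time D x u \<and> hit_time D x u \<le> T \<and> hits D x u (y + r *\<^sub>R u0) \<epsilon>"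
      using h pos \<epsilon>1 \<epsilon> by (auto simp: hits_def)
  qed
qed

lemma sgn_near:
  fixes u0 :: "'a::euclidean_space"
  assumes u0: "norm u0 = 1" and r: "0 < r" and p: "norm (p - r *\<^sub>R u0) \<le> s" and s: "s < r"
  shows "\<bar>norm p - r\<bar> \<le> s" "dist u0 (sgn p) \<le> 2 * s / r" "norm (sgn p) = 1" "norm p *\<^sub>R sgn p = p"
proof -
  have nr: "norm (r *\<^sub>R u0) = r" using u0 r by simp
  show 1: "\<bar>norm p - r\<bar> \<le> s" using norm_triangle_ineq3[of p "r *\<^sub>R u0"] p nr by simp
  then have p0: "p \<noteq> 0" using s by auto
  then show "norm (sgn p) = 1" "norm p *\<^sub>R sgn p = p" by (auto simp: norm_sgn sgn_div_norm)
  have "r * dist u0 (sgn p) = norm (r *\<^sub>R u0 - r *\<^sub>R sgn p)"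
    using r by (simp add: dist_norm flip: scaleR_diff_right)
  also have "r *\<^sub>R u0 - r *\<^sub>R sgn p = - (p - r *\<^sub>R u0) + (norm p - r) *\<^sub>R sgn p"
    using \<open>norm p *\<^sub>R sgn p = p\<close> by (simp add: scaleR_diff_left)
  also have "norm \<dots> \<le> norm (p - r *\<^sub>R u0) + norm ((norm p - r) *\<^sub>R sgn p)"
    by (metis norm_minus_cancel norm_triangle_ineq)
  also have "norm ((norm p - r) *\<^sub>R sgn p) = \<bar>norm p - r\<bar>" using p0 by (simp add: norm_sgn)
  finally have "r * dist u0 (sgn p) \<le> s + s" using p 1 by linarith
  then show "dist u0 (sgn p) \<le> 2 * s / r" using r by (simp add: field_simps)
qed

text \<open>Rays close to one that ends at a boundary point may graze past it. An exterior point
  \<open>e\<close> close to the end is a safe target, since the exterior is open: all rays close to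
  the one towards \<open>e\<close> have to leave \<open>D\<close> before reaching its
  vicinity.\<close>

lemma hits_exterior_target:
  fixes y u0 :: "'a::euclidean_space"
  assumes D: "open D" and start: "starts_in D X y u0" and u0: "norm u0 = 1"
    and r: "0 < r" "\<And>t. 0 < t \<Longrightarrow> t < r \<Longrightarrow> y + t *\<^sub>R u0 \<in> D" and \<epsilon>: "0 < \<epsilon>"
  obtains s where "0 < s" "\<And>e. e \<notin> closure D \<Longrightarrow> dist (y + r *\<^sub>R u0) e < s \<Longrightarrow>
      norm (sgn (e - y)) = 1 \<and> dist u0 (sgn (e - y)) < \<epsilon> \<and> (\<exists>\<rho>>0. \<forall>x\<in>X. dist y x < \<rho> \<longrightarrow>
        (\<forall>u. norm u = 1 \<longrightarrow> dist (sgn (e - y)) u < \<rho> \<longrightarrow> hits D x u (y + r *\<^sub>R u0) \<epsilon>))"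
proof -
  obtain \<eta> where \<eta>: "0 < \<eta>" "\<And>x u T. x \<in> X \<Longrightarrow> dist y x < \<eta> \<Longrightarrow> norm u = 1 \<Longrightarrow> dist u0 u < \<eta> \<Longrightarrow> \<bar>T - r\<bar> < \<eta> \<Longrightarrow>
      x + T *\<^sub>R u \<notin> D \<Longrightarrow> hits D x u (y + r *\<^sub>R u0) \<epsilon>"
    by (rule hits_near_segment[OF D start u0 r(1) _ \<epsilon>], rule r(2), assumption+, rule that, assumption, blast)
  define s where "s = Min {r / 2, \<eta> / 2, \<eta> * r / 8, \<epsilon> * r / 4}"
  have s: "0 < s" "s \<le> r / 2" "s \<le> \<eta> / 2" "s \<le> \<eta> * r / 8" "s \<le> \<epsilon> * r / 4"
    using r \<eta>(1) \<epsilon> by (auto simp: s_def simp del: le_divide_eq_numeral1)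
  show ?thesis
  proof (rule that[OF s(1)])
    fix e assume e: "e \<notin> closure D" "dist (y + r *\<^sub>R u0) e < s"
    define u1 where "u1 = sgn (e - y)"
    define T where "T = norm (e - y)"
    have p: "norm ((e - y) - r *\<^sub>R u0) \<le> s" using e(2) by (simp add: dist_norm norm_minus_commute algebra_simps)
    have sr: "s < r" using s r by linarith
    note sg = sgn_near[OF u0 r(1) p sr, folded u1_def T_def]
    have d: "2 * s / r \<le> \<eta> / 4" "2 * s / r \<le> \<epsilon> / 2" using s(4,5) r by (auto simp: field_simps)
    have eT: "y + T *\<^sub>R u1 = e" using sg(4) by simp
    have "open (- closure D)" by auto
    then obtain \<beta> where \<beta>: "\<beta> > 0" "ball e \<beta> \<subseteq> - closure D" using e(1) open_contains_ball by (metis ComplI)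
    have T0: "0 \<le> T" by (simp add: T_def)
    define \<rho> where "\<rho> = min (\<eta> / 2) (\<beta> / (2 * (1 + T)))"
    have \<rho>: "0 < \<rho>" "\<rho> \<le> \<eta> / 2" "\<rho> \<le> \<beta> / (2 * (1 + T))" using \<eta>(1) \<beta>(1) T0 by (auto simp: \<rho>_def simp del: le_divide_eq_numeral1)
    have \<rho>': "\<rho> * (1 + T) \<le> \<beta> / 2" using \<rho>(3) T0 by (auto simp: field_simps)
    have "hits D x u (y + r *\<^sub>R u0) \<epsilon>" if x: "x \<in> X" "dist y x < \<rho>" and u: "norm u = 1" "dist u1 u < \<rho>" for x u
    proof (rule \<eta>(2)[of x u T])
      show "dist u0 u < \<eta>" using dist_triangle[of u0 u u1] u sg(2) d \<rho> \<eta>(1) by linarith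
      show "\<bar>T - r\<bar> < \<eta>" using sg(1) s \<eta>(1) by linarith
      have "dist e (x + T *\<^sub>R u) = norm ((y - x) + T *\<^sub>R (u1 - u))"
        unfolding eT[symmetric] by (simp add: dist_norm algebra_simps)
      also have "\<dots> \<le> norm (y - x) + T * norm (u1 - u)"
        using T0 norm_triangle_ineq[of "y - x" "T *\<^sub>R (u1 - u)"] by simp
      also have "\<dots> \<le> \<rho> + T * \<rho>" using x u T0 by (intro add_mono mult_left_mono) (auto simp: dist_norm)
      also have "\<dots> \<le> \<beta> / 2" using \<rho>' by (simp add: algebra_simps)
      finally have "x + T *\<^sub>R u \<in> ball e \<beta>" using \<beta>(1) by simp
      then show "x + T *\<^sub>R u \<notin> D" using \<beta>(2) closure_subset by blast
    qed (use x u \<rho> \<eta>(1) in auto)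
    then show "norm (sgn (e - y)) = 1 \<and> dist u0 (sgn (e - y)) < \<epsilon> \<and> (\<exists>\<rho>>0. \<forall>x\<in>X. dist y x < \<rho> \<longrightarrow>
        (\<forall>u. norm u = 1 \<longrightarrow> dist (sgn (e - y)) u < \<rho> \<longrightarrow> hits D x u (y + r *\<^sub>R u0) \<epsilon>))"
      using sg d \<rho>(1) \<epsilon> unfolding u1_def[symmetric] by auto
  qed
qed

lemma cone_patch_exterior:
  assumes p: "cone_patch D w a \<kappa> \<delta>" and w: "w \<in> frontier D" and s: "0 < s"
  obtains e where "e \<notin> closure D" "dist w e < s"
proof -
  define t where "t = min s \<delta> / 2"
  have t: "0 < t" "t < s" "t < \<delta>" and na: "norm a = 1" and k: "\<kappa> < 1" using p s by (auto simp: cone_patch_def t_def)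
  have "a \<bullet> a = 1" "a \<noteq> 0" using na by (auto simp: norm_eq_1)
  then have "w - t *\<^sub>R a \<notin> closure D"
    using cone_patchD(2)[OF p w, of "t *\<^sub>R a"] t na k w by (auto simp: cone_patch_def)
  then show ?thesis using t na by (intro that[of "w - t *\<^sub>R a"]) (auto simp: dist_norm)
qed

definition chord :: "'a::euclidean_space set \<Rightarrow> 'a \<Rightarrow> 'a \<Rightarrow> bool" where
  "chord D z w \<longleftrightarrow> z \<noteq> w \<and> (\<forall>t. 0 < t \<longrightarrow> t < norm (w - z) \<longrightarrow> z + t *\<^sub>R sgn (w - z) \<in> D)"

lemma chord_sym:
  assumes "chord D z w" shows "chord D w z"
  unfolding chord_def
proof (intro conjI allI impI)
  fix t assume t: "0 < t" "t < norm (z - w)"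
  have "sgn (z - w) = - sgn (w - z)" by (metis minus_diff_eq sgn_minus)
  moreover have "w = z + norm (w - z) *\<^sub>R sgn (w - z)" by (cases "w = z") (auto simp: sgn_div_norm)
  ultimately have "w + t *\<^sub>R sgn (z - w) = z + (norm (w - z) - t) *\<^sub>R sgn (w - z)"
    by (metis (no_types, lifting) add_diff_eq scaleR_diff_left scaleR_minus_right uminus_add_conv_diff add.commute diff_conv_add_uminus)
  then show "w + t *\<^sub>R sgn (z - w) \<in> D" using assms t by (auto simp: chord_def norm_minus_commute)
qed (use assms in \<open>auto simp: chord_def\<close>)

text \<open>Caps have positive surface measure. This picks a generic direction near a prescribed
  one.\<close>

lemma AE_sphere_measure_direction:
  fixes u0 :: "'a::euclidean_space"
  assumes P: "AE u in sphere_measure. P u" and u0: "norm u0 = 1" and \<rho>: "0 < \<rho>"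
  obtains u where "norm u = 1" "dist u0 u < \<rho>" "P u"
proof -
  have "\<exists>u. norm u = 1 \<and> dist u0 u < \<rho> \<and> P u"
  proof (rule ccontr)
    assume "\<nexists>u. norm u = 1 \<and> dist u0 u < \<rho> \<and> P u"
    note none = this
    have "AE u in sphere_measure. u \<notin> ball u0 \<rho>"
      using P AE_sphere_measure_norm[where 'a='a] by eventually_elim (use none in auto)
    then have "ball u0 \<rho> \<in> null_sets sphere_measure" by (subst AE_iff_null_sets) auto
    then have "emeasure sphere_measure (ball u0 \<rho>) = 0" by auto
    then show False using emeasure_sphere_measure_ball_pos[OF u0 \<rho>] by simp
  qed
  then show ?thesis using that by blast
qed

text \<open>
  \<open>nrm\<close> is the inner normal field. The last assumption says that from any \<open>q\<close> almost no ray meets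
  the boundary outside \<open>Rt\<close> or tangentially.
\<close>

locale billiard_table =
  fixes D Rt :: "'a::euclidean_space set" and nrm :: "'a \<Rightarrow> 'a"
  assumes dim2: "2 \<le> DIM('a)"
    and D_open: "open D" and D_connected: "connected D" and D_bounded: "bounded D" and D_nonempty: "D \<noteq> {}"
    and patch_ex: "\<And>y. y \<in> frontier D \<Longrightarrow> \<exists>a \<kappa> \<delta>. cone_patch D y a \<kappa> \<delta>"
    and Rt_sub: "Rt \<subseteq> frontier D" and Rt_borel[measurable]: "Rt \<in> sets borel"
    and normal_patch: "\<And>x \<kappa>. x \<in> Rt \<Longrightarrow> 0 < \<kappa> \<Longrightarrow> \<kappa> < 1 \<Longrightarrow> \<exists>\<delta>. cone_patch D x (nrm x) \<kappa> \<delta>"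
    and bad_null: "\<And>q. AE u in sphere_measure. \<forall>t. t \<noteq> 0 \<longrightarrow> q + t *\<^sub>R u \<in> frontier D \<longrightarrow>
          q + t *\<^sub>R u \<in> Rt \<and> nrm (q + t *\<^sub>R u) \<bullet> u \<noteq> 0"
begin

section \<open>Normals and transversal hits in a billiard table\<close>

lemma norm_nrm: "x \<in> Rt \<Longrightarrow> norm (nrm x) = 1"
  using normal_patch[of x "1/2"] by (auto simp: cone_patch_def)

lemma frontier_not_D: "x \<in> frontier D \<Longrightarrow> x \<notin> D"
  using D_open by (auto simp: frontier_def interior_open)

lemma nrm_pos_imp:
  assumes x: "x \<in> Rt" and v: "0 < nrm x \<bullet> v"
  shows "\<exists>\<epsilon>>0. \<forall>t. 0 < t \<longrightarrow> t < \<epsilon> \<longrightarrow> x + t *\<^sub>R v \<in> D \<and> x - t *\<^sub>R v \<notin> closure D"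
proof -
  have v0: "v \<noteq> 0" using v by auto
  define \<kappa> where "\<kappa> = min (1/2) (nrm x \<bullet> v / (2 * norm v))"
  have \<kappa>: "0 < \<kappa>" "\<kappa> < 1" "\<kappa> * norm v < nrm x \<bullet> v"
  proof -
    show "0 < \<kappa>" "\<kappa> < 1" using v v0 by (auto simp: \<kappa>_def)
    have "\<kappa> * norm v \<le> (nrm x \<bullet> v / (2 * norm v)) * norm v" by (intro mult_right_mono) (auto simp: \<kappa>_def)
    also have "\<dots> = nrm x \<bullet> v / 2" using v0 by simp
    finally show "\<kappa> * norm v < nrm x \<bullet> v" using v by linarith
  qed
  obtain \<delta> where p: "cone_patch D x (nrm x) \<kappa> \<delta>" using normal_patch[OF x \<kappa>(1,2)] by blast
  have \<delta>: "\<delta> > 0" using p by (simp add: cone_patch_def)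
  have xf: "x \<in> frontier D" using x Rt_sub by auto
  show ?thesis
  proof (intro exI[of _ "\<delta> / norm v"] conjI allI impI)
    fix t assume t: "0 < t" "t < \<delta> / norm v"
    have 1: "norm (t *\<^sub>R v) < \<delta>" using t v0 by (simp add: field_simps)
    have 2: "\<kappa> * norm (t *\<^sub>R v) < nrm x \<bullet> (t *\<^sub>R v)" using \<kappa>(3) t by (simp add: mult.left_commute)
    show "x + t *\<^sub>R v \<in> D" "x - t *\<^sub>R v \<notin> closure D"
      using cone_patchD[OF p xf, of "t *\<^sub>R v"] 1 2 v0 t \<delta> by auto
  qed (use \<delta> v0 in auto)
qed

lemma nrm_nonneg_of_inside:
  assumes x: "x \<in> Rt" and \<delta>: "0 < \<delta>" and v: "\<And>t. 0 < t \<Longrightarrow> t < \<delta> \<Longrightarrow> x + t *\<^sub>R v \<in> D"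
  shows "0 \<le> nrm x \<bullet> v"
proof (rule ccontr)
  assume "\<not> 0 \<le> nrm x \<bullet> v"
  then have "0 < nrm x \<bullet> (- v)" by simp
  from nrm_pos_imp[OF x this] obtain \<epsilon> where e: "\<epsilon> > 0" "\<And>t. 0 < t \<Longrightarrow> t < \<epsilon> \<Longrightarrow> x + t *\<^sub>R v \<notin> closure D" by auto
  define t where "t = min \<delta> \<epsilon> / 2"
  have "0 < t" "t < \<delta>" "t < \<epsilon>" using \<delta> e(1) by (auto simp: t_def)
  then show False using v e(2) closure_subset by blast
qed

text \<open>With \<open>c\<close> half of the margin, the vector
  \<open>u - c *\<^sub>R nrm x\<close> still lies in the open cone around \<open>a\<close>, so it
  points into \<open>D\<close> and has a nonnegative normal component; that is the claim.\<close>

lemma nrm_lower_bound: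
  assumes p: "cone_patch D y a \<kappa> \<delta>" and x: "x \<in> Rt" "dist y x < \<delta>" and u: "norm u = 1" "\<kappa>' \<le> a \<bullet> u" "\<kappa> < \<kappa>'"
  shows "(\<kappa>' - \<kappa>) / 2 \<le> nrm x \<bullet> u"
proof -
  define c where "c = (\<kappa>' - \<kappa>) / 2"
  have na: "norm a = 1" and \<kappa>: "0 \<le> \<kappa>" "\<kappa> < 1" and \<delta>: "0 < \<delta>" using p by (auto simp: cone_patch_def)
  have c: "c > 0" using u by (simp add: c_def)
  define v where "v = u - c *\<^sub>R nrm x"
  have "a \<bullet> nrm x \<le> 1" using Cauchy_Schwarz_ineq2[of a "nrm x"] na norm_nrm[OF x(1)] by simp
  then have "c * (a \<bullet> nrm x) \<le> c * 1" using c by (intro mult_left_mono) auto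
  then have av: "\<kappa>' - c \<le> a \<bullet> v" using u by (simp add: v_def inner_diff_right)
  have "norm v \<le> 1 + c" using norm_triangle_ineq4[of u "c *\<^sub>R nrm x"] u c norm_nrm[OF x(1)] by (simp add: v_def)
  then have "\<kappa> * norm v \<le> \<kappa> * (1 + c)" using \<kappa> by (intro mult_left_mono) auto
  also have "\<dots> < \<kappa>' - c"
  proof -
    have "\<kappa> * c < 1 * c" using \<kappa> c by (intro mult_strict_right_mono) auto
    moreover have "\<kappa>' = \<kappa> + 2 * c" by (simp add: c_def field_simps)
    ultimately show ?thesis by (simp add: distrib_left)
  qed
  finally have cone: "\<kappa> * norm v < a \<bullet> v" using av by linarith
  have v0: "v \<noteq> 0" using cone by auto
  have "x + t *\<^sub>R v \<in> D" if t: "0 < t" "t < \<delta> / norm v" for t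
  proof (rule cone_patchD(1)[OF p])
    show "norm (t *\<^sub>R v) < \<delta>" using t v0 by (simp add: field_simps)
    show "\<kappa> * norm (t *\<^sub>R v) < a \<bullet> (t *\<^sub>R v)" using cone t by (simp add: mult.left_commute)
  qed (use x Rt_sub t v0 in auto)
  then have "0 \<le> nrm x \<bullet> v" using \<delta> v0 by (intro nrm_nonneg_of_inside[OF x(1), of "\<delta> / norm v"]) auto
  then show ?thesis using norm_nrm[OF x(1)] by (simp add: v_def inner_diff_right norm_eq_1 c_def)
qed

lemma exit_ex:
  assumes "norm u = 1"
  obtains T where "0 < T" "x + T *\<^sub>R u \<notin> D"
proof -
  obtain b where b: "b > 0" "\<And>x. x \<in> D \<Longrightarrow> norm x \<le> b" using D_bounded by (auto simp: bounded_pos)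
  have "x + (b + norm x + 1) *\<^sub>R u \<notin> D"
  proof
    assume "x + (b + norm x + 1) *\<^sub>R u \<in> D"
    then have "norm (x + (b + norm x + 1) *\<^sub>R u) \<le> b" by (rule b(2))
    moreover have "norm ((b + norm x + 1) *\<^sub>R u) \<le> norm (x + (b + norm x + 1) *\<^sub>R u) + norm x"
      by (metis add_diff_cancel_left' norm_triangle_ineq4)
    moreover have "norm ((b + norm x + 1) *\<^sub>R u) = b + norm x + 1" using assms b(1) by (simp add: add_nonneg_nonneg)
    ultimately show False by linarith
  qed
  then show ?thesis using b(1) by (intro that[of "b + norm x + 1"]) (auto simp: add_pos_nonneg add_nonneg_pos)
qed

text \<open>The direction \<open>u1\<close> points at an exterior point just behind
  \<open>w\<close>. The uniform lower bound on the normal component is what makes the reflection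
  density bounded below on the cap around \<open>u1\<close>.\<close>

lemma aim_at_chord_end:
  assumes p: "cone_patch D y a \<kappa> \<delta>" and y: "y \<in> frontier D" and w: "w \<in> frontier D" and ch: "chord D y w"
    and cone: "\<kappa> * norm (w - y) < a \<bullet> (w - y)" and \<epsilon>: "0 < \<epsilon>"
  obtains u1 \<rho> c where "norm u1 = 1" "0 < \<rho>" "0 < c"
    "\<And>x u. x \<in> frontier D \<Longrightarrow> dist y x < \<rho> \<Longrightarrow> norm u = 1 \<Longrightarrow> dist u1 u < \<rho> \<Longrightarrow> hits D x u w \<epsilon>"
    "\<And>x u. x \<in> Rt \<Longrightarrow> dist y x < \<rho> \<Longrightarrow> norm u = 1 \<Longrightarrow> dist u1 u < \<rho> \<Longrightarrow> c \<le> nrm x \<bullet> u"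
proof -
  define r where "r = norm (w - y)"
  define u0 where "u0 = sgn (w - y)"
  have na: "norm a = 1" and \<delta>: "0 < \<delta>" using p by (auto simp: cone_patch_def)
  have wy: "w \<noteq> y" using ch by (auto simp: chord_def)
  have r: "0 < r" and u0: "norm u0 = 1" and wr: "w = y + r *\<^sub>R u0"
    using wy by (auto simp: r_def u0_def norm_sgn sgn_div_norm)
  have seg: "y + t *\<^sub>R u0 \<in> D" if "0 < t" "t < r" for t using ch that by (auto simp: chord_def r_def u0_def)
  have au: "\<kappa> < a \<bullet> u0"
  proof -
    have "\<kappa> * r < r * (a \<bullet> u0)" using cone r u0 by (simp add: wr)
    then show ?thesis using r by (simp add: mult.commute[of r])
  qed
  \<comment> \<open>A quarter of the angular margin: the step from \<open>u0\<close> to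
    \<open>u1\<close> and the one to the final direction together use up at most half of it.\<close>
  define \<epsilon>1 where "\<epsilon>1 = min \<epsilon> ((a \<bullet> u0 - \<kappa>) / 4)"
  have \<epsilon>1: "0 < \<epsilon>1" "\<epsilon>1 \<le> \<epsilon>" "\<epsilon>1 \<le> (a \<bullet> u0 - \<kappa>) / 4" using \<epsilon> au by (auto simp: \<epsilon>1_def simp del: le_divide_eq_numeral1)
  obtain s where s: "0 < s" "\<And>e. e \<notin> closure D \<Longrightarrow> dist (y + r *\<^sub>R u0) e < s \<Longrightarrow>
      norm (sgn (e - y)) = 1 \<and> dist u0 (sgn (e - y)) < \<epsilon>1 \<and> (\<exists>\<rho>>0. \<forall>x\<in>frontier D. dist y x < \<rho> \<longrightarrow>
        (\<forall>u. norm u = 1 \<longrightarrow> dist (sgn (e - y)) u < \<rho> \<longrightarrow> hits D x u (y + r *\<^sub>R u0) \<epsilon>1))"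
    by (rule hits_exterior_target[OF D_open starts_in_patch[OF p au] u0 r _ \<epsilon>1(1)], rule seg, assumption+) (rule that)
  obtain a' \<kappa>' \<delta>' where p': "cone_patch D w a' \<kappa>' \<delta>'" using patch_ex[OF w] by blast
  obtain e where e: "e \<notin> closure D" "dist w e < s" using cone_patch_exterior[OF p' w s(1)] .
  define u1 where "u1 = sgn (e - y)"
  obtain \<rho>1 where 1: "norm u1 = 1" "dist u0 u1 < \<epsilon>1" "\<rho>1 > 0"
    "\<And>x u. x \<in> frontier D \<Longrightarrow> dist y x < \<rho>1 \<Longrightarrow> norm u = 1 \<Longrightarrow> dist u1 u < \<rho>1 \<Longrightarrow> hits D x u w \<epsilon>1"
    using s(2)[OF e(1)] e(2) wr unfolding u1_def by auto
  define \<rho> where "\<rho> = Min {\<rho>1, \<delta>, \<epsilon>1}"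
  have \<rho>: "0 < \<rho>" "\<rho> \<le> \<rho>1" "\<rho> \<le> \<delta>" "\<rho> \<le> \<epsilon>1" using 1 \<delta> \<epsilon>1 by (auto simp: \<rho>_def simp del: le_divide_eq_numeral1)
  show ?thesis
  proof (rule that[of u1 \<rho> "(a \<bullet> u0 - \<kappa>) / 4"])
    fix x u assume x: "x \<in> Rt" "dist y x < \<rho>" and u: "norm u = 1" "dist u1 u < \<rho>"
    have "dist u0 u \<le> 2 * \<epsilon>1" using dist_triangle[of u0 u u1] 1 u \<rho> by linarith
    then have "(a \<bullet> u0 + \<kappa>) / 2 \<le> a \<bullet> u" using inner_dist_le[OF na, of u0 u] \<epsilon>1 by (simp add: field_simps)
    from nrm_lower_bound[OF p x(1) _ u(1) this] show "(a \<bullet> u0 - \<kappa>) / 4 \<le> nrm x \<bullet> u"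
      using x \<rho> au by (simp add: field_simps)
  next
    fix x u assume "x \<in> frontier D" "dist y x < \<rho>" "norm u = 1" "dist u1 u < \<rho>"
    then have "hits D x u w \<epsilon>1" using 1(4) \<rho> by auto
    then show "hits D x u w \<epsilon>" using \<epsilon>1 by (auto simp: hits_def)
  qed (use 1 \<rho> au in auto)
qed

text \<open>Read backwards from its end the ray runs inside \<open>D\<close>, so its arrival cannot
  have a positive normal component.\<close>

lemma hits_transversal_end:
  assumes z: "hit_point D x u \<in> Rt" and r: "0 < hit_time D x u"
    and seg: "\<And>t. 0 < t \<Longrightarrow> t < hit_time D x u \<Longrightarrow> x + t *\<^sub>R u \<in> D"
    and nz: "nrm (hit_point D x u) \<bullet> u \<noteq> 0"
  shows "nrm (hit_point D x u) \<bullet> u < 0"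
proof -
  have "0 \<le> nrm (hit_point D x u) \<bullet> (- u)"
  proof (rule nrm_nonneg_of_inside[OF z r])
    fix t assume "0 < t" "t < hit_time D x u"
    then show "hit_point D x u + t *\<^sub>R - u \<in> D"
      using seg[of "hit_time D x u - t"] by (simp add: hit_point_def algebra_simps)
  qed
  then show ?thesis using nz by auto
qed

lemma hits_chord:
  assumes "hits D x u w \<epsilon>" "norm u = 1"
  shows "chord D x (hit_point D x u)"
  using assms by (auto simp: chord_def hits_def hit_point_def sgn_div_norm)

text \<open>A generic direction close to the cone axis at \<open>y\<close> first hits the boundary
  at a regular point \<open>z\<close>, transversally. Transversality gives a cone at
  \<open>z\<close> that contains the incoming directions, which makes \<open>z\<close> visible
  without obstruction from every boundary point near \<open>y\<close>.\<close>

lemma transversal_point_seen_nearby: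
  assumes p: "cone_patch D y a \<kappa> \<delta>" and y: "y \<in> frontier D"
  obtains z \<rho> c where "z \<in> Rt" "0 < \<rho>" "0 < c"
    "\<And>y'. y' \<in> frontier D \<Longrightarrow> dist y y' < \<rho> \<Longrightarrow> chord D y' z \<and> dist y y' < \<delta> \<and>
       \<kappa> * norm (z - y') < a \<bullet> (z - y') \<and> c * norm (y' - z) < nrm z \<bullet> (y' - z)"
proof -
  have na: "norm a = 1" and \<delta>: "0 < \<delta>" and \<kappa>: "0 \<le> \<kappa>" "\<kappa> < 1" using p by (auto simp: cone_patch_def)
  obtain u where u: "norm u = 1" "dist a u < 1 - \<kappa>" and good: "\<And>t. t \<noteq> 0 \<Longrightarrow> y + t *\<^sub>R u \<in> frontier D \<Longrightarrow>
          y + t *\<^sub>R u \<in> Rt \<and> nrm (y + t *\<^sub>R u) \<bullet> u \<noteq> 0"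
    using AE_sphere_measure_direction[OF bad_null[of y] na, of "1 - \<kappa>"] \<kappa> by auto
  have au: "\<kappa> < a \<bullet> u" using inner_dist_le[OF na, of a u] u na by (simp add: norm_eq_1)
  have st: "starts_in D (frontier D) y u" by (rule starts_in_patch[OF p au])
  have st0: "y + t *\<^sub>R u \<in> D" if "0 < t" "t < \<delta>" for t
  proof -
    have "u \<noteq> 0" using u(1) by auto
    moreover have "t * \<kappa> < t * (a \<bullet> u)" using that au by simp
    ultimately show ?thesis using cone_patchD(1)[OF p y, of "t *\<^sub>R u"] that u y \<delta> by (auto simp: mult.commute)
  qed
  obtain T where T: "0 < T" "y + T *\<^sub>R u \<notin> D" using exit_ex[OF u(1)] .
  note h = hit_time_props[OF D_open \<delta> st0 T]
  define r where "r = hit_time D y u"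
  define z where "z = y + r *\<^sub>R u"
  have zh: "hit_point D y u = z" by (simp add: hit_point_def z_def r_def)
  have r: "0 < r" using h(1) \<delta> by (simp add: r_def)
  have zf: "z \<in> frontier D" using h(3) zh by simp
  have zR: "z \<in> Rt" and nz: "nrm z \<bullet> u \<noteq> 0" using good[of r] r zf by (auto simp: z_def)
  have nz': "nrm z \<bullet> u < 0" using hits_transversal_end[of y u] zR nz h r unfolding zh r_def by auto
  define c where "c = min (1/2) (- (nrm z \<bullet> u) / 2)"
  have c: "0 < c" "c < 1" "c < - (nrm z \<bullet> u)" using nz' by (auto simp: c_def)
  obtain \<delta>z where pz: "cone_patch D z (nrm z) c \<delta>z" using normal_patch[OF zR c(1,2)] by blast
  have \<delta>z: "\<delta>z > 0" using pz by (simp add: cone_patch_def)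
  define \<epsilon> where "\<epsilon> = min (\<delta>z / 2) r"
  have \<epsilon>: "0 < \<epsilon>" "\<epsilon> \<le> \<delta>z / 2" using \<delta>z r by (auto simp: \<epsilon>_def simp del: le_divide_eq_numeral1)
  have hseg: "y + t *\<^sub>R u \<in> D" if "0 < t" "t < r" for t using h(4)[of t] that by (auto simp: r_def)
  obtain \<eta> where \<eta>: "0 < \<eta>" "\<And>x u' T. x \<in> frontier D \<Longrightarrow> dist y x < \<eta> \<Longrightarrow> norm u' = 1 \<Longrightarrow> dist u u' < \<eta> \<Longrightarrow> \<bar>T - r\<bar> < \<eta> \<Longrightarrow>
      x + T *\<^sub>R u' \<notin> D \<Longrightarrow> r - \<epsilon> < hit_time D x u' \<and> hit_time D x u' \<le> T \<and> hits D x u' (y + r *\<^sub>R u) \<epsilon>"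
    by (rule hits_near_segment[OF D_open st u(1) r _ \<epsilon>(1)], rule hseg, assumption+) (rule that)
  define m where "m = Min {\<eta>, a \<bullet> u - \<kappa>, - (nrm z \<bullet> u) - c}"
  have m: "0 < m" "m \<le> \<eta>" "m \<le> a \<bullet> u - \<kappa>" "m \<le> - (nrm z \<bullet> u) - c" using \<eta>(1) au c by (auto simp: m_def simp del: le_divide_eq_numeral1)
  define \<rho> where "\<rho> = Min {m / 2, r / 2, m * r / 4, \<delta>z / 4, \<delta>}"
  have \<rho>: "0 < \<rho>" "\<rho> \<le> m / 2" "\<rho> \<le> r / 2" "\<rho> \<le> m * r / 4" "\<rho> \<le> \<delta>z / 4" "\<rho> \<le> \<delta>"
    using m(1) r \<delta>z \<delta> by (auto simp: \<rho>_def simp del: le_divide_eq_numeral1)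
  show ?thesis
  proof (rule that[OF zR \<rho>(1) c(1)])
    fix y' assume y': "y' \<in> frontier D" "dist y y' < \<rho>"
    define u' where "u' = sgn (z - y')"
    define r' where "r' = norm (z - y')"
    have "norm ((z - y') - r *\<^sub>R u) \<le> dist y y'" by (simp add: z_def dist_norm)
    then have pp: "norm ((z - y') - r *\<^sub>R u) \<le> \<rho>" using y' by simp
    have \<rho>r: "\<rho> < r" using \<rho> r by linarith
    note sg = sgn_near[OF u(1) r pp \<rho>r, folded u'_def r'_def]
    have du: "dist u u' \<le> m / 2"
    proof -
      have "2 * \<rho> / r \<le> m / 2" using \<rho>(4) r by (simp add: field_simps)
      then show ?thesis using sg(2) by linarith
    qed
    have zr': "z = y' + r' *\<^sub>R u'" using sg(4) by (simp add: algebra_simps)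
    have r'0: "0 < r'" using sg(1) \<rho>r by linarith
    have zD: "z \<notin> D" using frontier_not_D[OF zf] .
    have hh: "r - \<epsilon> < hit_time D y' u'" "hit_time D y' u' \<le> r'" "hits D y' u' z \<epsilon>"
      using \<eta>(2)[of y' u' r'] y' sg du m \<rho> zD by (auto simp: zr'[symmetric] z_def[symmetric])
    have au': "\<kappa> < a \<bullet> u'" using inner_dist_le[OF na, of u u'] du m by linarith
    have nu': "nrm z \<bullet> u' < - c" using inner_dist_le[OF norm_nrm[OF zR], of u u'] du m by linarith
    \<comment> \<open>A ray aimed at \<open>z\<close> cannot stop earlier: stability places an
      earlier hit within \<open>\<delta>z\<close> of \<open>z\<close> on the same line, and the cone
      at \<open>z\<close> puts that part of the line in \<open>D\<close>.\<close>
    have eq: "hit_time D y' u' = r'"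
    proof (rule ccontr)
      assume ne: "hit_time D y' u' \<noteq> r'"
      define s where "s = r' - hit_time D y' u'"
      have s: "0 < s" "s < \<delta>z" using hh ne sg(1) \<rho> \<epsilon> \<delta>z by (auto simp: s_def simp del: le_divide_eq_numeral1)
      have "z + s *\<^sub>R (- u') \<in> D"
      proof -
        have "u' \<noteq> 0" using sg(3) by auto
        moreover have "s * (nrm z \<bullet> u') < s * (- c)" using s nu' by (intro mult_strict_left_mono) auto
        ultimately show ?thesis
          using cone_patchD(1)[OF pz zf, of "s *\<^sub>R (- u')"] s sg(3) \<delta>z by (auto simp: mult.commute)
      qed
      moreover have "z + s *\<^sub>R (- u') = hit_point D y' u'"
        unfolding zr' hit_point_def s_def by (simp add: algebra_simps)
      ultimately show False using hh(3) frontier_not_D by (auto simp: hits_def)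
    qed
    have "chord D y' z"
      using hh(3) r'0 unfolding chord_def u'_def[symmetric] r'_def[symmetric] hits_def eq
      by (auto simp: r'_def)
    moreover have "\<kappa> * norm (z - y') < a \<bullet> (z - y')"
      using au' r'0 unfolding r'_def[symmetric] by (simp add: zr' mult.commute)
    moreover have "c * norm (y' - z) < nrm z \<bullet> (y' - z)"
    proof -
      have "c * r' < (- (nrm z \<bullet> u')) * r'" using nu' r'0 by (intro mult_strict_right_mono) auto
      then have "c * r' < r' * (- (nrm z \<bullet> u'))" by (simp only: mult.commute)
      moreover have "y' - z = - (r' *\<^sub>R u')" by (subst zr') simp
      moreover have "norm (y' - z) = r'" by (simp add: r'_def norm_minus_commute)
      ultimately show ?thesis by (simp only: inner_minus_right inner_scaleR_right mult_minus_right)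
    qed
    ultimately show "chord D y' z \<and> dist y y' < \<delta> \<and> \<kappa> * norm (z - y') < a \<bullet> (z - y') \<and> c * norm (y' - z) < nrm z \<bullet> (y' - z)"
      using y'(2) \<rho>(6) by auto
  qed
qed

section \<open>Linking any two boundary points by chords\<close>

text \<open>Neighbouring points are related through a common visible point \<open>z\<close>, so the
  mutual \<open>P\<close>-class \<open>C1\<close> of \<open>y0\<close> and its complement
  \<open>C2\<close> are both closed. If \<open>C2\<close> were nonempty, connectedness of
  \<open>D\<close> would give a point \<open>p\<close> of \<open>D\<close> equidistant from both;
  the ball around \<open>p\<close> up to that distance lies in \<open>D\<close> and touches
  \<open>C1\<close> at \<open>a\<close> and \<open>C2\<close> at \<open>b\<close>. The chord from
  \<open>a\<close> to \<open>b\<close> runs in this ball and can be perturbed to one with regular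
  transversal ends in \<open>C1\<close> and \<open>C2\<close>, which are then related both
  ways.\<close>

lemma frontier_connected_by:
  assumes trans: "\<And>x y z. P x y \<Longrightarrow> P y z \<Longrightarrow> P x z"
    and aim: "\<And>y w a \<kappa> \<delta>. y \<in> frontier D \<Longrightarrow> w \<in> frontier D \<Longrightarrow> cone_patch D y a \<kappa> \<delta> \<Longrightarrow> chord D y w \<Longrightarrow>
        \<kappa> * norm (w - y) < a \<bullet> (w - y) \<Longrightarrow> P y w"
    and y0: "y0 \<in> frontier D" and y1: "y1 \<in> frontier D"
  shows "P y0 y1"
proof -
  \<comment> \<open>Both directions are needed: \<open>P\<close> is not assumed symmetric.\<close>
  have local: "\<exists>\<rho>>0. \<forall>y'\<in>frontier D. dist y y' < \<rho> \<longrightarrow> P y y' \<and> P y' y" if y: "y \<in> frontier D" for y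
  proof -
    obtain a \<kappa> \<delta> where p: "cone_patch D y a \<kappa> \<delta>" using patch_ex[OF y] by blast
    obtain z \<rho> c where z: "z \<in> Rt" "0 < \<rho>" "0 < c"
      "\<And>y'. y' \<in> frontier D \<Longrightarrow> dist y y' < \<rho> \<Longrightarrow> chord D y' z \<and> dist y y' < \<delta> \<and>
       \<kappa> * norm (z - y') < a \<bullet> (z - y') \<and> c * norm (y' - z) < nrm z \<bullet> (y' - z)"
      by (rule transversal_point_seen_nearby[OF p y]) (rule that)
    have zf: "z \<in> frontier D" using z(1) Rt_sub by auto
    have c1: "c < 1"
    proof -
      have yz: "y \<noteq> z" using z(4)[OF y] z(2) by (auto simp: chord_def)
      have "c * norm (y - z) < nrm z \<bullet> (y - z)" using z(4)[OF y] z(2) by auto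
      also have "\<dots> \<le> norm (y - z)" using norm_cauchy_schwarz[of "nrm z" "y - z"] norm_nrm[OF z(1)] by simp
      finally show ?thesis using yz by simp
    qed
    obtain \<delta>z where pz: "cone_patch D z (nrm z) c \<delta>z" using normal_patch[OF z(1,3) c1] by blast
    have both: "P y' z \<and> P z y'" if y': "y' \<in> frontier D" "dist y y' < \<rho>" for y'
      using aim[OF y'(1) zf cone_patch_shift[OF p], of ] aim[OF zf y'(1) pz] z(4)[OF y'] chord_sym by blast
    then have "P y z \<and> P z y" using y z(2) by auto
    then show ?thesis using both z(2) trans by blast
  qed
  define C1 where "C1 = {y \<in> frontier D. P y0 y \<and> P y y0}"
  define C2 where "C2 = frontier D - C1"
  have near: "\<exists>y'\<in>C. P y y' \<and> P y' y" if "y \<in> frontier D" "y \<in> closure C" "C \<subseteq> frontier D" for y C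
    using local[OF that(1)] that(2,3) unfolding closure_approachable by (metis dist_commute subset_iff)
  have cl1: "closed C1"
  proof -
    have "y \<in> C1" if "y \<in> closure C1" for y
    proof -
      have yf: "y \<in> frontier D" using that closure_minimal[of C1 "frontier D"] frontier_closed by (auto simp: C1_def)
      have "C1 \<subseteq> frontier D" by (auto simp: C1_def)
      from near[OF yf that this] obtain y' where "y' \<in> C1" "P y y'" "P y' y" by blast
      then show ?thesis using trans yf unfolding C1_def by blast
    qed
    then show ?thesis by (metis closure_subset closure_eq subset_antisym subsetI)
  qed
  have cl2: "closed C2"
  proof -
    have "y \<in> C2" if "y \<in> closure C2" for y
    proof -
      have yf: "y \<in> frontier D" using that closure_minimal[of C2 "frontier D"] frontier_closed by (auto simp: C2_def)
      have "C2 \<subseteq> frontier D" by (auto simp: C2_def)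
      from near[OF yf that this] obtain y' where "y' \<in> C2" "P y y'" "P y' y" by blast
      then show ?thesis using trans yf unfolding C2_def C1_def by blast
    qed
    then show ?thesis by (metis closure_subset closure_eq subset_antisym subsetI)
  qed
  have y0C: "y0 \<in> C1" using local[OF y0] y0 by (auto simp: C1_def)
  have "C2 = {}"
  proof (rule ccontr)
    assume ne2: "C2 \<noteq> {}"
    have ne1: "C1 \<noteq> {}" using y0C by auto
    have un: "frontier D = C1 \<union> C2" and dj: "C1 \<inter> C2 = {}" by (auto simp: C2_def C1_def)
    have closer: "\<exists>p\<in>D. infdist p A < infdist p B"
      if A: "A \<noteq> {}" "A \<subseteq> frontier D" and B: "closed B" "B \<noteq> {}" "A \<inter> B = {}" for A B
    proof -
      obtain c where c: "c \<in> A" using A by auto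
      have d: "0 < infdist c B" using B c in_closed_iff_infdist_zero[OF B(1,2), of c] infdist_nonneg[of c B] by force
      have "c \<in> closure D" using c A by (auto simp: frontier_def)
      then obtain p where p: "p \<in> D" "dist p c < infdist c B / 2" using d unfolding closure_approachable by (meson half_gt_zero)
      have "infdist p A \<le> dist p c" using c by (rule infdist_le)
      moreover have "infdist c B \<le> infdist p B + dist c p" by (rule infdist_triangle)
      ultimately show ?thesis using p d by (intro bexI[of _ p]) (auto simp: dist_commute)
    qed
    \<comment> \<open>Negative somewhere in \<open>D\<close> close to \<open>C1\<close> and positive
      somewhere close to \<open>C2\<close>, hence zero at some \<open>p\<close>.\<close>
    define f where "f p = infdist p C1 - infdist p C2" for p
    have "connected (f ` D)" unfolding f_def
      by (intro connected_continuous_image D_connected continuous_intros)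
    moreover obtain p1 where "p1 \<in> D" "f p1 < 0" using closer[OF ne1 _ cl2 ne2 dj] un by (auto simp: f_def)
    moreover obtain p2 where "p2 \<in> D" "0 < f p2" using closer[OF ne2 _ cl1 ne1] un dj by (auto simp: f_def)
    ultimately have "0 \<in> f ` D" using connected_contains_Icc[of "f ` D" "f p1" "f p2"] by force
    then obtain p where p: "p \<in> D" "infdist p C1 = infdist p C2" by (auto simp: f_def)
    define R0 where "R0 = infdist p C1"
    obtain a where a: "a \<in> C1" "R0 = dist p a" using infdist_attains_inf[OF cl1 ne1, of p] by (auto simp: R0_def)
    obtain b where b: "b \<in> C2" "R0 = dist p b" using infdist_attains_inf[OF cl2 ne2, of p] p by (auto simp: R0_def)
    have af: "a \<in> frontier D" and bf: "b \<in> frontier D" using a b un by auto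
    have ab: "a \<noteq> b" using a b dj by auto
    have ballD: "q \<in> D" if q: "dist p q < R0" for q
    proof (rule ccontr)
      assume "q \<notin> D"
      then obtain z where z: "z \<in> closed_segment p q" "z \<in> frontier D" using segment_crosses_frontier[OF p(1)] by blast
      have "dist p z \<le> dist p q" using z(1) by (metis dist_commute dist_in_closed_segment(1))
      moreover have "R0 \<le> dist p z"
        using z(2) un infdist_le[of z C1 p] infdist_le[of z C2 p] p R0_def by auto
      ultimately show False using q by linarith
    qed
    define r where "r = norm (a - b) / 2"
    define u0 where "u0 = sgn (a - b)"
    define q where "q = (1/2) *\<^sub>R (a + b)"
    have r: "0 < r" and u0: "norm u0 = 1" using ab by (auto simp: r_def u0_def norm_sgn)
    have ru: "r *\<^sub>R u0 = (1/2) *\<^sub>R (a - b)" using ab by (simp add: r_def u0_def sgn_div_norm)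
    have aq: "a = q + r *\<^sub>R u0" and bq: "b = q + r *\<^sub>R (- u0)"
      unfolding scaleR_minus_right ru q_def by (simp_all flip: scaleR_add_left scaleR_diff_left add: algebra_simps)
    \<comment> \<open>Strict convexity of the ball: for end points at equal distance
      \<open>R0\<close> from \<open>p\<close>, the squared distance of the point with parameter
      \<open>s\<close> is \<open>R0\<^sup>2\<close> minus \<open>(1 - s\<^sup>2) / 4\<close> times
      the squared chord length.\<close>
    have seg: "q + t *\<^sub>R u0 \<in> D" if t: "\<bar>t\<bar> < r" for t
    proof -
      define s where "s = t / r"
      have s: "\<bar>s\<bar> < 1" using t r by (simp add: s_def)
      define A where "A = a - p"
      define B where "B = b - p"
      have AB: "norm A = R0" "norm B = R0" using a b by (auto simp: A_def B_def dist_norm norm_minus_commute)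
      have "t *\<^sub>R u0 = s *\<^sub>R (r *\<^sub>R u0)" using r by (simp add: s_def)
      then have tu: "t *\<^sub>R u0 = s *\<^sub>R (1/2) *\<^sub>R (a - b)" unfolding ru .
      have e: "q + t *\<^sub>R u0 - p = ((1 + s)/2) *\<^sub>R A + ((1 - s)/2) *\<^sub>R B"
        unfolding tu q_def A_def B_def by (rule euclidean_eqI) (simp add: inner_simps field_simps)
      have "(norm (q + t *\<^sub>R u0 - p))\<^sup>2 = ((1 + s)/2)\<^sup>2 * (A \<bullet> A) + 2 * ((1 + s)/2) * ((1 - s)/2) * (A \<bullet> B) + ((1 - s)/2)\<^sup>2 * (B \<bullet> B)"
      proof -
        have "(norm (k *\<^sub>R A + l *\<^sub>R B))\<^sup>2 = k\<^sup>2 * (A \<bullet> A) + 2 * k * l * (A \<bullet> B) + l\<^sup>2 * (B \<bullet> B)" for k l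
          unfolding power2_norm_eq_inner by (simp add: inner_simps power2_eq_square inner_commute[of B A] algebra_simps)
        then show ?thesis unfolding e by blast
      qed
      also have "\<dots> = R0\<^sup>2 - (1 - s\<^sup>2) / 4 * (norm (A - B))\<^sup>2"
      proof -
        have "A \<bullet> A = R0\<^sup>2" "B \<bullet> B = R0\<^sup>2" using AB by (auto simp: dot_square_norm)
        moreover from this have "(norm (A - B))\<^sup>2 = 2 * R0\<^sup>2 - 2 * (A \<bullet> B)"
          unfolding power2_norm_eq_inner by (simp add: inner_simps inner_commute)
        moreover have "((1 + s)/2)\<^sup>2 * Q + 2 * ((1 + s)/2) * ((1 - s)/2) * x + ((1 - s)/2)\<^sup>2 * Q =
            Q - (1 - s\<^sup>2) / 4 * (2 * Q - 2 * x)" for Q x :: real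
          by (simp add: power2_eq_square field_simps)
        ultimately show ?thesis by simp
      qed
      also have "\<dots> < R0\<^sup>2"
      proof -
        have "0 < 1 - s\<^sup>2" using s by (simp add: abs_square_less_1)
        moreover have "A - B \<noteq> 0" using ab by (simp add: A_def B_def)
        ultimately show ?thesis by simp
      qed
      finally have "norm (q + t *\<^sub>R u0 - p) < R0"
        by (rule power2_less_imp_less) (use AB(1) norm_ge_zero[of A] in simp)
      then show ?thesis by (intro ballD) (simp add: dist_norm norm_minus_commute)
    qed
    have qD: "q \<in> D" using seg[of 0] r by simp
    have da: "0 < infdist a C2" "0 < infdist b C1"
      using a b dj in_closed_iff_infdist_zero[OF cl2 ne2, of a] in_closed_iff_infdist_zero[OF cl1 ne1, of b]
        infdist_nonneg[of a C2] infdist_nonneg[of b C1] by force+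
    define \<epsilon> where "\<epsilon> = min (infdist a C2) (infdist b C1)"
    have \<epsilon>: "0 < \<epsilon>" "\<epsilon> \<le> infdist a C2" "\<epsilon> \<le> infdist b C1" using da by (auto simp: \<epsilon>_def simp del: le_divide_eq_numeral1)
    have mu0: "norm (- u0) = 1" using u0 by simp
    have seg': "q + t *\<^sub>R u0 \<in> D" "q + t *\<^sub>R (- u0) \<in> D" if "0 < t" "t < r" for t
      using seg[of t] seg[of "-t"] that by auto
    obtain \<eta>a where \<eta>a: "0 < \<eta>a" "\<And>x u T. dist q x < \<eta>a \<Longrightarrow> norm u = 1 \<Longrightarrow> dist u0 u < \<eta>a \<Longrightarrow> \<bar>T - r\<bar> < \<eta>a \<Longrightarrow>
      x + T *\<^sub>R u \<notin> D \<Longrightarrow> hits D x u a \<epsilon>"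
      by (rule hits_near_segment[OF D_open starts_in_interior[OF D_open qD] u0 r _ \<epsilon>(1)],
          rule seg'(1), assumption+, rule that, assumption) (simp add: aq)
    obtain \<eta>b where \<eta>b: "0 < \<eta>b" "\<And>x u T. dist q x < \<eta>b \<Longrightarrow> norm u = 1 \<Longrightarrow> dist (- u0) u < \<eta>b \<Longrightarrow> \<bar>T - r\<bar> < \<eta>b \<Longrightarrow>
      x + T *\<^sub>R u \<notin> D \<Longrightarrow> hits D x u b \<epsilon>"
      by (rule hits_near_segment[OF D_open starts_in_interior[OF D_open qD] mu0 r _ \<epsilon>(1)],
          rule seg'(2), assumption+, rule that, assumption) (simp add: bq)
    obtain \<eta>q where \<eta>q: "0 < \<eta>q" "ball q \<eta>q \<subseteq> D" using qD D_open open_contains_ball by blast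
    define m where "m = Min {\<eta>a, \<eta>b, \<eta>q}"
    have m: "0 < m" "m \<le> \<eta>a" "m \<le> \<eta>b" "m \<le> \<eta>q" using \<eta>a \<eta>b \<eta>q by (auto simp: m_def simp del: le_divide_eq_numeral1)
    define s where "s = Min {m / 2, r / 2, m * r / 8}"
    have s: "0 < s" "s \<le> m / 2" "s \<le> r / 2" "s \<le> m * r / 8" using m r by (auto simp: s_def simp del: le_divide_eq_numeral1)
    \<comment> \<open>The end points \<open>a\<close> and \<open>b\<close> may be irregular. They
      are replaced by exterior points close by, and the new chord is shot from the midpoint
      \<open>q'\<close> of these in two opposite directions, so that a single generic direction
      handles both ends.\<close>
    obtain ea where ea: "ea \<notin> closure D" "dist a ea < s"
      using patch_ex[OF af] cone_patch_exterior[OF _ af s(1)] by metis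
    obtain eb where eb: "eb \<notin> closure D" "dist b eb < s"
      using patch_ex[OF bf] cone_patch_exterior[OF _ bf s(1)] by metis
    define q' where "q' = (1/2) *\<^sub>R (ea + eb)"
    define v where "v = (1/2) *\<^sub>R (ea - eb)"
    define T where "T = norm v"
    define u1 where "u1 = sgn v"
    have "q - q' = (1/2) *\<^sub>R ((a - ea) + (b - eb))" by (simp add: q_def q'_def algebra_simps)
    then have "dist q q' \<le> (dist a ea + dist b eb) / 2"
      using norm_triangle_ineq[of "a - ea" "b - eb"] by (simp add: dist_norm)
    then have qq': "dist q q' < s" using ea(2) eb(2) by argo
    have "v - r *\<^sub>R u0 = (1/2) *\<^sub>R ((ea - a) - (eb - b))" unfolding ru v_def by (simp add: algebra_simps)
    then have "norm (v - r *\<^sub>R u0) \<le> (dist a ea + dist b eb) / 2"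
      using norm_triangle_ineq4[of "ea - a" "eb - b"] by (simp add: dist_norm norm_minus_commute)
    then have vs: "norm (v - r *\<^sub>R u0) \<le> s" using ea(2) eb(2) by argo
    have sr: "s < r" using s r by linarith
    note sg = sgn_near[OF u0 r vs sr, folded u1_def T_def]
    have du: "dist u0 u1 \<le> m / 4"
    proof -
      have "2 * s / r \<le> m / 4" using s(4) r by (simp add: field_simps)
      then show ?thesis using sg(2) by linarith
    qed
    have eq: "ea = q' + T *\<^sub>R u1" "eb = q' + T *\<^sub>R (- u1)"
      using sg(4) by (simp_all add: q'_def v_def flip: scaleR_add_left scaleR_diff_left) (simp_all add: algebra_simps flip: scaleR_add_left)
    have T0: "0 < T" using sg(1) sr by linarith
    obtain \<beta>a where \<beta>a: "\<beta>a > 0" "ball ea \<beta>a \<subseteq> - closure D"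
      using ea(1) open_contains_ball[of "- closure D"] by (metis ComplI closed_closure open_Compl)
    obtain \<beta>b where \<beta>b: "\<beta>b > 0" "ball eb \<beta>b \<subseteq> - closure D"
      using eb(1) open_contains_ball[of "- closure D"] by (metis ComplI closed_closure open_Compl)
    define \<rho> where "\<rho> = Min {m / 2, \<beta>a / T, \<beta>b / T}"
    have \<rho>: "0 < \<rho>" "\<rho> \<le> m / 2" "\<rho> \<le> \<beta>a / T" "\<rho> \<le> \<beta>b / T" using m \<beta>a \<beta>b T0 by (auto simp: \<rho>_def simp del: le_divide_eq_numeral1)
    obtain u where u: "norm u = 1" "dist u1 u < \<rho>" and good: "\<And>t. t \<noteq> 0 \<Longrightarrow> q' + t *\<^sub>R u \<in> frontier D \<Longrightarrow>
          q' + t *\<^sub>R u \<in> Rt \<and> nrm (q' + t *\<^sub>R u) \<bullet> u \<noteq> 0"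
      using AE_sphere_measure_direction[OF bad_null[of q'] sg(3) \<rho>(1)] by auto
    have "T * dist u1 u < T * \<rho>" using u(2) T0 by simp
    moreover have "T * \<rho> \<le> \<beta>a" "T * \<rho> \<le> \<beta>b" using \<rho>(3,4) T0 by (auto simp: field_simps)
    ultimately have Tu: "T * dist u1 u < \<beta>a" "T * dist u1 u < \<beta>b" by auto
    have ext: "q' + T *\<^sub>R u \<notin> D" "q' + T *\<^sub>R (- u) \<notin> D"
    proof -
      have "dist ea (q' + T *\<^sub>R u) = T * dist u1 u" "dist eb (q' + T *\<^sub>R (- u)) = T * dist u1 u"
        using T0 unfolding eq by (simp_all add: dist_norm norm_minus_commute flip: scaleR_diff_right)
      then have "q' + T *\<^sub>R u \<in> ball ea \<beta>a" "q' + T *\<^sub>R (- u) \<in> ball eb \<beta>b" using Tu by auto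
      then show "q' + T *\<^sub>R u \<notin> D" "q' + T *\<^sub>R (- u) \<notin> D" using \<beta>a \<beta>b closure_subset by blast+
    qed
    have du': "dist u0 u < m" using dist_triangle[of u0 u u1] du u(2) \<rho>(2) m(1) by linarith
    have du'': "dist (- u0) (- u) < m" using du' by (simp add: dist_norm norm_minus_commute)
    have Tm: "\<bar>T - r\<bar> < m" using sg(1) s m by linarith
    have ha: "hits D q' u a \<epsilon>" using \<eta>a(2)[of q' u T] qq' s m u du' Tm ext by auto
    have hb: "hits D q' (- u) b \<epsilon>" using \<eta>b(2)[of q' "- u" T] qq' s m u du'' Tm ext by auto
    define \<alpha> where "\<alpha> = hit_point D q' u"
    define \<beta> where "\<beta> = hit_point D q' (- u)"
    define ta where "ta = hit_time D q' u"
    define tb where "tb = hit_time D q' (- u)"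
    have tab: "0 < ta" "0 < tb" using ha hb by (auto simp: hits_def ta_def tb_def)
    have \<alpha>: "\<alpha> = q' + ta *\<^sub>R u" and \<beta>: "\<beta> = q' + (- tb) *\<^sub>R u"
      by (auto simp: \<alpha>_def \<beta>_def ta_def tb_def hit_point_def)
    have fr: "\<alpha> \<in> frontier D" "\<beta> \<in> frontier D" using ha hb by (auto simp: hits_def \<alpha>_def \<beta>_def)
    \<comment> \<open>\<open>\<epsilon>\<close> is at most the distance from \<open>a\<close> to
      \<open>C2\<close>, so a boundary point closer than that to \<open>a\<close> belongs to
      \<open>C1\<close>; likewise for \<open>\<beta>\<close> below.\<close>
    have \<alpha>C: "\<alpha> \<in> C1" using ha \<epsilon> fr un infdist_le[of \<alpha> C2 a] by (force simp: hits_def \<alpha>_def)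
    have \<beta>C: "\<beta> \<in> C2" using hb \<epsilon> fr un infdist_le[of \<beta> C1 b] by (force simp: hits_def \<beta>_def)
    have R: "\<alpha> \<in> Rt" "nrm \<alpha> \<bullet> u \<noteq> 0" "\<beta> \<in> Rt" "nrm \<beta> \<bullet> u \<noteq> 0"
      using good[of ta] good[of "- tb"] tab fr by (auto simp: \<alpha> \<beta>)
    have n\<alpha>: "nrm \<alpha> \<bullet> u < 0"
      using hits_transversal_end[of q' u] ha R unfolding hits_def \<alpha>_def[symmetric] by auto
    have "nrm \<beta> \<bullet> (- u) < 0"
      using hits_transversal_end[of q' "- u"] hb R unfolding hits_def \<beta>_def[symmetric] by auto
    then have n\<beta>: "0 < nrm \<beta> \<bullet> u" by simp
    have q'D: "q' \<in> D" using \<eta>q qq' s m by auto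
    have diff: "\<alpha> - \<beta> = (ta + tb) *\<^sub>R u" by (simp add: \<alpha> \<beta> algebra_simps)
    have sgd: "sgn (\<alpha> - \<beta>) = u" "norm (\<alpha> - \<beta>) = ta + tb"
      using tab u by (auto simp: diff sgn_div_norm)
    have ch: "chord D \<beta> \<alpha>"
      unfolding chord_def sgd
    proof (intro conjI allI impI)
      show "\<beta> \<noteq> \<alpha>" using \<alpha>C \<beta>C dj by auto
      fix t assume t: "0 < t" "t < ta + tb"
      have "\<beta> + t *\<^sub>R u = q' + (t - tb) *\<^sub>R u" by (simp add: \<beta> algebra_simps)
      moreover have "q' + (t - tb) *\<^sub>R u \<in> D"
      proof -
        consider "t = tb" | "t > tb" | "t < tb" by linarith
        then show ?thesis
        proof cases
          case 2 then show ?thesis using ha t by (auto simp: hits_def ta_def)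
        next
          case 3
          then have "q' + (tb - t) *\<^sub>R (- u) \<in> D" using hb t unfolding hits_def tb_def[symmetric] by auto
          then show ?thesis by (simp add: algebra_simps)
        qed (use q'D in auto)
      qed
      ultimately show "\<beta> + t *\<^sub>R u \<in> D" by simp
    qed
    have conn: "P x y" if x: "x \<in> Rt" and y: "y \<in> frontier D" and ch: "chord D x y" and pos: "0 < nrm x \<bullet> (y - x)" for x y
    proof -
      have yx: "norm (y - x) > 0" using ch by (auto simp: chord_def)
      define \<kappa> where "\<kappa> = min (1/2) (nrm x \<bullet> (y - x) / (2 * norm (y - x)))"
      have \<kappa>: "0 < \<kappa>" "\<kappa> < 1" using pos yx by (auto simp: \<kappa>_def)
      have "\<kappa> * norm (y - x) \<le> (nrm x \<bullet> (y - x) / (2 * norm (y - x))) * norm (y - x)" by (intro mult_right_mono) (auto simp: \<kappa>_def)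
      also have "\<dots> = nrm x \<bullet> (y - x) / 2" using yx by simp
      finally have "\<kappa> * norm (y - x) < nrm x \<bullet> (y - x)" using pos by linarith
      then show ?thesis using aim[of x y] normal_patch[OF x \<kappa>] x y Rt_sub ch by blast
    qed
    have "P \<beta> \<alpha>" using conn[OF R(3) fr(1) ch] n\<beta> tab by (simp add: diff)
    moreover have "P \<alpha> \<beta>"
    proof (rule conn[OF R(1) fr(2) chord_sym[OF ch]])
      have "\<beta> - \<alpha> = - ((ta + tb) *\<^sub>R u)" using diff by (metis minus_diff_eq)
      then show "0 < nrm \<alpha> \<bullet> (\<beta> - \<alpha>)" using n\<alpha> tab by (simp add: mult_pos_neg)
    qed
    ultimately have "\<beta> \<in> C1" using \<alpha>C trans fr unfolding C1_def by blast
    then show False using \<beta>C dj by auto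
  qed
  then show ?thesis using y1 by (auto simp: C2_def C1_def)
qed

end

section \<open>Directions that avoid small sets and tangencies\<close>

text \<open>The Householder reflection in the hyperplane orthogonal to \<open>n - b\<close>.\<close>

lemma orthogonal_transformation_between_unit_vectors:
  fixes n b :: "'a::euclidean_space"
  assumes "norm n = 1" "norm b = 1"
  obtains T where "orthogonal_transformation T" "T n = b"
proof (cases "n = b")
  case True
  then show ?thesis by (intro that[of "\<lambda>x. x"]) auto
next
  case False
  define v where "v = n - b"
  define T where "T x = x - (2 * (v \<bullet> x) / (v \<bullet> v)) *\<^sub>R v" for x
  have vv: "v \<bullet> v \<noteq> 0" using False by (simp add: v_def)
  have "v \<bullet> v = 2 * (v \<bullet> n)"
    using assms by (simp add: v_def inner_simps norm_eq_1 inner_commute)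
  then have "T n = b" using vv by (simp add: T_def v_def)
  moreover have "linear T"
    by (rule linearI) (auto simp: T_def inner_simps algebra_simps add_divide_distrib)
  moreover have "T x \<bullet> T y = x \<bullet> y" for x y
  proof -
    have "T x \<bullet> T y = x \<bullet> y - (2 * (v \<bullet> y) / (v \<bullet> v)) * (v \<bullet> x) - (2 * (v \<bullet> x) / (v \<bullet> v)) * (v \<bullet> y) +
        (2 * (v \<bullet> x) / (v \<bullet> v)) * (2 * (v \<bullet> y) / (v \<bullet> v)) * (v \<bullet> v)"
      by (simp add: T_def inner_diff_left inner_diff_right inner_commute[of x v])
    also have "\<dots> = x \<bullet> y" using vv by simp
    finally show ?thesis .
  qed
  ultimately show ?thesis by (intro that[of T]) (auto simp: orthogonal_transformation_def)
qed

section \<open>Upper bounds for surface measure via thickened sets\<close>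

lemma emeasure_lborel_strip_le:
  fixes n w :: "'a::euclidean_space"
  assumes n: "norm n = 1" and \<beta>: "0 \<le> \<beta>" and r: "0 \<le> r"
  shows "emeasure lborel {x. norm (x - w) < r \<and> \<bar>n \<bullet> x\<bar> \<le> \<beta>} \<le> ennreal (2 * \<beta> * (2 * r) ^ (DIM('a) - 1))"
proof -
  obtain b :: 'a where b: "b \<in> Basis" using nonempty_Basis by blast
  obtain T where T: "orthogonal_transformation T" "T n = b"
    using orthogonal_transformation_between_unit_vectors[OF n, of b] b by auto
  have lin: "linear T" using T(1) by (rule orthogonal_transformation_linear)
  have [measurable]: "T \<in> borel_measurable borel"
    using lin by (intro borel_measurable_continuous_onI linear_continuous_on)
      (simp add: linear_conv_bounded_linear)
  define l where "l = (\<Sum>i\<in>Basis. (if i = b then - \<beta> else T w \<bullet> i - r) *\<^sub>R i)"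
  define u where "u = (\<Sum>i\<in>Basis. (if i = b then \<beta> else T w \<bullet> i + r) *\<^sub>R i)"
  have li: "l \<bullet> i = (if i = b then - \<beta> else T w \<bullet> i - r)" "u \<bullet> i = (if i = b then \<beta> else T w \<bullet> i + r)"
    if "i \<in> Basis" for i using that by (simp_all add: l_def u_def)
  have sub: "{x. norm (x - w) < r \<and> \<bar>n \<bullet> x\<bar> \<le> \<beta>} \<subseteq> T -` cbox l u"
  proof clarsimp
    fix x assume x: "norm (x - w) < r" "\<bar>n \<bullet> x\<bar> \<le> \<beta>"
    have "b \<bullet> T x = n \<bullet> x" using T unfolding orthogonal_transformation_def by metis
    moreover have "\<bar>(T x - T w) \<bullet> i\<bar> < r" if "i \<in> Basis" for i
      using Basis_le_norm[OF that, of "T (x - w)"] orthogonal_transformation_norm[OF T(1), of "x - w"] x(1) lin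
      by (simp add: linear_diff)
    ultimately show "T x \<in> cbox l u"
      using x(2) by (fastforce simp: mem_box li inner_commute[of b] inner_diff_left abs_le_iff abs_less_iff)
  qed
  have "emeasure lborel {x. norm (x - w) < r \<and> \<bar>n \<bullet> x\<bar> \<le> \<beta>} \<le> emeasure lborel (T -` cbox l u)"
    by (rule emeasure_mono[OF sub]) (use measurable_sets_borel[OF \<open>T \<in> borel_measurable borel\<close>, of "cbox l u"] in simp)
  also have "\<dots> = emeasure (distr lborel borel T) (cbox l u)"
    by (subst emeasure_distr) auto
  also have "\<dots> = emeasure lborel (cbox l u)" by (simp add: lborel_distr_orthogonal[OF T(1)])
  also have "\<dots> = ennreal (\<Prod>i\<in>Basis. (u - l) \<bullet> i)"
    using \<beta> r by (intro emeasure_lborel_cbox) (auto simp: li)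
  also have "(\<Prod>i\<in>Basis. (u - l) \<bullet> i) = (\<Prod>i\<in>Basis. if i = b then 2 * \<beta> else 2 * r)"
    by (intro prod.cong) (auto simp: li inner_diff_left)
  also have "\<dots> = 2 * \<beta> * (2 * r) ^ (DIM('a) - 1)"
    using b by (subst prod.remove[OF _ b]) (auto simp: card_Diff_singleton)
  finally show ?thesis .
qed

text \<open>The shell over \<open>A\<close> has volume proportional to
  \<open>(1 + \<rho>) ^ d - 1\<close>, which is at least \<open>\<rho> * d\<close> by Bernoulli.
  Upper bounds for surface measure thereby reduce to volumes.\<close>

lemma sphere_measure_shell_le:
  fixes A :: "'a::euclidean_space set"
  assumes A[measurable]: "A \<in> sets borel" and \<rho>: "0 < \<rho>"
  shows "ennreal \<rho> * emeasure sphere_measure A \<le> emeasure lborel {x. 1 \<le> norm x \<and> norm x < 1 + \<rho> \<and> sgn x \<in> A}"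
proof -
  define d where "d = DIM('a)"
  define S where "S r = {x. x \<in> ball 0 r \<and> sgn x \<in> A}" for r
  have S[measurable]: "S r \<in> sets borel" for r
  proof -
    have "S r = ball 0 r \<inter> sgn -` A" by (auto simp: S_def)
    then show ?thesis using measurable_sets_borel[OF borel_measurable_sgn A] by simp
  qed
  have fin: "emeasure lborel (S 1) \<noteq> \<infinity>"
  proof -
    have "emeasure lborel (S 1) \<le> emeasure lborel (ball 0 1 :: 'a set)"
      by (rule emeasure_mono) (auto simp: S_def)
    then show ?thesis using emeasure_lborel_ball_finite[of "0::'a" 1] by (auto simp: top_unique)
  qed
  have scale: "emeasure lborel (S r) = ennreal (r ^ d) * emeasure lborel (S 1)" if r: "0 < r" for r
  proof -
    have "emeasure lborel (S r) = emeasure (density (distr lborel borel (\<lambda>x. 0 + r *\<^sub>R x)) (\<lambda>_. ennreal (\<bar>r\<bar> ^ d))) (S r)"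
      using r lborel_affine[of r "0::'a"] by (simp add: d_def)
    also have "\<dots> = ennreal (r ^ d) * emeasure lborel ((\<lambda>x. r *\<^sub>R x) -` S r)"
      using r by (subst emeasure_density_const) (auto simp: emeasure_distr)
    also have "(\<lambda>x. r *\<^sub>R x) -` S r = S 1"
      using r by (auto simp: S_def sgn_scaleR)
    finally show ?thesis .
  qed
  have "{x. 1 \<le> norm x \<and> norm x < 1 + \<rho> \<and> sgn x \<in> A} = S (1 + \<rho>) - S 1"
    using \<rho> by (auto simp: S_def)
  moreover have "emeasure lborel (S (1 + \<rho>) - S 1) = emeasure lborel (S (1 + \<rho>)) - emeasure lborel (S 1)"
  proof -
    have "S 1 \<subseteq> S (1 + \<rho>)" using \<rho> by (auto simp: S_def)
    then have "emeasure lborel (S (1 + \<rho>) - S 1) = emeasure lborel (S (1 + \<rho>)) - emeasure lborel (S 1)"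
      using fin S by (intro emeasure_Diff) simp_all
    then show "emeasure lborel (S (1 + \<rho>) - S 1) = emeasure lborel (S (1 + \<rho>)) - emeasure lborel (S 1)" .
  qed
  ultimately have "emeasure lborel {x. 1 \<le> norm x \<and> norm x < 1 + \<rho> \<and> sgn x \<in> A} = emeasure lborel (S (1 + \<rho>)) - emeasure lborel (S 1)"
    by simp
  also have "\<dots> = ennreal ((1 + \<rho>) ^ d) * emeasure lborel (S 1) - ennreal 1 * emeasure lborel (S 1)"
    using scale[of "1 + \<rho>"] \<rho> by simp
  also have "\<dots> = ennreal ((1 + \<rho>) ^ d - 1) * emeasure lborel (S 1)"
  proof -
    obtain s where s: "emeasure lborel (S 1) = ennreal s" "0 \<le> s" using fin by (cases "emeasure lborel (S 1)") auto
    have "1 \<le> (1 + \<rho>) ^ d" using \<rho> by (intro one_le_power) auto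
    then show ?thesis using s \<rho> by (simp add: left_diff_distrib ennreal_minus flip: ennreal_mult)
  qed
  also have "\<dots> \<ge> ennreal (\<rho> * d) * emeasure lborel (S 1)"
    using Bernoulli_inequality[of \<rho> d] \<rho> by (intro mult_right_mono ennreal_leI) (auto simp: mult.commute)
  also have "ennreal (\<rho> * d) * emeasure lborel (S 1) = ennreal \<rho> * emeasure sphere_measure A"
    using \<rho> emeasure_sphere_measure[OF A]
    by (simp add: S_def d_def ennreal_mult ennreal_of_nat_eq_real_of_nat mult.assoc)
  finally show ?thesis .
qed

text \<open>Thickened radially by \<open>\<rho>\<close>, the slab fits into a strip of half-width
  \<open>2 * \<beta>\<close> inside a ball of radius \<open>2 * \<rho>\<close>. The gain over the
  bound for a whole cap is the factor of order \<open>\<beta> / \<rho>\<close>, on which the Sard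
  argument rests.\<close>

lemma measure_sphere_slab_le:
  fixes n w :: "'a::euclidean_space"
  assumes n: "norm n = 1" and \<beta>: "0 \<le> \<beta>" and \<rho>: "0 < \<rho>" "\<rho> \<le> 1"
  shows "\<rho> * measure sphere_measure {u. norm u = 1 \<and> norm (u - w) < \<rho> \<and> \<bar>n \<bullet> u\<bar> \<le> \<beta>} \<le> 4 * \<beta> * (4 * \<rho>) ^ (DIM('a) - 1)"
proof -
  interpret finite_measure "sphere_measure :: 'a measure" by (rule finite_measure_sphere_measure)
  let ?A = "{u. norm u = 1 \<and> norm (u - w) < \<rho> \<and> \<bar>n \<bullet> u\<bar> \<le> \<beta>}"
  have A: "?A \<in> sets borel" by measurable
  have sub: "{x. 1 \<le> norm x \<and> norm x < 1 + \<rho> \<and> sgn x \<in> ?A} \<subseteq> {x. norm (x - w) < 2 * \<rho> \<and> \<bar>n \<bullet> x\<bar> \<le> 2 * \<beta>}"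
  proof clarsimp
    fix x assume x: "1 \<le> norm x" "norm x < 1 + \<rho>" "norm (sgn x) = 1" "norm (sgn x - w) < \<rho>" "\<bar>n \<bullet> sgn x\<bar> \<le> \<beta>"
    have "x \<noteq> 0" using x(1) by auto
    then have xs: "x = norm x *\<^sub>R sgn x" by (auto simp: sgn_div_norm)
    have "x - sgn x = (norm x - 1) *\<^sub>R sgn x" using xs by (simp add: scaleR_diff_left)
    then have "norm (x - sgn x) = norm x - 1" using x by simp
    then have 1: "norm (x - w) < 2 * \<rho>"
      using norm_triangle_ineq[of "x - sgn x" "sgn x - w"] x by simp
    have "\<bar>n \<bullet> x\<bar> = norm x * \<bar>n \<bullet> sgn x\<bar>" by (subst xs) (simp add: abs_mult)
    also have "\<dots> \<le> 2 * \<beta>" using x \<rho> \<beta> by (intro mult_mono) auto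
    finally show "norm (x - w) < 2 * \<rho> \<and> \<bar>n \<bullet> x\<bar> \<le> 2 * \<beta>" using 1 by simp
  qed
  have "ennreal (\<rho> * measure sphere_measure ?A) = ennreal \<rho> * emeasure sphere_measure ?A"
    using \<rho> by (simp add: ennreal_mult emeasure_eq_measure)
  also have "\<dots> \<le> emeasure lborel {x. 1 \<le> norm x \<and> norm x < 1 + \<rho> \<and> sgn x \<in> ?A}"
    by (rule sphere_measure_shell_le[OF A \<rho>(1)])
  also have "\<dots> \<le> emeasure lborel {x. norm (x - w) < 2 * \<rho> \<and> \<bar>n \<bullet> x\<bar> \<le> 2 * \<beta>}"
    by (rule emeasure_mono[OF sub]) measurable
  also have "\<dots> \<le> ennreal (2 * (2 * \<beta>) * (2 * (2 * \<rho>)) ^ (DIM('a) - 1))"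
    using n \<beta> \<rho> by (intro emeasure_lborel_strip_le) auto
  finally show ?thesis using \<beta> \<rho> by (simp add: ennreal_le_iff)
qed

lemma measure_sphere_ball_le:
  fixes w :: "'a::euclidean_space"
  assumes \<rho>: "0 < \<rho>" "\<rho> \<le> 1"
  shows "measure sphere_measure (ball w \<rho>) \<le> 8 * (4 * \<rho>) ^ (DIM('a) - 1)"
proof -
  interpret finite_measure "sphere_measure :: 'a measure" by (rule finite_measure_sphere_measure)
  let ?X = "ball w \<rho>"
  have sub: "{x. 1 \<le> norm x \<and> norm x < 1 + \<rho> \<and> sgn x \<in> ?X} \<subseteq> ball w (2 * \<rho>)"
  proof clarsimp
    fix x assume x: "1 \<le> norm x" "norm x < 1 + \<rho>" "dist w (sgn x) < \<rho>"
    have "x \<noteq> 0" using x(1) by auto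
    then have xs: "x = norm x *\<^sub>R sgn x" and n1: "norm (sgn x) = 1" by (auto simp: sgn_div_norm)
    have "x - sgn x = (norm x - 1) *\<^sub>R sgn x" using xs by (simp add: scaleR_diff_left)
    then have "norm (x - sgn x) = norm x - 1" using x n1 by simp
    then show "dist w x < 2 * \<rho>" using dist_triangle[of w x "sgn x"] x by (simp add: dist_norm norm_minus_commute)
  qed
  obtain b :: 'a where b: "b \<in> Basis" using nonempty_Basis by blast
  have "ball w (2 * \<rho>) \<subseteq> cbox (w - (\<Sum>i\<in>Basis. (2 * \<rho>) *\<^sub>R i)) (w + (\<Sum>i\<in>Basis. (2 * \<rho>) *\<^sub>R i))"
  proof
    fix x assume "x \<in> ball w (2 * \<rho>)"
    then have "\<bar>(x - w) \<bullet> i\<bar> \<le> 2 * \<rho>" if "i \<in> Basis" for i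
      using Basis_le_norm[OF that, of "x - w"] by (auto simp: dist_norm norm_minus_commute)
    then show "x \<in> cbox (w - (\<Sum>i\<in>Basis. (2 * \<rho>) *\<^sub>R i)) (w + (\<Sum>i\<in>Basis. (2 * \<rho>) *\<^sub>R i))"
      by (fastforce simp: mem_box inner_diff_left inner_add_left abs_le_iff)
  qed
  then have "emeasure lborel (ball w (2 * \<rho>)) \<le> emeasure lborel (cbox (w - (\<Sum>i\<in>Basis. (2 * \<rho>) *\<^sub>R i)) (w + (\<Sum>i\<in>Basis. (2 * \<rho>) *\<^sub>R i)))"
    by (intro emeasure_mono) auto
  also have "\<dots> = ennreal (\<Prod>i\<in>(Basis::'a set). 4 * \<rho>)"
    using \<rho> by (subst emeasure_lborel_cbox) (auto simp: inner_diff_left inner_add_left intro!: arg_cong[where f=ennreal] prod.cong)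
  also have "\<dots> = ennreal (4 * \<rho> * (4 * \<rho>) ^ (DIM('a) - 1))"
    by (simp add: power_eq_if)
  finally have vol: "emeasure lborel (ball w (2 * \<rho>)) \<le> ennreal (4 * \<rho> * (4 * \<rho>) ^ (DIM('a) - 1))" .
  have "ennreal (\<rho> * measure sphere_measure ?X) = ennreal \<rho> * emeasure sphere_measure ?X"
    using \<rho> by (simp add: ennreal_mult emeasure_eq_measure)
  also have "\<dots> \<le> emeasure lborel {x. 1 \<le> norm x \<and> norm x < 1 + \<rho> \<and> sgn x \<in> ?X}"
    by (rule sphere_measure_shell_le[OF _ \<rho>(1)]) simp
  also have "\<dots> \<le> emeasure lborel (ball w (2 * \<rho>))"
    by (rule emeasure_mono[OF sub]) auto
  also note vol
  finally have "\<rho> * measure sphere_measure ?X \<le> 4 * \<rho> * (4 * \<rho>) ^ (DIM('a) - 1)"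
    using \<rho> by (subst (asm) ennreal_le_iff) auto
  then have "\<rho> * measure sphere_measure ?X \<le> \<rho> * (4 * (4 * \<rho>) ^ (DIM('a) - 1))" by (simp add: ac_simps)
  then have "measure sphere_measure ?X \<le> 4 * (4 * \<rho>) ^ (DIM('a) - 1)" using \<rho> by simp
  also have "\<dots> \<le> 8 * (4 * \<rho>) ^ (DIM('a) - 1)" using \<rho> by (intro mult_right_mono) auto
  finally show ?thesis .
qed

text \<open>Null sets through arbitrarily small measurable covers, as the projected sets below come
  without measurability.\<close>

lemma AE_notin_outer_null:
  assumes "\<And>\<epsilon>. 0 < \<epsilon> \<Longrightarrow> \<exists>A\<in>sets M. B \<subseteq> A \<and> emeasure M A \<le> ennreal \<epsilon>"
  shows "AE u in M. u \<notin> B"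
proof -
  have "\<exists>A\<in>sets M. B \<subseteq> A \<and> emeasure M A \<le> ennreal (1 / real (Suc n))" for n
    by (rule assms) simp
  then obtain A where A: "\<And>n. A n \<in> sets M" "\<And>n. B \<subseteq> A n" "\<And>n. emeasure M (A n) \<le> ennreal (1 / real (Suc n))"
    by metis
  define N where "N = (\<Inter>n. A n)"
  have N: "N \<in> sets M" using A(1) by (auto simp: N_def)
  have "emeasure M N \<le> ennreal (1 / real (Suc n))" for n
    using emeasure_mono[of N "A n" M] A(1,3)[of n] order_trans unfolding N_def by blast
  moreover have "(\<lambda>n. ennreal (1 / real (Suc n))) \<longlonglongrightarrow> ennreal 0"
    by (intro tendsto_ennrealI LIMSEQ_Suc lim_1_over_n)
  ultimately have "emeasure M N \<le> 0"
    by (metis LIMSEQ_le_const ennreal_0)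
  then show ?thesis using N A(2) by (intro AE_I[of _ _ N]) (auto simp: N_def)
qed

lemma sgn_diff_le:
  fixes a b :: "'a::real_normed_vector"
  assumes "b \<noteq> 0" "c \<le> norm b" "0 < c"
  shows "norm (sgn a - sgn b) \<le> 2 * norm (a - b) / c"
proof -
  have "norm b * norm (sgn a - sgn b) = norm (norm b *\<^sub>R sgn a - b)"
  proof -
    have "norm b *\<^sub>R sgn b = b" using assms(1) by (simp add: sgn_div_norm)
    then have "norm b *\<^sub>R sgn a - b = norm b *\<^sub>R (sgn a - sgn b)" by (simp add: scaleR_diff_right)
    then show ?thesis by simp
  qed
  also have "\<dots> = norm ((norm b - norm a) *\<^sub>R sgn a + (a - b))"
  proof -
    have "norm a *\<^sub>R sgn a = a" by (cases "a = 0") (auto simp: sgn_div_norm)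
    then have "norm b *\<^sub>R sgn a - b = (norm b - norm a) *\<^sub>R sgn a + (a - b)" by (simp add: scaleR_diff_left)
    then show ?thesis by (rule arg_cong)
  qed
  also have "\<dots> \<le> \<bar>norm b - norm a\<bar> + norm (a - b)"
    using norm_triangle_ineq[of "(norm b - norm a) *\<^sub>R sgn a" "a - b"] by (auto simp: norm_sgn split: if_splits)
  also have "\<dots> \<le> 2 * norm (a - b)" using norm_triangle_ineq3[of b a] by (simp add: norm_minus_commute)
  finally have "norm b * norm (sgn a - sgn b) \<le> 2 * norm (a - b)" .
  moreover have "c * norm (sgn a - sgn b) \<le> norm b * norm (sgn a - sgn b)" using assms by (intro mult_right_mono) auto
  ultimately show ?thesis using assms by (simp add: field_simps)
qed

text \<open>The radial projection from \<open>q\<close> is Lipschitz only away from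
  \<open>q\<close>, hence the countable split by \<open>1 / j\<close>; the sign
  \<open>\<sigma>\<close> accounts for negative \<open>t\<close>.\<close>

lemma AE_direction_avoids:
  fixes q :: "'a::euclidean_space"
  assumes "\<And>j \<sigma> :: real. 0 < j \<Longrightarrow> \<sigma> = 1 \<or> \<sigma> = -1 \<Longrightarrow>
     AE u in sphere_measure. u \<notin> {\<sigma> *\<^sub>R sgn (z - q) | z. z \<in> S \<and> 1 / j \<le> norm (z - q)}"
  shows "AE u in sphere_measure. \<forall>t. t \<noteq> 0 \<longrightarrow> q + t *\<^sub>R u \<notin> S"
proof -
  have "AE u in sphere_measure. \<forall>j::nat. u \<notin> {1 *\<^sub>R sgn (z - q) | z. z \<in> S \<and> 1 / real (Suc j) \<le> norm (z - q)} \<and>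
      u \<notin> {(-1) *\<^sub>R sgn (z - q) | z. z \<in> S \<and> 1 / real (Suc j) \<le> norm (z - q)}"
    by (intro AE_all_countable[THEN iffD2] allI AE_conjI assms) auto
  then show ?thesis
    using AE_sphere_measure_norm
  proof eventually_elim
    case (elim u)
    show ?case
    proof (intro allI impI notI)
      fix t :: real assume t: "t \<noteq> 0" "q + t *\<^sub>R u \<in> S"
      define z where "z = q + t *\<^sub>R u"
      have zq: "norm (z - q) = \<bar>t\<bar>" using elim(2) by (simp add: z_def)
      obtain j where j: "1 / real (Suc j) < \<bar>t\<bar>" using reals_Archimedean[of "\<bar>t\<bar>"] t(1) by (auto simp: inverse_eq_divide)
      have "sgn (z - q) = sgn t *\<^sub>R u"
        using elim(2) by (simp add: z_def sgn_scaleR) (simp add: sgn_div_norm)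
      then have "u = sgn t *\<^sub>R sgn (z - q)" using t(1) by (auto simp: sgn_if)
      moreover have "u \<noteq> 1 *\<^sub>R sgn (z - q)" "u \<noteq> (-1) *\<^sub>R sgn (z - q)"
        using elim(1)[rule_format, of j] t(2) j zq less_imp_le[OF j] unfolding z_def[symmetric] by auto
      moreover have "sgn t = 1 \<or> sgn t = -1" using t(1) by (auto simp: sgn_if)
      ultimately show False by metis
    qed
  qed
qed

lemma power_add_le_2:
  fixes x y :: real
  assumes "0 \<le> x" "0 \<le> y"
  shows "(x + y) ^ m \<le> 2 ^ m * (x ^ m + y ^ m)"
proof -
  have "(x + y) ^ m \<le> (2 * max x y) ^ m" using assms by (intro power_mono) auto
  also have "\<dots> = 2 ^ m * max x y ^ m" by (simp add: power_mult_distrib)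
  also have "max x y ^ m \<le> x ^ m + y ^ m" using assms by (auto simp: max_def)
  finally show ?thesis by simp
qed

section \<open>Exceptional directions form a null set\<close>

text \<open>At distance at least \<open>1 / j\<close> from \<open>q\<close> the projection expands
  by at most \<open>2 * j\<close>, so a cover of \<open>N\<close> by sets of diameter
  \<open>dk k\<close> becomes a cover of the directions by caps of radius about
  \<open>2 * j * dk k\<close>, whose measure is of order \<open>dk k ^ m\<close>.\<close>

lemma AE_direction_avoids_hausdorff_null:
  fixes q :: "'a::euclidean_space" and N :: "'a set"
  assumes N: "hausdorff_measure (DIM('a) - 1) N = 0" and dim: "2 \<le> DIM('a)"
  shows "AE u in sphere_measure. \<forall>t. t \<noteq> 0 \<longrightarrow> q + t *\<^sub>R u \<notin> N"
proof (rule AE_direction_avoids)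
  interpret finite_measure "sphere_measure :: 'a measure" by (rule finite_measure_sphere_measure)
  fix j \<sigma> :: real assume j: "0 < j" and \<sigma>: "\<sigma> = 1 \<or> \<sigma> = -1"
  define m where "m = DIM('a) - 1"
  have m: "0 < m" using dim by (simp add: m_def)
  let ?B = "{\<sigma> *\<^sub>R sgn (z - q) | z. z \<in> N \<and> 1 / j \<le> norm (z - q)}"
  \<comment> \<open>Collects the cap bound \<open>8 * (4 * \<rho>) ^ m\<close>, the factor
    \<open>2 ^ m\<close> for splitting the power of a sum, and the two summands
    \<open>(2 * j) ^ m\<close> and 1 for the diameters and for the extra radii
    \<open>\<eta>\<close>.\<close>
  define K where "K = 8 * 4 ^ m * 2 ^ m * ((2 * j) ^ m + 1)"
  have K: "0 < K" using j by (auto simp: K_def intro!: mult_pos_pos add_nonneg_pos)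
  show "AE u in sphere_measure. u \<notin> ?B"
  proof (rule AE_notin_outer_null)
    fix \<epsilon>0 :: real assume \<epsilon>0: "0 < \<epsilon>0"
    define \<epsilon> where "\<epsilon> = \<epsilon>0 / K"
    have \<epsilon>: "0 < \<epsilon>" using \<epsilon>0 K by (simp add: \<epsilon>_def)
    \<comment> \<open>Makes \<open>2 * j * dk k\<close> at most one half, so that the cap radii are
      at most 1.\<close>
    define \<delta> where "\<delta> = 1 / (4 * j)"
    have \<delta>: "0 < \<delta>" using j by (simp add: \<delta>_def)
    have "hausdorff_premeasure m \<delta> N \<le> hausdorff_measure m N"
      unfolding hausdorff_measure_def using \<delta> by (intro SUP_upper) auto
    then have "hausdorff_premeasure m \<delta> N < ennreal \<epsilon>" using N \<epsilon> by (simp add: m_def)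
    then obtain C where C: "N \<subseteq> (\<Union>k. C k)" "\<And>k. bounded (C k)" "\<And>k. diameter (C k) \<le> \<delta>"
      "(\<Sum>k. ennreal (diameter (C k) ^ m)) < ennreal \<epsilon>"
      unfolding hausdorff_premeasure_def INF_less_iff by blast
    define dk where "dk k = diameter (C k)" for k
    have dk0: "0 \<le> dk k" for k unfolding dk_def using C(2) by (rule diameter_ge_0)
    \<comment> \<open>Extra radius, needed because a covering set may have diameter 0; the sum over
      \<open>k\<close> is at most \<open>\<epsilon>\<close>.\<close>
    define \<eta> where "\<eta> k = min (1/2) (\<epsilon> * (1/2) ^ Suc k)" for k :: nat
    have \<eta>: "0 < \<eta> k" "\<eta> k \<le> 1/2" "\<eta> k \<le> \<epsilon> * (1/2) ^ Suc k" for k using \<epsilon> by (auto simp: \<eta>_def)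
    define \<rho> where "\<rho> k = 2 * j * dk k + \<eta> k" for k
    have \<rho>: "0 < \<rho> k" "\<rho> k \<le> 1" for k
    proof -
      have "2 * j * dk k \<le> 2 * j * \<delta>" using C(3) j by (intro mult_left_mono) (auto simp: dk_def)
      also have "\<dots> = 1/2" using j by (simp add: \<delta>_def)
      finally show "\<rho> k \<le> 1" using \<eta>[of k] by (simp add: \<rho>_def)
      show "0 < \<rho> k" using \<eta>[of k] j dk0[of k] by (simp add: \<rho>_def add_nonneg_pos)
    qed
    \<comment> \<open>Each cap is centred at the direction of a point that the covering set really
      shares with the relevant part of \<open>N\<close>; for sets without such a point the centre is
      arbitrary.\<close>
    define w where "w k = \<sigma> *\<^sub>R sgn ((SOME z. z \<in> C k \<and> z \<in> N \<and> 1 / j \<le> norm (z - q)) - q)" for k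
    define A where "A = (\<Union>k. ball (w k) (\<rho> k))"
    have "?B \<subseteq> A"
    proof
      fix u assume "u \<in> ?B"
      then obtain z where z: "u = \<sigma> *\<^sub>R sgn (z - q)" "z \<in> N" "1 / j \<le> norm (z - q)" by auto
      obtain k where k: "z \<in> C k" using C(1) z(2) by auto
      define z' where "z' = (SOME z. z \<in> C k \<and> z \<in> N \<and> 1 / j \<le> norm (z - q))"
      have z': "z' \<in> C k \<and> z' \<in> N \<and> 1 / j \<le> norm (z' - q)"
        unfolding z'_def by (rule someI[of _ z]) (use z k in auto)
      have "z' - q \<noteq> 0" using z' j by auto
      then have "norm (sgn (z - q) - sgn (z' - q)) \<le> 2 * norm ((z - q) - (z' - q)) / (1 / j)"
        using z' j by (intro sgn_diff_le) auto
      also have "\<dots> \<le> 2 * j * dk k"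
      proof -
        have "norm (z - z') \<le> dk k" unfolding dk_def
          using diameter_bounded_bound[OF C(2) k, of z'] z' by (simp add: dist_norm)
        then show ?thesis using j by (simp add: mult_left_mono mult.assoc mult.commute)
      qed
      also have "\<dots> < \<rho> k" using \<eta> by (simp add: \<rho>_def)
      finally have "dist (w k) u < \<rho> k"
        using \<sigma> by (auto simp: w_def z'_def[symmetric] z(1) dist_norm norm_minus_commute)
      then show "u \<in> A" by (auto simp: A_def)
    qed
    moreover have "emeasure sphere_measure A \<le> ennreal \<epsilon>0"
    proof -
      have "emeasure sphere_measure A \<le> (\<Sum>k. emeasure sphere_measure (ball (w k) (\<rho> k)))"
        unfolding A_def by (intro emeasure_subadditive_countably) auto
      also have "\<dots> \<le> (\<Sum>k. ennreal (8 * 4 ^ m * 2 ^ m * (2 * j) ^ m) * ennreal (dk k ^ m) +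
           ennreal (8 * 4 ^ m * 2 ^ m) * ennreal (\<epsilon> * (1/2) ^ Suc k))"
      proof (intro suminf_le summableI)
        fix k
        have "measure sphere_measure (ball (w k) (\<rho> k)) \<le> 8 * (4 * \<rho> k) ^ m"
          unfolding m_def using \<rho> by (intro measure_sphere_ball_le) auto
        also have "(4 * \<rho> k) ^ m = 4 ^ m * (2 * j * dk k + \<eta> k) ^ m" by (simp only: \<rho>_def power_mult_distrib)
        also have "\<dots> \<le> 4 ^ m * (2 ^ m * ((2 * j * dk k) ^ m + \<eta> k ^ m))"
          using j dk0[of k] \<eta>[of k] by (intro mult_left_mono power_add_le_2) auto
        also have "\<eta> k ^ m \<le> \<eta> k ^ 1" using \<eta>[of k] m by (intro power_decreasing) auto
        finally have "measure sphere_measure (ball (w k) (\<rho> k)) \<le>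
            8 * (4 ^ m * (2 ^ m * ((2 * j * dk k) ^ m + \<epsilon> * (1/2) ^ Suc k)))"
          using \<eta>(3)[of k] by (auto intro: order_trans)
        then have "emeasure sphere_measure (ball (w k) (\<rho> k)) \<le>
            ennreal ((8 * 4 ^ m * 2 ^ m * (2 * j) ^ m) * dk k ^ m + (8 * 4 ^ m * 2 ^ m) * (\<epsilon> * (1/2) ^ Suc k))"
          by (simp add: emeasure_eq_measure ennreal_leI algebra_simps power_mult_distrib)
        also have "\<dots> = ennreal (8 * 4 ^ m * 2 ^ m * (2 * j) ^ m) * ennreal (dk k ^ m) +
           ennreal (8 * 4 ^ m * 2 ^ m) * ennreal (\<epsilon> * (1/2) ^ Suc k)"
          using j dk0[of k] \<epsilon> by (subst ennreal_plus; simp only: ennreal_mult mult_nonneg_nonneg zero_le_power zero_le_numeral less_imp_le)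
        finally show "emeasure sphere_measure (ball (w k) (\<rho> k)) \<le> \<dots>" .
      qed
      also have "\<dots> = ennreal (8 * 4 ^ m * 2 ^ m * (2 * j) ^ m) * (\<Sum>k. ennreal (dk k ^ m)) +
          ennreal (8 * 4 ^ m * 2 ^ m) * (\<Sum>k. ennreal (\<epsilon> * (1/2) ^ Suc k))"
        by (subst suminf_add[symmetric]) (auto intro!: summableI simp: ennreal_suminf_cmult)
      also have "(\<Sum>k. ennreal (\<epsilon> * (1/2) ^ Suc k)) = ennreal \<epsilon>"
        using \<epsilon> power_half_series sums_mult[OF power_half_series, of \<epsilon>]
        by (intro suminf_ennreal_eq) auto
      also have "ennreal (8 * 4 ^ m * 2 ^ m * (2 * j) ^ m) * (\<Sum>k. ennreal (dk k ^ m)) + ennreal (8 * 4 ^ m * 2 ^ m) * ennreal \<epsilon>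
         \<le> ennreal (8 * 4 ^ m * 2 ^ m * (2 * j) ^ m) * ennreal \<epsilon> + ennreal (8 * 4 ^ m * 2 ^ m) * ennreal \<epsilon>"
        using C(4) by (intro add_mono mult_left_mono) (auto simp: dk_def)
      also have "\<dots> = ennreal (K * \<epsilon>)"
        using j \<epsilon> by (simp add: K_def algebra_simps flip: ennreal_mult ennreal_plus)
      also have "K * \<epsilon> = \<epsilon>0" using K by (simp add: \<epsilon>_def)
      finally show ?thesis .
    qed
    moreover have "A \<in> sets sphere_measure" by (auto simp: A_def)
    ultimately show "\<exists>A\<in>sets sphere_measure. ?B \<subseteq> A \<and> emeasure sphere_measure A \<le> ennreal \<epsilon>0" by blast
  qed
qed

text \<open>The critical points of the radial projection from \<open>q\<close>: \<open>n\<close> is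
  normal to the surface at \<open>z\<close> and to the ray from \<open>q\<close>. Asking for
  normality in all charts lets any given chart be used in the estimate.\<close>

definition tangential_points :: "'m::finite space set \<Rightarrow> 'm space \<Rightarrow> 'm space set" where
  "tangential_points S q = {z \<in> S. \<exists>n. norm n = 1 \<and> n \<bullet> (z - q) = 0 \<and>
     (\<forall>\<phi> \<phi>' p w. C1_chart S z \<phi> \<phi>' p \<longrightarrow> n \<bullet> blinfun_apply (\<phi>' p) w = 0)}"

text \<open>
  The points where the radial projection of a chart is critical project to a null set. This is
  Sard's theorem in equal dimensions: a cube of side \<open>h\<close> around a critical point projects into a
  piece of size \<open>h\<close> of a strip whose width is \<open>o(h)\<close>.
\<close>

lemma AE_direction_avoids_tangential_local:
  fixes S :: "'m::finite space set"
  assumes ch: "C1_chart S y \<phi> \<phi>' p"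
  obtains \<delta> where "0 < \<delta>"
    "AE u in sphere_measure. \<forall>t. t \<noteq> 0 \<longrightarrow> q + t *\<^sub>R u \<notin> tangential_points S q \<inter> ball y \<delta>"
proof -
  interpret finite_measure "sphere_measure :: 'm space measure" by (rule finite_measure_sphere_measure)
  obtain G W \<psi> where G: "open G" "open W" "p \<in> G" "y \<in> W" "\<phi> p = y" "homeomorphism G (S \<inter> W) \<phi> \<psi>"
    "\<And>x. x \<in> G \<Longrightarrow> (\<phi> has_derivative blinfun_apply (\<phi>' x)) (at x)" "continuous_on G \<phi>'"
    "\<And>x. x \<in> G \<Longrightarrow> inj (blinfun_apply (\<phi>' x))"
    using ch unfolding C1_chart_def by blast
  obtain r where r: "0 < r" "cball p r \<subseteq> G" using G(1,3) open_contains_cball by blast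
  have chart: "C1_chart S (\<phi> x) \<phi> \<phi>' x" if x: "x \<in> G" for x
  proof -
    have "\<phi> x \<in> W" using G(6) x by (auto simp: homeomorphism_def)
    then show ?thesis unfolding C1_chart_def using G x by blast
  qed
  have cont: "continuous_on (cball p r) \<phi>'" using G(8) r(2) by (rule continuous_on_subset)
  have uc: "uniformly_continuous_on (cball p r) \<phi>'" using cont by (intro compact_uniformly_continuous) auto
  have "bounded (\<phi>' ` cball p r)" using cont by (intro compact_imp_bounded compact_continuous_image) auto
  then obtain M1 where M1: "0 < M1" "\<And>x. x \<in> cball p r \<Longrightarrow> norm (\<phi>' x) \<le> M1" by (auto simp: bounded_pos)
  \<comment> \<open>One more than the Lipschitz constant, to obtain a strict inequality at the slab
    radius.\<close>
  define M where "M = M1 + 1"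
  have M: "0 < M" using M1 by (simp add: M_def)
  have lip: "norm (\<phi> x - \<phi> x') \<le> M1 * norm (x - x')" if "x \<in> cball p r" "x' \<in> cball p r" for x x'
  proof (rule differentiable_bound[where f'="\<lambda>x. blinfun_apply (\<phi>' x)" and S="cball p r"])
    show "(\<phi> has_derivative blinfun_apply (\<phi>' x)) (at x within cball p r)" if "x \<in> cball p r" for x
      using G(7) r that by (blast intro: has_derivative_at_withinI)
    show "onorm (blinfun_apply (\<phi>' x)) \<le> M1" if "x \<in> cball p r" for x
      using M1(2)[OF that] by (simp add: norm_blinfun.rep_eq)
  qed (use that in auto)
  have psi: "continuous_on (S \<inter> W) \<psi>" "\<And>z. z \<in> S \<inter> W \<Longrightarrow> \<phi> (\<psi> z) = z" and psiy: "\<psi> y = p" and yS: "y \<in> S \<inter> W"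
    using G(3,5,6) unfolding homeomorphism_def by auto
  obtain d1 where d1: "d1 > 0" "\<And>z. z \<in> S \<inter> W \<Longrightarrow> dist z y < d1 \<Longrightarrow> dist (\<psi> z) p < r"
    using psi(1) yS r(1) unfolding continuous_on_iff psiy[symmetric] by metis
  obtain d2 where d2: "d2 > 0" "ball y d2 \<subseteq> W" using G(2,4) open_contains_ball by blast
  define \<delta> where "\<delta> = min d1 d2"
  have \<delta>: "0 < \<delta>" using d1 d2 by (simp add: \<delta>_def)
  have param: "\<exists>x\<in>cball p r. z = \<phi> x" if "z \<in> S \<inter> ball y \<delta>" for z
  proof -
    have "z \<in> ball y d2" using that by (simp add: \<delta>_def)
    then have zW: "z \<in> S \<inter> W" using that d2 by blast
    moreover have "dist z y < d1" using that by (simp add: \<delta>_def dist_commute)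
    ultimately show ?thesis using d1(2) psi(2) by (intro bexI[of _ "\<psi> z"]) (auto simp: dist_commute less_imp_le)
  qed
  define m where "m = CARD('m)"
  have m: "0 < m" by (simp add: m_def)
  have dim: "DIM('m space) - 1 = m" by (simp add: m_def)
  let ?T = "tangential_points S q \<inter> ball y \<delta>"
  have "AE u in sphere_measure. \<forall>t. t \<noteq> 0 \<longrightarrow> q + t *\<^sub>R u \<notin> ?T"
  proof (rule AE_direction_avoids)
    fix j \<sigma> :: real assume j: "0 < j" and \<sigma>: "\<sigma> = 1 \<or> \<sigma> = -1"
    let ?B = "{\<sigma> *\<^sub>R sgn (z - q) | z. z \<in> ?T \<and> 1 / j \<le> norm (z - q)}"
    define E where "E = {x \<in> cball p r. \<phi> x \<in> ?T \<and> 1 / j \<le> norm (\<phi> x - q)}"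
    \<comment> \<open>There are at most \<open>N ^ m\<close> cubes, each contributing
      \<open>4 * \<beta> * 4 ^ m * \<rho> ^ (m - 1)\<close>. As \<open>\<beta>\<close> and
      \<open>\<rho>\<close> are multiples of \<open>h\<close>, the number of cubes cancels through
      \<open>N * h = 2 * r\<close> and a single factor \<open>\<epsilon>\<close> remains from
      \<open>\<beta>\<close>.\<close>
    define K where "K = 4 * j * m * 4 ^ m * (2 * j * M * m) ^ (m - 1) * (2 * r) ^ m"
    have K: "0 < K" using j M m r by (simp add: K_def)
    show "AE u in sphere_measure. u \<notin> ?B"
    proof (rule AE_notin_outer_null)
      fix \<epsilon>0 :: real assume \<epsilon>0: "0 < \<epsilon>0"
      define \<epsilon> where "\<epsilon> = \<epsilon>0 / K"
      have \<epsilon>: "0 < \<epsilon>" using \<epsilon>0 K by (simp add: \<epsilon>_def)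
      obtain h0 where h0: "0 < h0" "\<And>x x'. x \<in> cball p r \<Longrightarrow> x' \<in> cball p r \<Longrightarrow> dist x' x < h0 \<Longrightarrow> dist (\<phi>' x') (\<phi>' x) < \<epsilon>"
        using uc \<epsilon> unfolding uniformly_continuous_on_def by metis
      \<comment> \<open>So fine a grid that \<open>\<phi>'\<close> varies by less than
        \<open>\<epsilon>\<close> on a cube and the slab radius \<open>\<rho>\<close> is at most
        1.\<close>
      obtain N :: nat where N: "2 * r * m / h0 + 4 * j * M * m * r < N" using reals_Archimedean2 by blast
      have N0: "0 < real N"
      proof -
        have "0 \<le> 2 * r * m / h0 + 4 * j * M * m * r" using r h0 j M by simp
        then show ?thesis using N by linarith
      qed
      define h where "h = 2 * r / N"
      have h: "0 < h" using r N0 by (simp add: h_def)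
      have mh: "m * h < h0"
      proof -
        have "2 * r * m / h0 < N" using N r j M by (smt (verit) mult_nonneg_nonneg of_nat_0_le_iff)
        then have "2 * r * m < N * h0" using h0 by (simp add: field_simps)
        then show ?thesis using N0 by (simp add: h_def field_simps)
      qed
      \<comment> \<open>\<open>\<rho>\<close> bounds how far the projection moves within a cube;
        \<open>\<beta>\<close> bounds the component along the normal at the critical point, smaller
        by the factor \<open>\<epsilon>\<close>.\<close>
      define \<rho> where "\<rho> = 2 * j * M * m * h"
      define \<beta> where "\<beta> = j * \<epsilon> * m * h"
      have \<rho>: "0 < \<rho>" "\<rho> \<le> 1"
      proof -
        show "0 < \<rho>" using j M m h by (simp add: \<rho>_def)
        have "0 \<le> 2 * r * m / h0" using r h0 by simp
        then have "4 * j * M * m * r \<le> N" using N by linarith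
        then show "\<rho> \<le> 1" using N0 by (simp add: \<rho>_def h_def field_simps)
      qed
      have \<beta>: "0 \<le> \<beta>" using j \<epsilon> h by (simp add: \<beta>_def)
      define I where "I = PiE (UNIV :: 'm set) (\<lambda>_. {..<N})"
      have I: "finite I" "card I = N ^ m" by (simp_all add: I_def m_def card_PiE finite_PiE)
      define Q where "Q f = {x :: real ^ 'm. \<forall>i. p $ i - r + h * f i \<le> x $ i \<and> x $ i \<le> p $ i - r + h * (f i + 1)}" for f :: "'m \<Rightarrow> nat"
      have diamQ: "norm (x - x') \<le> m * h" if "x \<in> Q f" "x' \<in> Q f" for x x' f
      proof -
        have "\<bar>(x - x') $ i\<bar> \<le> h" for i
        proof -
          have "p $ i - r + h * f i \<le> x $ i" "x $ i \<le> p $ i - r + h * f i + h"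
            "p $ i - r + h * f i \<le> x' $ i" "x' $ i \<le> p $ i - r + h * f i + h"
            using that by (auto simp: Q_def algebra_simps)
          then show ?thesis by simp
        qed
        then have "(\<Sum>i\<in>UNIV. \<bar>(x - x') $ i\<bar>) \<le> (\<Sum>i\<in>(UNIV::'m set). h)" by (intro sum_mono)
        then show ?thesis using norm_le_l1_cart[of "x - x'"] by (simp add: m_def)
      qed
      have coverQ: "\<exists>f\<in>I. x \<in> Q f" if x: "x \<in> cball p r" for x
      proof -
        define g where "g i = (x $ i - (p $ i - r)) / h" for i
        have g: "0 \<le> g i \<and> g i \<le> N" for i
        proof -
          have "\<bar>x $ i - p $ i\<bar> \<le> r" using component_le_norm_cart[of "x - p" i] x by (simp add: dist_norm norm_minus_commute)
          then have "0 \<le> x $ i - (p $ i - r)" "x $ i - (p $ i - r) \<le> 2 * r" by auto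
          moreover have "2 * r = N * h" using N0 by (simp add: h_def)
          ultimately show ?thesis using h by (simp add: g_def field_simps)
        qed
        \<comment> \<open>The cap at \<open>N - 1\<close> assigns points of the far face to the last
          cube.\<close>
        define f where "f i = min (N - 1) (nat \<lfloor>g i\<rfloor>)" for i
        have fg: "real (f i) \<le> g i \<and> g i \<le> real (f i) + 1" for i
        proof (cases "nat \<lfloor>g i\<rfloor> \<le> N - 1")
          case True
          then have "f i = nat \<lfloor>g i\<rfloor>" by (simp add: f_def)
          then show ?thesis using g[of i] by linarith
        next
          case False
          then have "f i = N - 1" "real N \<le> g i" using g[of i] N0 by (auto simp: f_def) linarith
          then show ?thesis using g[of i] N0 by (auto simp: of_nat_diff)
        qed
        have "f \<in> I" using N0 by (auto simp: I_def f_def)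
        moreover have "x \<in> Q f"
          unfolding Q_def
        proof (clarify, intro conjI)
          fix i
          have "x $ i = p $ i - r + h * g i" using h by (simp add: g_def)
          then show "p $ i - r + h * f i \<le> x $ i" "x $ i \<le> p $ i - r + h * (f i + 1)"
            using fg[of i] h by (auto simp: mult_left_mono)
        qed
        ultimately show ?thesis by blast
      qed
      \<comment> \<open>For every cube that contains a critical parameter, one such parameter, the
        normal \<open>nf\<close> there, and the slab \<open>R\<close> around the direction of its
        image.\<close>
      define xf where "xf f = (SOME x. x \<in> E \<inter> Q f)" for f
      define nf where "nf f = (SOME n. norm n = 1 \<and> n \<bullet> (\<phi> (xf f) - q) = 0 \<and>
         (\<forall>\<phi>1 \<phi>1' p1 w. C1_chart S (\<phi> (xf f)) \<phi>1 \<phi>1' p1 \<longrightarrow> n \<bullet> blinfun_apply (\<phi>1' p1) w = 0))" for f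
      define w where "w f = \<sigma> *\<^sub>R sgn (\<phi> (xf f) - q)" for f
      define R where "R f = {u. norm u = 1 \<and> norm (u - w f) < \<rho> \<and> \<bar>nf f \<bullet> u\<bar> \<le> \<beta>}" for f
      define I' where "I' = {f \<in> I. E \<inter> Q f \<noteq> {}}"
      have I': "finite I'" "card I' \<le> N ^ m" using I card_mono[of I I'] by (auto simp: I'_def)
      have xf: "xf f \<in> E \<inter> Q f" if "f \<in> I'" for f
        using that unfolding xf_def I'_def by (metis (mono_tags, lifting) ex_in_conv mem_Collect_eq someI_ex)
      have nf: "norm (nf f) = 1 \<and> nf f \<bullet> (\<phi> (xf f) - q) = 0 \<and>
         (\<forall>\<phi>1 \<phi>1' p1 w. C1_chart S (\<phi> (xf f)) \<phi>1 \<phi>1' p1 \<longrightarrow> nf f \<bullet> blinfun_apply (\<phi>1' p1) w = 0)" if "f \<in> I'" for f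
      proof -
        have "\<phi> (xf f) \<in> tangential_points S q" using xf[OF that] by (auto simp: E_def)
        then have "\<exists>n. norm n = 1 \<and> n \<bullet> (\<phi> (xf f) - q) = 0 \<and>
         (\<forall>\<phi>1 \<phi>1' p1 w. C1_chart S (\<phi> (xf f)) \<phi>1 \<phi>1' p1 \<longrightarrow> n \<bullet> blinfun_apply (\<phi>1' p1) w = 0)"
          unfolding tangential_points_def mem_Collect_eq by (rule conjunct2)
        then show ?thesis unfolding nf_def by (rule someI_ex)
      qed
      have Rm: "R f \<in> sets sphere_measure" for f
        unfolding R_def by simp measurable
      have "?B \<subseteq> (\<Union>f\<in>I'. R f)"
      proof
        fix u assume "u \<in> ?B"
        then obtain z where z: "u = \<sigma> *\<^sub>R sgn (z - q)" "z \<in> ?T" "1 / j \<le> norm (z - q)" by auto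
        have zS: "z \<in> S \<inter> ball y \<delta>" using z(2) by (auto simp: tangential_points_def)
        obtain x where x: "x \<in> cball p r" "z = \<phi> x" using param[OF zS] by auto
        have xE: "x \<in> E" using x z by (auto simp: E_def)
        obtain f where f: "f \<in> I" "x \<in> Q f" using coverQ[OF x(1)] by auto
        have fI: "f \<in> I'" using f xE by (auto simp: I'_def)
        define x0 where "x0 = xf f"
        have x0: "x0 \<in> E" "x0 \<in> Q f" using xf[OF fI] by (auto simp: x0_def)
        have x0r: "x0 \<in> cball p r" and x0j: "1 / j \<le> norm (\<phi> x0 - q)" using x0 by (auto simp: E_def)
        have d: "norm (x - x0) \<le> m * h" using diamQ f x0 by blast
        have nz: "\<phi> x0 - q \<noteq> 0" using x0j j by auto
        have ju: "1 / (1 / j) = j" by simp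
        have "norm (sgn (z - q) - sgn (\<phi> x0 - q)) \<le> 2 * norm ((z - q) - (\<phi> x0 - q)) / (1 / j)"
          using x0j j nz by (intro sgn_diff_le) auto
        also have "\<dots> = 2 * j * norm (\<phi> x - \<phi> x0)" using x(2) by simp
        also have "\<dots> \<le> 2 * j * (M1 * norm (x - x0))" using lip[OF x(1) x0r] j by (intro mult_left_mono) auto
        also have "\<dots> \<le> 2 * j * (M1 * (m * h))" using d M1 j by (intro mult_left_mono) auto
        also have "\<dots> < \<rho>" using j m h M1 by (simp add: \<rho>_def M_def)
        finally have 1: "norm (u - w f) < \<rho>"
          using \<sigma> unfolding z(1) w_def x0_def[symmetric] by (auto simp: norm_minus_commute)
        have lin: "norm (\<phi> x - \<phi> x0 - blinfun_apply (\<phi>' x0) (x - x0)) \<le> norm (x - x0) * \<epsilon>"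
        proof (rule differentiable_bound_linearization[where S="cball p r \<inter> ball x0 h0" and f'="\<lambda>q. blinfun_apply (\<phi>' q)"])
          show "x0 + t *\<^sub>R (x - x0) \<in> cball p r \<inter> ball x0 h0" if t: "t \<in> {0..1}" for t
          proof -
            have "(1 - t) *\<^sub>R x0 + t *\<^sub>R x \<in> cball p r"
              using convex_cball[of p r] x(1) x0r t unfolding convex_alt by auto
            moreover have "(1 - t) *\<^sub>R x0 + t *\<^sub>R x = x0 + t *\<^sub>R (x - x0)" by (simp add: algebra_simps)
            moreover have "t * norm (x - x0) \<le> 1 * norm (x - x0)" using t by (intro mult_right_mono) auto
            ultimately show ?thesis using d mh t by (simp add: dist_norm)
          qed
          show "(\<phi> has_derivative blinfun_apply (\<phi>' x)) (at x within cball p r \<inter> ball x0 h0)" if "x \<in> cball p r \<inter> ball x0 h0" for x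
            using G(7) r that by (blast intro: has_derivative_at_withinI)
          show "onorm (blinfun_apply (\<phi>' x) - blinfun_apply (\<phi>' x0)) \<le> \<epsilon>" if "x \<in> cball p r \<inter> ball x0 h0" for x
          proof -
            have "norm (\<phi>' x - \<phi>' x0) < \<epsilon>" using h0(2)[of x0 x] that x0r by (auto simp: dist_norm norm_minus_commute)
            then show ?thesis by (simp add: norm_blinfun.rep_eq minus_blinfun.rep_eq fun_diff_def)
          qed
        qed (use x0r h0 in auto)
        note n = nf[OF fI, folded x0_def]
        have n\<phi>: "nf f \<bullet> blinfun_apply (\<phi>' x0) (x - x0) = 0"
          using n chart[of x0] x0r r(2) by blast
        \<comment> \<open>The normal annihilates both \<open>\<phi> x0 - q\<close> and the
          derivative at \<open>x0\<close>, so only the linearization error is left.\<close>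
        have "nf f \<bullet> (z - q) = nf f \<bullet> (\<phi> x - \<phi> x0 - blinfun_apply (\<phi>' x0) (x - x0))"
          using n n\<phi> x(2) by (simp add: inner_diff_right)
        also have "\<bar>\<dots>\<bar> \<le> norm (x - x0) * \<epsilon>"
          using Cauchy_Schwarz_ineq2[of "nf f" "\<phi> x - \<phi> x0 - blinfun_apply (\<phi>' x0) (x - x0)"] n lin by simp
        also have "\<dots> \<le> (m * h) * \<epsilon>" using d \<epsilon> by (intro mult_right_mono) auto
        finally have nzq: "\<bar>nf f \<bullet> (z - q)\<bar> \<le> m * h * \<epsilon>" .
        have zq0: "0 < norm (z - q)" using z(3) j by (smt (verit) divide_pos_pos)
        have inv: "inverse (norm (z - q)) \<le> j" using z(3) zq0 j by (simp add: field_simps)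
        have "\<bar>nf f \<bullet> u\<bar> = inverse (norm (z - q)) * \<bar>nf f \<bullet> (z - q)\<bar>"
          using \<sigma> zq0 unfolding z(1) by (auto simp: sgn_div_norm abs_mult)
        also have "\<dots> \<le> j * (m * h * \<epsilon>)" using inv nzq j zq0 by (intro mult_mono) auto
        finally have 2: "\<bar>nf f \<bullet> u\<bar> \<le> \<beta>" by (simp add: \<beta>_def ac_simps)
        have "norm u = 1" using \<sigma> zq0 unfolding z(1) by (auto simp: norm_sgn)
        then show "u \<in> (\<Union>f\<in>I'. R f)" using 1 2 fI by (auto simp: R_def)
      qed
      moreover have "emeasure sphere_measure (\<Union>f\<in>I'. R f) \<le> ennreal \<epsilon>0"
      proof -
        define b where "b = 4 * \<beta> * 4 ^ m * \<rho> ^ (m - 1)"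
        have b0: "0 \<le> b" using \<beta> \<rho> by (simp add: b_def)
        have Rb: "measure sphere_measure (R f) \<le> b" if f: "f \<in> I'" for f
        proof -
          have "\<rho> * measure sphere_measure (R f) \<le> 4 * \<beta> * (4 * \<rho>) ^ m"
            unfolding R_def dim[symmetric] using nf[OF f] \<beta> \<rho> by (intro measure_sphere_slab_le) auto
          also have "\<dots> = \<rho> * b" using m by (simp add: b_def power_mult_distrib power_eq_if[of \<rho> m])
          finally show ?thesis using \<rho> by simp
        qed
        have "measure sphere_measure (\<Union>f\<in>I'. R f) \<le> (\<Sum>f\<in>I'. measure sphere_measure (R f))"
          using I' Rm by (intro finite_measure_subadditive_finite) auto
        also have "\<dots> \<le> (\<Sum>f\<in>I'. b)" using Rb by (intro sum_mono) auto
        also have "\<dots> = real (card I') * b" by simp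
        also have "\<dots> \<le> real (N ^ m) * b" using I' b0 by (intro mult_right_mono) (auto simp only: of_nat_le_iff)
        also have "\<dots> = K * \<epsilon>"
        proof -
          have "h ^ m = h * h ^ (m - 1)" using m by (simp add: power_eq_if)
          moreover have "N ^ m * h ^ m = (2 * r) ^ m" using N0 by (simp add: h_def power_divide)
          ultimately have "real N ^ m * (h * h ^ (m - 1)) = (2 * r) ^ m" by simp
          moreover have "real (N ^ m) * b = 4 * j * m * 4 ^ m * (2 * j * M * m) ^ (m - 1) * \<epsilon> * (real N ^ m * (h * h ^ (m - 1)))"
            by (simp add: b_def \<beta>_def \<rho>_def power_mult_distrib ac_simps)
          ultimately show ?thesis by (simp add: K_def ac_simps)
        qed
        also have "\<dots> = \<epsilon>0" using K by (simp add: \<epsilon>_def)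
        finally show ?thesis by (simp add: emeasure_eq_measure ennreal_leI)
      qed
      moreover have "(\<Union>f\<in>I'. R f) \<in> sets sphere_measure" using I' Rm by (intro sets.finite_UN) auto
      ultimately show "\<exists>A\<in>sets sphere_measure. ?B \<subseteq> A \<and> emeasure sphere_measure A \<le> ennreal \<epsilon>0" by blast
    qed
  qed
  then show ?thesis using \<delta> by (rule that[rotated])
qed

text \<open>Lindelof reduces the local statement to countably many balls.\<close>

lemma AE_direction_avoids_tangential:
  fixes S R :: "'m::finite space set"
  assumes "\<And>x. x \<in> R \<Longrightarrow> \<exists>\<phi> \<phi>' p. C1_chart S x \<phi> \<phi>' p"
  shows "AE u in sphere_measure. \<forall>t. t \<noteq> 0 \<longrightarrow> q + t *\<^sub>R u \<notin> tangential_points S q \<inter> R"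
proof -
  have "\<exists>\<delta>>0. AE u in sphere_measure. \<forall>t. t \<noteq> 0 \<longrightarrow> q + t *\<^sub>R u \<notin> tangential_points S q \<inter> ball x \<delta>" if x: "x \<in> R" for x
  proof -
    obtain \<phi> \<phi>' p where "C1_chart S x \<phi> \<phi>' p" using assms[OF x] by blast
    then show ?thesis by (rule AE_direction_avoids_tangential_local) blast
  qed
  then have "\<forall>x\<in>R. \<exists>\<delta>. 0 < \<delta> \<and> (AE u in sphere_measure. \<forall>t. t \<noteq> 0 \<longrightarrow> q + t *\<^sub>R u \<notin> tangential_points S q \<inter> ball x \<delta>)"
    by (intro ballI)
  from bchoice[OF this] obtain \<delta> where \<delta>0: "\<forall>x\<in>R. 0 < \<delta> x \<and>
      (AE u in sphere_measure. \<forall>t. t \<noteq> 0 \<longrightarrow> q + t *\<^sub>R u \<notin> tangential_points S q \<inter> ball x (\<delta> x))" by (rule exE)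
  have \<delta>: "0 < \<delta> x" "AE u in sphere_measure. \<forall>t. t \<noteq> 0 \<longrightarrow> q + t *\<^sub>R u \<notin> tangential_points S q \<inter> ball x (\<delta> x)"
    if "x \<in> R" for x using bspec[OF \<delta>0 that] by (rule conjunct1, rule conjunct2)
  obtain \<F> where F: "\<F> \<subseteq> (\<lambda>x. ball x (\<delta> x)) ` R" "countable \<F>" "\<Union>\<F> = (\<Union>x\<in>R. ball x (\<delta> x))"
    using Lindelof[of "(\<lambda>x. ball x (\<delta> x)) ` R"] by auto
  have "AE u in sphere_measure. \<forall>V\<in>\<F>. \<forall>t. t \<noteq> 0 \<longrightarrow> q + t *\<^sub>R u \<notin> tangential_points S q \<inter> V"
    using F(1) \<delta>(2) by (subst AE_ball_countable[OF F(2)]) fast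
  then show ?thesis
  proof eventually_elim
    case (elim u)
    show ?case
    proof (intro allI impI notI)
      fix t assume t: "t \<noteq> 0" "q + t *\<^sub>R u \<in> tangential_points S q \<inter> R"
      then have "q + t *\<^sub>R u \<in> \<Union>\<F>" using \<delta>(1) unfolding F(3) by (intro UN_I[of "q + t *\<^sub>R u"]) auto
      then show False using elim t by blast
    qed
  qed
qed

text \<open>For \<open>bad_null\<close>, a direction is bad if its line meets the boundary outside
  \<open>Rt\<close>, a Hausdorff-null set, or tangentially at a point of \<open>Rt\<close>, where
  the inner normal witnesses membership in \<open>tangential_points\<close>.\<close>

lemma billiard_domain_imp_table:
  fixes D Rt :: "'m::finite space set"
  assumes dom: "billiard_domain D Rt" and bd: "bounded D"
  shows "billiard_table D Rt (inner_normal D)"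
proof -
  have D: "open D" "connected D" "D \<noteq> {}" "lipschitz_boundary D" "openin (top_of_set (frontier D)) Rt"
    "hausdorff_measure (CARD('m)) (frontier D - Rt) = 0"
    "\<And>x. x \<in> Rt \<Longrightarrow> \<exists>\<phi> \<phi>' p. C1_chart (frontier D) x \<phi> \<phi>' p"
    using dom unfolding billiard_domain_def by auto
  have sub: "Rt \<subseteq> frontier D" using D(5) by (auto simp: openin_open)
  have dim: "DIM('m space) = CARD('m) + 1" by simp
  have card: "1 \<le> CARD('m)" by (simp add: Suc_leI)
  show ?thesis
  proof
    show "2 \<le> DIM('m space)" using card dim by linarith
    show "\<exists>a \<kappa> \<delta>. cone_patch D y a \<kappa> \<delta>" if "y \<in> frontier D" for y
      using lipschitz_boundary_imp_cone_patch[OF D(4,1) that] by blast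
    show "Rt \<in> sets borel"
    proof -
      obtain T where "open T" "Rt = frontier D \<inter> T" using D(5) by (auto simp: openin_open)
      moreover have "frontier D \<in> sets borel" by (intro borel_closed frontier_closed)
      ultimately show ?thesis by auto
    qed
    show "\<exists>\<delta>. cone_patch D x (inner_normal D x) \<kappa> \<delta>" if "x \<in> Rt" "0 < \<kappa>" "\<kappa> < 1" for x \<kappa>
      using inner_normal(2)[OF D(4,1) _ D(7)] that sub by blast
    show "AE u in sphere_measure. \<forall>t. t \<noteq> 0 \<longrightarrow> q + t *\<^sub>R u \<in> frontier D \<longrightarrow>
          q + t *\<^sub>R u \<in> Rt \<and> inner_normal D (q + t *\<^sub>R u) \<bullet> u \<noteq> 0" for q
    proof -
      have "hausdorff_measure (DIM('m space) - 1) (frontier D - Rt) = 0" using D(6) by simp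
      then have "AE u in sphere_measure. \<forall>t. t \<noteq> 0 \<longrightarrow> q + t *\<^sub>R u \<notin> frontier D - Rt"
        using card dim by (intro AE_direction_avoids_hausdorff_null) linarith+
      moreover have "AE u in sphere_measure. \<forall>t. t \<noteq> 0 \<longrightarrow> q + t *\<^sub>R u \<notin> tangential_points (frontier D) q \<inter> Rt"
        using D(7) by (rule AE_direction_avoids_tangential)
      ultimately show ?thesis
      proof eventually_elim
        case (elim u)
        show ?case
        proof (intro allI impI conjI notI)
          fix t assume t: "t \<noteq> 0" "q + t *\<^sub>R u \<in> frontier D"
          show R: "q + t *\<^sub>R u \<in> Rt" using elim(1) t by blast
          assume "inner_normal D (q + t *\<^sub>R u) \<bullet> u = 0"
          moreover have "norm (inner_normal D (q + t *\<^sub>R u)) = 1"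
            using inner_normal(1)[OF D(4,1) t(2) D(7)[OF R]] .
          ultimately have "q + t *\<^sub>R u \<in> tangential_points (frontier D) q"
            unfolding tangential_points_def mem_Collect_eq
            using inner_normal(3)[OF D(4,1) t(2) D(7)[OF R]] t(2)
            by (intro conjI exI[of _ "inner_normal D (q + t *\<^sub>R u)"] allI impI) simp_all
          then show False using elim(2) t R by blast
        qed
      qed
    qed
  qed (use D bd sub in auto)
qed

section \<open>The chain of reflection points\<close>

lemma closed_hitting_set:
  fixes F :: "'a::euclidean_space set"
  assumes "closed F"
  shows "closed {p :: 'a \<times> 'a. \<exists>t\<in>{a..b::real}. fst p + t *\<^sub>R snd p \<in> F}"
proof -
  have "closed ((\<lambda>q :: real \<times> ('a \<times> 'a). fst (snd q) + fst q *\<^sub>R snd (snd q)) -` F)"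
    using assms by (intro closed_vimage continuous_intros)
  from closed_compact_projection[OF compact_Icc this, of a b]
  have "closed {p :: 'a \<times> 'a. \<exists>t. t \<in> {a..b} \<and> (t, p) \<in> (\<lambda>q. fst (snd q) + fst q *\<^sub>R snd (snd q)) -` F}" .
  moreover have "{p :: 'a \<times> 'a. \<exists>t. t \<in> {a..b} \<and> (t, p) \<in> (\<lambda>q. fst (snd q) + fst q *\<^sub>R snd (snd q)) -` F} =
     {p. \<exists>t\<in>{a..b}. fst p + t *\<^sub>R snd p \<in> F}" by auto
  ultimately show ?thesis by simp
qed

text \<open>A hit strictly between 0 and \<open>c\<close> occurs within some compact interval
  \<open>[1/(n+1), c - 1/(n+1)]\<close>, and by compact projection the pairs with a hit in a compact
  interval form a closed set.\<close>

lemma borel_measurable_hit_time[measurable]: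
  fixes D :: "'a::euclidean_space set"
  shows "(\<lambda>p. hit_time D (fst p) (snd p)) \<in> borel_measurable (borel \<Otimes>\<^sub>M borel)"
proof -
  define H where "H p = {t. 0 < t \<and> fst p + t *\<^sub>R snd p \<in> frontier D}" for p :: "'a \<times> 'a"
  define A where "A c = {p. \<exists>t\<in>H p. t < c}" for c :: real
  have A: "A c \<in> sets borel" for c
  proof -
    have "A c = (\<Union>n::nat. {p. \<exists>t\<in>{1 / real (Suc n)..c - 1 / real (Suc n)}. fst p + t *\<^sub>R snd p \<in> frontier D})"
    proof (intro set_eqI iffI)
      fix p assume "p \<in> A c"
      then obtain t where t: "0 < t" "t < c" "fst p + t *\<^sub>R snd p \<in> frontier D" by (auto simp: A_def H_def)
      obtain n where n: "1 / real (Suc n) < min t (c - t)"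
        using reals_Archimedean[of "min t (c - t)"] t by (auto simp: inverse_eq_divide)
      then show "p \<in> (\<Union>n. {p. \<exists>t\<in>{1 / real (Suc n)..c - 1 / real (Suc n)}. fst p + t *\<^sub>R snd p \<in> frontier D})"
        using t by (intro UN_I[of n]) (auto intro!: bexI[of _ t])
    next
      fix p assume "p \<in> (\<Union>n. {p. \<exists>t\<in>{1 / real (Suc n)..c - 1 / real (Suc n)}. fst p + t *\<^sub>R snd p \<in> frontier D})"
      then obtain n t where t: "1 / real (Suc n) \<le> t" "t \<le> c - 1 / real (Suc n)" "fst p + t *\<^sub>R snd p \<in> frontier D" by auto
      have "0 < 1 / real (Suc n)" by simp
      then have "0 < t" "t < c" using t by linarith+
      then show "p \<in> A c" using t by (auto simp: A_def H_def)
    qed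
    also have "\<dots> \<in> sets borel"
      by (intro sets.countable_UN image_subsetI borel_closed closed_hitting_set frontier_closed)
    finally show ?thesis .
  qed
  define E where "E = {p. H p \<noteq> {}}"
  have "E = (\<Union>n::nat. A (real n))"
    unfolding E_def A_def by (auto simp: ex_in_conv[symmetric]) (meson reals_Archimedean2)
  then have E: "E \<in> sets borel" using A by auto
  have "(\<lambda>p. Inf (H p)) \<in> borel_measurable borel"
  proof (rule borel_measurableI_less)
    fix c :: real
    have lt: "Inf (H p) < c \<longleftrightarrow> (\<exists>t\<in>H p. t < c)" if "H p \<noteq> {}" for p
      using that by (intro cInf_less_iff) (auto simp: H_def intro!: bdd_belowI[of _ 0])
    \<comment> \<open>Rays that never hit get the unspecified but fixed value
      \<open>Inf {}\<close>.\<close>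
    have "{p \<in> space borel. Inf (H p) < c} = (A c \<inter> E) \<union> (if Inf {} < c then - E else {})"
    proof (intro set_eqI)
      fix p
      show "p \<in> {p \<in> space borel. Inf (H p) < c} \<longleftrightarrow> p \<in> (A c \<inter> E) \<union> (if Inf {} < c then - E else {})"
      proof (cases "H p = {}")
        case True
        then have "p \<notin> E" "p \<notin> A c" by (simp_all add: E_def A_def)
        then show ?thesis using True by simp
      next
        case False
        then have "p \<in> E" by (simp add: E_def)
        then show ?thesis using lt[OF False] by (simp add: A_def)
      qed
    qed
    then show "{p \<in> space borel. Inf (H p) < c} \<in> sets borel" using A E by auto
  qed
  then show ?thesis unfolding hit_time_def H_def borel_prod[symmetric] .
qed

lemma borel_measurable_hit_time'[measurable (raw)]:
  fixes f g :: "'b \<Rightarrow> 'a::euclidean_space"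
  assumes "f \<in> borel_measurable M" "g \<in> borel_measurable M"
  shows "(\<lambda>x. hit_time D (f x) (g x)) \<in> borel_measurable M"
  using measurable_compose[OF measurable_Pair[OF assms] borel_measurable_hit_time] by simp

lemma borel_measurable_hit_point'[measurable (raw)]:
  fixes f g :: "'b \<Rightarrow> 'a::euclidean_space"
  assumes [measurable]: "f \<in> borel_measurable M" "g \<in> borel_measurable M"
  shows "(\<lambda>x. hit_point D (f x) (g x)) \<in> borel_measurable M"
  unfolding hit_point_def by measurable

text \<open>
  A particle at \<open>x\<close> leaves in the direction \<open>V x \<eta>\<close>, where \<open>\<eta>\<close> has law \<open>law\<close>. The last two assumptions
  state that this direction is absolutely continuous, with a density bounded below away from the
  tangent plane, uniformly in \<open>x\<close>.
\<close>

locale stochastic_table = billiard_table D Rt nrm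
  for D Rt :: "'a::euclidean_space set" and nrm :: "'a \<Rightarrow> 'a" +
  fixes V :: "'a \<Rightarrow> 'a \<Rightarrow> 'a" and law :: "'a measure"
  assumes law_prob: "prob_space law" and law_sets[measurable_cong]: "sets law = sets borel"
    and V_meas: "(\<lambda>p. V (fst p) (snd p)) \<in> borel_measurable (borel \<Otimes>\<^sub>M borel)"
    and V_dir: "\<And>x. x \<in> Rt \<Longrightarrow> AE \<eta> in law. norm (V x \<eta>) = 1 \<and> 0 < nrm x \<bullet> V x \<eta>"
    and V_ac: "\<And>x P. x \<in> Rt \<Longrightarrow> AE u in sphere_measure. P u \<Longrightarrow> AE \<eta> in law. P (V x \<eta>)"
    and V_lower: "\<And>c. 0 < c \<Longrightarrow> \<exists>k>0. \<forall>x\<in>Rt. \<forall>g \<in> borel_measurable borel.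
      ennreal k * (\<integral>\<^sup>+u. g u * indicator {u. norm u = 1 \<and> c \<le> nrm x \<bullet> u} u \<partial>sphere_measure) \<le>
      (\<integral>\<^sup>+\<eta>. g (V x \<eta>) \<partial>law)"
begin

sublocale law: prob_space law by (rule law_prob)

lemma V_lowerE:
  assumes "0 < c"
  obtains k where "0 < k" "\<And>x g. x \<in> Rt \<Longrightarrow> g \<in> borel_measurable borel \<Longrightarrow>
      ennreal k * (\<integral>\<^sup>+u. g u * indicator {u. norm u = 1 \<and> c \<le> nrm x \<bullet> u} u \<partial>sphere_measure) \<le>
      (\<integral>\<^sup>+\<eta>. g (V x \<eta>) \<partial>law)"
proof -
  from V_lower[OF assms] obtain k where k: "0 < k" "\<forall>x\<in>Rt. \<forall>g \<in> borel_measurable borel.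
      ennreal k * (\<integral>\<^sup>+u. g u * indicator {u. norm u = 1 \<and> c \<le> nrm x \<bullet> u} u \<partial>sphere_measure) \<le>
      (\<integral>\<^sup>+\<eta>. g (V x \<eta>) \<partial>law)" by (elim exE conjE)
  show ?thesis by (rule that[OF k(1) bspec[OF bspec[OF k(2)]]])
qed

lemma V_meas'[measurable (raw)]:
  assumes "f \<in> borel_measurable M" "g \<in> borel_measurable M"
  shows "(\<lambda>x. V (f x) (g x)) \<in> borel_measurable M"
  using measurable_compose[OF measurable_Pair[OF assms] V_meas] by simp

definition len :: "'a \<Rightarrow> 'a \<Rightarrow> real" where "len x \<eta> = hit_time D x (V x \<eta>)"
definition nxt :: "'a \<Rightarrow> 'a \<Rightarrow> 'a" where "nxt x \<eta> = hit_point D x (V x \<eta>)"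

lemma len_meas'[measurable (raw)]:
  assumes [measurable]: "f \<in> borel_measurable M" "g \<in> borel_measurable M"
  shows "(\<lambda>x. len (f x) (g x)) \<in> borel_measurable M"
  unfolding len_def by measurable

lemma nxt_meas'[measurable (raw)]:
  assumes [measurable]: "f \<in> borel_measurable M" "g \<in> borel_measurable M"
  shows "(\<lambda>x. nxt (f x) (g x)) \<in> borel_measurable M"
  unfolding nxt_def by measurable

text \<open>Bounds every flight length; the added 1 makes positivity immediate.\<close>

definition diam :: real where "diam = diameter D + 1"

lemma diam_pos: "0 < diam"
  using diameter_ge_0[OF D_bounded] by (simp add: diam_def)

lemma dist_le_diam:
  assumes "x \<in> closure D" "y \<in> closure D"
  shows "dist x y \<le> diam"
  using diameter_bounded_bound[OF bounded_closure[OF D_bounded] assms] diameter_closure[OF D_bounded]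
  by (simp add: diam_def)

lemma inside_ray:
  assumes x: "x \<in> Rt" and u: "norm u = 1" "0 < nrm x \<bullet> u"
  shows "hit_point D x u \<in> frontier D" "0 < hit_time D x u" "hit_time D x u \<le> diam"
    "\<And>t. 0 < t \<Longrightarrow> t < hit_time D x u \<Longrightarrow> x + t *\<^sub>R u \<in> D"
proof -
  obtain \<epsilon> where \<epsilon>: "0 < \<epsilon>" "\<And>t. 0 < t \<Longrightarrow> t < \<epsilon> \<Longrightarrow> x + t *\<^sub>R u \<in> D" using nrm_pos_imp[OF x u(2)] by auto
  obtain T where T: "0 < T" "x + T *\<^sub>R u \<notin> D" using exit_ex[OF u(1)] .
  note h = hit_time_props[OF D_open \<epsilon>(1) _ T]
  show fr: "hit_point D x u \<in> frontier D" and pos: "0 < hit_time D x u"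
    and "\<And>t. 0 < t \<Longrightarrow> t < hit_time D x u \<Longrightarrow> x + t *\<^sub>R u \<in> D"
    using h \<epsilon> by (blast, fastforce, blast)
  have "dist x (hit_point D x u) = hit_time D x u" using u pos by (simp add: hit_point_def dist_norm)
  moreover have "x \<in> closure D" "hit_point D x u \<in> closure D" using x Rt_sub fr by (auto simp: frontier_def)
  ultimately show "hit_time D x u \<le> diam" using dist_le_diam by metis
qed

text \<open>By \<open>V_ac\<close> the exceptional directions of \<open>bad_null\<close> are not
  chosen, so the chain of reflection points stays in \<open>Rt\<close> almost surely.\<close>

lemma step_AE:
  assumes x: "x \<in> Rt"
  shows "AE \<eta> in law. nxt x \<eta> \<in> Rt \<and> 0 < len x \<eta> \<and> len x \<eta> \<le> diam \<and> norm (V x \<eta>) = 1 \<and>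
    (\<forall>t. 0 < t \<longrightarrow> t < len x \<eta> \<longrightarrow> x + t *\<^sub>R V x \<eta> \<in> D)"
  using V_dir[OF x] V_ac[OF x bad_null[of x]]
proof eventually_elim
  case (elim \<eta>)
  note r = inside_ray[OF x, of "V x \<eta>"]
  have "hit_point D x (V x \<eta>) \<in> Rt"
    using elim r(1,2) by (auto simp: hit_point_def)
  then show ?case using elim r by (auto simp: nxt_def len_def)
qed

text \<open>\<open>K\<close> is the transition operator of (reflection point, remaining time).\<close>

definition K :: "('a \<Rightarrow> real \<Rightarrow> ennreal) \<Rightarrow> 'a \<Rightarrow> real \<Rightarrow> ennreal" where
  "K g x s = (\<integral>\<^sup>+\<eta>. g (nxt x \<eta>) (s - len x \<eta>) \<partial>law)"

definition meas2 :: "('a \<Rightarrow> real \<Rightarrow> ennreal) \<Rightarrow> bool" where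
  "meas2 g \<longleftrightarrow> (\<lambda>p. g (fst p) (snd p)) \<in> borel_measurable (borel \<Otimes>\<^sub>M borel)"

lemma meas2D:
  assumes "meas2 g" "f \<in> borel_measurable M" "h \<in> borel_measurable M"
  shows "(\<lambda>x. g (f x) (h x)) \<in> borel_measurable M"
  using measurable_compose[OF measurable_Pair[OF assms(2,3)] assms(1)[unfolded meas2_def]] by simp

lemma meas2_K:
  assumes "meas2 g" shows "meas2 (K g)"
proof -
  note [measurable (raw)] = meas2D[OF assms]
  show ?thesis unfolding meas2_def K_def
    by (intro law.borel_measurable_nn_integral) measurable
qed

lemma meas2_K_iter: "meas2 g \<Longrightarrow> meas2 ((K ^^ n) g)"
  by (induction n) (auto intro: meas2_K)

lemma K_cmult:
  assumes "meas2 g" shows "K (\<lambda>x s. c * g x s) x s = c * K g x s"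
  unfolding K_def using assms by (intro nn_integral_cmult meas2D) measurable

lemma K_iter_cmult:
  assumes "meas2 g" shows "(K ^^ n) (\<lambda>x s. c * g x s) = (\<lambda>x s. c * (K ^^ n) g x s)"
proof (induction n)
  case (Suc n)
  then show ?case by (simp add: K_cmult[OF meas2_K_iter[OF assms]])
qed simp

text \<open>Since \<open>n\<close> flights take at most \<open>n * diam\<close>, only remaining
  times between \<open>s - n * diam\<close> and \<open>s\<close> matter.\<close>

lemma K_iter_mono:
  assumes "x \<in> Rt" "\<And>y \<sigma>. y \<in> Rt \<Longrightarrow> s - n * diam \<le> \<sigma> \<Longrightarrow> \<sigma> \<le> s \<Longrightarrow> g y \<sigma> \<le> g' y \<sigma>"
  shows "(K ^^ n) g x s \<le> (K ^^ n) g' x s"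
  using assms
proof (induction n arbitrary: x s)
  case (Suc n)
  have "(\<integral>\<^sup>+\<eta>. (K ^^ n) g (nxt x \<eta>) (s - len x \<eta>) \<partial>law) \<le> (\<integral>\<^sup>+\<eta>. (K ^^ n) g' (nxt x \<eta>) (s - len x \<eta>) \<partial>law)"
  proof (rule nn_integral_mono_AE, use step_AE[OF Suc.prems(1)] in eventually_elim)
    fix \<eta> assume e: "nxt x \<eta> \<in> Rt \<and> 0 < len x \<eta> \<and> len x \<eta> \<le> diam \<and> norm (V x \<eta>) = 1 \<and>
      (\<forall>t. 0 < t \<longrightarrow> t < len x \<eta> \<longrightarrow> x + t *\<^sub>R V x \<eta> \<in> D)"
    show "(K ^^ n) g (nxt x \<eta>) (s - len x \<eta>) \<le> (K ^^ n) g' (nxt x \<eta>) (s - len x \<eta>)"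
    proof (rule Suc.IH)
      fix y \<sigma> assume "y \<in> Rt" "s - len x \<eta> - n * diam \<le> \<sigma>" "\<sigma> \<le> s - len x \<eta>"
      then show "g y \<sigma> \<le> g' y \<sigma>" using e by (intro Suc.prems(2)) (auto simp: algebra_simps)
    qed (use e in auto)
  qed
  then show ?case
    unfolding funpow.simps comp_def K_def[of "(K ^^ n) g" x s] K_def[of "(K ^^ n) g'" x s] .
qed auto

lemma K_iter_add: "(K ^^ (n + m)) g = (K ^^ n) ((K ^^ m) g)"
  by (simp add: funpow_add)

definition in_set :: "'a set \<Rightarrow> 'a \<Rightarrow> real \<Rightarrow> ennreal" where "in_set B x s = indicator B x"

lemma meas2_in_set:
  assumes [measurable]: "B \<in> sets borel" shows "meas2 (in_set B)"
  unfolding meas2_def in_set_def by measurable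

section \<open>Reachability with uniform constants\<close>

text \<open>The number of steps and the probability are uniform near \<open>y\<close>: this is what
  composes along a path and what compactness makes global. The time argument is inert, because
  \<open>in_set\<close> ignores it.\<close>

definition reach :: "'a \<Rightarrow> 'a \<Rightarrow> bool" where
  "reach y z \<longleftrightarrow> (\<forall>\<epsilon>>0. \<exists>\<rho>>0. \<exists>n. \<exists>c>0. \<forall>x\<in>Rt. dist y x < \<rho> \<longrightarrow> (\<forall>s. ennreal c \<le> (K ^^ n) (in_set (ball z \<epsilon>)) x s))"

lemma reach_trans:
  assumes "reach x y" "reach y z" shows "reach x z"
  unfolding reach_def
proof (intro allI impI)
  fix \<epsilon> :: real assume "0 < \<epsilon>"
  then obtain \<rho> n c where 1: "\<rho> > 0" "c > 0" "\<And>w s. w \<in> Rt \<Longrightarrow> dist y w < \<rho> \<Longrightarrow> ennreal c \<le> (K ^^ n) (in_set (ball z \<epsilon>)) w s"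
    using assms(2) unfolding reach_def by metis
  obtain \<rho>' n' c' where 2: "\<rho>' > 0" "c' > 0" "\<And>w s. w \<in> Rt \<Longrightarrow> dist x w < \<rho>' \<Longrightarrow> ennreal c' \<le> (K ^^ n') (in_set (ball y \<rho>)) w s"
    using assms(1) 1(1) unfolding reach_def by metis
  show "\<exists>\<rho>>0. \<exists>n. \<exists>c>0. \<forall>w\<in>Rt. dist x w < \<rho> \<longrightarrow> (\<forall>s. ennreal c \<le> (K ^^ n) (in_set (ball z \<epsilon>)) w s)"
  proof (rule exI[of _ \<rho>'], rule conjI[OF 2(1)], rule exI[of _ "n' + n"], rule exI[of _ "c * c'"], intro conjI ballI allI impI)
    fix w s assume w: "w \<in> Rt" "dist x w < \<rho>'"
    have "ennreal (c * c') \<le> ennreal c * (K ^^ n') (in_set (ball y \<rho>)) w s"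
      using 2(3)[OF w, of s] 1(2) 2(2) by (simp add: ennreal_mult mult_left_mono)
    also have "\<dots> = (K ^^ n') (\<lambda>w s. ennreal c * in_set (ball y \<rho>) w s) w s"
      by (simp add: K_iter_cmult meas2_in_set)
    also have "\<dots> \<le> (K ^^ n') ((K ^^ n) (in_set (ball z \<epsilon>))) w s"
      using w 1(3) by (intro K_iter_mono) (auto simp: in_set_def indicator_def)
    finally show "ennreal (c * c') \<le> (K ^^ (n' + n)) (in_set (ball z \<epsilon>)) w s" by (simp add: K_iter_add)
  qed (use 1 2 in auto)
qed

text \<open>A single flight: the cap of good directions has positive surface measure, and the law of
  the direction dominates \<open>k\<close> times surface measure on it.\<close>

lemma reach_aim:
  assumes y: "y \<in> frontier D" and w: "w \<in> frontier D" and p: "cone_patch D y a \<kappa> \<delta>" and ch: "chord D y w"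
    and cone: "\<kappa> * norm (w - y) < a \<bullet> (w - y)"
  shows "reach y w"
  unfolding reach_def
proof (intro allI impI)
  fix \<epsilon> :: real assume \<epsilon>: "0 < \<epsilon>"
  obtain u1 \<rho> c where 1: "norm u1 = 1" "0 < \<rho>" "0 < c"
    "\<And>x u. x \<in> frontier D \<Longrightarrow> dist y x < \<rho> \<Longrightarrow> norm u = 1 \<Longrightarrow> dist u1 u < \<rho> \<Longrightarrow> hits D x u w \<epsilon>"
    "\<And>x u. x \<in> Rt \<Longrightarrow> dist y x < \<rho> \<Longrightarrow> norm u = 1 \<Longrightarrow> dist u1 u < \<rho> \<Longrightarrow> c \<le> nrm x \<bullet> u"
    by (rule aim_at_chord_end[OF p y w ch cone \<epsilon>]) (rule that)
  obtain k where k: "k > 0" "\<And>x g. x \<in> Rt \<Longrightarrow> g \<in> borel_measurable borel \<Longrightarrow>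
      ennreal k * (\<integral>\<^sup>+u. g u * indicator {u. norm u = 1 \<and> c \<le> nrm x \<bullet> u} u \<partial>sphere_measure) \<le>
      (\<integral>\<^sup>+\<eta>. g (V x \<eta>) \<partial>law)" by (rule V_lowerE[OF 1(3)]) (rule that)
  have [measurable]: "ball w \<epsilon> \<in> sets borel" by simp
  have fin: "emeasure sphere_measure (ball u1 \<rho>) \<noteq> \<infinity>"
    using finite_measure.emeasure_finite[OF finite_measure_sphere_measure] by simp
  define b where "b = measure sphere_measure (ball u1 \<rho>)"
  have b: "emeasure sphere_measure (ball u1 \<rho>) = ennreal b" using fin by (simp add: b_def emeasure_eq_ennreal_measure)
  have b0: "0 < b" using emeasure_sphere_measure_ball_pos[OF 1(1,2)] by (simp add: b)
  show "\<exists>\<rho>>0. \<exists>n. \<exists>c>0. \<forall>x\<in>Rt. dist y x < \<rho> \<longrightarrow> (\<forall>s. ennreal c \<le> (K ^^ n) (in_set (ball w \<epsilon>)) x s)"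
  proof (rule exI[of _ \<rho>], rule conjI[OF 1(2)], rule exI[of _ 1], rule exI[of _ "k * b"], intro conjI ballI allI impI)
    fix x s assume x: "x \<in> Rt" "dist y x < \<rho>"
    have "ennreal b = (\<integral>\<^sup>+u. indicator (ball u1 \<rho>) u \<partial>sphere_measure)" by (simp add: b)
    also have "\<dots> \<le> (\<integral>\<^sup>+u. indicator (ball w \<epsilon>) (hit_point D x u) * indicator {u. norm u = 1 \<and> c \<le> nrm x \<bullet> u} u \<partial>sphere_measure)"
    proof (rule nn_integral_mono_AE, use AE_sphere_measure_norm in eventually_elim)
      fix u :: 'a assume u: "norm u = 1"
      show "indicator (ball u1 \<rho>) u \<le> (indicator (ball w \<epsilon>) (hit_point D x u) * indicator {u. norm u = 1 \<and> c \<le> nrm x \<bullet> u} u :: ennreal)"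
        using 1(4)[of x u] 1(5)[of x u] x u Rt_sub by (auto simp: indicator_def hits_def)
    qed
    finally have "ennreal (k * b) \<le> ennreal k * \<dots>" using k(1) b0 by (simp add: ennreal_mult mult_left_mono)
    also have "\<dots> \<le> (\<integral>\<^sup>+\<eta>. indicator (ball w \<epsilon>) (hit_point D x (V x \<eta>)) \<partial>law)"
      by (intro k(2) x) measurable
    finally show "ennreal (k * b) \<le> (K ^^ 1) (in_set (ball w \<epsilon>)) x s"
      by (simp add: K_def in_set_def nxt_def)
  qed (use 1 k b0 in auto)
qed

lemma reach_all: "y \<in> frontier D \<Longrightarrow> z \<in> frontier D \<Longrightarrow> reach y z"
  by (rule frontier_connected_by[of reach]) (auto intro: reach_trans reach_aim)

lemma frontier_compact: "compact (frontier D)"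
  using D_bounded by (simp add: compact_frontier_bounded)

text \<open>Turns a locally valid parameter into finitely many parameters, of which maxima and
  minima give uniform constants.\<close>

lemma frontier_finite_cover:
  assumes "\<And>y. y \<in> frontier D \<Longrightarrow> \<exists>\<rho>>0. \<exists>c. (c :: 'c) \<in> X \<and> (\<forall>x\<in>Rt. dist y x < \<rho> \<longrightarrow> Q c x)"
  obtains C where "finite C" "C \<subseteq> X" "\<And>x. x \<in> Rt \<Longrightarrow> \<exists>c\<in>C. Q c x"
proof -
  obtain \<rho> c where 1: "\<And>y. y \<in> frontier D \<Longrightarrow> 0 < \<rho> y" "\<And>y. y \<in> frontier D \<Longrightarrow> c y \<in> X"
    "\<And>y x. y \<in> frontier D \<Longrightarrow> x \<in> Rt \<Longrightarrow> dist y x < \<rho> y \<Longrightarrow> Q (c y) x" using assms by metis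
  have "frontier D \<subseteq> (\<Union>y\<in>frontier D. ball y (\<rho> y))" using 1(1) by force
  then obtain Y where Y: "Y \<subseteq> frontier D" "finite Y" "frontier D \<subseteq> (\<Union>y\<in>Y. ball y (\<rho> y))"
    using compactE_image[OF frontier_compact, of "frontier D" "\<lambda>y. ball y (\<rho> y)"] by blast
  show ?thesis
  proof (rule that[of "c ` Y"])
    fix x assume x: "x \<in> Rt"
    then obtain y where "y \<in> Y" "dist y x < \<rho> y" using Y(3) Rt_sub by auto
    then show "\<exists>c\<in>c ` Y. Q c x" using 1(3) x Y(1) by auto
  qed (use Y 1(2) in auto)
qed

lemma reach_uniform:
  assumes z: "z \<in> frontier D" and \<epsilon>: "0 < \<epsilon>"
  obtains N c where "0 < c" "\<And>x. x \<in> Rt \<Longrightarrow> \<exists>n\<le>N. \<forall>s. ennreal c \<le> (K ^^ n) (in_set (ball z \<epsilon>)) x s"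
proof -
  define Q where "Q nc x \<longleftrightarrow> (\<forall>s. ennreal (snd nc) \<le> (K ^^ fst nc) (in_set (ball z \<epsilon>)) x s)" for nc :: "nat \<times> real" and x
  have cov: "\<exists>\<rho>>0. \<exists>nc. nc \<in> {nc. 0 < snd nc} \<and> (\<forall>x\<in>Rt. dist y x < \<rho> \<longrightarrow> Q nc x)" if y: "y \<in> frontier D" for y
  proof -
    obtain \<rho> n c where "\<rho> > 0" "c > 0" "\<forall>x\<in>Rt. dist y x < \<rho> \<longrightarrow> (\<forall>s. ennreal c \<le> (K ^^ n) (in_set (ball z \<epsilon>)) x s)"
      using reach_all[OF y z] \<epsilon> unfolding reach_def by blast
    then show ?thesis unfolding Q_def by (intro exI[of _ \<rho>] conjI exI[of _ "(n, c)"]) auto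
  qed
  obtain C where C: "finite C" "C \<subseteq> {nc. 0 < snd nc}" "\<And>x. x \<in> Rt \<Longrightarrow> \<exists>nc\<in>C. Q nc x"
    by (rule frontier_finite_cover[where Q=Q], rule cov, assumption) (rule that)
  define N where "N = Max (insert 0 (fst ` C))"
  define c where "c = Min (insert 1 (snd ` C))"
  show ?thesis
  proof (rule that[of c N])
    show "0 < c" using C(1,2) by (auto simp: c_def)
    fix x assume "x \<in> Rt"
    then obtain nc where nc: "nc \<in> C" "Q nc x" using C(3) by blast
    have "fst nc \<le> N" "c \<le> snd nc" using nc(1) C(1) by (auto simp: N_def c_def)
    then show "\<exists>n\<le>N. \<forall>s. ennreal c \<le> (K ^^ n) (in_set (ball z \<epsilon>)) x s"
      using nc(2) unfolding Q_def by (meson ennreal_leI order_trans)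
  qed
qed

text \<open>Near \<open>y\<close> all rays close to the axis of the cone at \<open>y\<close> stay in
  \<open>D\<close> for a common time \<open>\<delta>0\<close>, and their directions have probability
  bounded below; compactness of the boundary does the rest. This excludes accumulation of
  reflections and drives the propagation of lower bounds in time.\<close>

lemma long_flight_uniform:
  obtains r0 p where "0 < r0" "0 < p" "\<And>x. x \<in> Rt \<Longrightarrow> ennreal p \<le> emeasure law {\<eta>. r0 \<le> len x \<eta>}"
proof -
  define Q where "Q rp x \<longleftrightarrow> ennreal (snd rp) \<le> emeasure law {\<eta>. fst rp \<le> len x \<eta>}" for rp :: "real \<times> real" and x
  have cov: "\<exists>\<rho>>0. \<exists>rp. rp \<in> {rp. 0 < fst rp \<and> 0 < snd rp} \<and> (\<forall>x\<in>Rt. dist y x < \<rho> \<longrightarrow> Q rp x)" if y: "y \<in> frontier D" for y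
  proof -
    obtain a \<kappa> \<delta> where p: "cone_patch D y a \<kappa> \<delta>" using patch_ex[OF y] by blast
    have na: "norm a = 1" and \<kappa>: "0 \<le> \<kappa>" "\<kappa> < 1" and \<delta>: "0 < \<delta>" using p by (auto simp: cone_patch_def)
    have aa: "a \<bullet> a = 1" using na by (simp add: norm_eq_1)
    obtain \<delta>0 \<eta>0 where s: "\<delta>0 > 0" "\<eta>0 > 0" "\<And>x u t. x \<in> frontier D \<Longrightarrow> dist y x < \<eta>0 \<Longrightarrow> norm u = 1 \<Longrightarrow> dist a u < \<eta>0 \<Longrightarrow>
     0 < t \<Longrightarrow> t < \<delta>0 \<Longrightarrow> x + t *\<^sub>R u \<in> D"
      using starts_in_patch[OF p, of a] \<kappa> aa unfolding starts_in_def by metis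
    define \<rho> where "\<rho> = Min {\<eta>0, \<delta>, (1 - \<kappa>) / 2}"
    have \<rho>: "0 < \<rho>" "\<rho> \<le> \<eta>0" "\<rho> \<le> \<delta>" "\<rho> \<le> (1 - \<kappa>) / 2" using s \<delta> \<kappa> by (auto simp: \<rho>_def simp del: le_divide_eq_numeral1)
    define c where "c = (1 - \<kappa>) / 4"
    have c: "0 < c" using \<kappa> by (simp add: c_def)
    obtain k where k: "k > 0" "\<And>x g. x \<in> Rt \<Longrightarrow> g \<in> borel_measurable borel \<Longrightarrow>
      ennreal k * (\<integral>\<^sup>+u. g u * indicator {u. norm u = 1 \<and> c \<le> nrm x \<bullet> u} u \<partial>sphere_measure) \<le>
      (\<integral>\<^sup>+\<eta>. g (V x \<eta>) \<partial>law)" by (rule V_lowerE[OF c]) (rule that)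
    have fin: "emeasure sphere_measure (ball a \<rho>) \<noteq> \<infinity>"
      using finite_measure.emeasure_finite[OF finite_measure_sphere_measure] by simp
    define b where "b = measure sphere_measure (ball a \<rho>)"
    have b: "emeasure sphere_measure (ball a \<rho>) = ennreal b" using fin by (simp add: b_def emeasure_eq_ennreal_measure)
    have b0: "0 < b" using emeasure_sphere_measure_ball_pos[OF na \<rho>(1)] by (simp add: b)
    have "Q (\<delta>0, k * b) x" if x: "x \<in> Rt" "dist y x < \<rho>" for x
    proof -
      have "ennreal b = (\<integral>\<^sup>+u. indicator (ball a \<rho>) u \<partial>sphere_measure)" by (simp add: b)
      also have "\<dots> \<le> (\<integral>\<^sup>+u. indicator {\<delta>0..} (hit_time D x u) * indicator {u. norm u = 1 \<and> c \<le> nrm x \<bullet> u} u \<partial>sphere_measure)"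
      proof (rule nn_integral_mono_AE, use AE_sphere_measure_norm in eventually_elim)
        fix u :: 'a assume u: "norm u = 1"
        show "indicator (ball a \<rho>) u \<le> (indicator {\<delta>0..} (hit_time D x u) * indicator {u. norm u = 1 \<and> c \<le> nrm x \<bullet> u} u :: ennreal)"
        proof (cases "u \<in> ball a \<rho>")
          case True
          then have au: "dist a u < \<rho>" by simp
          have "(1 + \<kappa>) / 2 \<le> a \<bullet> u" using inner_dist_le[OF na, of a u] au aa \<rho>(4) by (simp add: field_simps)
          from nrm_lower_bound[OF p x(1) _ u this] have "c \<le> nrm x \<bullet> u" using x \<rho> \<kappa> by (simp add: c_def field_simps)
          moreover have "\<delta>0 \<le> hit_time D x u"
          proof -
            obtain T where T: "0 < T" "x + T *\<^sub>R u \<notin> D" using exit_ex[OF u] .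
            show ?thesis
              by (rule hit_time_props(1)[OF D_open s(1) _ T]) (use s(3)[of x u] x u au \<rho> Rt_sub in auto)
          qed
          ultimately show ?thesis using u by (auto simp: indicator_def)
        qed simp
      qed
      finally have "ennreal (k * b) \<le> ennreal k * \<dots>" using k(1) b0 by (simp add: ennreal_mult mult_left_mono)
      also have "\<dots> \<le> (\<integral>\<^sup>+\<eta>. indicator {\<delta>0..} (hit_time D x (V x \<eta>)) \<partial>law)"
        by (intro k(2) x) measurable
      also have "\<dots> = (\<integral>\<^sup>+\<eta>. indicator {\<eta>. \<delta>0 \<le> len x \<eta>} \<eta> \<partial>law)"
        by (intro nn_integral_cong) (auto simp: indicator_def len_def)
      also have "\<dots> = emeasure law {\<eta>. \<delta>0 \<le> len x \<eta>}"
      proof -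
        have "{\<eta> \<in> space law. \<delta>0 \<le> len x \<eta>} \<in> sets law" by measurable
        moreover have "space law = UNIV" using sets_eq_imp_space_eq[OF law_sets] by simp
        ultimately show ?thesis by simp
      qed
      finally show ?thesis by (simp add: Q_def)
    qed
    then show ?thesis using \<rho>(1) s(1) k(1) b0 by (intro exI[of _ \<rho>] conjI exI[of _ "(\<delta>0, k * b)"]) auto
  qed
  obtain C where C: "finite C" "C \<subseteq> {rp. 0 < fst rp \<and> 0 < snd rp}" "\<And>x. x \<in> Rt \<Longrightarrow> \<exists>rp\<in>C. Q rp x"
    by (rule frontier_finite_cover[where Q=Q], rule cov, assumption) (rule that)
  define r0 where "r0 = Min (insert 1 (fst ` C))"
  define p where "p = Min (insert 1 (snd ` C))"
  show ?thesis
  proof (rule that[of r0 p])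
    show "0 < r0" "0 < p" using C(1,2) by (auto simp: r0_def p_def)
    fix x assume "x \<in> Rt"
    then obtain rp where rp: "rp \<in> C" "Q rp x" using C(3) by blast
    have "r0 \<le> fst rp" "p \<le> snd rp" using rp(1) C(1) by (auto simp: r0_def p_def)
    have m: "{\<eta>. r0 \<le> len x \<eta>} \<in> sets law"
    proof -
      have "{\<eta> \<in> space law. r0 \<le> len x \<eta>} \<in> sets law" by measurable
      moreover have "space law = UNIV" using sets_eq_imp_space_eq[OF law_sets] by simp
      ultimately show ?thesis by simp
    qed
    have "ennreal p \<le> ennreal (snd rp)" using \<open>p \<le> snd rp\<close> by (rule ennreal_leI)
    also have "\<dots> \<le> emeasure law {\<eta>. fst rp \<le> len x \<eta>}" using rp(2) by (simp add: Q_def)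
    also have "\<dots> \<le> emeasure law {\<eta>. r0 \<le> len x \<eta>}" using \<open>r0 \<le> fst rp\<close> m by (intro emeasure_mono) auto
    finally show "ennreal p \<le> emeasure law {\<eta>. r0 \<le> len x \<eta>}" .
  qed
qed

end

section \<open>A local minorization by two flights\<close>

text \<open>Neither \<open>z - z'\<close> nor its negative can lie in the cone, since a boundary
  point is not in \<open>D\<close>.\<close>

lemma cone_patch_flat:
  assumes D: "open D" and p: "cone_patch D y a \<kappa> \<delta>"
    and z: "z \<in> frontier D" "dist y z < \<delta> / 2" and z': "z' \<in> frontier D" "dist y z' < \<delta> / 2"
  shows "\<bar>a \<bullet> (z - z')\<bar> \<le> \<kappa> * norm (z - z')"
proof -
  have \<delta>: "0 < \<delta>" using p by (simp add: cone_patch_def)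
  have nf: "p \<notin> D" if "p \<in> frontier D" for p using that D by (auto simp: frontier_def interior_open)
  have d: "norm (z - z') < \<delta>" using dist_triangle[of z z' y] z z' by (simp add: dist_norm norm_minus_commute)
  have "\<not> \<kappa> * norm v < a \<bullet> v" if "v = z - z' \<and> w = z' \<and> w' = z \<or> v = z' - z \<and> w = z \<and> w' = z'" for v w w'
  proof
    assume c: "\<kappa> * norm v < a \<bullet> v"
    then have "v \<noteq> 0" by auto
    then have "w + v \<in> D" using that c d z z' \<delta> cone_patchD(1)[OF p, of w v] by (auto simp: norm_minus_commute)
    then show False using that nf z z' by auto
  qed
  from this[of "z - z'" z' z] this[of "z' - z" z z'] show ?thesis
    by (auto simp: norm_minus_commute abs_le_iff inner_diff_right not_less)
qed

text \<open>Here the dimension matters: on the zero-dimensional sphere points have positive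
  measure.\<close>

lemma AE_sphere_measure_neq:
  fixes n :: "'a::euclidean_space"
  assumes dim: "2 \<le> DIM('a)"
  shows "AE u in sphere_measure. u \<noteq> n"
proof -
  interpret finite_measure "sphere_measure :: 'a measure" by (rule finite_measure_sphere_measure)
  have "AE u in sphere_measure. u \<notin> {n}"
  proof (rule AE_notin_outer_null)
    fix \<epsilon> :: real assume \<epsilon>: "0 < \<epsilon>"
    define \<rho> where "\<rho> = min (1/4) (\<epsilon> / 32)"
    have \<rho>: "0 < \<rho>" "4 * \<rho> \<le> 1" "32 * \<rho> \<le> \<epsilon>" using \<epsilon> by (auto simp: \<rho>_def)
    have "measure sphere_measure (ball n \<rho>) \<le> 8 * (4 * \<rho>) ^ (DIM('a) - 1)"
      using \<rho> by (intro measure_sphere_ball_le) auto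
    also have "\<dots> \<le> 8 * (4 * \<rho>) ^ 1" using \<rho> dim by (intro mult_left_mono power_decreasing) auto
    also have "\<dots> \<le> \<epsilon>" using \<rho> by simp
    finally have "emeasure sphere_measure (ball n \<rho>) \<le> ennreal \<epsilon>" by (simp add: emeasure_eq_measure ennreal_leI)
    then show "\<exists>A\<in>sets sphere_measure. {n} \<subseteq> A \<and> emeasure sphere_measure A \<le> ennreal \<epsilon>"
      using \<rho> by (intro bexI[of _ "ball n \<rho>"]) auto
  qed
  then show ?thesis by simp
qed

section \<open>Transversal chords and the flight map along them\<close>

context billiard_table
begin

definition transversal :: "'a \<Rightarrow> 'a \<Rightarrow> bool" where
  "transversal z w \<longleftrightarrow> z \<in> Rt \<and> w \<in> Rt \<and> chord D z w \<and> 0 < nrm z \<bullet> (w - z) \<and> 0 < nrm w \<bullet> (z - w)"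

lemma transversal_sym: "transversal z w \<Longrightarrow> transversal w z"
  by (auto simp: transversal_def chord_sym)

text \<open>
  The condition on the normal at \<open>w\<close> ensures that the flight time from \<open>z\<close> is not stationary at
  \<open>w\<close>.
\<close>

lemma transversal_ex:
  obtains z w where "transversal z w" "nrm w \<noteq> sgn (z - w)"
proof -
  have "frontier D \<noteq> {}"
  proof
    assume "frontier D = {}"
    then have "D = UNIV" using frontier_eq_empty[of D] D_nonempty by auto
    then show False using D_bounded not_bounded_UNIV by auto
  qed
  then obtain y where y: "y \<in> frontier D" by auto
  obtain a \<kappa> \<delta> where p: "cone_patch D y a \<kappa> \<delta>" using patch_ex[OF y] by blast
  obtain z where z: "z \<in> Rt" by (rule transversal_point_seen_nearby[OF p y])
  have zf: "z \<in> frontier D" using z Rt_sub by auto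
  obtain \<delta>z where pz: "cone_patch D z (nrm z) (1/2) \<delta>z" using normal_patch[OF z, of "1/2"] by auto
  obtain w \<rho> c where w: "w \<in> Rt" "0 < \<rho>" "0 < c" and c: "\<And>y'. y' \<in> frontier D \<Longrightarrow> dist z y' < \<rho> \<Longrightarrow> chord D y' w \<and> dist z y' < \<delta>z \<and>
       (1/2) * norm (w - y') < nrm z \<bullet> (w - y') \<and> c * norm (y' - w) < nrm w \<bullet> (y' - w)"
    by (rule transversal_point_seen_nearby[OF pz zf]) (rule that)
  have wf: "w \<in> frontier D" using w Rt_sub by auto
  have zw: "chord D z w" "c * norm (z - w) < nrm w \<bullet> (z - w)" using c[OF zf] w(2) by auto
  have wz: "chord D w z" using zw(1) by (rule chord_sym)
  have nz: "0 < norm (z - w)" using zw by (auto simp: chord_def)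
  have c1: "c < 1"
  proof -
    have "nrm w \<bullet> (z - w) \<le> norm (z - w)" using norm_cauchy_schwarz[of "nrm w" "z - w"] norm_nrm[OF w(1)] by simp
    then have "c * norm (z - w) < 1 * norm (z - w)" using zw by simp
    then show ?thesis using nz by simp
  qed
  obtain \<delta>w where pw: "cone_patch D w (nrm w) c \<delta>w" using normal_patch[OF w(1,3) c1] by blast
  obtain u1 \<rho>1 c1 where 1: "norm u1 = 1" "0 < \<rho>1" "0 < c1"
    and 2: "\<And>x u. x \<in> frontier D \<Longrightarrow> dist w x < \<rho>1 \<Longrightarrow> norm u = 1 \<Longrightarrow> dist u1 u < \<rho>1 \<Longrightarrow> hits D x u z 1"
    and 3: "\<And>x u. x \<in> Rt \<Longrightarrow> dist w x < \<rho>1 \<Longrightarrow> norm u = 1 \<Longrightarrow> dist u1 u < \<rho>1 \<Longrightarrow> c1 \<le> nrm x \<bullet> u"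
    by (rule aim_at_chord_end[OF pw wf zf wz zw(2) zero_less_one]) (rule that)
  \<comment> \<open>Keep \<open>w\<close> and move the other end: a generic direction from
    \<open>w\<close> towards the vicinity of \<open>z\<close>, different from the normal at
    \<open>w\<close>, ends at a new regular point that replaces \<open>z\<close>.\<close>
  have "AE u in sphere_measure. u \<noteq> nrm w \<and> (\<forall>t. t \<noteq> 0 \<longrightarrow> w + t *\<^sub>R u \<in> frontier D \<longrightarrow>
          w + t *\<^sub>R u \<in> Rt \<and> nrm (w + t *\<^sub>R u) \<bullet> u \<noteq> 0)"
    using AE_sphere_measure_neq[OF dim2, of "nrm w"] bad_null[of w] by eventually_elim blast
  then obtain u where u: "norm u = 1" "dist u1 u < \<rho>1" "u \<noteq> nrm w" "\<And>t. t \<noteq> 0 \<Longrightarrow> w + t *\<^sub>R u \<in> frontier D \<Longrightarrow>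
          w + t *\<^sub>R u \<in> Rt \<and> nrm (w + t *\<^sub>R u) \<bullet> u \<noteq> 0"
    by (rule AE_sphere_measure_direction[OF _ 1(1,2)]) blast
  have h: "hits D w u z 1" using 2[OF wf] 1 u by auto
  define z' where "z' = hit_point D w u"
  define r where "r = hit_time D w u"
  have r: "0 < r" "z' = w + r *\<^sub>R u" "z' \<in> frontier D" using h by (auto simp: hits_def r_def z'_def hit_point_def)
  have z'R: "z' \<in> Rt" "nrm z' \<bullet> u \<noteq> 0" using u(4)[of r] r by auto
  have nz': "nrm z' \<bullet> u < 0"
    using hits_transversal_end[of w u] z'R h unfolding z'_def[symmetric] hits_def by auto
  have "chord D w z'" using hits_chord[OF h u(1)] by (simp add: z'_def)
  moreover have "0 < nrm w \<bullet> u" using 3[OF w(1) _ u(1,2)] 1(2,3) by simp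
  moreover have "w - z' = - (r *\<^sub>R u)" "z' - w = r *\<^sub>R u" using r by auto
  ultimately have "transversal z' w"
    using z'R w r nz' unfolding transversal_def by (auto simp: chord_sym mult_pos_neg)
  moreover have "sgn (z' - w) = u" using r u by (simp add: sgn_scaleR sgn_div_norm)
  ultimately show ?thesis using u(3) by (intro that) auto
qed

text \<open>Everything rests on one margin at \<open>w\<close>: the boundary there is flat up to
  slope \<open>\<alpha> / 4\<close>, whereas incoming directions have a normal component of at least
  \<open>\<alpha> / 2\<close> in absolute value. Hence the flight time, and with it the hit point,
  is Lipschitz in start and direction, and a ray meets the boundary near \<open>w\<close> only
  once.\<close>

lemma transversal_local_structure:
  assumes tr: "transversal z w" and \<epsilon>: "0 < \<epsilon>"
  defines "u0 \<equiv> sgn (w - z)"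
  obtains \<rho> C c where "0 < \<rho>" "0 < C" "0 < c"
    "\<And>x u. x \<in> frontier D \<Longrightarrow> dist z x < \<rho> \<Longrightarrow> norm u = 1 \<Longrightarrow> dist u0 u < \<rho> \<Longrightarrow> hits D x u w \<epsilon>"
    "\<And>x u. x \<in> Rt \<Longrightarrow> dist z x < \<rho> \<Longrightarrow> norm u = 1 \<Longrightarrow> dist u0 u < \<rho> \<Longrightarrow> c \<le> nrm x \<bullet> u"
    "\<And>x u x' u'. x \<in> frontier D \<Longrightarrow> dist z x < \<rho> \<Longrightarrow> norm u = 1 \<Longrightarrow> dist u0 u < \<rho> \<Longrightarrow>
       x' \<in> frontier D \<Longrightarrow> dist z x' < \<rho> \<Longrightarrow> norm u' = 1 \<Longrightarrow> dist u0 u' < \<rho> \<Longrightarrow>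
       norm (hit_point D x u - hit_point D x' u') \<le> C * (norm (x - x') + norm (u - u'))"
    "\<And>x b. x \<in> frontier D \<Longrightarrow> dist z x < \<rho> \<Longrightarrow> b \<in> frontier D \<Longrightarrow> dist w b < \<rho> \<Longrightarrow> dist u0 (sgn (b - x)) < \<rho> \<Longrightarrow>
       b \<noteq> x \<Longrightarrow> hit_point D x (sgn (b - x)) = b"
proof -
  have zR: "z \<in> Rt" and wR: "w \<in> Rt" and ch: "chord D z w" and pos: "0 < nrm z \<bullet> (w - z)" "0 < nrm w \<bullet> (z - w)"
    using tr by (auto simp: transversal_def)
  have zf: "z \<in> frontier D" and wf: "w \<in> frontier D" using zR wR Rt_sub by auto
  define r where "r = norm (w - z)"
  have r: "0 < r" using ch by (auto simp: r_def chord_def)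
  have u0: "norm u0 = 1" and wr: "w = z + r *\<^sub>R u0" using r by (auto simp: u0_def r_def norm_sgn sgn_div_norm)
  have seg: "z + t *\<^sub>R u0 \<in> D" if "0 < t" "t < r" for t using ch that by (auto simp: chord_def r_def u0_def)
  have nz: "0 < nrm z \<bullet> u0" using pos(1) r unfolding wr by (simp add: zero_less_mult_iff)
  have nw: "nrm w \<bullet> u0 < 0"
  proof -
    have "z - w = - (r *\<^sub>R u0)" unfolding wr by simp
    then have "0 < - (r * (nrm w \<bullet> u0))" using pos(2) by simp
    then show ?thesis using r by (simp add: mult_less_0_iff)
  qed
  define \<alpha> where "\<alpha> = - (nrm w \<bullet> u0)"
  have \<alpha>: "0 < \<alpha>" "\<alpha> \<le> 1"
    using nw Cauchy_Schwarz_ineq2[of "nrm w" u0] norm_nrm[OF wR] u0 by (auto simp: \<alpha>_def)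
  define \<kappa>z where "\<kappa>z = nrm z \<bullet> u0 / 2"
  have nz1: "nrm z \<bullet> u0 \<le> 1" using Cauchy_Schwarz_ineq2[of "nrm z" u0] norm_nrm[OF zR] u0 by auto
  have \<kappa>z: "0 < \<kappa>z" "\<kappa>z < 1" "\<kappa>z < nrm z \<bullet> u0" using nz nz1 by (auto simp: \<kappa>z_def)
  obtain \<delta>z where pz: "cone_patch D z (nrm z) \<kappa>z \<delta>z" using normal_patch[OF zR \<kappa>z(1,2)] by blast
  have \<alpha>4: "0 < \<alpha> / 4" "\<alpha> / 4 < 1" using \<alpha> by auto
  obtain \<delta>w where pw: "cone_patch D w (nrm w) (\<alpha> / 4) \<delta>w" using normal_patch[OF wR \<alpha>4] by blast
  have \<delta>: "0 < \<delta>z" "0 < \<delta>w" using pz pw by (auto simp: cone_patch_def)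
  define \<epsilon>1 where "\<epsilon>1 = min \<epsilon> (\<delta>w / 2)"
  have \<epsilon>1: "0 < \<epsilon>1" "\<epsilon>1 \<le> \<epsilon>" "\<epsilon>1 \<le> \<delta>w / 2" using \<epsilon> \<delta> by (auto simp: \<epsilon>1_def)
  obtain \<eta> where \<eta>: "0 < \<eta>" "\<And>x u T. x \<in> frontier D \<Longrightarrow> dist z x < \<eta> \<Longrightarrow> norm u = 1 \<Longrightarrow> dist u0 u < \<eta> \<Longrightarrow> \<bar>T - r\<bar> < \<eta> \<Longrightarrow>
      x + T *\<^sub>R u \<notin> D \<Longrightarrow> r - \<epsilon>1 < hit_time D x u \<and> hit_time D x u \<le> T \<and> hits D x u (z + r *\<^sub>R u0) \<epsilon>1"
    by (rule hits_near_segment[OF D_open starts_in_patch[OF pz \<kappa>z(3)] u0 r _ \<epsilon>1(1)], rule seg, assumption+) (rule that)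
  have "0 < nrm w \<bullet> (- u0)" using nw by simp
  then obtain \<tau>0 where \<tau>0: "0 < \<tau>0" "\<And>t. 0 < t \<Longrightarrow> t < \<tau>0 \<Longrightarrow> w - t *\<^sub>R (- u0) \<notin> closure D"
    using nrm_pos_imp[OF wR, of "- u0"] by auto
  \<comment> \<open>Transversality puts the continuation of the ray beyond \<open>w\<close> outside
    the closure of \<open>D\<close>. So directions around \<open>u0\<close> itself can be used, with
    no detour to another exterior target.\<close>
  define \<tau> where "\<tau> = min \<eta> \<tau>0 / 2"
  have \<tau>: "0 < \<tau>" "\<tau> < \<eta>" "\<tau> < \<tau>0" using \<eta>(1) \<tau>0(1) by (auto simp: \<tau>_def)
  define T where "T = r + \<tau>"
  have T: "0 < T" "\<bar>T - r\<bar> < \<eta>" using r \<tau> by (auto simp: T_def)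
  have eT: "z + T *\<^sub>R u0 \<notin> closure D" using \<tau>0(2)[OF \<tau>(1,3)] by (simp add: wr T_def algebra_simps)
  obtain \<beta> where \<beta>: "\<beta> > 0" "ball (z + T *\<^sub>R u0) \<beta> \<subseteq> - closure D"
    using eT open_contains_ball[of "- closure D"] by (metis ComplI closed_closure open_Compl)
  define \<rho> where "\<rho> = Min {\<eta>, \<beta> / (1 + T), \<delta>z, \<kappa>z / 2, \<alpha> / 2, \<delta>w / 2}"
  have \<rho>: "0 < \<rho>" "\<rho> \<le> \<eta>" "\<rho> \<le> \<beta> / (1 + T)" "\<rho> \<le> \<delta>z" "\<rho> \<le> \<kappa>z / 2" "\<rho> \<le> \<alpha> / 2" "\<rho> \<le> \<delta>w / 2"
  proof -
    show "0 < \<rho>" unfolding \<rho>_def using \<eta>(1) \<beta>(1) T(1) \<delta> \<kappa>z(1) \<alpha>(1) by (subst Min_gr_iff) auto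
    have "\<rho> \<le> x" if "x \<in> {\<eta>, \<beta> / (1 + T), \<delta>z, \<kappa>z / 2, \<alpha> / 2, \<delta>w / 2}" for x
      unfolding \<rho>_def using that by (intro Min_le) auto
    then show "\<rho> \<le> \<eta>" "\<rho> \<le> \<beta> / (1 + T)" "\<rho> \<le> \<delta>z" "\<rho> \<le> \<kappa>z / 2" "\<rho> \<le> \<alpha> / 2" "\<rho> \<le> \<delta>w / 2"
      by blast+
  qed
  have hit1: "hits D x u w \<epsilon>1 \<and> hit_time D x u \<le> T" if x: "x \<in> frontier D" "dist z x < \<rho>" and u: "norm u = 1" "dist u0 u < \<rho>" for x u
  proof -
    have "dist (z + T *\<^sub>R u0) (x + T *\<^sub>R u) = norm ((z - x) + T *\<^sub>R (u0 - u))" by (simp add: dist_norm algebra_simps)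
    also have "\<dots> \<le> norm (z - x) + T * norm (u0 - u)"
      using T(1) norm_triangle_ineq[of "z - x" "T *\<^sub>R (u0 - u)"] by simp
    also have "\<dots> < \<rho> + T * \<rho>" using x u T(1) by (intro add_less_le_mono mult_left_mono) (auto simp: dist_norm)
    also have "\<dots> \<le> \<beta>" using \<rho>(3) T(1) by (simp add: field_simps)
    finally have "x + T *\<^sub>R u \<in> ball (z + T *\<^sub>R u0) \<beta>" by simp
    then have "x + T *\<^sub>R u \<notin> D" using \<beta>(2) closure_subset by blast
    then show ?thesis using \<eta>(2)[of x u T] x u \<rho> T wr by auto
  qed
  have nu: "nrm w \<bullet> u \<le> - (\<alpha> / 2)" if "dist u0 u < \<rho>" for u
    using inner_dist_le[OF norm_nrm[OF wR], of u0 u] that \<rho>(6) by (simp add: \<alpha>_def)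
  have hrange: "0 < hit_time D x u" "hit_time D x u \<le> T" if "x \<in> frontier D" "dist z x < \<rho>" "norm u = 1" "dist u0 u < \<rho>" for x u
    using hit1[OF that] by (auto simp: hits_def)
  have lip: "norm (hit_point D x u - hit_point D x' u') \<le> (1 + 8 / \<alpha>) * (1 + T) * (norm (x - x') + norm (u - u'))"
    if x: "x \<in> frontier D" "dist z x < \<rho>" and u: "norm u = 1" "dist u0 u < \<rho>"
      and x': "x' \<in> frontier D" "dist z x' < \<rho>" and u': "norm u' = 1" "dist u0 u' < \<rho>"
      and rT: "0 \<le> hit_time D x u" "hit_time D x u \<le> T" for x u x' u'
  proof -
    define h h' where "h = hit_point D x u" and "h' = hit_point D x' u'"
    define t t' where "t = hit_time D x u" and "t' = hit_time D x' u'"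
    define E where "E = norm (x - x') + T * norm (u - u')"
    have E0: "0 \<le> E" using T(1) by (simp add: E_def)
    have hf: "h \<in> frontier D" "dist w h < \<delta>w / 2" "h' \<in> frontier D" "dist w h' < \<delta>w / 2"
      using hit1[OF x u] hit1[OF x' u'] \<epsilon>1 by (auto simp: hits_def h_def h'_def)
    have flat: "\<bar>nrm w \<bullet> (h - h')\<bar> \<le> \<alpha> / 4 * norm (h - h')" by (rule cone_patch_flat[OF D_open pw hf])
    define e where "e = (x - x') + t *\<^sub>R (u - u')"
    have hh: "h - h' = e + (t - t') *\<^sub>R u'"
      by (simp add: h_def h'_def hit_point_def t_def t'_def e_def algebra_simps)
    have "norm e \<le> norm (x - x') + \<bar>t\<bar> * norm (u - u')" unfolding e_def using norm_triangle_ineq[of "x - x'" "t *\<^sub>R (u - u')"] by simp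
    also have "\<dots> \<le> E" unfolding E_def using rT by (intro add_left_mono mult_right_mono) (auto simp: t_def)
    finally have eE: "norm e \<le> E" .
    have hE: "norm (h - h') \<le> E + \<bar>t - t'\<bar>"
      using norm_triangle_ineq[of e "(t - t') *\<^sub>R u'"] eE u' by (simp add: hh)
    \<comment> \<open>Project \<open>h - h' = e + (t - t') *\<^sub>R u'\<close> on the normal at
      \<open>w\<close>: flatness bounds the left side by \<open>\<alpha> / 4\<close> times its norm,
      which is at most \<open>E + \<bar>t - t'\<bar>\<close>, and the term in \<open>t - t'\<close>
      can be absorbed.\<close>
    have "\<bar>t - t'\<bar> * (\<alpha> / 2) \<le> \<bar>t - t'\<bar> * \<bar>nrm w \<bullet> u'\<bar>" using nu[OF u'(2)] \<alpha> by (intro mult_left_mono) auto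
    also have "\<dots> = \<bar>nrm w \<bullet> (h - h') - nrm w \<bullet> e\<bar>" by (simp add: hh inner_add_right abs_mult)
    also have "\<dots> \<le> \<bar>nrm w \<bullet> (h - h')\<bar> + \<bar>nrm w \<bullet> e\<bar>" by linarith
    also have "\<bar>nrm w \<bullet> e\<bar> \<le> E" using Cauchy_Schwarz_ineq2[of "nrm w" e] norm_nrm[OF wR] eE by simp
    also have "\<bar>nrm w \<bullet> (h - h')\<bar> \<le> \<alpha> / 4 * (E + \<bar>t - t'\<bar>)" using flat hE \<alpha> by (meson \<alpha>4(1) less_imp_le mult_left_mono order_trans)
    finally have "\<bar>t - t'\<bar> * (\<alpha> / 2) \<le> \<alpha> / 4 * (E + \<bar>t - t'\<bar>) + E" by simp
    moreover have "\<bar>t - t'\<bar> * (\<alpha> / 2) = \<bar>t - t'\<bar> * (\<alpha> / 4) + \<bar>t - t'\<bar> * (\<alpha> / 4)" by simp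
    moreover have "\<alpha> / 4 * (E + \<bar>t - t'\<bar>) = \<alpha> / 4 * E + \<bar>t - t'\<bar> * (\<alpha> / 4)" by (simp add: distrib_left mult.commute)
    ultimately have "\<bar>t - t'\<bar> * (\<alpha> / 4) \<le> \<alpha> / 4 * E + E" by linarith
    also have "\<dots> \<le> 2 * E"
    proof -
      have "\<alpha> / 4 * E \<le> 1 * E" using \<alpha> E0 by (intro mult_right_mono) auto
      then show ?thesis by simp
    qed
    finally have "\<bar>t - t'\<bar> \<le> 8 / \<alpha> * E" using \<alpha> by (simp add: field_simps)
    then have "norm (h - h') \<le> (1 + 8 / \<alpha>) * E" using hE by (simp add: algebra_simps)
    also have "\<dots> \<le> (1 + 8 / \<alpha>) * ((1 + T) * (norm (x - x') + norm (u - u')))"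
    proof (intro mult_left_mono)
      show "E \<le> (1 + T) * (norm (x - x') + norm (u - u'))"
        unfolding E_def using T(1) by (simp add: algebra_simps)
      show "0 \<le> 1 + 8 / \<alpha>" using \<alpha> by simp
    qed
    finally show ?thesis by (simp add: h_def h'_def mult.assoc)
  qed
  show ?thesis
  proof (rule that[of \<rho> "(1 + 8 / \<alpha>) * (1 + T)" "\<kappa>z / 4"])
    show "0 < \<rho>" "0 < (1 + 8 / \<alpha>) * (1 + T)" "0 < \<kappa>z / 4" using \<rho> \<alpha> T \<kappa>z by (auto intro!: mult_pos_pos add_pos_pos)
    show "hits D x u w \<epsilon>" if "x \<in> frontier D" "dist z x < \<rho>" "norm u = 1" "dist u0 u < \<rho>" for x u
      using hit1[OF that] \<epsilon>1 by (auto simp: hits_def)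
    show "\<kappa>z / 4 \<le> nrm x \<bullet> u" if "x \<in> Rt" "dist z x < \<rho>" "norm u = 1" "dist u0 u < \<rho>" for x u
    proof -
      have "\<kappa>z * 3 / 2 \<le> nrm z \<bullet> u"
        using inner_dist_le[OF norm_nrm[OF zR], of u0 u] that \<rho>(5) by (simp add: \<kappa>z_def field_simps)
      from nrm_lower_bound[OF pz that(1) _ that(3) this] show ?thesis using that \<rho> \<kappa>z by simp
    qed
    show "norm (hit_point D x u - hit_point D x' u') \<le> (1 + 8 / \<alpha>) * (1 + T) * (norm (x - x') + norm (u - u'))"
      if "x \<in> frontier D" "dist z x < \<rho>" "norm u = 1" "dist u0 u < \<rho>"
       "x' \<in> frontier D" "dist z x' < \<rho>" "norm u' = 1" "dist u0 u' < \<rho>" for x u x' u'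
      using lip[OF that] hrange[OF that(1-4)] by simp
    show "hit_point D x (sgn (b - x)) = b"
      if x: "x \<in> frontier D" "dist z x < \<rho>" and b: "b \<in> frontier D" "dist w b < \<rho>" and s: "dist u0 (sgn (b - x)) < \<rho>" "b \<noteq> x" for x b
    proof (rule ccontr)
      define u where "u = sgn (b - x)"
      define h where "h = hit_point D x u"
      assume "hit_point D x (sgn (b - x)) \<noteq> b"
      then have hb: "h \<noteq> b" by (simp add: h_def u_def)
      have u: "norm u = 1" "dist u0 u < \<rho>" "b = x + norm (b - x) *\<^sub>R u"
        using s by (auto simp: u_def norm_sgn sgn_div_norm)
      have hf: "h \<in> frontier D" "dist w h < \<delta>w / 2" using hit1[OF x u(1,2)] \<epsilon>1 by (auto simp: hits_def h_def)
      have bb: "dist w b < \<delta>w / 2" using b \<rho> by linarith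
      have "h - b = (hit_time D x u - norm (b - x)) *\<^sub>R u"
        using u(3) by (simp add: h_def hit_point_def algebra_simps)
      then obtain q where q: "h - b = q *\<^sub>R u" by blast
      have q0: "q \<noteq> 0" using hb q by auto
      \<comment> \<open>Two distinct boundary points on one ray would make the ray as flat as the
        boundary.\<close>
      have "\<bar>nrm w \<bullet> (h - b)\<bar> \<le> \<alpha> / 4 * norm (h - b)" by (rule cone_patch_flat[OF D_open pw hf b(1) bb])
      then have "\<bar>q\<bar> * \<bar>nrm w \<bullet> u\<bar> \<le> \<bar>q\<bar> * (\<alpha> / 4)" using u(1) by (simp add: q abs_mult mult.commute)
      then have "\<bar>nrm w \<bullet> u\<bar> \<le> \<alpha> / 4" using q0 by simp
      then show False using nu[OF u(2)] \<alpha> by linarith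
    qed
  qed
qed

text \<open>A constant flight time would make the boundary near \<open>w\<close> a piece of a sphere
  around \<open>z\<close>, and then the normal at \<open>w\<close> would point to \<open>z\<close>.
  The proof is quantitative: turning \<open>u0\<close> slightly towards the part of the normal
  orthogonal to it moves the hit point along the normal more than flatness permits.\<close>

lemma flight_time_not_locally_constant:
  assumes tr: "transversal z w" and np: "nrm w \<noteq> sgn (z - w)" and \<eta>: "0 < \<eta>"
  defines "u0 \<equiv> sgn (w - z)"
  shows "\<exists>u. norm u = 1 \<and> dist u0 u < \<eta> \<and> hit_time D z u \<noteq> norm (w - z)"
proof (rule ccontr)
  assume neg: "\<not> ?thesis"
  have zR: "z \<in> Rt" and wR: "w \<in> Rt" and zw: "z \<noteq> w" and nw: "0 < nrm w \<bullet> (z - w)" using tr by (auto simp: transversal_def chord_def)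
  have zf: "z \<in> frontier D" and wf: "w \<in> frontier D" using zR wR Rt_sub by auto
  define r where "r = norm (w - z)"
  have r: "0 < r" using zw by (simp add: r_def)
  have const: "hit_time D z u = r" if "norm u = 1" "dist u0 u < \<eta>" for u using neg that by (auto simp: r_def)
  have u0: "norm u0 = 1" and wr: "w = z + r *\<^sub>R u0" using r by (auto simp: u0_def r_def norm_sgn sgn_div_norm)
  define n where "n = nrm w"
  have nn: "norm n = 1" using norm_nrm[OF wR] by (simp add: n_def)
  have u01: "u0 \<bullet> u0 = 1" and n1: "n \<bullet> n = 1" using u0 nn by (auto simp: norm_eq_1)
  \<comment> \<open>The component of the normal orthogonal to the chord; it vanishes only if the
    normal is parallel to the chord.\<close>
  define e where "e = n - (n \<bullet> u0) *\<^sub>R u0"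
  have eu: "e \<bullet> u0 = 0" using u01 by (simp add: e_def inner_diff_left)
  have ne: "n \<bullet> e = (norm e)\<^sup>2"
    unfolding power2_norm_eq_inner using eu by (simp add: e_def inner_diff_left inner_diff_right inner_commute u01)
  have e0: "e \<noteq> 0"
  proof
    assume "e = 0"
    then have nu: "n = (n \<bullet> u0) *\<^sub>R u0" by (simp add: e_def)
    then have "\<bar>n \<bullet> u0\<bar> = 1" using nn u0 by (metis norm_scaleR mult.right_neutral)
    moreover have "n \<bullet> u0 < 0"
    proof -
      have "z - w = - (r *\<^sub>R u0)" unfolding wr by simp
      then have "0 < - (r * (n \<bullet> u0))" using nw by (simp add: n_def)
      then show ?thesis using r by (simp add: mult_less_0_iff)
    qed
    ultimately have "n = - u0" using nu by (metis abs_of_neg minus_minus scaleR_minus1_left)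
    moreover have "sgn (z - w) = - u0" unfolding u0_def by (metis minus_diff_eq sgn_minus)
    ultimately show False using np by (simp add: n_def)
  qed
  define N where "N = norm e"
  have N: "0 < N" using e0 by (simp add: N_def)
  \<comment> \<open>With this flatness the normal displacement of \<open>u - u0\<close> is at most
    \<open>5/16 * (\<tau> * N * N)\<close>, against the lower bound
    \<open>\<tau> * N * N / 2\<close> derived below.\<close>
  define \<kappa> where "\<kappa> = min (1/2) (N / 4)"
  have \<kappa>: "0 < \<kappa>" "\<kappa> < 1" "\<kappa> \<le> N / 4" using N by (auto simp: \<kappa>_def)
  obtain \<delta> where p: "cone_patch D w n \<kappa> \<delta>" using normal_patch[OF wR \<kappa>(1,2)] by (auto simp: n_def)
  have \<delta>: "0 < \<delta>" using p by (simp add: cone_patch_def)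
  have \<delta>2: "0 < \<delta> / 2" using \<delta> by simp
  obtain \<rho> C c where \<rho>: "0 < \<rho>" and hit: "\<And>x u. x \<in> frontier D \<Longrightarrow> dist z x < \<rho> \<Longrightarrow> norm u = 1 \<Longrightarrow> dist u0 u < \<rho> \<Longrightarrow> hits D x u w (\<delta> / 2)"
    unfolding u0_def by (rule transversal_local_structure[OF tr \<delta>2]) blast
  \<comment> \<open>Scaled so that the deflection \<open>\<tau> * N\<close> equals
    \<open>m / 4\<close>; the normalization of \<open>v\<close> then changes its length only to
    second order.\<close>
  define \<tau> where "\<tau> = Min {\<rho>, \<eta>, 1, N} / (4 * N)"
  define m where "m = Min {\<rho>, \<eta>, 1, N}"
  have m: "0 < m" "m \<le> \<rho>" "m \<le> \<eta>" "m \<le> 1" "m \<le> N" using \<rho> \<eta> N by (auto simp: m_def)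
  have \<tau>: "0 < \<tau>" "\<tau> * N = m / 4" using m N by (auto simp: \<tau>_def m_def[symmetric])
  define v where "v = u0 + \<tau> *\<^sub>R e"
  define u where "u = sgn v"
  have v2: "(norm v)\<^sup>2 = 1 + (\<tau> * N)\<^sup>2"
    using eu u01 unfolding power2_norm_eq_inner v_def N_def power_mult_distrib
    by (simp add: inner_add_left inner_add_right inner_commute[of u0 e] power2_eq_square)
  have v1: "1 \<le> norm v"
  proof -
    have "1\<^sup>2 \<le> (norm v)\<^sup>2" unfolding v2 by simp
    then show ?thesis by (rule power2_le_imp_le) simp
  qed
  have vu: "norm (v - 1 *\<^sub>R u0) \<le> \<tau> * N" by (simp add: v_def N_def \<tau>(1) less_imp_le)
  have \<tau>N1: "\<tau> * N < 1" using m \<tau> by simp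
  note sg = sgn_near[OF u0 zero_less_one vu \<tau>N1, folded u_def]
  have un: "norm u = 1" and du: "dist u0 u \<le> m / 2" using sg \<tau>(2) by auto
  have du': "dist u0 u < \<rho>" "dist u0 u < \<eta>" using du m by linarith+
  have h: "hits D z u w (\<delta> / 2)" using hit[OF zf _ un du'(1)] \<rho> by simp
  have hp: "hit_point D z u = z + r *\<^sub>R u" using const[OF un du'(2)] by (simp add: hit_point_def)
  have "\<bar>n \<bullet> ((z + r *\<^sub>R u) - w)\<bar> \<le> \<kappa> * norm ((z + r *\<^sub>R u) - w)"
    using h wf \<delta> unfolding hits_def hp by (intro cone_patch_flat[OF D_open p]) auto
  moreover have "(z + r *\<^sub>R u) - w = r *\<^sub>R (u - u0)" by (simp add: wr algebra_simps)
  ultimately have "r * \<bar>n \<bullet> (u - u0)\<bar> \<le> r * (\<kappa> * norm (u - u0))" using r by (simp add: abs_mult)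
  then have fl: "\<bar>n \<bullet> (u - u0)\<bar> \<le> \<kappa> * norm (u - u0)" using r by simp
  define s where "s = 1 / norm v"
  have v0: "0 < norm v" using v1 by linarith
  have s: "0 < s" "s \<le> 1" using v0 v1 by (auto simp: s_def divide_le_eq_1)
  have us: "u = s *\<^sub>R v" by (simp add: u_def s_def sgn_div_norm inverse_eq_divide)
  have dec: "u - u0 = (s * \<tau>) *\<^sub>R e - (1 - s) *\<^sub>R u0"
    by (simp add: us v_def algebra_simps)
  have "1 - s \<le> (\<tau> * N)\<^sup>2"
  proof -
    have "norm v \<le> (norm v)\<^sup>2" using v1 by (simp add: power2_eq_square mult_le_cancel_left1)
    then have "norm v - 1 \<le> (\<tau> * N)\<^sup>2" using v2 by simp
    moreover have "1 - s = (norm v - 1) / norm v" using v0 by (simp add: s_def diff_divide_distrib)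
    moreover have "(norm v - 1) / norm v \<le> (norm v - 1) / 1" using v1 by (intro divide_left_mono) auto
    ultimately show ?thesis by simp
  qed
  also have "(\<tau> * N)\<^sup>2 \<le> (m / 4) * (\<tau> * N)" using \<tau> m by (simp add: power2_eq_square)
  also have "\<dots> \<le> (1 / 4) * (\<tau> * N)" using m \<tau> N by (intro mult_right_mono) auto
  finally have s1a: "1 - s \<le> (\<tau> * N) / 4" by simp
  have s34: "3/4 \<le> s" using s1a \<tau> m by simp
  have s1b: "1 - s \<le> \<tau> * N * N / 4"
  proof -
    have "1 - s \<le> (\<tau> * N)\<^sup>2" by fact
    also have "\<dots> = (m / 4) * (\<tau> * N)" using \<tau> by (simp add: power2_eq_square)
    also have "\<dots> \<le> (N / 4) * (\<tau> * N)" using m \<tau> N by (intro mult_right_mono) auto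
    finally show ?thesis by (simp add: ac_simps)
  qed
  have \<tau>NN: "0 < \<tau> * N * N" using \<tau>(1) N by simp
  have "\<bar>n \<bullet> u0\<bar> \<le> 1" using Cauchy_Schwarz_ineq2[of n u0] nn u0 by simp
  then have "(1 - s) * (n \<bullet> u0) \<le> (1 - s) * 1" using s by (intro mult_left_mono) auto
  also have "\<dots> \<le> \<tau> * N * N / 4" using s1b by simp
  finally have "(1 - s) * (n \<bullet> u0) \<le> \<tau> * N * N / 4" .
  moreover have "n \<bullet> (u - u0) = s * (\<tau> * N * N) - (1 - s) * (n \<bullet> u0)"
    using ne by (simp add: dec inner_diff_right N_def power2_eq_square)
  moreover have "3/4 * (\<tau> * N * N) \<le> s * (\<tau> * N * N)" using s34 \<tau>NN by (intro mult_right_mono) auto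
  ultimately have low: "\<tau> * N * N / 2 \<le> n \<bullet> (u - u0)" by linarith
  have "norm (u - u0) \<le> norm ((s * \<tau>) *\<^sub>R e) + norm ((1 - s) *\<^sub>R u0)" unfolding dec by (rule norm_triangle_ineq4)
  also have "\<dots> = s * \<tau> * N + (1 - s)" using s \<tau> u0 by (simp add: N_def)
  also have "\<dots> \<le> \<tau> * N + \<tau> * N / 4"
  proof -
    have "s * (\<tau> * N) \<le> 1 * (\<tau> * N)" using s \<tau> N by (intro mult_right_mono) auto
    then have "s * \<tau> * N \<le> \<tau> * N" by (simp add: mult.assoc)
    then show ?thesis using s1a by linarith
  qed
  finally have "norm (u - u0) \<le> \<tau> * N + \<tau> * N / 4" .
  then have "norm (u - u0) \<le> 5/4 * (\<tau> * N)" by linarith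
  then have "\<kappa> * norm (u - u0) \<le> (N / 4) * (5/4 * (\<tau> * N))" using \<kappa> N by (intro mult_mono) auto
  also have "\<dots> = 5/16 * (\<tau> * N * N)" by simp
  finally show False using fl low \<tau>NN by linarith
qed

end

section \<open>Transformation of surface measure and minorization of distributions\<close>

lemma ennreal_le_divideI:
  assumes "X \<le> ennreal M * Y" "0 < M"
  shows "ennreal (1 / M) * X \<le> Y"
proof -
  have "ennreal (1 / M) * X \<le> ennreal (1 / M) * (ennreal M * Y)" using assms(1) by (rule mult_left_mono) simp
  also have "\<dots> = Y" using assms(2) by (simp add: mult.assoc[symmetric] ennreal_mult[symmetric])
  finally show ?thesis .
qed

lemma nn_integral_le_of_emeasure_le:
  assumes sets: "sets N = sets M" and le: "\<And>A. A \<in> sets M \<Longrightarrow> c * emeasure M A \<le> emeasure N A"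
    and f: "f \<in> borel_measurable M"
  shows "c * (\<integral>\<^sup>+x. f x \<partial>M) \<le> (\<integral>\<^sup>+x. f x \<partial>N)"
proof -
  have "scale_measure c M \<le> N" using sets le by (subst le_measure) auto
  then have "(\<integral>\<^sup>+x. f x \<partial>scale_measure c M) \<le> (\<integral>\<^sup>+x. f x \<partial>N)"
    using sets by (intro nn_integral_mono_measure) auto
  then show ?thesis using f by (simp add: nn_integral_scale_measure)
qed

text \<open>Extend \<open>\<theta>\<close> homogeneously of degree one to the cone over
  \<open>A1\<close>. The extension is Lipschitz with constant \<open>1 + 2 * L\<close> and maps cone
  onto cone, so the volume bound applies.\<close>

lemma sphere_measure_lipschitz_image_le:
  fixes \<theta> :: "'a::euclidean_space \<Rightarrow> 'a"
  assumes A1: "A1 \<in> sets borel" "A1 \<subseteq> sphere 0 1" and A2: "A2 \<in> sets borel"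
    and lip: "L-lipschitz_on A1 \<theta>" and img: "A2 \<subseteq> \<theta> ` A1" "\<theta> ` A1 \<subseteq> sphere 0 1"
  shows "emeasure sphere_measure A2 \<le>
    ennreal (unit_ball_vol (DIM('a)) * (sqrt (DIM('a)) * (1 + 2 * L)) ^ DIM('a)) * emeasure sphere_measure A1"
proof -
  have L: "0 \<le> L" using lip by (rule lipschitz_on_nonneg)
  define S where "S = {x. x \<in> ball 0 1 \<and> sgn x \<in> A1}"
  define W where "W = {x. x \<in> ball 0 1 \<and> sgn x \<in> A2}"
  define F where "F x = norm x *\<^sub>R \<theta> (sgn x)" for x
  have S: "S \<in> sets borel"
  proof -
    have "S = ball 0 1 \<inter> sgn -` A1" by (auto simp: S_def)
    then show ?thesis using measurable_sets_borel[OF borel_measurable_sgn A1(1)] by simp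
  qed
  have nz: "x \<noteq> 0" if "x \<in> S" for x using that A1(2) by (auto simp: S_def)
  have \<theta>1: "norm (\<theta> u) = 1" if "u \<in> A1" for u using img(2) that by force
  have lipF: "(1 + 2 * L)-lipschitz_on S F"
  proof (rule lipschitz_onI)
    fix x y assume x: "x \<in> S" and y: "y \<in> S"
    define p q where "p = sgn x" and "q = sgn y"
    have pq: "p \<in> A1" "q \<in> A1" using x y by (auto simp: S_def p_def q_def)
    have xp: "x = norm x *\<^sub>R p" and yq: "y = norm y *\<^sub>R q" using nz[OF x] nz[OF y] by (auto simp: p_def q_def sgn_div_norm)
    have p1: "norm p = 1" using pq(1) A1(2) by auto
    have "norm y *\<^sub>R (p - q) = (norm y - norm x) *\<^sub>R p + (x - y)"
      by (simp add: scaleR_diff_right scaleR_diff_left xp[symmetric] yq[symmetric])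
    then have "norm y * norm (p - q) = norm ((norm y - norm x) *\<^sub>R p + (x - y))"
      by (metis abs_norm_cancel norm_scaleR)
    also have "\<dots> \<le> \<bar>norm y - norm x\<bar> + norm (x - y)"
      using norm_triangle_ineq[of "(norm y - norm x) *\<^sub>R p" "x - y"] p1 by simp
    also have "\<dots> \<le> 2 * norm (x - y)" using norm_triangle_ineq3[of y x] by (simp add: norm_minus_commute)
    finally have 1: "norm y * norm (p - q) \<le> 2 * norm (x - y)" .
    have "F x - F y = (norm x - norm y) *\<^sub>R \<theta> p + norm y *\<^sub>R (\<theta> p - \<theta> q)"
      by (simp add: F_def p_def q_def algebra_simps)
    then have 2: "dist (F x) (F y) \<le> \<bar>norm x - norm y\<bar> + norm y * norm (\<theta> p - \<theta> q)"
      using norm_triangle_ineq[of "(norm x - norm y) *\<^sub>R \<theta> p" "norm y *\<^sub>R (\<theta> p - \<theta> q)"] \<theta>1[OF pq(1)] by (simp add: dist_norm)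
    have "norm y * norm (\<theta> p - \<theta> q) \<le> norm y * (L * norm (p - q))"
      using lipschitz_onD[OF lip pq] by (intro mult_left_mono) (auto simp: dist_norm)
    also have "\<dots> = L * (norm y * norm (p - q))" by simp
    also have "\<dots> \<le> L * (2 * norm (x - y))" using 1 L by (intro mult_left_mono)
    finally have "dist (F x) (F y) \<le> norm (x - y) + L * (2 * norm (x - y))"
      using 2 norm_triangle_ineq3[of x y] by linarith
    then show "dist (F x) (F y) \<le> (1 + 2 * L) * dist x y" by (simp add: dist_norm algebra_simps)
  qed (use L in simp)
  have "W \<subseteq> F ` S"
  proof
    fix x assume "x \<in> W"
    then have x: "norm x < 1" "sgn x \<in> A2" by (auto simp: W_def)
    obtain u where u: "u \<in> A1" "sgn x = \<theta> u" using x(2) img(1) by auto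
    have x0: "x \<noteq> 0" using \<theta>1[OF u(1)] u(2) by auto
    have u1: "norm u = 1" using u(1) A1(2) by auto
    have "sgn (norm x *\<^sub>R u) = u" using x0 u1 by (simp add: sgn_scaleR sgn_div_norm)
    then have "norm x *\<^sub>R u \<in> S" "F (norm x *\<^sub>R u) = x"
      using x u u1 x0 by (auto simp: S_def F_def u(2)[symmetric] sgn_div_norm)
    then show "x \<in> F ` S" by (metis imageI)
  qed
  moreover have "bounded S" by (rule bounded_subset[of "ball 0 1"]) (auto simp: S_def)
  ultimately have "emeasure lborel W \<le>
    ennreal (unit_ball_vol (DIM('a)) * (sqrt (DIM('a)) * (1 + 2 * L)) ^ DIM('a)) * emeasure lborel S"
    using lipF S by (intro emeasure_lipschitz_image_le)
  then have "of_nat DIM('a) * emeasure lborel W \<le>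
    of_nat DIM('a) * (ennreal (unit_ball_vol (DIM('a)) * (sqrt (DIM('a)) * (1 + 2 * L)) ^ DIM('a)) * emeasure lborel S)"
    by (rule mult_left_mono) simp
  then show ?thesis using emeasure_sphere_measure[OF A1(1)] emeasure_sphere_measure[OF A2]
    by (simp add: S_def W_def mult.left_commute)
qed

text \<open>
  A Lipschitz function on the sphere that changes from \<open>\<alpha>\<close> to \<open>\<beta>\<close> between two small caps has a
  distribution that dominates Lebesgue measure on \<open>{\<alpha>..\<beta>}\<close>: it crosses every level on each of the
  parallel segments that join the caps.
\<close>

lemma sphere_measure_level_ge:
  fixes \<Phi> :: "'a::euclidean_space \<Rightarrow> real"
  assumes \<Phi>[measurable]: "\<Phi> \<in> borel_measurable borel" and I[measurable]: "I \<in> sets borel"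
    and u0: "norm u0 = 1" and \<tau>: "0 < \<tau>" "\<tau> \<le> 1/8"
    and lip: "L-lipschitz_on {u. norm u = 1 \<and> dist u0 u < 4 * \<tau>} \<Phi>" and L: "0 < L"
    and u1: "norm u1 = 1" "dist u0 u1 < \<tau>" and u2: "norm u2 = 1" "dist u0 u2 < \<tau>" and ne: "u1 \<noteq> u2"
    and \<rho>: "0 < \<rho>" "\<rho> \<le> \<tau>"
    and le: "\<And>u. norm u = 1 \<Longrightarrow> dist u1 u < \<rho> \<Longrightarrow> \<Phi> u \<le> \<alpha>"
    and ge: "\<And>u. norm u = 1 \<Longrightarrow> dist u2 u < \<rho> \<Longrightarrow> \<beta> \<le> \<Phi> u"
  shows "ennreal (unit_ball_vol (DIM('a)) * (\<rho> / 4) ^ DIM('a)) * emeasure lborel (I \<inter> {\<alpha>..\<beta>}) \<le>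
     ennreal (8 * L * norm (u2 - u1)) * emeasure sphere_measure {u. norm u = 1 \<and> dist u0 u < 4 * \<tau> \<and> \<Phi> u \<in> I}"
proof -
  \<comment> \<open>The problem is moved from the sphere to the halfway sphere. Around
    \<open>(1/2) *\<^sub>R v\<close> the radial projection enlarges distances to the centre at most
    fourfold, so balls of radius \<open>\<rho> / 4\<close> project into the caps of radius
    \<open>\<rho>\<close>, and \<open>X\<close> stays within the unit ball, where cone volume is
    bounded by surface measure.\<close>
  define X where "X = ball ((1/2) *\<^sub>R u0) \<tau>"
  define G where "G x = \<Phi> (sgn x)" for x
  let ?A = "{u. norm u = 1 \<and> dist u0 u < 4 * \<tau> \<and> \<Phi> u \<in> I}"
  have near: "norm x \<ge> 1/4 \<and> norm (sgn x) = 1 \<and> dist v (sgn x) \<le> 4 * dist ((1/2) *\<^sub>R v) x"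
    if v: "norm v = 1" and x: "dist ((1/2) *\<^sub>R v) x < 1/4" for v x :: 'a
  proof -
    have "norm ((1/2) *\<^sub>R v) - norm x \<le> dist ((1/2) *\<^sub>R v) x" unfolding dist_norm by (rule norm_triangle_ineq2)
    then have nx: "1/4 \<le> norm x" using v x by simp
    then have x0: "x \<noteq> 0" by auto
    have sv: "sgn ((1/2) *\<^sub>R v) = v" using v by (simp add: sgn_scaleR sgn_div_norm)
    have "norm (sgn x - sgn ((1/2) *\<^sub>R v)) \<le> 2 * norm (x - (1/2) *\<^sub>R v) / (1/2)"
      using v by (intro sgn_diff_le) auto
    then have "dist v (sgn x) \<le> 4 * dist ((1/2) *\<^sub>R v) x" by (simp add: sv dist_norm norm_minus_commute)
    then show ?thesis using nx x0 by (simp add: norm_sgn)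
  qed
  have Xn: "1/4 \<le> norm x \<and> norm (sgn x) = 1 \<and> dist u0 (sgn x) < 4 * \<tau> \<and> norm x < 1" if "x \<in> X" for x
  proof -
    have d: "dist ((1/2) *\<^sub>R u0) x < \<tau>" using that by (simp add: X_def)
    have "norm x \<le> norm ((1/2) *\<^sub>R u0) + dist ((1/2) *\<^sub>R u0) x"
      by (simp add: dist_norm) (metis add.commute norm_minus_commute norm_triangle_sub u0 norm_scaleR abs_of_pos half_gt_zero_iff mult.right_neutral zero_less_one abs_divide abs_one abs_numeral)
    then show ?thesis using near[OF u0, of x] d \<tau> u0 by auto
  qed
  have lipG: "(8 * L)-lipschitz_on X G"
  proof (rule lipschitz_onI)
    fix x y assume x: "x \<in> X" and y: "y \<in> X"
    have "dist (G x) (G y) \<le> L * dist (sgn x) (sgn y)"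
      unfolding G_def using Xn[OF x] Xn[OF y] by (intro lipschitz_onD[OF lip]) auto
    also have "dist (sgn x) (sgn y) \<le> 2 * norm (x - y) / (1/4)"
      unfolding dist_norm using Xn[OF y] by (intro sgn_diff_le) auto
    finally show "dist (G x) (G y) \<le> 8 * L * dist x y" using L by (simp add: dist_norm mult_left_mono)
  qed (use L in simp)
  have sub: "ball ((1/2) *\<^sub>R v) (\<rho> / 4) \<subseteq> X" if "dist u0 v < \<tau>" for v
  proof
    fix x assume "x \<in> ball ((1/2) *\<^sub>R v) (\<rho> / 4)"
    then have "dist ((1/2) *\<^sub>R v) x < \<tau> / 4" using \<rho> by simp
    moreover have "dist ((1/2) *\<^sub>R u0) ((1/2) *\<^sub>R v) = dist u0 v / 2"
      by (simp add: dist_norm flip: scaleR_diff_right)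
    ultimately have "dist ((1/2) *\<^sub>R u0) x < \<tau>"
      using dist_triangle[of "(1/2) *\<^sub>R u0" x "(1/2) *\<^sub>R v"] that \<tau> by linarith
    then show "x \<in> X" by (simp add: X_def)
  qed
  have nearv: "norm (sgn x) = 1 \<and> dist v (sgn x) < \<rho>" if "norm v = 1" "x \<in> ball ((1/2) *\<^sub>R v) (\<rho> / 4)" for v x :: 'a
    using near[OF that(1), of x] that(2) \<rho> \<tau> by auto
  have "emeasure lborel (ball ((1/2) *\<^sub>R u1) (\<rho> / 4)) * emeasure lborel (I \<inter> {\<alpha>..\<beta>}) \<le>
    ennreal (2 * ((8 * L) * norm ((1/2) *\<^sub>R u2 - (1/2) *\<^sub>R u1))) * emeasure lborel {x \<in> X. G x \<in> I}"
  proof (rule lipschitz_preimage_measure_ge[OF _ _ lipG _ sub[OF u1(2)] sub[OF u2(2)]])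
    show "G x \<le> \<alpha>" if "x \<in> ball ((1/2) *\<^sub>R u1) (\<rho> / 4)" for x
      using le nearv[OF u1(1) that] by (simp add: G_def)
    show "\<beta> \<le> G x" if "x \<in> ball ((1/2) *\<^sub>R u2) (\<rho> / 4)" for x
      using ge nearv[OF u2(1) that] by (simp add: G_def)
  qed (use L \<rho> ne in \<open>auto simp: X_def\<close>)
  also have "2 * ((8 * L) * norm ((1/2) *\<^sub>R u2 - (1/2) *\<^sub>R u1)) = 8 * L * norm (u2 - u1)"
    by (simp flip: scaleR_diff_right)
  also have "emeasure lborel {x \<in> X. G x \<in> I} \<le> emeasure sphere_measure ?A"
  proof -
    have A: "?A \<in> sets borel" by measurable
    have "emeasure lborel {x \<in> X. G x \<in> I} \<le> emeasure lborel {x. x \<in> ball 0 1 \<and> sgn x \<in> ?A}"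
    proof (rule emeasure_mono)
      show "{x \<in> X. G x \<in> I} \<subseteq> {x. x \<in> ball 0 1 \<and> sgn x \<in> ?A}" using Xn by (auto simp: G_def)
      have "{x. x \<in> ball 0 1 \<and> sgn x \<in> ?A} = ball 0 1 \<inter> sgn -` ?A" by auto
      then show "{x. x \<in> ball 0 1 \<and> sgn x \<in> ?A} \<in> sets lborel"
        using measurable_sets_borel[OF borel_measurable_sgn A] by simp
    qed
    also have "\<dots> = 1 * \<dots>" by simp
    also have "\<dots> \<le> of_nat DIM('a) * emeasure lborel {x. x \<in> ball 0 1 \<and> sgn x \<in> ?A}"
    proof (rule mult_right_mono)
      have "1 \<le> DIM('a)" by (simp add: Suc_leI)
      then have "ennreal 1 \<le> ennreal (real DIM('a))" by (intro ennreal_leI) simp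
      then show "(1::ennreal) \<le> of_nat DIM('a)" by (simp add: ennreal_of_nat_eq_real_of_nat)
    qed simp
    also have "\<dots> = emeasure sphere_measure ?A" using emeasure_sphere_measure[OF A] by simp
    finally show ?thesis .
  qed
  finally show ?thesis using \<rho> by (simp add: emeasure_ball mult_left_mono)
qed

section \<open>The joint law of return point and elapsed time after two flights\<close>

context stochastic_table
begin

text \<open>The loop runs from \<open>a\<close> near \<open>z\<close> to \<open>w'\<close> near
  \<open>w\<close> and on to \<open>b\<close> near \<open>z\<close>. First, whatever
  \<open>w'\<close>, the law of \<open>b\<close> dominates a multiple of \<open>lam\<close>, the law
  of the point seen from \<open>w\<close> itself (\<open>b1\<close>). Second, for fixed
  \<open>a\<close> and \<open>b\<close> the length of the broken line through the point hit from
  \<open>a\<close> along \<open>u\<close> dominates Lebesgue measure on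
  \<open>{\<alpha>..\<beta>}\<close> when \<open>u\<close> is random (\<open>b2\<close>). All
  constants are uniform in \<open>a\<close> and \<open>b\<close>.\<close>

lemma loop_minorization:
  obtains z \<epsilon> lam \<alpha> \<beta> c where "z \<in> Rt" "0 < \<epsilon>" "sets lam = sets borel" "finite_measure lam" "emeasure lam UNIV \<noteq> 0"
    "AE b in lam. b \<in> Rt \<and> dist z b < \<epsilon>" "\<alpha> < \<beta>" "0 < c"
    "\<And>a s g. a \<in> Rt \<Longrightarrow> dist z a < \<epsilon> \<Longrightarrow> meas2 g \<Longrightarrow>
      ennreal c * (\<integral>\<^sup>+b. (\<integral>\<^sup>+t. indicator {\<alpha>..\<beta>} t * g b (s - t) \<partial>lborel) \<partial>lam) \<le> (K ^^ 2) g a s"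
proof -
  interpret sph: finite_measure "sphere_measure :: 'a measure" by (rule finite_measure_sphere_measure)
  obtain z w where tr: "transversal z w" and np: "nrm w \<noteq> sgn (z - w)" by (rule transversal_ex)
  have tr': "transversal w z" using tr by (rule transversal_sym)
  have zR: "z \<in> Rt" and wR: "w \<in> Rt" and zw: "z \<noteq> w" using tr by (auto simp: transversal_def chord_def)
  have zf: "z \<in> frontier D" and wf: "w \<in> frontier D" using zR wR Rt_sub by auto
  define r where "r = norm (w - z)"
  have r: "0 < r" using zw by (simp add: r_def)
  define u0 where "u0 = sgn (w - z)"
  define v0 where "v0 = sgn (z - w)"
  have u0: "norm u0 = 1" and v0: "norm v0 = 1" using zw by (auto simp: u0_def v0_def norm_sgn)
  have zr: "z = w + r *\<^sub>R v0" using zw by (simp add: v0_def r_def sgn_div_norm norm_minus_commute)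
  have r2: "0 < r / 2" using r by simp
  obtain \<rho>2 C2 c2 where L2: "0 < \<rho>2" "0 < C2" "0 < c2"
    and hits2: "\<And>x u. x \<in> frontier D \<Longrightarrow> dist w x < \<rho>2 \<Longrightarrow> norm u = 1 \<Longrightarrow> dist v0 u < \<rho>2 \<Longrightarrow> hits D x u z (r / 2)"
    and low2: "\<And>x u. x \<in> Rt \<Longrightarrow> dist w x < \<rho>2 \<Longrightarrow> norm u = 1 \<Longrightarrow> dist v0 u < \<rho>2 \<Longrightarrow> c2 \<le> nrm x \<bullet> u"
    and lip2: "\<And>x u x' u'. x \<in> frontier D \<Longrightarrow> dist w x < \<rho>2 \<Longrightarrow> norm u = 1 \<Longrightarrow> dist v0 u < \<rho>2 \<Longrightarrow>
       x' \<in> frontier D \<Longrightarrow> dist w x' < \<rho>2 \<Longrightarrow> norm u' = 1 \<Longrightarrow> dist v0 u' < \<rho>2 \<Longrightarrow>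
       norm (hit_point D x u - hit_point D x' u') \<le> C2 * (norm (x - x') + norm (u - u'))"
    and exact2: "\<And>x b. x \<in> frontier D \<Longrightarrow> dist w x < \<rho>2 \<Longrightarrow> b \<in> frontier D \<Longrightarrow> dist z b < \<rho>2 \<Longrightarrow> dist v0 (sgn (b - x)) < \<rho>2 \<Longrightarrow>
       b \<noteq> x \<Longrightarrow> hit_point D x (sgn (b - x)) = b"
    by (rule transversal_local_structure[OF tr' r2, folded v0_def]) (rule that)
  \<comment> \<open>The tolerance around \<open>w\<close>: from any \<open>w'\<close> this close,
    aiming at a point within \<open>\<rho>5\<close> of \<open>z\<close> needs a direction within
    \<open>\<rho>2\<close> of \<open>v0\<close>.\<close>
  define \<rho>5 where "\<rho>5 = Min {\<rho>2 / 2, r * \<rho>2 / 8, r / 8}"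
  have \<rho>5: "0 < \<rho>5" "\<rho>5 \<le> \<rho>2 / 2" "\<rho>5 \<le> r * \<rho>2 / 8" "\<rho>5 \<le> r / 8"
    using L2 r by (auto simp: \<rho>5_def simp del: le_divide_eq_numeral1)
  obtain \<rho>1 C1 c1 where L1: "0 < \<rho>1" "0 < C1" "0 < c1"
    and hits1: "\<And>x u. x \<in> frontier D \<Longrightarrow> dist z x < \<rho>1 \<Longrightarrow> norm u = 1 \<Longrightarrow> dist u0 u < \<rho>1 \<Longrightarrow> hits D x u w \<rho>5"
    and low1: "\<And>x u. x \<in> Rt \<Longrightarrow> dist z x < \<rho>1 \<Longrightarrow> norm u = 1 \<Longrightarrow> dist u0 u < \<rho>1 \<Longrightarrow> c1 \<le> nrm x \<bullet> u"
    and lip1: "\<And>x u x' u'. x \<in> frontier D \<Longrightarrow> dist z x < \<rho>1 \<Longrightarrow> norm u = 1 \<Longrightarrow> dist u0 u < \<rho>1 \<Longrightarrow>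
       x' \<in> frontier D \<Longrightarrow> dist z x' < \<rho>1 \<Longrightarrow> norm u' = 1 \<Longrightarrow> dist u0 u' < \<rho>1 \<Longrightarrow>
       norm (hit_point D x u - hit_point D x' u') \<le> C1 * (norm (x - x') + norm (u - u'))"
    and exact1: "\<And>x b. x \<in> frontier D \<Longrightarrow> dist z x < \<rho>1 \<Longrightarrow> b \<in> frontier D \<Longrightarrow> dist w b < \<rho>1 \<Longrightarrow> dist u0 (sgn (b - x)) < \<rho>1 \<Longrightarrow>
       b \<noteq> x \<Longrightarrow> hit_point D x (sgn (b - x)) = b"
    by (rule transversal_local_structure[OF tr \<rho>5(1), folded u0_def]) (rule that)
  define \<tau> where "\<tau> = min (\<rho>1 / 4) (1 / 8)"
  have \<tau>: "0 < \<tau>" "4 * \<tau> \<le> \<rho>1" "\<tau> \<le> 1/8" using L1 by (auto simp: \<tau>_def)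
  have hz: "hit_time D z u0 = r"
  proof -
    have "hit_point D z (sgn (w - z)) = w" using exact1[OF zf _ wf] L1 zw by (auto simp: u0_def)
    then have "z + hit_time D z u0 *\<^sub>R u0 = w" by (simp add: hit_point_def u0_def)
    then have "w - z = hit_time D z u0 *\<^sub>R u0" by (metis add_diff_cancel_left')
    moreover have "w - z = r *\<^sub>R u0" using zw by (simp add: u0_def r_def sgn_div_norm)
    ultimately have "hit_time D z u0 *\<^sub>R u0 = r *\<^sub>R u0" by metis
    moreover have "u0 \<noteq> 0" using u0 by auto
    ultimately show ?thesis by (metis scaleR_cancel_right)
  qed
  obtain u' where u': "norm u' = 1" "dist u0 u' < \<tau>" "hit_time D z u' \<noteq> r"
    using flight_time_not_locally_constant[OF tr np \<tau>(1)] by (auto simp: u0_def r_def)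
  obtain u1 u2 where u12: "norm u1 = 1" "dist u0 u1 < \<tau>" "norm u2 = 1" "dist u0 u2 < \<tau>" "hit_time D z u1 < hit_time D z u2"
  proof (cases "hit_time D z u' < r")
    case True then show ?thesis using u' u0 hz \<tau>(1) by (intro that[of u' u0]) auto
  next
    case False then show ?thesis using u' u0 hz \<tau>(1) by (intro that[of u0 u']) auto
  qed
  have ne12: "u1 \<noteq> u2" using u12(5) by auto
  \<comment> \<open>The closed loops from \<open>z\<close> along \<open>u1\<close> and
    \<open>u2\<close> have lengths twice the flight times, hence \<open>2 * \<gamma>\<close> apart.
    A margin \<open>\<gamma> / 2\<close> at each end absorbs the displacement of \<open>a\<close>,
    \<open>b\<close> and the direction; the interval left has length
    \<open>\<gamma>\<close>.\<close>
  define \<gamma> where "\<gamma> = hit_time D z u2 - hit_time D z u1"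
  have \<gamma>: "0 < \<gamma>" using u12 by (simp add: \<gamma>_def)
  define \<alpha> where "\<alpha> = 2 * hit_time D z u1 + \<gamma> / 2"
  define \<beta> where "\<beta> = 2 * hit_time D z u2 - \<gamma> / 2"
  have "\<beta> - \<alpha> = \<gamma>" by (simp add: \<alpha>_def \<beta>_def \<gamma>_def field_simps)
  then have \<alpha>\<beta>: "\<alpha> < \<beta>" using \<gamma> by linarith
  define N1 where "N1 = C1 + 1"
  have N1: "0 < N1" using L1 by (simp add: N1_def)
  \<comment> \<open>Displacements of this size change the loop length by at most
    \<open>2 * (C1 * (2 * x0)) + 2 * x0\<close>, which must not exceed the margin.\<close>
  define x0 where "x0 = \<gamma> / (8 * N1)"
  have x0: "0 < x0" "2 * (C1 * (2 * x0)) + 2 * x0 \<le> \<gamma> / 2"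
  proof -
    show "0 < x0" using \<gamma> N1 by (simp add: x0_def)
    have "N1 * x0 = \<gamma> / 8" using N1 by (simp add: x0_def)
    then have "C1 * x0 + x0 = \<gamma> / 8" by (simp add: N1_def algebra_simps)
    then show "2 * (C1 * (2 * x0)) + 2 * x0 \<le> \<gamma> / 2" using \<open>0 < x0\<close> by (simp add: algebra_simps)
  qed
  define \<rho>3 where "\<rho>3 = min \<tau> x0"
  have \<rho>3: "0 < \<rho>3" "\<rho>3 \<le> \<tau>" "\<rho>3 \<le> x0" using \<tau> x0 by (auto simp: \<rho>3_def)
  define \<epsilon> where "\<epsilon> = Min {\<rho>1, \<rho>2, x0}"
  have \<epsilon>: "0 < \<epsilon>" "\<epsilon> \<le> \<rho>1" "\<epsilon> \<le> \<rho>2" "\<epsilon> \<le> x0" using L1 L2 x0 by (auto simp: \<epsilon>_def)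
  \<comment> \<open>Keeps the support of \<open>lam\<close> within \<open>\<epsilon>\<close> of
    \<open>z\<close>, so that loops can be iterated, and within \<open>\<rho>5\<close>, so that its
    points can be targeted from every \<open>w'\<close>.\<close>
  define \<rho>4 where "\<rho>4 = Min {\<rho>2, \<epsilon> / (2 * C2), \<rho>5 / C2}"
  have \<rho>4: "0 < \<rho>4" "\<rho>4 \<le> \<rho>2" "\<rho>4 \<le> \<epsilon> / (2 * C2)" "\<rho>4 \<le> \<rho>5 / C2"
    using L2 \<epsilon> \<rho>5 by (auto simp: \<rho>4_def)
  have C\<rho>4: "C2 * \<rho>4 \<le> \<epsilon> / 2" "C2 * \<rho>4 \<le> \<rho>5" using \<rho>4(3,4) L2 by (auto simp: field_simps)
  define O2 where "O2 = {v. norm v = 1 \<and> dist v0 v < \<rho>4}"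
  have O2[measurable]: "O2 \<in> sets borel" unfolding O2_def by measurable
  have hz0: "hit_point D w v0 = z" using exact2[OF wf _ zf] L2 zw by (auto simp: v0_def)
  have hO2: "hit_point D w v \<in> frontier D \<and> dist z (hit_point D w v) \<le> C2 * \<rho>4 \<and> sgn (hit_point D w v - w) = v" if v: "v \<in> O2" for v
  proof -
    have v': "norm v = 1" "dist v0 v < \<rho>2" "norm (v0 - v) < \<rho>4" using v \<rho>4 by (auto simp: O2_def dist_norm)
    have h: "hits D w v z (r / 2)" using hits2[OF wf _ v'(1,2)] L2 by simp
    have "norm (hit_point D w v0 - hit_point D w v) \<le> C2 * (norm (w - w) + norm (v0 - v))"
      using lip2[OF wf _ v0 _ wf _ v'(1,2)] L2 by simp
    also have "\<dots> \<le> C2 * \<rho>4" using v' L2 by (intro mult_left_mono) auto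
    finally have "dist z (hit_point D w v) \<le> C2 * \<rho>4" by (simp add: hz0 dist_norm)
    then show ?thesis using h v' by (auto simp: hits_def hit_point_def sgn_scaleR sgn_div_norm)
  qed
  \<comment> \<open>The reference measure: the points hit from \<open>w\<close> itself along
    directions in the cap \<open>O2\<close>.\<close>
  define lam where "lam = distr (density sphere_measure (indicator O2)) borel (hit_point D w)"
  have hw[measurable]: "hit_point D w \<in> borel_measurable borel"
    by (intro borel_measurable_hit_point') measurable
  have lam_sets[measurable_cong]: "sets lam = sets borel" by (simp add: lam_def)
  have lam_int: "(\<integral>\<^sup>+b. G b \<partial>lam) = (\<integral>\<^sup>+v. indicator O2 v * G (hit_point D w v) \<partial>sphere_measure)"
    if [measurable]: "G \<in> borel_measurable borel" for G
    unfolding lam_def by (simp add: nn_integral_distr nn_integral_density)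
  have lam_em: "emeasure lam B = emeasure sphere_measure {v \<in> O2. hit_point D w v \<in> B}" if [measurable]: "B \<in> sets borel" for B
  proof -
    have "emeasure lam B = (\<integral>\<^sup>+b. indicator B b \<partial>lam)" using that lam_sets by simp
    also have "\<dots> = (\<integral>\<^sup>+v. indicator {v \<in> O2. hit_point D w v \<in> B} v \<partial>sphere_measure)"
      by (subst lam_int, simp, intro nn_integral_cong) (auto simp: indicator_def)
    also have "\<dots> = emeasure sphere_measure {v \<in> O2. hit_point D w v \<in> B}" by simp
    finally show ?thesis .
  qed
  have lam_fin: "finite_measure lam"
  proof
    have "space lam = UNIV" using sets_eq_imp_space_eq[OF lam_sets] by simp
    then show "emeasure lam (space lam) \<noteq> \<infinity>" using lam_em[of UNIV] sph.emeasure_finite by simp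
  qed
  have lam_pos: "emeasure lam UNIV \<noteq> 0"
  proof -
    have "0 < emeasure sphere_measure (ball v0 \<rho>4)" by (rule emeasure_sphere_measure_ball_pos[OF v0 \<rho>4(1)])
    also have "emeasure sphere_measure (ball v0 \<rho>4) = emeasure sphere_measure O2"
      using AE_sphere_measure_norm by (intro emeasure_eq_AE) (auto simp: O2_def)
    finally show ?thesis using lam_em[of UNIV] by simp
  qed
  have lam_AE: "AE b in lam. b \<in> Rt \<and> dist z b < \<epsilon>"
  proof -
    have "AE v in density sphere_measure (indicator O2). hit_point D w v \<in> Rt \<and> dist z (hit_point D w v) < \<epsilon>"
    proof (subst AE_density, simp, use bad_null[of w] in eventually_elim, intro impI)
      fix v assume bn: "\<forall>t. t \<noteq> 0 \<longrightarrow> w + t *\<^sub>R v \<in> frontier D \<longrightarrow> w + t *\<^sub>R v \<in> Rt \<and> nrm (w + t *\<^sub>R v) \<bullet> v \<noteq> 0"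
        and "0 < (indicator O2 v :: ennreal)"
      then have v: "v \<in> O2" by (cases "v \<in> O2") auto
      have "hits D w v z (r / 2)" using hits2[OF wf] L2 v \<rho>4 by (auto simp: O2_def)
      then have "hit_point D w v \<in> Rt" using bn by (auto simp: hits_def hit_point_def)
      then show "hit_point D w v \<in> Rt \<and> dist z (hit_point D w v) < \<epsilon>" using hO2[OF v] C\<rho>4 \<epsilon> by auto
    qed
    then show ?thesis unfolding lam_def by (subst AE_distr_iff) auto
  qed
  define M1 where "M1 = unit_ball_vol (DIM('a)) * (sqrt (DIM('a)) * (1 + 2 * (4 * C2 / r))) ^ DIM('a)"
  have M1: "0 < M1" using L2 r by (auto simp: M1_def intro!: mult_pos_pos zero_less_power add_pos_pos)
  \<comment> \<open>A change of direction coordinates on the boundary near \<open>z\<close>, from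
    those at \<open>w'\<close> to those at \<open>w\<close>. A Lipschitz bound in this one direction
    already suffices for domination.\<close>
  have b1: "ennreal (1 / M1) * (\<integral>\<^sup>+b. G b \<partial>lam) \<le>
      (\<integral>\<^sup>+u. indicator {u. norm u = 1 \<and> dist v0 u < \<rho>2} u * G (hit_point D w' u) \<partial>sphere_measure)"
    if w': "w' \<in> frontier D" "dist w w' < \<rho>5" and G[measurable]: "G \<in> borel_measurable borel" for w' G
  proof -
    define O1 where "O1 = {u. norm u = 1 \<and> dist v0 u < \<rho>2}"
    have O1[measurable]: "O1 \<in> sets borel" unfolding O1_def by measurable
    have hw'[measurable]: "hit_point D w' \<in> borel_measurable borel"
      by (intro borel_measurable_hit_point') measurable
    define N where "N = distr (density sphere_measure (indicator O1)) borel (hit_point D w')"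
    have ww': "dist w w' < \<rho>2" using w' \<rho>5 L2 by linarith
    have "ennreal (1 / M1) * emeasure lam B \<le> emeasure N B" if "B \<in> sets lam" for B
    proof -
      have B[measurable]: "B \<in> sets borel" using that lam_sets by simp
      define A1 where "A1 = {u \<in> O1. hit_point D w' u \<in> B}"
      define A2 where "A2 = {v \<in> O2. hit_point D w v \<in> B}"
      have A[measurable]: "A1 \<in> sets borel" "A2 \<in> sets borel" unfolding A1_def A2_def by measurable
      \<comment> \<open>The direction from \<open>w\<close> to the point hit from \<open>w'\<close>
        along \<open>u\<close>. Hit points keep distance \<open>r / 2\<close> from \<open>w\<close>,
        which gives the Lipschitz constant \<open>4 * C2 / r\<close>.\<close>
      define \<theta> where "\<theta> u = sgn (hit_point D w' u - w)" for u
      have far: "r / 2 \<le> norm (hit_point D w' u - w)" if "u \<in> O1" for u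
      proof -
        have "dist z (hit_point D w' u) < r / 2" using hits2[OF w'(1) ww'] that by (auto simp: O1_def hits_def)
        moreover have "dist z w \<le> dist z (hit_point D w' u) + dist (hit_point D w' u) w" by (rule dist_triangle)
        moreover have "dist z w = r" by (simp add: r_def dist_norm norm_minus_commute)
        ultimately show ?thesis by (simp add: dist_norm)
      qed
      have lip: "(4 * C2 / r)-lipschitz_on A1 \<theta>"
      proof (rule lipschitz_onI)
        fix p q assume "p \<in> A1" "q \<in> A1"
        then have pq: "p \<in> O1" "q \<in> O1" by (auto simp: A1_def)
        have "dist (\<theta> p) (\<theta> q) \<le> 2 * norm ((hit_point D w' p - w) - (hit_point D w' q - w)) / (r / 2)"
          unfolding \<theta>_def dist_norm using far[OF pq(2)] r by (intro sgn_diff_le) auto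
        also have "\<dots> = (4 / r) * norm (hit_point D w' p - hit_point D w' q)" by simp
        also have "\<dots> \<le> (4 / r) * (C2 * (norm (w' - w') + norm (p - q)))"
          using lip2[OF w'(1) ww' _ _ w'(1) ww', of p q] pq r by (intro mult_left_mono) (auto simp: O1_def)
        finally show "dist (\<theta> p) (\<theta> q) \<le> 4 * C2 / r * dist p q" by (simp add: dist_norm)
      qed (use L2 r in simp)
      have "A2 \<subseteq> \<theta> ` A1"
      proof
        fix v assume v: "v \<in> A2"
        then have vO: "v \<in> O2" by (simp add: A2_def)
        define b where "b = hit_point D w v"
        have b: "b \<in> frontier D" "dist z b \<le> C2 * \<rho>4" "sgn (b - w) = v" using hO2[OF vO] by (auto simp: b_def)
        define u where "u = sgn (b - w')"
        have eq: "(b - w') - r *\<^sub>R v0 = (b - z) + (w - w')" unfolding zr by simp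
        have "norm ((b - w') - r *\<^sub>R v0) \<le> dist z b + dist w w'"
          unfolding eq using norm_triangle_ineq[of "b - z" "w - w'"] by (simp add: dist_norm norm_minus_commute)
        then have nb: "norm ((b - w') - r *\<^sub>R v0) \<le> 2 * \<rho>5" using b(2) C\<rho>4(2) w'(2) by linarith
        have "2 * \<rho>5 < r" using \<rho>5 r by linarith
        note sg = sgn_near[OF v0 r nb this, folded u_def]
        have "2 * (2 * \<rho>5) / r \<le> \<rho>2 / 2" using \<rho>5(3) r by (simp add: field_simps)
        then have du: "dist v0 u < \<rho>2" using sg(2) L2 by linarith
        have bw: "b \<noteq> w'" using sg(3) by (auto simp: u_def)
        have db: "dist z b < \<rho>2" using b(2) C\<rho>4(2) \<rho>5 L2 by linarith
        have "hit_point D w' u = b" unfolding u_def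
          by (rule exact2[OF w'(1) ww' b(1) db du[unfolded u_def] bw])
        then show "v \<in> \<theta> ` A1"
          using b(3) sg(3) du v by (intro image_eqI[of _ _ u]) (auto simp: \<theta>_def A1_def O1_def A2_def b_def)
      qed
      moreover have "\<theta> ` A1 \<subseteq> sphere 0 1"
      proof clarify
        fix u assume "u \<in> A1"
        then have "u \<in> O1" by (simp add: A1_def)
        then have "r / 2 \<le> norm (hit_point D w' u - w)" by (rule far)
        then have "0 < norm (hit_point D w' u - w)" using r by linarith
        then have "hit_point D w' u - w \<noteq> 0" by (metis norm_zero less_irrefl)
        then show "\<theta> u \<in> sphere 0 1" unfolding \<theta>_def mem_sphere dist_0_norm norm_sgn by (rule if_not_P)
      qed
      moreover have "A1 \<subseteq> sphere 0 1" by (auto simp: A1_def O1_def)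
      ultimately have "emeasure sphere_measure A2 \<le> ennreal M1 * emeasure sphere_measure A1"
        unfolding M1_def using lip A by (intro sphere_measure_lipschitz_image_le)
      moreover have "emeasure N B = emeasure sphere_measure A1"
      proof -
        have "emeasure N B = (\<integral>\<^sup>+u. indicator O1 u * indicator B (hit_point D w' u) \<partial>sphere_measure)"
          unfolding N_def by (subst nn_integral_indicator[symmetric], simp, subst nn_integral_distr, simp_all add: nn_integral_density)
        also have "\<dots> = (\<integral>\<^sup>+u. indicator A1 u \<partial>sphere_measure)"
          by (intro nn_integral_cong) (auto simp: A1_def indicator_def)
        finally show ?thesis by simp
      qed
      ultimately show ?thesis using lam_em[OF B] M1 by (intro ennreal_le_divideI) (auto simp: A2_def)
    qed
    then have "ennreal (1 / M1) * (\<integral>\<^sup>+b. G b \<partial>lam) \<le> (\<integral>\<^sup>+b. G b \<partial>N)"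
      by (intro nn_integral_le_of_emeasure_le) (auto simp: N_def lam_sets)
    also have "\<dots> = (\<integral>\<^sup>+u. indicator O1 u * G (hit_point D w' u) \<partial>sphere_measure)"
      unfolding N_def by (simp add: nn_integral_distr nn_integral_density)
    finally show ?thesis by (simp add: O1_def)
  qed
  define v where "v = unit_ball_vol (DIM('a)) * (\<rho>3 / 4) ^ DIM('a)"
  define M2 where "M2 = 8 * (2 * C1) * norm (u2 - u1)"
  have v: "0 < v" and M2: "0 < M2" using \<rho>3 L1 ne12 by (auto simp: v_def M2_def)
  have b2: "ennreal (v / M2) * (\<integral>\<^sup>+t. indicator {\<alpha>..\<beta>} t * G t \<partial>lborel) \<le>
     (\<integral>\<^sup>+u. indicator {u. norm u = 1 \<and> dist u0 u < \<rho>1} u * G (norm (a - hit_point D a u) + norm (hit_point D a u - b)) \<partial>sphere_measure)"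
    if a: "a \<in> frontier D" "dist z a < \<epsilon>" and b: "dist z b < \<epsilon>" and G[measurable]: "G \<in> borel_measurable borel" for a b G
  proof -
    define \<Phi> where "\<Phi> u = norm (a - hit_point D a u) + norm (hit_point D a u - b)" for u
    have \<Phi>[measurable]: "\<Phi> \<in> borel_measurable borel" unfolding \<Phi>_def by measurable
    have a1: "dist z a < \<rho>1" using a \<epsilon> by simp
    define O1 where "O1 = {u. norm u = 1 \<and> dist u0 u < \<rho>1}"
    have O1[measurable]: "O1 \<in> sets borel" unfolding O1_def by measurable
    define N where "N = distr (density sphere_measure (indicator O1)) borel \<Phi>"
    have lip: "(2 * C1)-lipschitz_on {u. norm u = 1 \<and> dist u0 u < 4 * \<tau>} \<Phi>"
    proof (rule lipschitz_onI)
      fix p q assume "p \<in> {u. norm u = 1 \<and> dist u0 u < 4 * \<tau>}" "q \<in> {u. norm u = 1 \<and> dist u0 u < 4 * \<tau>}"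
      then have pq: "norm p = 1" "dist u0 p < \<rho>1" "norm q = 1" "dist u0 q < \<rho>1" using \<tau> by auto
      have h: "norm (hit_point D a p - hit_point D a q) \<le> C1 * norm (p - q)"
        using lip1[OF a(1) a1 pq(1,2) a(1) a1 pq(3,4)] by simp
      have "\<bar>norm (a - hit_point D a p) - norm (a - hit_point D a q)\<bar> \<le> norm (hit_point D a p - hit_point D a q)"
        using norm_triangle_ineq3[of "a - hit_point D a p" "a - hit_point D a q"] by (simp add: norm_minus_commute)
      moreover have "\<bar>norm (hit_point D a p - b) - norm (hit_point D a q - b)\<bar> \<le> norm (hit_point D a p - hit_point D a q)"
        using norm_triangle_ineq3[of "hit_point D a p - b" "hit_point D a q - b"] by simp
      ultimately have "\<bar>\<Phi> p - \<Phi> q\<bar> \<le> 2 * (C1 * norm (p - q))" using h unfolding \<Phi>_def by linarith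
      then show "dist (\<Phi> p) (\<Phi> q) \<le> 2 * C1 * dist p q" by (simp add: dist_norm mult.assoc)
    qed (use L1 in simp)
    have val: "\<bar>\<Phi> u - 2 * hit_time D z ui\<bar> \<le> \<gamma> / 2" if ui: "norm ui = 1" "dist u0 ui < \<tau>" and u: "norm u = 1" "dist ui u < \<rho>3" for ui u
    proof -
      \<comment> \<open>Compare each of the two legs of the broken line with the straight flight
        from \<open>z\<close> along \<open>ui\<close> and back.\<close>
      have "dist u0 u < \<rho>1" using dist_triangle[of u0 u ui] ui u \<rho>3 \<tau> by linarith
      moreover have uir: "dist u0 ui < \<rho>1" using ui \<tau> by linarith
      ultimately have "norm (hit_point D a u - hit_point D z ui) \<le> C1 * (norm (a - z) + norm (u - ui))"
        using lip1[OF a(1) a1 u(1) _ zf _ ui(1)] L1 by simp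
      also have "\<dots> \<le> C1 * (2 * x0)"
        using L1 a u \<epsilon> \<rho>3 by (intro mult_left_mono) (auto simp: dist_norm norm_minus_commute)
      finally have hh: "norm (hit_point D a u - hit_point D z ui) \<le> C1 * (2 * x0)" .
      have "0 < hit_time D z ui" using hits1[OF zf _ ui(1) uir] L1 by (auto simp: hits_def)
      then have nz: "norm (z - hit_point D z ui) = hit_time D z ui" using ui by (simp add: hit_point_def)
      have "(a - hit_point D a u) - (z - hit_point D z ui) = (a - z) - (hit_point D a u - hit_point D z ui)" by simp
      then have "norm ((a - hit_point D a u) - (z - hit_point D z ui)) \<le> norm (a - z) + norm (hit_point D a u - hit_point D z ui)"
        by (metis norm_triangle_ineq4)
      then have 1: "\<bar>norm (a - hit_point D a u) - hit_time D z ui\<bar> \<le> norm (a - z) + C1 * (2 * x0)"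
        using norm_triangle_ineq3[of "a - hit_point D a u" "z - hit_point D z ui"] hh nz by linarith
      have "(hit_point D a u - b) - (hit_point D z ui - z) = (hit_point D a u - hit_point D z ui) - (b - z)" by simp
      then have "norm ((hit_point D a u - b) - (hit_point D z ui - z)) \<le> norm (hit_point D a u - hit_point D z ui) + norm (b - z)"
        by (metis norm_triangle_ineq4)
      then have 2: "\<bar>norm (hit_point D a u - b) - hit_time D z ui\<bar> \<le> norm (b - z) + C1 * (2 * x0)"
        using norm_triangle_ineq3[of "hit_point D a u - b" "hit_point D z ui - z"] hh nz by (simp add: norm_minus_commute)
      have "norm (a - z) \<le> x0" "norm (b - z) \<le> x0" using a b \<epsilon> by (auto simp: dist_norm norm_minus_commute)
      then show ?thesis using 1 2 x0(2) unfolding \<Phi>_def by linarith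
    qed
    have "ennreal (v / M2) * emeasure (density lborel (indicator {\<alpha>..\<beta>})) I \<le> emeasure N I"
      if "I \<in> sets (density lborel (indicator {\<alpha>..\<beta>} :: real \<Rightarrow> ennreal))" for I
    proof -
      have I[measurable]: "I \<in> sets borel" using that by simp
      let ?A = "{u. norm u = 1 \<and> dist u0 u < 4 * \<tau> \<and> \<Phi> u \<in> I}"
      have "ennreal v * emeasure lborel (I \<inter> {\<alpha>..\<beta>}) \<le> ennreal M2 * emeasure sphere_measure ?A"
        unfolding v_def M2_def
      proof (rule sphere_measure_level_ge[OF \<Phi> I u0 \<tau>(1,3) lip _ u12(1-4) ne12 \<rho>3(1,2)])
        show "\<Phi> u \<le> \<alpha>" if "norm u = 1" "dist u1 u < \<rho>3" for u
          using abs_le_D1[OF val[OF u12(1,2) that]] unfolding \<alpha>_def by linarith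
        show "\<beta> \<le> \<Phi> u" if "norm u = 1" "dist u2 u < \<rho>3" for u
          using abs_le_D2[OF val[OF u12(3,4) that]] unfolding \<beta>_def by linarith
      qed (use L1 in simp)
      then have "ennreal (1 / M2) * (ennreal v * emeasure lborel (I \<inter> {\<alpha>..\<beta>})) \<le> emeasure sphere_measure ?A"
        using M2 by (rule ennreal_le_divideI)
      also have "\<dots> \<le> emeasure sphere_measure {u \<in> O1. \<Phi> u \<in> I}"
        using \<tau> by (intro emeasure_mono) (auto simp: O1_def)
      also have "\<dots> = emeasure N I"
      proof -
        have "emeasure N I = (\<integral>\<^sup>+u. indicator O1 u * indicator I (\<Phi> u) \<partial>sphere_measure)"
          unfolding N_def by (subst nn_integral_indicator[symmetric], simp, subst nn_integral_distr, simp_all add: nn_integral_density)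
        also have "\<dots> = (\<integral>\<^sup>+u. indicator {u \<in> O1. \<Phi> u \<in> I} u \<partial>sphere_measure)"
          by (intro nn_integral_cong) (auto simp: indicator_def)
        finally show ?thesis by simp
      qed
      also have "ennreal (1 / M2) * (ennreal v * emeasure lborel (I \<inter> {\<alpha>..\<beta>})) = ennreal (v / M2) * emeasure (density lborel (indicator {\<alpha>..\<beta>})) I"
        using v M2 by (simp add: emeasure_density mult.assoc[symmetric] ennreal_mult[symmetric] Int_commute flip: indicator_inter_arith)
      finally show ?thesis .
    qed
    then have "ennreal (v / M2) * (\<integral>\<^sup>+t. G t \<partial>density lborel (indicator {\<alpha>..\<beta>})) \<le> (\<integral>\<^sup>+t. G t \<partial>N)"
      by (intro nn_integral_le_of_emeasure_le) (auto simp: N_def)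
    also have "\<dots> = (\<integral>\<^sup>+u. indicator O1 u * G (\<Phi> u) \<partial>sphere_measure)"
      unfolding N_def by (simp add: nn_integral_distr nn_integral_density)
    finally show ?thesis by (simp add: nn_integral_density O1_def \<Phi>_def)
  qed
  obtain k1 where k1: "0 < k1" and k1': "\<And>x g. x \<in> Rt \<Longrightarrow> g \<in> borel_measurable borel \<Longrightarrow>
      ennreal k1 * (\<integral>\<^sup>+u. g u * indicator {u. norm u = 1 \<and> c1 \<le> nrm x \<bullet> u} u \<partial>sphere_measure) \<le>
      (\<integral>\<^sup>+\<eta>. g (V x \<eta>) \<partial>law)" by (rule V_lowerE[OF L1(3)]) (rule that)
  obtain k2 where k2: "0 < k2" and k2': "\<And>x g. x \<in> Rt \<Longrightarrow> g \<in> borel_measurable borel \<Longrightarrow>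
      ennreal k2 * (\<integral>\<^sup>+u. g u * indicator {u. norm u = 1 \<and> c2 \<le> nrm x \<bullet> u} u \<partial>sphere_measure) \<le>
      (\<integral>\<^sup>+\<eta>. g (V x \<eta>) \<partial>law)" by (rule V_lowerE[OF L2(3)]) (rule that)
  have step2: "ennreal (k2 / M1) * (\<integral>\<^sup>+b. g b (s - norm (w' - b)) \<partial>lam) \<le> K g w' s"
    if w': "w' \<in> Rt" "dist w w' < \<rho>5" and g: "meas2 g" for w' g s
  proof -
    note [measurable (raw)] = meas2D[OF g]
    have w'f: "w' \<in> frontier D" and ww': "dist w w' < \<rho>2" using w' Rt_sub \<rho>5 L2 by auto
    have "ennreal (1 / M1) * (\<integral>\<^sup>+b. g b (s - norm (w' - b)) \<partial>lam) \<le>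
      (\<integral>\<^sup>+u. indicator {u. norm u = 1 \<and> dist v0 u < \<rho>2} u * g (hit_point D w' u) (s - norm (w' - hit_point D w' u)) \<partial>sphere_measure)"
      by (rule b1[OF w'f w'(2)]) measurable
    also have "\<dots> \<le> (\<integral>\<^sup>+u. g (hit_point D w' u) (s - hit_time D w' u) * indicator {u. norm u = 1 \<and> c2 \<le> nrm w' \<bullet> u} u \<partial>sphere_measure)"
    proof (rule nn_integral_mono)
      fix u
      show "indicator {u. norm u = 1 \<and> dist v0 u < \<rho>2} u * g (hit_point D w' u) (s - norm (w' - hit_point D w' u)) \<le>
        g (hit_point D w' u) (s - hit_time D w' u) * indicator {u. norm u = 1 \<and> c2 \<le> nrm w' \<bullet> u} u"
      proof (cases "norm u = 1 \<and> dist v0 u < \<rho>2")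
        case True
        then have "0 < hit_time D w' u" using hits2[OF w'f ww'] by (auto simp: hits_def)
        then have "norm (w' - hit_point D w' u) = hit_time D w' u" using True by (simp add: hit_point_def)
        then show ?thesis using True low2[OF w'(1) ww'] by (auto simp: indicator_def)
      qed (simp add: indicator_def)
    qed
    finally have "ennreal k2 * (ennreal (1 / M1) * (\<integral>\<^sup>+b. g b (s - norm (w' - b)) \<partial>lam)) \<le> ennreal k2 * \<dots>"
      by (rule mult_left_mono) simp
    also have "\<dots> \<le> (\<integral>\<^sup>+\<eta>. g (hit_point D w' (V w' \<eta>)) (s - hit_time D w' (V w' \<eta>)) \<partial>law)"
      by (rule k2'[OF w'(1)]) measurable
    also have "\<dots> = K g w' s" by (simp add: K_def nxt_def len_def)
    finally show ?thesis using k2 M1 by (simp add: mult.assoc[symmetric] ennreal_mult[symmetric])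
  qed
  \<comment> \<open>Bound the second flight by \<open>lam\<close> through \<open>step2\<close>,
    exchange the two integrals so that \<open>b\<close> is fixed while \<open>u\<close> varies, and
    then apply \<open>b2\<close>.\<close>
  have main: "ennreal (k1 * (k2 / M1) * (v / M2)) * (\<integral>\<^sup>+b. (\<integral>\<^sup>+t. indicator {\<alpha>..\<beta>} t * g b (s - t) \<partial>lborel) \<partial>lam) \<le> (K ^^ 2) g a s"
    if a: "a \<in> Rt" "dist z a < \<epsilon>" and g: "meas2 g" for a s g
  proof -
    note [measurable (raw)] = meas2D[OF g] meas2D[OF meas2_K[OF g]]
    interpret lam: finite_measure lam by (rule lam_fin)
    interpret pr: pair_sigma_finite "sphere_measure :: 'a measure" lam ..
    have af: "a \<in> frontier D" and az: "dist z a < \<rho>1" using a Rt_sub \<epsilon> by auto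
    define O1 where "O1 = {u. norm u = 1 \<and> dist u0 u < \<rho>1}"
    have O1[measurable]: "O1 \<in> sets borel" unfolding O1_def by measurable
    define \<Phi> where "\<Phi> b u = norm (a - hit_point D a u) + norm (hit_point D a u - b)" for b u
    have "ennreal (v / M2) * (\<integral>\<^sup>+b. (\<integral>\<^sup>+t. indicator {\<alpha>..\<beta>} t * g b (s - t) \<partial>lborel) \<partial>lam) =
       (\<integral>\<^sup>+b. ennreal (v / M2) * (\<integral>\<^sup>+t. indicator {\<alpha>..\<beta>} t * g b (s - t) \<partial>lborel) \<partial>lam)"
      by (subst nn_integral_cmult) (auto intro!: lborel.borel_measurable_nn_integral simp: lam_sets cong: measurable_cong_sets, measurable)
    also have "\<dots> \<le> (\<integral>\<^sup>+b. (\<integral>\<^sup>+u. indicator O1 u * g b (s - \<Phi> b u) \<partial>sphere_measure) \<partial>lam)"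
    proof (rule nn_integral_mono_AE, use lam_AE in eventually_elim)
      fix b assume b: "b \<in> Rt \<and> dist z b < \<epsilon>"
      show "ennreal (v / M2) * (\<integral>\<^sup>+t. indicator {\<alpha>..\<beta>} t * g b (s - t) \<partial>lborel) \<le>
         (\<integral>\<^sup>+u. indicator O1 u * g b (s - \<Phi> b u) \<partial>sphere_measure)"
        unfolding O1_def \<Phi>_def using b by (intro b2[OF af a(2)]) (auto, measurable)
    qed
    also have "\<dots> = (\<integral>\<^sup>+u. (\<integral>\<^sup>+b. indicator O1 u * g b (s - \<Phi> b u) \<partial>lam) \<partial>sphere_measure)"
      unfolding \<Phi>_def by (intro pr.Fubini') measurable
    also have "\<dots> = (\<integral>\<^sup>+u. indicator O1 u * (\<integral>\<^sup>+b. g b ((s - norm (a - hit_point D a u)) - norm (hit_point D a u - b)) \<partial>lam) \<partial>sphere_measure)"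
      unfolding \<Phi>_def by (intro nn_integral_cong, subst nn_integral_cmult[symmetric]) (measurable, simp add: diff_diff_eq)
    finally have 1: "ennreal (v / M2) * (\<integral>\<^sup>+b. (\<integral>\<^sup>+t. indicator {\<alpha>..\<beta>} t * g b (s - t) \<partial>lborel) \<partial>lam) \<le> \<dots>" .
    have "ennreal (k2 / M1) * (\<integral>\<^sup>+u. indicator O1 u * (\<integral>\<^sup>+b. g b ((s - norm (a - hit_point D a u)) - norm (hit_point D a u - b)) \<partial>lam) \<partial>sphere_measure) =
      (\<integral>\<^sup>+u. ennreal (k2 / M1) * (indicator O1 u * (\<integral>\<^sup>+b. g b ((s - norm (a - hit_point D a u)) - norm (hit_point D a u - b)) \<partial>lam)) \<partial>sphere_measure)"
    proof (subst nn_integral_cmult)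
      have [measurable]: "(\<lambda>u. \<integral>\<^sup>+b. g b (s - norm (a - hit_point D a u) - norm (hit_point D a u - b)) \<partial>lam) \<in> borel_measurable sphere_measure"
        by (intro lam.borel_measurable_nn_integral) measurable
      show "(\<lambda>u. indicator O1 u * (\<integral>\<^sup>+b. g b (s - norm (a - hit_point D a u) - norm (hit_point D a u - b)) \<partial>lam)) \<in> borel_measurable sphere_measure"
        by measurable
    qed simp
    also have "\<dots> \<le> (\<integral>\<^sup>+u. K g (hit_point D a u) (s - hit_time D a u) * indicator {u. norm u = 1 \<and> c1 \<le> nrm a \<bullet> u} u \<partial>sphere_measure)"
    proof (rule nn_integral_mono_AE, use bad_null[of a] in eventually_elim)
      fix u assume bn: "\<forall>t. t \<noteq> 0 \<longrightarrow> a + t *\<^sub>R u \<in> frontier D \<longrightarrow> a + t *\<^sub>R u \<in> Rt \<and> nrm (a + t *\<^sub>R u) \<bullet> u \<noteq> 0"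
      show "ennreal (k2 / M1) * (indicator O1 u * (\<integral>\<^sup>+b. g b ((s - norm (a - hit_point D a u)) - norm (hit_point D a u - b)) \<partial>lam)) \<le>
        K g (hit_point D a u) (s - hit_time D a u) * indicator {u. norm u = 1 \<and> c1 \<le> nrm a \<bullet> u} u"
      proof (cases "u \<in> O1")
        case True
        then have u: "norm u = 1" "dist u0 u < \<rho>1" by (auto simp: O1_def)
        have h: "hits D a u w \<rho>5" by (rule hits1[OF af az u])
        then have hR: "hit_point D a u \<in> Rt" using bn by (auto simp: hits_def hit_point_def)
        have hn: "norm (a - hit_point D a u) = hit_time D a u" using h u by (simp add: hits_def hit_point_def)
        have "ennreal (k2 / M1) * (\<integral>\<^sup>+b. g b ((s - hit_time D a u) - norm (hit_point D a u - b)) \<partial>lam) \<le> K g (hit_point D a u) (s - hit_time D a u)"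
          using h by (intro step2[OF hR _ g]) (simp add: hits_def)
        then show ?thesis using True u low1[OF a(1) az u] by (simp add: hn)
      qed simp
    qed
    finally have "ennreal k1 * (ennreal (k2 / M1) * (\<integral>\<^sup>+u. indicator O1 u * (\<integral>\<^sup>+b. g b ((s - norm (a - hit_point D a u)) - norm (hit_point D a u - b)) \<partial>lam) \<partial>sphere_measure)) \<le> ennreal k1 * \<dots>"
      by (rule mult_left_mono) simp
    also have "\<dots> \<le> (\<integral>\<^sup>+\<eta>. K g (hit_point D a (V a \<eta>)) (s - hit_time D a (V a \<eta>)) \<partial>law)"
      by (rule k1'[OF a(1)]) measurable
    also have "\<dots> = (K ^^ 2) g a s" by (simp add: K_def[of "K g"] nxt_def len_def numeral_2_eq_2)
    finally have 2: "ennreal k1 * (ennreal (k2 / M1) * (\<integral>\<^sup>+u. indicator O1 u * (\<integral>\<^sup>+b. g b ((s - norm (a - hit_point D a u)) - norm (hit_point D a u - b)) \<partial>lam) \<partial>sphere_measure)) \<le> (K ^^ 2) g a s" .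
    have "ennreal (k1 * (k2 / M1) * (v / M2)) * (\<integral>\<^sup>+b. (\<integral>\<^sup>+t. indicator {\<alpha>..\<beta>} t * g b (s - t) \<partial>lborel) \<partial>lam) =
      ennreal k1 * (ennreal (k2 / M1) * (ennreal (v / M2) * (\<integral>\<^sup>+b. (\<integral>\<^sup>+t. indicator {\<alpha>..\<beta>} t * g b (s - t) \<partial>lborel) \<partial>lam)))"
      using k1 k2 M1 v M2 by (simp add: mult.assoc[symmetric] ennreal_mult[symmetric])
    also have "\<dots> \<le> ennreal k1 * (ennreal (k2 / M1) * (\<integral>\<^sup>+u. indicator O1 u * (\<integral>\<^sup>+b. g b ((s - norm (a - hit_point D a u)) - norm (hit_point D a u - b)) \<partial>lam) \<partial>sphere_measure))"
      using 1 by (intro mult_left_mono) auto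
    also note 2
    finally show ?thesis .
  qed
  have c: "0 < k1 * (k2 / M1) * (v / M2)" using k1 k2 M1 v M2 by simp
  show ?thesis
    by (rule that[OF zR \<epsilon>(1) lam_sets lam_fin lam_pos lam_AE \<alpha>\<beta> c main])
qed

end

section \<open>Doeblin condition and contraction\<close>

lemma nn_integral_shift:
  fixes G :: "real \<Rightarrow> ennreal"
  assumes "G \<in> borel_measurable borel"
  shows "(\<integral>\<^sup>+t. G (c + t) \<partial>lborel) = (\<integral>\<^sup>+t. G t \<partial>lborel)"
  using nn_integral_real_affine[of G 1 c] assms by simp

text \<open>The convolution of the two interval indicators is at least \<open>\<eta>\<close> on the
  sum of the intervals shortened by \<open>\<eta>\<close> at both ends.\<close>

lemma interval_convolution_ge:
  fixes G :: "real \<Rightarrow> ennreal"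
  assumes "0 \<le> \<eta>" "\<alpha> + \<eta> \<le> \<beta>" "\<alpha>' + \<eta> \<le> \<beta>'" and G[measurable]: "G \<in> borel_measurable borel"
  shows "ennreal \<eta> * (\<integral>\<^sup>+w. indicator {\<alpha> + \<alpha>' + \<eta>..\<beta> + \<beta>' - \<eta>} w * G w \<partial>lborel) \<le>
    (\<integral>\<^sup>+t. indicator {\<alpha>..\<beta>} t * (\<integral>\<^sup>+t'. indicator {\<alpha>'..\<beta>'} t' * G (t + t') \<partial>lborel) \<partial>lborel)"
proof -
  have inner: "(\<integral>\<^sup>+t'. indicator {\<alpha>'..\<beta>'} t' * G (t + t') \<partial>lborel) = (\<integral>\<^sup>+w. indicator {\<alpha>'..\<beta>'} (w - t) * G w \<partial>lborel)" for t
    using nn_integral_shift[of "\<lambda>w. indicator {\<alpha>'..\<beta>'} (w - t) * G w" t] by simp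
  have len: "ennreal \<eta> \<le> (\<integral>\<^sup>+t. indicator {\<alpha>..\<beta>} t * indicator {\<alpha>'..\<beta>'} (w - t) \<partial>lborel)"
    if w: "w \<in> {\<alpha> + \<alpha>' + \<eta>..\<beta> + \<beta>' - \<eta>}" for w
  proof -
    have "\<eta> \<le> min \<beta> (w - \<alpha>') - max \<alpha> (w - \<beta>')" using w assms by auto
    then have "ennreal \<eta> \<le> emeasure lborel {max \<alpha> (w - \<beta>')..min \<beta> (w - \<alpha>')}"
      using assms(1) by (subst emeasure_lborel_Icc) (auto intro: ennreal_leI)
    also have "\<dots> = (\<integral>\<^sup>+t. indicator {max \<alpha> (w - \<beta>')..min \<beta> (w - \<alpha>')} t \<partial>lborel)" by simp
    also have "\<dots> = (\<integral>\<^sup>+t. indicator {\<alpha>..\<beta>} t * indicator {\<alpha>'..\<beta>'} (w - t) \<partial>lborel)"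
      by (intro nn_integral_cong) (auto simp: indicator_def)
    finally show ?thesis .
  qed
  have "ennreal \<eta> * (\<integral>\<^sup>+w. indicator {\<alpha> + \<alpha>' + \<eta>..\<beta> + \<beta>' - \<eta>} w * G w \<partial>lborel) =
     (\<integral>\<^sup>+w. ennreal \<eta> * (indicator {\<alpha> + \<alpha>' + \<eta>..\<beta> + \<beta>' - \<eta>} w * G w) \<partial>lborel)"
    by (intro nn_integral_cmult[symmetric]) measurable
  also have "\<dots> \<le> (\<integral>\<^sup>+w. (\<integral>\<^sup>+t. indicator {\<alpha>..\<beta>} t * indicator {\<alpha>'..\<beta>'} (w - t) \<partial>lborel) * G w \<partial>lborel)"
    using len by (intro nn_integral_mono) (auto simp: indicator_def[of "{\<alpha> + \<alpha>' + \<eta>..\<beta> + \<beta>' - \<eta>}"] intro!: mult_right_mono)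
  also have "\<dots> = (\<integral>\<^sup>+w. (\<integral>\<^sup>+t. indicator {\<alpha>..\<beta>} t * (indicator {\<alpha>'..\<beta>'} (w - t) * G w) \<partial>lborel) \<partial>lborel)"
    by (intro nn_integral_cong, subst nn_integral_multc[symmetric]) (auto simp: mult.assoc)
  also have "\<dots> = (\<integral>\<^sup>+t. (\<integral>\<^sup>+w. indicator {\<alpha>..\<beta>} t * (indicator {\<alpha>'..\<beta>'} (w - t) * G w) \<partial>lborel) \<partial>lborel)"
    by (rule lborel_pair.Fubini') measurable
  also have "\<dots> = (\<integral>\<^sup>+t. indicator {\<alpha>..\<beta>} t * (\<integral>\<^sup>+t'. indicator {\<alpha>'..\<beta>'} t' * G (t + t') \<partial>lborel) \<partial>lborel)"
    unfolding inner by (intro nn_integral_cong nn_integral_cmult) measurable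
  finally show ?thesis .
qed

context stochastic_table
begin

section \<open>Minorization over long time intervals from every starting point\<close>

text \<open>The integral against the minorizing product measure: \<open>lam\<close> for the point,
  Lebesgue measure on \<open>{\<alpha>..\<beta>}\<close> for the time elapsed.\<close>

definition strip_int :: "'a measure \<Rightarrow> real \<Rightarrow> real \<Rightarrow> ('a \<Rightarrow> real \<Rightarrow> ennreal) \<Rightarrow> real \<Rightarrow> ennreal" where
  "strip_int lam \<alpha> \<beta> g s = (\<integral>\<^sup>+b. (\<integral>\<^sup>+t. indicator {\<alpha>..\<beta>} t * g b (s - t) \<partial>lborel) \<partial>lam)"

lemma meas2_strip:
  assumes g: "meas2 g" and [measurable]: "h \<in> borel_measurable M" "k \<in> borel_measurable M"
  shows "(\<lambda>x. \<integral>\<^sup>+t'. indicator {\<alpha>..\<beta>} t' * g (k x) (s - (h x + t')) \<partial>lborel) \<in> borel_measurable M"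
proof -
  have "(\<lambda>(x, t'). indicator {\<alpha>..\<beta>} t' * g (k x) (s - (h x + t'))) \<in> borel_measurable (M \<Otimes>\<^sub>M lborel)"
    unfolding split_beta'
    apply (rule borel_measurable_times_ennreal)
    subgoal by measurable
    apply (rule meas2D[OF g])
    subgoal by measurable
    subgoal by measurable
    done
  from lborel.borel_measurable_nn_integral[OF this] show ?thesis .
qed

lemma strip_swap:
  assumes g: "meas2 g" and sl[measurable_cong]: "sets lam = sets borel" and fl: "finite_measure lam"
  shows "(\<integral>\<^sup>+b. (\<integral>\<^sup>+t. indicator {\<alpha>..\<beta>} t * (\<integral>\<^sup>+t'. indicator {\<alpha>'..\<beta>'} t' * g b (s - (t + t')) \<partial>lborel) \<partial>lborel) \<partial>lam) =
    (\<integral>\<^sup>+t. indicator {\<alpha>..\<beta>} t * strip_int lam \<alpha>' \<beta>' g (s - t) \<partial>lborel)"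
proof -
  interpret lam: finite_measure lam by fact
  interpret pl: pair_sigma_finite lborel lam ..
  have sw: "strip_int lam \<alpha>' \<beta>' g (s - t) = (\<integral>\<^sup>+b. (\<integral>\<^sup>+t'. indicator {\<alpha>'..\<beta>'} t' * g b (s - (t + t')) \<partial>lborel) \<partial>lam)" for t
    unfolding strip_int_def by (simp add: algebra_simps)
  have 1: "(\<lambda>(t, b). indicator {\<alpha>..\<beta>} t * (\<integral>\<^sup>+t'. indicator {\<alpha>'..\<beta>'} t' * g b (s - (t + t')) \<partial>lborel)) \<in> borel_measurable (lborel \<Otimes>\<^sub>M lam)"
    unfolding split_beta'
    apply (rule borel_measurable_times_ennreal[OF _ meas2_strip[OF g]])
    subgoal by measurable
    subgoal by measurable
    subgoal by measurable
    done
  have 2: "(\<lambda>b. \<integral>\<^sup>+t'. indicator {\<alpha>'..\<beta>'} t' * g b (s - (t + t')) \<partial>lborel) \<in> borel_measurable lam" for t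
    apply (rule meas2_strip[OF g, of "\<lambda>_. t"])
    subgoal by measurable
    subgoal by measurable
    done
  show ?thesis unfolding sw pl.Fubini'[OF 1] by (intro nn_integral_cong nn_integral_cmult 2)
qed

text \<open>
  Each further loop convolves the elapsed time with a uniform distribution, which lengthens the
  interval by a fixed amount.
\<close>

lemma minorization_near:
  obtains z \<epsilon> lam where "z \<in> Rt" "0 < \<epsilon>" "sets lam = sets borel" "finite_measure lam" "emeasure lam UNIV \<noteq> 0"
    "AE b in lam. b \<in> Rt"
    "\<And>L. \<exists>\<alpha> \<beta> c n. 0 < c \<and> L \<le> \<beta> - \<alpha> \<and> (\<forall>a\<in>Rt. dist z a < \<epsilon> \<longrightarrow> (\<forall>g s. meas2 g \<longrightarrow>
      ennreal c * strip_int lam \<alpha> \<beta> g s \<le> (K ^^ n) g a s))"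
proof -
  obtain z \<epsilon> lam \<alpha> \<beta> c where z: "z \<in> Rt" "0 < \<epsilon>" and sl[measurable_cong]: "sets lam = sets borel"
    and fl: "finite_measure lam" and l0: "emeasure lam UNIV \<noteq> 0"
    and ae: "AE b in lam. b \<in> Rt \<and> dist z b < \<epsilon>" and \<alpha>\<beta>: "\<alpha> < \<beta>" and c: "0 < c"
    and base: "\<And>a s g. a \<in> Rt \<Longrightarrow> dist z a < \<epsilon> \<Longrightarrow> meas2 g \<Longrightarrow>
      ennreal c * (\<integral>\<^sup>+b. (\<integral>\<^sup>+t. indicator {\<alpha>..\<beta>} t * g b (s - t) \<partial>lborel) \<partial>lam) \<le> (K ^^ 2) g a s"
    by (rule loop_minorization) (rule that)
  interpret lam: finite_measure lam by fact
  define \<Lambda> where "\<Lambda> = measure lam UNIV"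
  have sp: "space lam = UNIV" using sets_eq_imp_space_eq[OF sl] by simp
  have \<Lambda>: "emeasure lam UNIV = ennreal \<Lambda>" by (simp add: \<Lambda>_def lam.emeasure_eq_measure)
  then have \<Lambda>0: "0 < \<Lambda>" using l0 by (simp add: zero_less_iff_neq_zero[symmetric])
  \<comment> \<open>A quarter of the basic length: each additional loop then lengthens the interval
    by \<open>(\<beta> - \<alpha>) - 2 * \<eta>\<close>, which is half the basic length.\<close>
  define \<eta> where "\<eta> = (\<beta> - \<alpha>) / 4"
  have step: "\<exists>\<alpha>' \<beta>' c'. 0 < c' \<and> \<beta>' - \<alpha>' = (\<beta> - \<alpha>) * (1 + k / 2) \<and> (\<forall>a\<in>Rt. dist z a < \<epsilon> \<longrightarrow> (\<forall>g s. meas2 g \<longrightarrow>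
      ennreal c' * strip_int lam \<alpha>' \<beta>' g s \<le> (K ^^ (2 + 2 * k)) g a s))" for k :: nat
  proof (induction k)
    case 0
    show ?case using base c by (intro exI[of _ \<alpha>] exI[of _ \<beta>] exI[of _ c]) (simp add: strip_int_def)
  next
    case (Suc k)
    then obtain \<alpha>' \<beta>' c' where c': "0 < c'" and d: "\<beta>' - \<alpha>' = (\<beta> - \<alpha>) * (1 + k / 2)"
      and IH: "\<And>a g s. a \<in> Rt \<Longrightarrow> dist z a < \<epsilon> \<Longrightarrow> meas2 g \<Longrightarrow> ennreal c' * strip_int lam \<alpha>' \<beta>' g s \<le> (K ^^ (2 + 2 * k)) g a s"
      by (elim exE conjE) (rule that, auto)
    have "(\<beta> - \<alpha>) * 1 \<le> (\<beta> - \<alpha>) * (1 + k / 2)" using \<alpha>\<beta> by (intro mult_left_mono) auto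
    then have "\<beta> - \<alpha> \<le> \<beta>' - \<alpha>'" using d by simp
    moreover have \<eta>4: "4 * \<eta> = \<beta> - \<alpha>" by (simp add: \<eta>_def)
    ultimately have \<eta>: "0 < \<eta>" "\<alpha> + \<eta> \<le> \<beta>" "\<alpha>' + \<eta> \<le> \<beta>'" using \<alpha>\<beta> by linarith+
    show ?case
    proof (rule exI[of _ "\<alpha> + \<alpha>' + \<eta>"], rule exI[of _ "\<beta> + \<beta>' - \<eta>"], rule exI[of _ "c * (c' * (\<Lambda> * \<eta>))"], intro conjI ballI impI allI)
      show "0 < c * (c' * (\<Lambda> * \<eta>))" using c c' \<Lambda>0 \<eta> by simp
      show "\<beta> + \<beta>' - \<eta> - (\<alpha> + \<alpha>' + \<eta>) = (\<beta> - \<alpha>) * (1 + real (Suc k) / 2)"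
        using d by (simp add: \<eta>_def field_simps)
      fix a g s assume a: "a \<in> Rt" "dist z a < \<epsilon>" and g: "meas2 g"
      note [measurable (raw)] = meas2D[OF g]
      let ?h = "(K ^^ (2 + 2 * k)) g"
      have h: "meas2 ?h" by (rule meas2_K_iter[OF g])
      have Smeas[measurable]: "(\<lambda>t. strip_int lam \<alpha>' \<beta>' g (s - t)) \<in> borel_measurable borel"
        unfolding strip_int_def by measurable
      define S where "S = strip_int lam (\<alpha> + \<alpha>' + \<eta>) (\<beta> + \<beta>' - \<eta>) g s"
      define X where "X = (\<integral>\<^sup>+t. indicator {\<alpha>..\<beta>} t * strip_int lam \<alpha>' \<beta>' g (s - t) \<partial>lborel)"
      have "ennreal \<eta> * S =
         (\<integral>\<^sup>+b. ennreal \<eta> * (\<integral>\<^sup>+t. indicator {\<alpha> + \<alpha>' + \<eta>..\<beta> + \<beta>' - \<eta>} t * g b (s - t) \<partial>lborel) \<partial>lam)"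
        unfolding S_def strip_int_def by (intro nn_integral_cmult[symmetric]) measurable
      also have "\<dots> \<le> (\<integral>\<^sup>+b. (\<integral>\<^sup>+t. indicator {\<alpha>..\<beta>} t * (\<integral>\<^sup>+t'. indicator {\<alpha>'..\<beta>'} t' * g b (s - (t + t')) \<partial>lborel) \<partial>lborel) \<partial>lam)"
      proof (rule nn_integral_mono)
        fix b
        have "(\<lambda>w. g b (s - w)) \<in> borel_measurable borel" by measurable
        from interval_convolution_ge[OF less_imp_le[OF \<eta>(1)] \<eta>(2,3) this]
        show "ennreal \<eta> * (\<integral>\<^sup>+t. indicator {\<alpha> + \<alpha>' + \<eta>..\<beta> + \<beta>' - \<eta>} t * g b (s - t) \<partial>lborel) \<le>
          (\<integral>\<^sup>+t. indicator {\<alpha>..\<beta>} t * (\<integral>\<^sup>+t'. indicator {\<alpha>'..\<beta>'} t' * g b (s - (t + t')) \<partial>lborel) \<partial>lborel)" .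
      qed
      also have "\<dots> = X" unfolding X_def by (rule strip_swap[OF g sl fl])
      finally have 1: "ennreal \<eta> * S \<le> X" .
      have inner: "(\<integral>\<^sup>+t. indicator {\<alpha>..\<beta>} t * (ennreal c' * strip_int lam \<alpha>' \<beta>' g (s - t)) \<partial>lborel) = ennreal c' * X"
      proof -
        have "(\<integral>\<^sup>+t. indicator {\<alpha>..\<beta>} t * (ennreal c' * strip_int lam \<alpha>' \<beta>' g (s - t)) \<partial>lborel) =
           (\<integral>\<^sup>+t. ennreal c' * (indicator {\<alpha>..\<beta>} t * strip_int lam \<alpha>' \<beta>' g (s - t)) \<partial>lborel)"
          by (simp only: mult.left_commute)
        also have "\<dots> = ennreal c' * X"
          unfolding X_def by (rule nn_integral_cmult) measurable
        finally show ?thesis .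
      qed
      \<comment> \<open>The induction hypothesis bounds the remaining loops by a quantity that does
        not involve their starting point \<open>b\<close>, so the integral over \<open>b\<close>
        contributes just the mass \<open>\<Lambda>\<close>.\<close>
      have "ennreal c' * X * ennreal \<Lambda> = (\<integral>\<^sup>+b. ennreal c' * X \<partial>lam)" by (simp add: \<Lambda>[symmetric] sp)
      also have "\<dots> = (\<integral>\<^sup>+b. (\<integral>\<^sup>+t. indicator {\<alpha>..\<beta>} t * (ennreal c' * strip_int lam \<alpha>' \<beta>' g (s - t)) \<partial>lborel) \<partial>lam)"
        unfolding inner ..
      also have "\<dots> \<le> (\<integral>\<^sup>+b. (\<integral>\<^sup>+t. indicator {\<alpha>..\<beta>} t * ?h b (s - t) \<partial>lborel) \<partial>lam)"
      proof (rule nn_integral_mono_AE, use ae in eventually_elim)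
        fix b assume b: "b \<in> Rt \<and> dist z b < \<epsilon>"
        show "(\<integral>\<^sup>+t. indicator {\<alpha>..\<beta>} t * (ennreal c' * strip_int lam \<alpha>' \<beta>' g (s - t)) \<partial>lborel) \<le> (\<integral>\<^sup>+t. indicator {\<alpha>..\<beta>} t * ?h b (s - t) \<partial>lborel)"
          using b by (intro nn_integral_mono mult_left_mono IH g) auto
      qed
      finally have 2: "ennreal c' * X * ennreal \<Lambda> \<le> (\<integral>\<^sup>+b. (\<integral>\<^sup>+t. indicator {\<alpha>..\<beta>} t * ?h b (s - t) \<partial>lborel) \<partial>lam)" .
      have "ennreal (c * (c' * (\<Lambda> * \<eta>))) * S = ennreal c * (ennreal c' * (ennreal \<eta> * S) * ennreal \<Lambda>)"
        using c c' \<Lambda>0 \<eta> by (simp add: ennreal_mult mult_ac)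
      also have "\<dots> \<le> ennreal c * (ennreal c' * X * ennreal \<Lambda>)"
        by (intro mult_left_mono mult_right_mono 1) auto
      also have "\<dots> \<le> ennreal c * (\<integral>\<^sup>+b. (\<integral>\<^sup>+t. indicator {\<alpha>..\<beta>} t * ?h b (s - t) \<partial>lborel) \<partial>lam)"
        by (intro mult_left_mono 2) auto
      also have "\<dots> \<le> (K ^^ 2) ?h a s" by (rule base[OF a h])
      also have "\<dots> = (K ^^ (2 + 2 * Suc k)) g a s"
        using K_iter_add[of 2 "2 + 2 * k" g] by simp
      finally show "ennreal (c * (c' * (\<Lambda> * \<eta>))) * strip_int lam (\<alpha> + \<alpha>' + \<eta>) (\<beta> + \<beta>' - \<eta>) g s \<le> (K ^^ (2 + 2 * Suc k)) g a s"
        unfolding S_def .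
    qed
  qed
  show ?thesis
  proof (rule that[OF z sl fl l0])
    show "AE b in lam. b \<in> Rt" using ae by auto
    fix L
    obtain k :: nat where k: "L * 2 / (\<beta> - \<alpha>) \<le> k" using real_arch_simple by blast
    then have "L \<le> (\<beta> - \<alpha>) * (k / 2)" using \<alpha>\<beta> by (simp add: field_simps)
    also have "\<dots> \<le> (\<beta> - \<alpha>) * (1 + k / 2)" using \<alpha>\<beta> by (intro mult_left_mono) auto
    finally show "\<exists>\<alpha> \<beta> c n. 0 < c \<and> L \<le> \<beta> - \<alpha> \<and> (\<forall>a\<in>Rt. dist z a < \<epsilon> \<longrightarrow> (\<forall>g s. meas2 g \<longrightarrow>
      ennreal c * strip_int lam \<alpha> \<beta> g s \<le> (K ^^ n) g a s))"
      using step[of k] by metis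
  qed
qed

text \<open>Approaching \<open>z\<close> takes a random time between 0 and \<open>N * diam\<close>.
  Trimming the interval from below by \<open>N * diam\<close> leaves a part common to all the
  shifted intervals; since the interval near \<open>z\<close> can be taken as long as desired, any
  length \<open>L\<close> survives.\<close>

lemma minorization:
  obtains lam A B \<delta> M where "sets lam = sets borel" "finite_measure lam" "emeasure lam UNIV \<noteq> 0"
    "AE b in lam. b \<in> Rt" "L \<le> B - A" "0 < \<delta>"
    "\<And>x. x \<in> Rt \<Longrightarrow> \<exists>n\<le>M. \<forall>g s. meas2 g \<longrightarrow> ennreal \<delta> * strip_int lam A B g s \<le> (K ^^ n) g x s"
proof -
  obtain z \<epsilon> lam where z: "z \<in> Rt" "0 < \<epsilon>" and sl[measurable_cong]: "sets lam = sets borel"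
    and fl: "finite_measure lam" and l0: "emeasure lam UNIV \<noteq> 0" and ae: "AE b in lam. b \<in> Rt"
    and near: "\<And>L. \<exists>\<alpha> \<beta> c n. 0 < c \<and> L \<le> \<beta> - \<alpha> \<and> (\<forall>a\<in>Rt. dist z a < \<epsilon> \<longrightarrow> (\<forall>g s. meas2 g \<longrightarrow>
      ennreal c * strip_int lam \<alpha> \<beta> g s \<le> (K ^^ n) g a s))"
    by (rule minorization_near) (rule that)
  have zf: "z \<in> frontier D" using z Rt_sub by auto
  obtain N c0 where c0: "0 < c0" and N: "\<And>x. x \<in> Rt \<Longrightarrow> \<exists>n\<le>N. \<forall>s. ennreal c0 \<le> (K ^^ n) (in_set (ball z \<epsilon>)) x s"
    by (rule reach_uniform[OF zf z(2)]) (rule that)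
  obtain \<alpha> \<beta> c n where c: "0 < c" and L: "L + N * diam \<le> \<beta> - \<alpha>"
    and mn: "\<And>a g s. a \<in> Rt \<Longrightarrow> dist z a < \<epsilon> \<Longrightarrow> meas2 g \<Longrightarrow> ennreal c * strip_int lam \<alpha> \<beta> g s \<le> (K ^^ n) g a s"
  proof -
    from near[of "L + N * diam"] obtain \<alpha> \<beta> c n where 1: "0 < c" "L + N * diam \<le> \<beta> - \<alpha>"
      "\<forall>a\<in>Rt. dist z a < \<epsilon> \<longrightarrow> (\<forall>g s. meas2 g \<longrightarrow> ennreal c * strip_int lam \<alpha> \<beta> g s \<le> (K ^^ n) g a s)"
      by (elim exE conjE)
    show ?thesis by (rule that[OF 1(1,2)]) (use 1(3) in blast)
  qed
  show ?thesis
  proof (rule that[OF sl fl l0 ae])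
    show "L \<le> \<beta> - (\<alpha> + N * diam)" using L by simp
    show "0 < c * c0" using c c0 by simp
    fix x assume x: "x \<in> Rt"
    from N[OF x] obtain n0 where n0: "n0 \<le> N" "\<And>s. ennreal c0 \<le> (K ^^ n0) (in_set (ball z \<epsilon>)) x s" by blast
    show "\<exists>n'\<le>N + n. \<forall>g s. meas2 g \<longrightarrow> ennreal (c * c0) * strip_int lam (\<alpha> + N * diam) \<beta> g s \<le> (K ^^ n') g x s"
    proof (intro exI[of _ "n0 + n"] conjI allI impI)
      fix g s assume g: "meas2 g"
      note [measurable (raw)] = meas2D[OF g]
      \<comment> \<open>Free of the intermediate point and of the remaining time, so it can be
        pulled out of the iterated operator.\<close>
      define J where "J = ennreal c * strip_int lam (\<alpha> + N * diam) \<beta> g s"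
      have le: "J * in_set (ball z \<epsilon>) y \<sigma> \<le> (K ^^ n) g y \<sigma>" if y: "y \<in> Rt" and \<sigma>: "s - n0 * diam \<le> \<sigma>" "\<sigma> \<le> s" for y \<sigma>
      proof (cases "y \<in> ball z \<epsilon>")
        case True
        have "real n0 * diam \<le> N * diam" using n0 diam_pos by (intro mult_right_mono) auto
        then have d: "0 \<le> s - \<sigma>" "s - \<sigma> \<le> N * diam" using \<sigma> by auto
        have "(\<integral>\<^sup>+t. indicator {\<alpha> + N * diam..\<beta>} t * g b (s - t) \<partial>lborel) \<le> (\<integral>\<^sup>+t. indicator {\<alpha>..\<beta>} t * g b (\<sigma> - t) \<partial>lborel)" for b
        proof -
          have "(\<integral>\<^sup>+t. indicator {\<alpha> + N * diam..\<beta>} t * g b (s - t) \<partial>lborel) = (\<integral>\<^sup>+t. indicator {\<alpha> + N * diam..\<beta>} ((s - \<sigma>) + t) * g b (s - ((s - \<sigma>) + t)) \<partial>lborel)"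
            by (rule nn_integral_shift[symmetric]) measurable
          also have "\<dots> \<le> (\<integral>\<^sup>+t. indicator {\<alpha>..\<beta>} t * g b (\<sigma> - t) \<partial>lborel)"
            using d by (intro nn_integral_mono) (auto simp: indicator_def)
          finally show ?thesis .
        qed
        then have "strip_int lam (\<alpha> + N * diam) \<beta> g s \<le> strip_int lam \<alpha> \<beta> g \<sigma>"
          unfolding strip_int_def by (rule nn_integral_mono)
        then have "J \<le> ennreal c * strip_int lam \<alpha> \<beta> g \<sigma>" unfolding J_def by (rule mult_left_mono) simp
        also have "\<dots> \<le> (K ^^ n) g y \<sigma>" using True by (intro mn y g) simp
        finally show ?thesis using True by (simp add: in_set_def)
      qed (simp add: in_set_def)
      have "ennreal (c * c0) * strip_int lam (\<alpha> + N * diam) \<beta> g s = J * ennreal c0"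
        using c c0 by (simp add: J_def ennreal_mult mult_ac)
      also have "\<dots> \<le> J * (K ^^ n0) (in_set (ball z \<epsilon>)) x s" by (intro mult_left_mono n0) simp
      also have "\<dots> = (K ^^ n0) (\<lambda>y \<sigma>. J * in_set (ball z \<epsilon>) y \<sigma>) x s" by (simp add: K_iter_cmult meas2_in_set)
      also have "\<dots> \<le> (K ^^ n0) ((K ^^ n) g) x s" by (rule K_iter_mono[OF x le])
      finally show "ennreal (c * c0) * strip_int lam (\<alpha> + N * diam) \<beta> g s \<le> (K ^^ (n0 + n)) g x s" by (simp add: K_iter_add)
    qed (use n0 in simp)
  qed
qed

section \<open>Space-time harmonic functions and contraction of their oscillation\<close>

text \<open>Harmonic functions of the chain (reflection point, remaining time) with values in
  \<open>[0, 1]\<close>. The mean value property starts at \<open>diam\<close>, when the first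
  flight is certainly over.\<close>

definition harm :: "('a \<Rightarrow> real \<Rightarrow> real) \<Rightarrow> bool" where
  "harm f \<longleftrightarrow> (\<lambda>p. f (fst p) (snd p)) \<in> borel_measurable (borel \<Otimes>\<^sub>M borel) \<and> (\<forall>x s. 0 \<le> f x s \<and> f x s \<le> 1) \<and>
    (\<forall>x\<in>Rt. \<forall>s\<ge>diam. f x s = (\<integral>\<eta>. f (nxt x \<eta>) (s - len x \<eta>) \<partial>law))"

lemma harm_meas:
  assumes "harm f" "g \<in> borel_measurable M" "h \<in> borel_measurable M"
  shows "(\<lambda>x. f (g x) (h x)) \<in> borel_measurable M"
proof -
  have "(\<lambda>p. f (fst p) (snd p)) \<in> borel_measurable (borel \<Otimes>\<^sub>M borel)" using assms(1) by (simp add: harm_def)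
  from measurable_compose[OF measurable_Pair[OF assms(2,3)] this] show ?thesis by simp
qed

lemma harm_bounds:
  assumes "harm f" shows "0 \<le> f x s" "f x s \<le> 1"
  using assms by (auto simp: harm_def)

lemma harm_int:
  assumes "harm f" shows "integrable law (\<lambda>\<eta>. f (nxt x \<eta>) (s - len x \<eta>))"
proof (rule law.integrable_const_bound[of _ 1])
  show "AE \<eta> in law. norm (f (nxt x \<eta>) (s - len x \<eta>)) \<le> 1" using harm_bounds[OF assms] by simp
  note [measurable (raw)] = harm_meas[OF assms]
  show "(\<lambda>\<eta>. f (nxt x \<eta>) (s - len x \<eta>)) \<in> borel_measurable law" by measurable
qed

lemma harm_step:
  assumes "harm f" "x \<in> Rt" "diam \<le> s"
  shows "f x s = (\<integral>\<eta>. f (nxt x \<eta>) (s - len x \<eta>) \<partial>law)"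
  using assms by (simp add: harm_def)

lemma harm_compl:
  assumes "harm f" shows "harm (\<lambda>x s. 1 - f x s)"
proof -
  have "(\<integral>\<eta>. 1 - f (nxt x \<eta>) (s - len x \<eta>) \<partial>law) = 1 - (\<integral>\<eta>. f (nxt x \<eta>) (s - len x \<eta>) \<partial>law)" for x s
    using harm_int[OF assms] by (simp add: law.prob_space)
  then show ?thesis using assms harm_step[OF assms] unfolding harm_def by auto
qed

text \<open>The mean value property iterated \<open>n\<close> times. \<open>ennreal\<close>
  truncates negative values, so it passes through only where \<open>m\<close> is a lower bound; the
  assumption on \<open>s\<close> keeps all remaining times above \<open>t0\<close>.\<close>

lemma K_iter_harm:
  assumes f: "harm f" and t0: "0 \<le> t0" and m: "\<And>x s. x \<in> Rt \<Longrightarrow> t0 \<le> s \<Longrightarrow> m \<le> f x s"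
  shows "x \<in> Rt \<Longrightarrow> t0 + n * diam \<le> s \<Longrightarrow> (K ^^ n) (\<lambda>y \<sigma>. ennreal (f y \<sigma> - m)) x s = ennreal (f x s - m)"
proof (induction n arbitrary: x s)
  case (Suc n)
  have sd: "t0 + n * diam + diam \<le> s" using Suc.prems(2) by (simp add: algebra_simps)
  have nd: "0 \<le> n * diam" using diam_pos by simp
  have "(K ^^ Suc n) (\<lambda>y \<sigma>. ennreal (f y \<sigma> - m)) x s =
     (\<integral>\<^sup>+\<eta>. (K ^^ n) (\<lambda>y \<sigma>. ennreal (f y \<sigma> - m)) (nxt x \<eta>) (s - len x \<eta>) \<partial>law)"
    unfolding funpow.simps comp_def K_def[of "(K ^^ n) _" x s] ..
  also have "\<dots> = (\<integral>\<^sup>+\<eta>. ennreal (f (nxt x \<eta>) (s - len x \<eta>) - m) \<partial>law)"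
  proof (rule nn_integral_cong_AE, use step_AE[OF Suc.prems(1)] in eventually_elim)
    case (elim \<eta>)
    then have "t0 + n * diam \<le> s - len x \<eta>" using sd by linarith
    with elim show ?case by (intro Suc.IH) auto
  qed
  also have "\<dots> = ennreal (\<integral>\<eta>. f (nxt x \<eta>) (s - len x \<eta>) - m \<partial>law)"
  proof (rule nn_integral_eq_integral)
    show "AE \<eta> in law. 0 \<le> f (nxt x \<eta>) (s - len x \<eta>) - m"
      using step_AE[OF Suc.prems(1)]
    proof eventually_elim
      case (elim \<eta>)
      then have "t0 \<le> s - len x \<eta>" using sd nd by linarith
      with elim have "m \<le> f (nxt x \<eta>) (s - len x \<eta>)" by (intro m) auto
      then show ?case by simp
    qed
  qed (use harm_int[OF f] in simp)
  also have "(\<integral>\<eta>. f (nxt x \<eta>) (s - len x \<eta>) - m \<partial>law) = f x s - m"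
    using harm_int[OF f] harm_step[OF f Suc.prems(1), of s] sd nd t0 by (simp add: law.prob_space)
  finally show ?case .
qed simp

text \<open>Every flight has probability at least \<open>p\<close> of lasting \<open>r0\<close>, so that on a new time interval of
  length \<open>r0\<close> the infimum of \<open>f\<close> cannot drop below the bound valid before it.\<close>

lemma harm_lower_bound_extends:
  assumes f: "harm f" and t0: "0 \<le> t0"
    and m: "\<And>x s. x \<in> Rt \<Longrightarrow> t0 \<le> s \<Longrightarrow> s \<le> t0 + diam \<Longrightarrow> m \<le> f x s"
  shows "x \<in> Rt \<Longrightarrow> t0 \<le> s \<Longrightarrow> m \<le> f x s"
proof -
  obtain r0 p where r0: "0 < r0" and p: "0 < p" "\<And>x. x \<in> Rt \<Longrightarrow> ennreal p \<le> emeasure law {\<eta>. r0 \<le> len x \<eta>}"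
    by (rule long_flight_uniform) (rule that)
  have sl: "space law = UNIV" using sets_eq_imp_space_eq[OF law_sets] by simp
  have ext: "m \<le> f x s" if "x \<in> Rt" "t0 \<le> s" "s \<le> t0 + diam + real j * r0" for x s j
    using that
  proof (induction j arbitrary: x s)
    case 0 then show ?case using m by simp
  next
    case (Suc j)
    define a where "a = t0 + diam + real j * r0"
    have a: "t0 + diam \<le> a" "t0 + diam + real (Suc j) * r0 = a + r0" using r0 by (simp_all add: a_def algebra_simps)
    have old: "m \<le> f y \<sigma>" if "y \<in> Rt" "t0 \<le> \<sigma>" "\<sigma> \<le> a" for y \<sigma> using Suc.IH that by (simp add: a_def)
    define Z where "Z = {p. fst p \<in> Rt \<and> t0 \<le> snd p \<and> snd p \<le> a + r0}"
    define F where "F = (\<lambda>p. f (fst p) (snd p)) ` Z"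
    define S where "S = Inf F"
    have xs: "(x, s) \<in> Z" using Suc.prems a by (simp add: Z_def)
    have bb: "bdd_below F" unfolding F_def using harm_bounds[OF f] by (intro bdd_belowI2[of _ 0]) auto
    have S: "S \<le> f y \<sigma>" if "y \<in> Rt" "t0 \<le> \<sigma>" "\<sigma> \<le> a + r0" for y \<sigma>
      unfolding S_def F_def using bb that by (intro cInf_lower) (auto simp: F_def Z_def image_iff)
    \<comment> \<open>Take an almost minimizing \<open>y\<close>, \<open>\<sigma>\<close> in the
      extended range. With probability at least \<open>p\<close> the flight lasts \<open>r0\<close>
      and leads to the range where \<open>m\<close> is known to be a bound, otherwise
      \<open>S\<close> still is one; so the mean is at least \<open>S + p * (m - S)\<close>,
      contrary to the choice.\<close>
    have "m \<le> S"
    proof (rule ccontr)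
      assume "\<not> m \<le> S"
      then have Sm: "S < m" by simp
      then have "Inf F < S + p * (m - S)" using p by (simp add: S_def)
      then obtain v where "v \<in> F" "v < S + p * (m - S)" using cInf_lessD[of F] xs by (auto simp: F_def)
      then obtain y \<sigma> where y: "y \<in> Rt" "t0 \<le> \<sigma>" "\<sigma> \<le> a + r0" "f y \<sigma> < S + p * (m - S)"
        by (auto simp: F_def Z_def)
      have \<sigma>a: "a < \<sigma>"
      proof (rule ccontr)
        assume "\<not> a < \<sigma>"
        then have 1: "m \<le> f y \<sigma>" using old y by simp
        have "emeasure law {\<eta>. r0 \<le> len y \<eta>} \<le> 1" using law.emeasure_space_1 by (metis emeasure_space)
        then have "ennreal p \<le> 1" using p(2)[OF y(1)] by (rule order_trans[rotated])
        then have "p \<le> 1" by simp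
        then have "p * (m - S) \<le> 1 * (m - S)" using Sm by (intro mult_right_mono) auto
        then show False using 1 y(4) by simp
      qed
      have me: "{\<eta>. r0 \<le> len y \<eta>} \<in> sets law"
      proof -
        have "{\<eta> \<in> space law. r0 \<le> len y \<eta>} \<in> sets law" by measurable
        then show ?thesis using sl by simp
      qed
      have "p \<le> measure law {\<eta>. r0 \<le> len y \<eta>}" using p(2)[OF y(1)] by (simp add: law.emeasure_eq_measure)
      then have "S + p * (m - S) \<le> S + measure law {\<eta>. r0 \<le> len y \<eta>} * (m - S)" using Sm by (simp add: mult_right_mono)
      also have "\<dots> = (\<integral>\<eta>. S + indicator {\<eta>. r0 \<le> len y \<eta>} \<eta> * (m - S) \<partial>law)"
        using me by (subst Bochner_Integration.integral_add) (auto simp: law.prob_space law.emeasure_eq_measure)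
      also have "\<dots> \<le> (\<integral>\<eta>. f (nxt y \<eta>) (\<sigma> - len y \<eta>) \<partial>law)"
      proof (rule integral_mono_AE)
        show "integrable law (\<lambda>\<eta>. S + indicator {\<eta>. r0 \<le> len y \<eta>} \<eta> * (m - S))"
          using me by (auto simp: law.emeasure_eq_measure)
        show "AE \<eta> in law. S + indicator {\<eta>. r0 \<le> len y \<eta>} \<eta> * (m - S) \<le> f (nxt y \<eta>) (\<sigma> - len y \<eta>)"
          using step_AE[OF y(1)]
        proof eventually_elim
          case (elim \<eta>)
          then have e: "nxt y \<eta> \<in> Rt" "t0 \<le> \<sigma> - len y \<eta>" "\<sigma> - len y \<eta> \<le> a + r0" using \<sigma>a a y by auto
          show ?case
          proof (cases "r0 \<le> len y \<eta>")
            case True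
            then have "m \<le> f (nxt y \<eta>) (\<sigma> - len y \<eta>)" using e y by (intro old) auto
            then show ?thesis using True by simp
          qed (use S[OF e] in simp)
        qed
      qed (rule harm_int[OF f])
      also have "\<dots> = f y \<sigma>" using y \<sigma>a a t0 by (intro harm_step[OF f, symmetric]) auto
      finally show False using y(4) by simp
    qed
    also have "S \<le> f x s" using Suc.prems a by (intro S) auto
    finally show ?case .
  qed
  show "m \<le> f x s" if x: "x \<in> Rt" "t0 \<le> s"
  proof -
    obtain j :: nat where "(s - t0 - diam) / r0 \<le> j" using real_arch_simple by blast
    then have "s \<le> t0 + diam + j * r0" using r0 by (simp add: field_simps)
    then show ?thesis using ext x by blast
  qed
qed

text \<open>The averages of \<open>f - m\<close> and of \<open>M - f\<close> over a fixed time
  window add up to a fixed multiple of \<open>M - m\<close>, so one of them is at least half of it.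
  By minorization this average raises the lower bound of \<open>f\<close>, or of
  \<open>1 - f\<close> in the second case, at every point and every time in an interval of length
  \<open>diam\<close>, from which it extends.\<close>

lemma oscillation_contracts:
  obtains T0 q where "0 < T0" "0 < q" "q < 1"
    "\<And>f t0 m M. harm f \<Longrightarrow> 0 \<le> t0 \<Longrightarrow> m \<le> M \<Longrightarrow> (\<forall>x\<in>Rt. \<forall>s\<ge>t0. m \<le> f x s \<and> f x s \<le> M) \<Longrightarrow>
      \<exists>m' M'. m' \<le> M' \<and> M' - m' \<le> (1 - q) * (M - m) \<and> (\<forall>x\<in>Rt. \<forall>s\<ge>t0 + T0. m' \<le> f x s \<and> f x s \<le> M')"
proof -
  obtain lam A B \<delta> N where sl[measurable_cong]: "sets lam = sets borel" and fl: "finite_measure lam" and l0: "emeasure lam UNIV \<noteq> 0"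
    and ae: "AE b in lam. b \<in> Rt" and L: "diam + 1 \<le> B - A" and \<delta>: "0 < \<delta>"
    and mn: "\<And>x. x \<in> Rt \<Longrightarrow> \<exists>n\<le>N. \<forall>g s. meas2 g \<longrightarrow> ennreal \<delta> * strip_int lam A B g s \<le> (K ^^ n) g x s"
    by (rule minorization[of "diam + 1"]) (rule that)
  interpret lam: finite_measure lam by fact
  define \<Lambda> where "\<Lambda> = measure lam UNIV"
  have sp: "space lam = UNIV" using sets_eq_imp_space_eq[OF sl] by simp
  have \<Lambda>: "emeasure lam UNIV = ennreal \<Lambda>" by (simp add: \<Lambda>_def lam.emeasure_eq_measure)
  then have \<Lambda>0: "0 < \<Lambda>" using l0 by (simp add: zero_less_iff_neq_zero[symmetric])
  \<comment> \<open>Large enough for \<open>N\<close> flights to fit in before \<open>t0\<close> is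
    reached and for the averaging window below to start after \<open>t0\<close>.\<close>
  define T0 where "T0 = max (N * diam) B + 1 + N * diam"
  have T0: "N * diam \<le> T0" "B \<le> T0" "0 < T0" proof -
    have "0 \<le> N * diam" using diam_pos by simp
    then show "N * diam \<le> T0" "B \<le> T0" "0 < T0" unfolding T0_def by linarith+
  qed
  define wd where "wd = B - A - diam"
  have wd: "0 < wd" using L by (simp add: wd_def)
  \<comment> \<open>The window is the part common to all intervals \<open>{s - B..s - A}\<close> for
    \<open>s\<close> between \<open>t0 + T0\<close> and \<open>t0 + T0 + diam\<close>. Its length
    \<open>wd\<close> is at least 1, because the minorization was taken with
    \<open>diam + 1 \<le> B - A\<close>.\<close>
  define avg where "avg h t0 = (\<integral>\<^sup>+b. (\<integral>\<^sup>+u. indicator {t0 + T0 + diam - B..t0 + T0 - A} u * ennreal (h b u) \<partial>lborel) \<partial>lam)"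
    for h :: "'a \<Rightarrow> real \<Rightarrow> real" and t0
  have improve: "m + \<delta> * \<kappa> \<le> f x s"
    if f: "harm f" and t0: "0 \<le> t0" and m: "\<And>x s. x \<in> Rt \<Longrightarrow> t0 \<le> s \<Longrightarrow> m \<le> f x s"
      and \<kappa>: "0 \<le> \<kappa>" "ennreal \<kappa> \<le> avg (\<lambda>b u. f b u - m) t0" and xs: "x \<in> Rt" "t0 + T0 \<le> s" for f t0 m \<kappa> x s
  proof (rule harm_lower_bound_extends[OF f _ _ xs])
    show "0 \<le> t0 + T0" using t0 T0 by simp
    fix x s assume x: "x \<in> Rt" and s: "t0 + T0 \<le> s" "s \<le> t0 + T0 + diam"
    let ?g = "\<lambda>y \<sigma>. ennreal (f y \<sigma> - m)"
    note [measurable (raw)] = harm_meas[OF f]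
    have g: "meas2 ?g" unfolding meas2_def by measurable
    obtain n where n: "n \<le> N" "\<And>g s. meas2 g \<Longrightarrow> ennreal \<delta> * strip_int lam A B g s \<le> (K ^^ n) g x s" using mn[OF x] by blast
    have "real n * diam \<le> N * diam" using n diam_pos by (intro mult_right_mono) auto
    then have sn: "t0 + n * diam \<le> s" using T0 s by linarith
    have inner: "(\<integral>\<^sup>+u. indicator {t0 + T0 + diam - B..t0 + T0 - A} u * ?g b u \<partial>lborel) \<le> (\<integral>\<^sup>+t. indicator {A..B} t * ?g b (s - t) \<partial>lborel)" for b
    proof -
      have "(\<integral>\<^sup>+u. indicator {t0 + T0 + diam - B..t0 + T0 - A} u * ?g b u \<partial>lborel) =
          (\<integral>\<^sup>+t. indicator {t0 + T0 + diam - B..t0 + T0 - A} (s - t) * ?g b (s - t) \<partial>lborel)"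
        using nn_integral_real_affine[of "\<lambda>u. indicator {t0 + T0 + diam - B..t0 + T0 - A} u * ?g b u" "-1" s] by simp
      also have "\<dots> \<le> (\<integral>\<^sup>+t. indicator {A..B} t * ?g b (s - t) \<partial>lborel)"
        using s by (intro nn_integral_mono) (auto simp: indicator_def)
      finally show ?thesis .
    qed
    have "ennreal (\<delta> * \<kappa>) \<le> ennreal \<delta> * avg (\<lambda>b u. f b u - m) t0" using \<kappa> \<delta> by (simp add: ennreal_mult mult_left_mono)
    also have "\<dots> \<le> ennreal \<delta> * strip_int lam A B ?g s"
      unfolding avg_def strip_int_def by (rule mult_left_mono[OF nn_integral_mono[OF inner]]) simp
    also have "\<dots> \<le> (K ^^ n) ?g x s" by (rule n(2)[OF g])
    also have "\<dots> = ennreal (f x s - m)" by (rule K_iter_harm[OF f t0 m x sn])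
    finally have "\<delta> * \<kappa> \<le> f x s - m"
      using m[OF x, of s] s T0 by (subst (asm) ennreal_le_iff) auto
    then show "m + \<delta> * \<kappa> \<le> f x s" by simp
  qed
  \<comment> \<open>The relative gain: minorization constant times half the total mass of the
    window; the minimum with one half keeps it below 1.\<close>
  define q where "q = min (1/2) (\<delta> * (wd * \<Lambda> / 2))"
  have q: "0 < q" "q < 1" "q \<le> \<delta> * (wd * \<Lambda> / 2)" using \<delta> wd \<Lambda>0 by (auto simp: q_def)
  show ?thesis
  proof (rule that[OF T0(3) q(1,2)])
    fix f t0 m M assume f: "harm f" and t0: "0 \<le> t0" and mM: "m \<le> (M :: real)"
      and bd': "\<forall>x\<in>Rt. \<forall>s\<ge>t0. m \<le> f x s \<and> f x s \<le> M"
    then have bd: "m \<le> f x s \<and> f x s \<le> M" if "x \<in> Rt" "t0 \<le> s" for x s using that by blast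
    note [measurable (raw)] = harm_meas[OF f]
    define \<kappa> where "\<kappa> = (M - m) * (wd * \<Lambda> / 2)"
    have \<kappa>: "0 \<le> \<kappa>" using mM wd \<Lambda>0 by (simp add: \<kappa>_def)
    have q\<kappa>: "q * (M - m) \<le> \<delta> * \<kappa>" using mult_right_mono[OF q(3), of "M - m"] mM by (simp add: \<kappa>_def mult_ac)
    have "avg (\<lambda>b u. f b u - m) t0 + avg (\<lambda>b u. M - f b u) t0 =
       (\<integral>\<^sup>+b. (\<integral>\<^sup>+u. indicator {t0 + T0 + diam - B..t0 + T0 - A} u * ennreal (f b u - m) \<partial>lborel) +
          (\<integral>\<^sup>+u. indicator {t0 + T0 + diam - B..t0 + T0 - A} u * ennreal (M - f b u) \<partial>lborel) \<partial>lam)"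
      unfolding avg_def by (rule nn_integral_add[symmetric]) measurable
    also have "\<dots> = (\<integral>\<^sup>+b. ennreal ((M - m) * wd) \<partial>lam)"
    proof (rule nn_integral_cong_AE, use ae in eventually_elim)
      fix b assume b: "b \<in> Rt"
      have "(\<integral>\<^sup>+u. indicator {t0 + T0 + diam - B..t0 + T0 - A} u * ennreal (f b u - m) \<partial>lborel) +
          (\<integral>\<^sup>+u. indicator {t0 + T0 + diam - B..t0 + T0 - A} u * ennreal (M - f b u) \<partial>lborel) =
          (\<integral>\<^sup>+u. indicator {t0 + T0 + diam - B..t0 + T0 - A} u * ennreal (f b u - m) +
             indicator {t0 + T0 + diam - B..t0 + T0 - A} u * ennreal (M - f b u) \<partial>lborel)"
        by (rule nn_integral_add[symmetric]) measurable
      also have "\<dots> = (\<integral>\<^sup>+u. ennreal (M - m) * indicator {t0 + T0 + diam - B..t0 + T0 - A} u \<partial>lborel)"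
      proof (rule nn_integral_cong)
        fix u
        show "indicator {t0 + T0 + diam - B..t0 + T0 - A} u * ennreal (f b u - m) +
             indicator {t0 + T0 + diam - B..t0 + T0 - A} u * ennreal (M - f b u) =
             ennreal (M - m) * indicator {t0 + T0 + diam - B..t0 + T0 - A} u"
        proof (cases "u \<in> {t0 + T0 + diam - B..t0 + T0 - A}")
          case True
          then have "t0 \<le> u" using T0 diam_pos by auto
          from bd[OF b this] show ?thesis using True by (simp add: ennreal_plus[symmetric] del: ennreal_plus)
        qed simp
      qed
      also have "\<dots> = ennreal (M - m) * ennreal wd"
      proof -
        have "emeasure lborel {t0 + T0 + diam - B..t0 + T0 - A} = ennreal ((t0 + T0 - A) - (t0 + T0 + diam - B))"
          using wd by (intro emeasure_lborel_Icc) (simp add: wd_def)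
        also have "(t0 + T0 - A) - (t0 + T0 + diam - B) = wd" by (simp add: wd_def)
        finally show ?thesis by (simp add: nn_integral_cmult_indicator)
      qed
      also have "\<dots> = ennreal ((M - m) * wd)" using mM wd by (simp add: ennreal_mult)
      finally show "(\<integral>\<^sup>+u. indicator {t0 + T0 + diam - B..t0 + T0 - A} u * ennreal (f b u - m) \<partial>lborel) +
          (\<integral>\<^sup>+u. indicator {t0 + T0 + diam - B..t0 + T0 - A} u * ennreal (M - f b u) \<partial>lborel) = ennreal ((M - m) * wd)" .
    qed
    also have "\<dots> = ennreal \<kappa> + ennreal \<kappa>"
    proof -
      have "(\<integral>\<^sup>+b. ennreal ((M - m) * wd) \<partial>lam) = ennreal ((M - m) * wd) * ennreal \<Lambda>" by (simp add: sp \<Lambda>)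
      also have "\<dots> = ennreal (\<kappa> + \<kappa>)" using mM wd \<Lambda>0 by (simp add: ennreal_mult[symmetric] \<kappa>_def)
      also have "\<dots> = ennreal \<kappa> + ennreal \<kappa>" using \<kappa> by (rule ennreal_plus[OF _ \<kappa>])
      finally show ?thesis .
    qed
    finally have sum: "avg (\<lambda>b u. f b u - m) t0 + avg (\<lambda>b u. M - f b u) t0 = ennreal \<kappa> + ennreal \<kappa>" .
    show "\<exists>m' M'. m' \<le> M' \<and> M' - m' \<le> (1 - q) * (M - m) \<and> (\<forall>x\<in>Rt. \<forall>s\<ge>t0 + T0. m' \<le> f x s \<and> f x s \<le> M')"
    proof (cases "ennreal \<kappa> \<le> avg (\<lambda>b u. f b u - m) t0")
      case True
      have "m + q * (M - m) \<le> f x s" if "x \<in> Rt" "t0 + T0 \<le> s" for x s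
        using improve[OF f t0 _ \<kappa> True that] bd q\<kappa> by fastforce
      moreover have "m + q * (M - m) \<le> M" using mult_right_mono[of q 1 "M - m"] q mM by simp
      ultimately show ?thesis using bd T0 by (intro exI[of _ "m + q * (M - m)"] exI[of _ M]) (auto simp: algebra_simps)
    next
      case False
      \<comment> \<open>For \<open>1 - f\<close> with lower bound \<open>1 - M\<close>, the excess
        is again \<open>M - f\<close>.\<close>
      have "ennreal \<kappa> \<le> avg (\<lambda>b u. (1 - f b u) - (1 - M)) t0"
      proof (rule ccontr)
        assume "\<not> ennreal \<kappa> \<le> avg (\<lambda>b u. (1 - f b u) - (1 - M)) t0"
        then have "avg (\<lambda>b u. f b u - m) t0 + avg (\<lambda>b u. M - f b u) t0 < ennreal \<kappa> + ennreal \<kappa>"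
          using False by (intro add_strict_mono) auto
        then show False using sum by simp
      qed
      then have "(1 - M) + \<delta> * \<kappa> \<le> 1 - f x s" if "x \<in> Rt" "t0 + T0 \<le> s" for x s
        using improve[OF harm_compl[OF f] t0 _ \<kappa> _ that, of "1 - M"] bd by fastforce
      then have "f x s \<le> M - q * (M - m)" if "x \<in> Rt" "t0 + T0 \<le> s" for x s using q\<kappa> that by fastforce
      moreover have "m \<le> M - q * (M - m)" using mult_right_mono[of q 1 "M - m"] q mM by simp
      ultimately show ?thesis using bd T0 by (intro exI[of _ m] exI[of _ "M - q * (M - m)"]) (auto simp: algebra_simps)
    qed
  qed
qed

lemma harm_forgets:
  obtains T0 q where "0 < T0" "0 < q" "q < 1"
    "\<And>f (k::nat) x y (s::real) (t::real). harm f \<Longrightarrow> x \<in> Rt \<Longrightarrow> y \<in> Rt \<Longrightarrow> real k * T0 \<le> s \<Longrightarrow> real k * T0 \<le> t \<Longrightarrow> \<bar>f x s - f y t\<bar> \<le> (1 - q) ^ k"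
proof -
  obtain T0 q where T0: "0 < T0" and q: "0 < q" "q < 1"
    and con: "\<And>f t0 m M. harm f \<Longrightarrow> 0 \<le> t0 \<Longrightarrow> m \<le> M \<Longrightarrow> (\<forall>x\<in>Rt. \<forall>s\<ge>t0. m \<le> f x s \<and> f x s \<le> M) \<Longrightarrow>
      \<exists>m' M'. m' \<le> M' \<and> M' - m' \<le> (1 - q) * (M - m) \<and> (\<forall>x\<in>Rt. \<forall>s\<ge>t0 + T0. m' \<le> f x s \<and> f x s \<le> M')"
    by (rule oscillation_contracts) (rule that)
  have it: "\<exists>m M. m \<le> M \<and> M - m \<le> (1 - q) ^ k \<and> (\<forall>x\<in>Rt. \<forall>s\<ge>real k * T0. m \<le> f x s \<and> f x s \<le> M)" if f: "harm f" for f and k :: nat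
  proof (induction k)
    case 0
    show ?case using harm_bounds[OF f] by (intro exI[of _ 0] exI[of _ 1]) auto
  next
    case (Suc k)
    then obtain m M where m: "m \<le> M" "M - m \<le> (1 - q) ^ k" "\<And>x s. x \<in> Rt \<Longrightarrow> real k * T0 \<le> s \<Longrightarrow> m \<le> f x s \<and> f x s \<le> M" by blast
    have "\<exists>m' M'. m' \<le> M' \<and> M' - m' \<le> (1 - q) * (M - m) \<and> (\<forall>x\<in>Rt. \<forall>s\<ge>real k * T0 + T0. m' \<le> f x s \<and> f x s \<le> M')"
      using T0 m by (intro con f) auto
    moreover have "(1 - q) * (M - m) \<le> (1 - q) ^ Suc k" using m(2) q by (simp add: mult_left_mono)
    moreover have "real k * T0 + T0 = real (Suc k) * T0" by (simp add: algebra_simps)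
    ultimately show ?case by (metis order_trans)
  qed
  show ?thesis
  proof (rule that[OF T0 q])
    fix f and k :: nat and x y and s t :: real assume "harm f" "x \<in> Rt" "y \<in> Rt" "real k * T0 \<le> s" "real k * T0 \<le> t"
    then obtain m M where m: "M - m \<le> (1 - q) ^ k" "m \<le> f x s" "f x s \<le> M" "m \<le> f y t" "f y t \<le> M" using it[of f k] by blast
    then show "\<bar>f x s - f y t\<bar> \<le> (1 - q) ^ k" by linarith
  qed
qed

end

section \<open>The billiard trajectory\<close>

lemma nn_integral_sequence_step:
  assumes "prob_space M" and f: "f \<in> borel_measurable (\<Pi>\<^sub>M n\<in>(UNIV :: nat set). M)"
  shows "(\<integral>\<^sup>+\<omega>. f \<omega> \<partial>(\<Pi>\<^sub>M n\<in>(UNIV :: nat set). M)) =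
    (\<integral>\<^sup>+s. (\<integral>\<^sup>+\<omega>. f (case_nat s \<omega>) \<partial>(\<Pi>\<^sub>M n\<in>(UNIV :: nat set). M)) \<partial>M)"
proof -
  interpret M: prob_space M by fact
  interpret sequence_space M ..
  have m: "(\<lambda>(s, \<omega>). case_nat s \<omega>) \<in> measurable (M \<Otimes>\<^sub>M S) S" by (simp add: measurable_case_nat')
  have "(\<integral>\<^sup>+\<omega>. f \<omega> \<partial>S) = (\<integral>\<^sup>+\<omega>. f \<omega> \<partial>(distr (M \<Otimes>\<^sub>M S) S (\<lambda>(s, \<omega>). case_nat s \<omega>)))" by (simp only: PiM_iter)
  also have "\<dots> = (\<integral>\<^sup>+p. f (case_nat (fst p) (snd p)) \<partial>(M \<Otimes>\<^sub>M S))"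
    using m f by (subst nn_integral_distr) (simp_all add: split_beta')
  also have "\<dots> = (\<integral>\<^sup>+s. (\<integral>\<^sup>+\<omega>. f (case_nat s \<omega>) \<partial>S) \<partial>M)"
    using measurable_compose[OF m f] by (subst nn_integral_fst[symmetric]) (simp_all add: split_beta')
  finally show ?thesis .
qed

text \<open>Closeness uniform in the set is what makes the setwise limit countably additive: along
  sets decreasing to the empty set, some \<open>P k\<close> within \<open>\<epsilon> k\<close> of
  the limit is already continuous at the empty set.\<close>

lemma limit_prob_space:
  fixes P :: "nat \<Rightarrow> 'a measure"
  assumes P: "\<And>k. prob_space (P k)" "\<And>k. sets (P k) = sets N"
    and close: "\<And>k l A. A \<in> sets N \<Longrightarrow> k \<le> l \<Longrightarrow> \<bar>measure (P k) A - measure (P l) A\<bar> \<le> \<epsilon> k"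
    and \<epsilon>: "\<epsilon> \<longlonglongrightarrow> 0"
  obtains \<nu> where "prob_space \<nu>" "sets \<nu> = sets N" "\<And>A. A \<in> sets N \<Longrightarrow> (\<lambda>k. measure (P k) A) \<longlonglongrightarrow> measure \<nu> A"
proof -
  interpret P: prob_space "P k" for k by (rule P)
  define L where "L A = lim (\<lambda>k. measure (P k) A)" for A
  have lim: "(\<lambda>k. measure (P k) A) \<longlonglongrightarrow> L A" if A: "A \<in> sets N" for A
  proof -
    have "Cauchy (\<lambda>k. measure (P k) A)"
    proof (rule metric_CauchyI)
      fix e :: real assume e: "0 < e"
      then obtain k0 where "\<bar>\<epsilon> k\<bar> < e / 2" if "k \<ge> k0" for k
        using LIMSEQ_D[OF \<epsilon>, of "e / 2"] by auto
      then have k0: "\<epsilon> k0 < e / 2" by (meson abs_less_iff le_refl)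
      have "dist (measure (P m) A) (measure (P n) A) < e" if "m \<ge> k0" "n \<ge> k0" for m n
        using close[OF A that(1)] close[OF A that(2)] k0 unfolding dist_real_def by linarith
      then show "\<exists>M. \<forall>m\<ge>M. \<forall>n\<ge>M. dist (measure (P m) A) (measure (P n) A) < e" by blast
    qed
    then show ?thesis unfolding L_def by (simp add: Cauchy_convergent_iff convergent_LIMSEQ_iff)
  qed
  have L0: "0 \<le> L A" if "A \<in> sets N" for A by (rule LIMSEQ_le_const[OF lim[OF that]]) auto
  have L1: "L A \<le> 1" if "A \<in> sets N" for A by (rule LIMSEQ_le_const2[OF lim[OF that]]) (auto simp: P.prob_le_1)
  have LP: "\<bar>measure (P k) A - L A\<bar> \<le> \<epsilon> k" if A: "A \<in> sets N" for A k
  proof (rule LIMSEQ_le_const2)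
    show "(\<lambda>l. \<bar>measure (P k) A - measure (P l) A\<bar>) \<longlonglongrightarrow> \<bar>measure (P k) A - L A\<bar>"
      by (intro tendsto_intros lim A)
  qed (use close[OF A] in blast)
  have empty: "L {} = 0" using lim[of "{}"] by (simp add: LIMSEQ_const_iff)
  have add: "L (A \<union> B) = L A + L B" if "A \<in> sets N" "B \<in> sets N" "A \<inter> B = {}" for A B
  proof (rule LIMSEQ_unique)
    show "(\<lambda>k. measure (P k) (A \<union> B)) \<longlonglongrightarrow> L (A \<union> B)" using that by (intro lim) auto
    have "measure (P k) (A \<union> B) = measure (P k) A + measure (P k) B" for k
      using that P(2) by (intro P.finite_measure_Union) auto
    then show "(\<lambda>k. measure (P k) (A \<union> B)) \<longlonglongrightarrow> L A + L B"
      using tendsto_add[OF lim[OF that(1)] lim[OF that(2)]] by simp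
  qed
  have cont: "(\<lambda>i. ennreal (L (A i))) \<longlonglongrightarrow> 0" if A: "range A \<subseteq> sets N" "decseq A" "(\<Inter>i. A i) = {}" for A
  proof -
    have As: "A i \<in> sets N" for i using A by auto
    have "(\<lambda>i. L (A i)) \<longlonglongrightarrow> 0"
    proof (rule LIMSEQ_I)
      fix e :: real assume e: "0 < e"
      then obtain k where "\<bar>\<epsilon> k\<bar> < e / 2" using LIMSEQ_D[OF \<epsilon>, of "e / 2"] by auto
      moreover have "(\<lambda>i. measure (P k) (A i)) \<longlonglongrightarrow> measure (P k) (\<Inter>i. A i)"
        using A P(2) by (intro P.finite_Lim_measure_decseq) auto
      then have "(\<lambda>i. measure (P k) (A i)) \<longlonglongrightarrow> 0" using A by simp
      then obtain n0 where n0: "\<And>n. n \<ge> n0 \<Longrightarrow> \<bar>measure (P k) (A n)\<bar> < e / 2" using LIMSEQ_D[of _ 0 "e / 2"] e by force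
      ultimately have "\<bar>L (A n)\<bar> < e" if "n \<ge> n0" for n
        using LP[OF As, of k n] n0[OF that] by linarith
      then show "\<exists>n0. \<forall>n\<ge>n0. norm (L (A n) - 0) < e" by auto
    qed
    then show ?thesis using tendsto_ennrealI[of "\<lambda>i. L (A i)" 0] by simp
  qed
  have pos: "positive (sets N) (\<lambda>A. ennreal (L A))" by (simp add: positive_def empty)
  have ca: "countably_additive (sets N) (\<lambda>A. ennreal (L A))"
    by (rule sets.empty_continuous_imp_countably_additive[OF pos _ _ cont])
      (auto simp: additive_def add L0)
  define \<nu> where "\<nu> = measure_of (space N) (sets N) (\<lambda>A. ennreal (L A))"
  have s: "sets \<nu> = sets N" "space \<nu> = space N" by (simp_all add: \<nu>_def)
  have e: "emeasure \<nu> A = ennreal (L A)" if "A \<in> sets N" for A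
    unfolding \<nu>_def using pos ca that by (intro emeasure_measure_of) (auto dest: sets.sets_into_space)
  have sp: "space (P k) = space N" for k using P(2) by (rule sets_eq_imp_space_eq)
  have "L (space N) = 1"
  proof (rule LIMSEQ_unique[OF lim])
    have "measure (P k) (space N) = 1" for k using P.prob_space[of k] by (simp add: sp)
    then show "(\<lambda>k. measure (P k) (space N)) \<longlonglongrightarrow> 1" by simp
  qed simp
  then have "prob_space \<nu>" using e[of "space N"] s by (intro prob_spaceI) auto
  moreover have "measure \<nu> A = L A" if "A \<in> sets N" for A using e[OF that] L0[OF that] by (simp add: measure_def)
  ultimately show ?thesis using s lim by (intro that[of \<nu>]) auto
qed

context stochastic_table
begin

section \<open>The trajectory started on the boundary and its law\<close>

abbreviation "seqs \<equiv> \<Pi>\<^sub>M n\<in>(UNIV :: nat set). law"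

sublocale seqs: prob_space seqs
  by (rule prob_space_PiM) (rule law_prob)

primrec pt :: "'a \<Rightarrow> (nat \<Rightarrow> 'a) \<Rightarrow> nat \<Rightarrow> 'a" where
  "pt x \<eta> 0 = x"
| "pt x \<eta> (Suc n) = nxt (pt x \<eta> n) (\<eta> n)"

definition tm :: "'a \<Rightarrow> (nat \<Rightarrow> 'a) \<Rightarrow> nat \<Rightarrow> real" where
  "tm x \<eta> n = (\<Sum>k<n. len (pt x \<eta> k) (\<eta> k))"

definition at_leg :: "'a \<Rightarrow> (nat \<Rightarrow> 'a) \<Rightarrow> real \<Rightarrow> nat \<Rightarrow> bool" where
  "at_leg x \<eta> t n \<longleftrightarrow> tm x \<eta> n \<le> t \<and> t < tm x \<eta> (Suc n)"

text \<open>A version of \<open>boundary_billiard\<close> that is Borel measurable for all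
  sequences: \<open>LEAST\<close> and a default value replace the definite description. The two
  agree on good paths.\<close>

definition traj :: "'a \<Rightarrow> (nat \<Rightarrow> 'a) \<Rightarrow> real \<Rightarrow> 'a \<times> 'a" where
  "traj x \<eta> t = (if \<exists>n. at_leg x \<eta> t n then
     let n = (LEAST n. at_leg x \<eta> t n) in
       (pt x \<eta> n + (t - tm x \<eta> n) *\<^sub>R V (pt x \<eta> n) (\<eta> n), V (pt x \<eta> n) (\<eta> n)) else (0, 0))"

lemma pt_shift: "pt x (case_nat a \<eta>) (Suc n) = pt (nxt x a) \<eta> n"
  by (induction n) auto

lemma tm_shift: "tm x (case_nat a \<eta>) (Suc n) = len x a + tm (nxt x a) \<eta> n"
  by (simp add: tm_def lessThan_Suc_eq_insert_0 sum.reindex pt_shift del: pt.simps(2))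

lemma at_leg_shift: "at_leg x (case_nat a \<eta>) t (Suc n) \<longleftrightarrow> at_leg (nxt x a) \<eta> (t - len x a) n"
  by (auto simp: at_leg_def tm_shift)

text \<open>Regeneration at the first reflection: if the first flight is over by time
  \<open>t\<close>, the rest is a trajectory from the next point driven by the shifted
  sequence.\<close>

lemma traj_shift:
  assumes "len x a \<le> t"
  shows "traj x (case_nat a \<eta>) t = traj (nxt x a) \<eta> (t - len x a)"
proof -
  have 0: "\<not> at_leg x (case_nat a \<eta>) t 0" using assms by (simp add: at_leg_def tm_def)
  have ex: "(\<exists>n. at_leg x (case_nat a \<eta>) t n) \<longleftrightarrow> (\<exists>n. at_leg (nxt x a) \<eta> (t - len x a) n)"
    using 0 at_leg_shift by (metis not0_implies_Suc)
  show ?thesis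
  proof (cases "\<exists>n. at_leg x (case_nat a \<eta>) t n")
    case True
    then obtain m where "at_leg x (case_nat a \<eta>) t m" ..
    from Least_Suc[of "at_leg x (case_nat a \<eta>) t", OF this 0]
    have "(LEAST n. at_leg x (case_nat a \<eta>) t n) = Suc (LEAST n. at_leg (nxt x a) \<eta> (t - len x a) n)"
      by (simp add: at_leg_shift)
    then show ?thesis using True ex by (simp add: traj_def Let_def pt_shift tm_shift algebra_simps del: pt.simps(2))
  qed (use ex in \<open>simp add: traj_def\<close>)
qed

lemma pt_meas[measurable (raw)]:
  assumes [measurable]: "X \<in> borel_measurable M" "\<And>n. (\<lambda>m. Y m n) \<in> borel_measurable M"
  shows "(\<lambda>m. pt (X m) (Y m) n) \<in> borel_measurable M"
  by (induction n) simp_all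

lemma tm_meas[measurable (raw)]:
  assumes [measurable]: "X \<in> borel_measurable M" "\<And>n. (\<lambda>m. Y m n) \<in> borel_measurable M"
  shows "(\<lambda>m. tm (X m) (Y m) n) \<in> borel_measurable M"
  unfolding tm_def by measurable

lemma traj_meas:
  assumes X: "X \<in> borel_measurable M" and Y: "\<And>n. (\<lambda>m. Y m n) \<in> borel_measurable M" and T[measurable]: "T \<in> borel_measurable M"
  shows "(\<lambda>m. traj (X m) (Y m) (T m)) \<in> borel_measurable M"
proof -
  define P where "P n m = pt (X m) (Y m) n" for n m
  define R where "R n m = tm (X m) (Y m) n" for n m
  define W where "W n m = Y m n" for n m
  have [measurable]: "P n \<in> borel_measurable M" "R n \<in> borel_measurable M" "W n \<in> borel_measurable M" for n
    unfolding P_def R_def W_def by (rule pt_meas[OF X Y], rule tm_meas[OF X Y], rule Y)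
  define F where "F n m = (P n m + (T m - R n m) *\<^sub>R V (P n m) (W n m), V (P n m) (W n m))" for n m
  have F: "F n \<in> borel_measurable M" for n
    unfolding F_def by (intro borel_measurable_Pair) measurable
  define leg where "leg n m \<longleftrightarrow> R n m \<le> T m \<and> T m < R (Suc n) m" for n m
  have [measurable]: "Measurable.pred M (leg n)" for n unfolding leg_def by measurable
  have [measurable]: "(\<lambda>m. F (LEAST n. leg n m) m) \<in> borel_measurable M"
    by (rule measurable_compose_countable[OF F]) measurable
  have "(\<lambda>m. if \<exists>n. leg n m then F (LEAST n. leg n m) m else (0, 0)) \<in> borel_measurable M" by measurable
  then show ?thesis
    unfolding traj_def Let_def F_def P_def R_def W_def leg_def at_leg_def .
qed

lemma seq_component: "(\<lambda>\<eta>. \<eta> n) \<in> borel_measurable seqs"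
  using measurable_component_singleton[of n UNIV "\<lambda>_. law"] law_sets by (simp cong: measurable_cong_sets)

definition traj_law :: "'a \<Rightarrow> real \<Rightarrow> ('a \<times> 'a) measure" where
  "traj_law x s = distr seqs borel (\<lambda>\<eta>. traj x \<eta> s)"

lemma traj_seqs[measurable]: "(\<lambda>\<eta>. traj x \<eta> s) \<in> borel_measurable seqs"
  by (rule traj_meas) (auto intro: seq_component)

lemma pt_seqs[measurable]: "(\<lambda>\<eta>. pt x \<eta> n) \<in> borel_measurable seqs"
  by (rule pt_meas) (auto intro: seq_component)

lemma tm_seqs[measurable]: "(\<lambda>\<eta>. tm x \<eta> n) \<in> borel_measurable seqs"
  by (rule tm_meas) (auto intro: seq_component)

lemma prob_traj_law: "prob_space (traj_law x s)"
  unfolding traj_law_def by (rule seqs.prob_space_distr) measurable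

lemma ennreal_traj_law:
  assumes A: "A \<in> sets borel"
  shows "ennreal (measure (traj_law x s) A) = (\<integral>\<^sup>+\<eta>. indicator A (traj x \<eta> s) \<partial>seqs)"
proof -
  interpret t: prob_space "traj_law x s" by (rule prob_traj_law)
  have "A \<in> sets (traj_law x s)" using A by (simp add: traj_law_def)
  then have "ennreal (measure (traj_law x s) A) = (\<integral>\<^sup>+y. indicator A y \<partial>traj_law x s)"
    by (simp add: t.emeasure_eq_measure)
  also have "\<dots> = (\<integral>\<^sup>+\<eta>. indicator A (traj x \<eta> s) \<partial>seqs)"
    unfolding traj_law_def using A by (subst nn_integral_distr) auto
  finally show ?thesis .
qed

lemma traj_law_meas:
  assumes [measurable]: "A \<in> sets borel" "X \<in> borel_measurable M" "T \<in> borel_measurable M"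
  shows "(\<lambda>m. measure (traj_law (X m) (T m)) A) \<in> borel_measurable M"
proof -
  have [measurable]: "(\<lambda>p. traj (X (fst p)) (snd p) (T (fst p))) \<in> borel_measurable (M \<Otimes>\<^sub>M seqs)"
    apply (rule traj_meas)
    subgoal by measurable
    subgoal by (rule measurable_compose[OF measurable_snd seq_component])
    subgoal by measurable
    done
  have "(\<lambda>(m, \<eta>). indicator A (traj (X m) \<eta> (T m)) :: ennreal) \<in> borel_measurable (M \<Otimes>\<^sub>M seqs)"
    unfolding split_beta' by measurable
  from seqs.borel_measurable_nn_integral[OF this]
  have "(\<lambda>m. ennreal (measure (traj_law (X m) (T m)) A)) \<in> borel_measurable M"
    by (simp add: ennreal_traj_law)
  then have "(\<lambda>m. enn2real (ennreal (measure (traj_law (X m) (T m)) A))) \<in> borel_measurable M" by measurable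
  then show ?thesis by simp
qed

text \<open>The Markov property at the first reflection. This brings in the oscillation bound, with
  constants not depending on \<open>A\<close>.\<close>

lemma harm_traj_law:
  assumes A: "A \<in> sets borel"
  shows "harm (\<lambda>x s. measure (traj_law x s) A)"
  unfolding harm_def
proof (intro conjI allI ballI impI)
  show "(\<lambda>p. measure (traj_law (fst p) (snd p)) A) \<in> borel_measurable (borel \<Otimes>\<^sub>M borel)"
    by (rule traj_law_meas[OF A]) measurable
  show "measure (traj_law x s) A \<le> 1" for x s by (rule prob_space.prob_le_1[OF prob_traj_law])
  fix x s assume x: "x \<in> Rt" and s: "diam \<le> s"
  have m[measurable]: "(\<lambda>\<eta>. measure (traj_law (nxt x \<eta>) (s - len x \<eta>)) A) \<in> borel_measurable law"
    by (rule traj_law_meas[OF A]) measurable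
  have "ennreal (measure (traj_law x s) A) = (\<integral>\<^sup>+a. (\<integral>\<^sup>+\<eta>. indicator A (traj x (case_nat a \<eta>) s) \<partial>seqs) \<partial>law)"
    unfolding ennreal_traj_law[OF A] by (rule nn_integral_sequence_step[OF law_prob measurable_compose[OF traj_seqs borel_measurable_indicator[OF A]]])
  also have "\<dots> = (\<integral>\<^sup>+a. ennreal (measure (traj_law (nxt x a) (s - len x a)) A) \<partial>law)"
  proof (rule nn_integral_cong_AE, use step_AE[OF x] in eventually_elim)
    case (elim a)
    then have "len x a \<le> s" using s by linarith
    then show ?case by (simp add: ennreal_traj_law[OF A] traj_shift)
  qed
  also have "\<dots> = ennreal (\<integral>a. measure (traj_law (nxt x a) (s - len x a)) A \<partial>law)"
  proof (rule nn_integral_eq_integral)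
    show "integrable law (\<lambda>a. measure (traj_law (nxt x a) (s - len x a)) A)"
      by (rule law.integrable_const_bound[of _ 1]) (auto simp: prob_space.prob_le_1[OF prob_traj_law])
  qed simp
  finally show "measure (traj_law x s) A = (\<integral>a. measure (traj_law (nxt x a) (s - len x a)) A \<partial>law)"
    by (simp add: integral_nonneg_AE)
qed simp

text \<open>
  By the definition of the hitting time the open flight segment does not meet the boundary, so it
  lies in \<open>D\<close> as soon as its midpoint does; this makes \<open>good\<close> a measurable condition.
\<close>

definition good :: "'a \<Rightarrow> 'a \<Rightarrow> bool" where
  "good x \<eta> \<longleftrightarrow> x \<in> Rt \<and> 0 < len x \<eta> \<and> norm (V x \<eta>) = 1 \<and> x + (len x \<eta> / 2) *\<^sub>R V x \<eta> \<in> D"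

definition good_path :: "'a \<Rightarrow> (nat \<Rightarrow> 'a) \<Rightarrow> bool" where
  "good_path x \<eta> \<longleftrightarrow> (\<forall>n. good (pt x \<eta> n) (\<eta> n)) \<and> (\<forall>c::nat. \<exists>n. c < tm x \<eta> n)"

lemma D_borel[measurable]: "D \<in> sets borel" using D_open by simp
declare Rt_borel[measurable]

lemma good_meas:
  assumes [measurable]: "f \<in> borel_measurable M" "g \<in> borel_measurable M"
  shows "Measurable.pred M (\<lambda>m. good (f m) (g m))"
  unfolding good_def by measurable

lemma good_path_meas:
  assumes [measurable]: "X \<in> borel_measurable M" "\<And>n. (\<lambda>m. Y m n) \<in> borel_measurable M"
  shows "Measurable.pred M (\<lambda>m. good_path (X m) (Y m))"
proof -
  have [measurable]: "Measurable.pred M (\<lambda>m. good (pt (X m) (Y m) n) (Y m n))" for n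
    by (rule good_meas) measurable
  show ?thesis unfolding good_path_def by measurable
qed

section \<open>Almost all paths are good\<close>

lemma good_AE:
  assumes "x \<in> Rt" shows "AE \<eta> in law. good x \<eta>"
  using step_AE[OF assms] by eventually_elim (use assms in \<open>auto simp: good_def\<close>)

lemma AE_seqs_step:
  assumes Q: "Measurable.pred seqs Q" and ae: "AE a in law. AE \<eta> in seqs. Q (case_nat a \<eta>)"
  shows "AE \<eta> in seqs. Q \<eta>"
proof -
  have m: "{\<eta> \<in> space seqs. \<not> Q \<eta>} \<in> sets seqs" using Q by measurable
  have "emeasure seqs {\<eta> \<in> space seqs. \<not> Q \<eta>} = (\<integral>\<^sup>+\<eta>. indicator {\<eta> \<in> space seqs. \<not> Q \<eta>} \<eta> \<partial>seqs)"
    using m by simp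
  also have "\<dots> = (\<integral>\<^sup>+a. (\<integral>\<^sup>+\<eta>. indicator {\<eta> \<in> space seqs. \<not> Q \<eta>} (case_nat a \<eta>) \<partial>seqs) \<partial>law)"
    using m by (intro nn_integral_sequence_step law_prob) simp
  also have "\<dots> = (\<integral>\<^sup>+a. 0 \<partial>law)"
  proof (rule nn_integral_cong_AE, use ae in eventually_elim)
    case (elim a)
    then have "(\<integral>\<^sup>+\<eta>. indicator {\<eta> \<in> space seqs. \<not> Q \<eta>} (case_nat a \<eta>) \<partial>seqs) = (\<integral>\<^sup>+\<eta>. 0 \<partial>seqs)"
      by (intro nn_integral_cong_AE) (auto simp: indicator_def elim!: eventually_mono)
    then show ?case by simp
  qed
  finally have "emeasure seqs {\<eta> \<in> space seqs. \<not> Q \<eta>} = 0" by simp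
  then show ?thesis using m by (simp add: AE_iff_measurable[OF m])
qed

lemma good_pt_AE:
  shows "x \<in> Rt \<Longrightarrow> AE \<eta> in seqs. good (pt x \<eta> n) (\<eta> n)"
proof (induction n arbitrary: x)
  case 0
  show ?case
  proof (rule AE_seqs_step)
    show "Measurable.pred seqs (\<lambda>\<eta>. good (pt x \<eta> 0) (\<eta> 0))" by (rule good_meas[OF pt_seqs seq_component])
    show "AE a in law. AE \<eta> in seqs. good (pt x (case_nat a \<eta>) 0) (case_nat a \<eta> 0)"
      using good_AE[OF 0] by eventually_elim simp
  qed
next
  case (Suc n)
  show ?case
  proof (rule AE_seqs_step)
    show "Measurable.pred seqs (\<lambda>\<eta>. good (pt x \<eta> (Suc n)) (\<eta> (Suc n)))" by (rule good_meas[OF pt_seqs seq_component])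
    show "AE a in law. AE \<eta> in seqs. good (pt x (case_nat a \<eta>) (Suc n)) (case_nat a \<eta> (Suc n))"
      using step_AE[OF Suc.prems]
    proof eventually_elim
      case (elim a)
      then have "AE \<eta> in seqs. good (pt (nxt x a) \<eta> n) (\<eta> n)" by (intro Suc.IH) simp
      then show ?case by (simp add: pt_shift del: pt.simps(2))
    qed
  qed
qed

text \<open>The Laplace transform of the reflection times decays geometrically, because each flight
  lasts \<open>r0\<close> with conditional probability at least \<open>p\<close>; if the times
  stayed below \<open>c\<close>, the transform could not fall below a multiple of
  \<open>exp (- c)\<close>.\<close>

lemma tm_unbounded_AE:
  assumes x: "x \<in> Rt" shows "AE \<eta> in seqs. \<exists>n. (c::nat) < tm x \<eta> n"
proof -
  obtain r0 p where r0: "0 < r0" and p: "0 < p" "\<And>x. x \<in> Rt \<Longrightarrow> ennreal p \<le> emeasure law {\<eta>. r0 \<le> len x \<eta>}"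
    by (rule long_flight_uniform) (rule that)
  have sl: "space law = UNIV" using sets_eq_imp_space_eq[OF law_sets] by simp
  \<comment> \<open>The bound for the mean of \<open>exp (- len)\<close>: at most
    \<open>exp (- r0)\<close> on long flights and at most 1 on the others.\<close>
  define r where "r = 1 - p * (1 - exp (- r0))"
  have e1: "exp (- r0) < 1" using r0 by simp
  have me: "{\<eta>. r0 \<le> len y \<eta>} \<in> sets law" for y
  proof -
    have "{\<eta> \<in> space law. r0 \<le> len y \<eta>} \<in> sets law" by measurable
    then show ?thesis using sl by simp
  qed
  have pm: "p \<le> measure law {\<eta>. r0 \<le> len y \<eta>}" if "y \<in> Rt" for y
    using p(2)[OF that] by (simp add: law.emeasure_eq_measure)
  have p1: "p \<le> 1" using pm[OF x] law.prob_le_1 order_trans by blast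
  have r: "0 \<le> r" "r < 1"
  proof -
    have "p * (1 - exp (- r0)) \<le> 1 * 1" using p p1 e1 by (intro mult_mono) auto
    then show "0 \<le> r" by (simp add: r_def)
    show "r < 1" using p e1 by (simp add: r_def)
  qed
  have one: "(\<integral>\<^sup>+\<eta>. ennreal (exp (- len y \<eta>)) \<partial>law) \<le> ennreal r" if y: "y \<in> Rt" for y
  proof -
    have "(\<integral>\<^sup>+\<eta>. ennreal (exp (- len y \<eta>)) \<partial>law) \<le> (\<integral>\<^sup>+\<eta>. ennreal (1 - indicator {\<eta>. r0 \<le> len y \<eta>} \<eta> * (1 - exp (- r0))) \<partial>law)"
      by (rule nn_integral_mono_AE, use step_AE[OF y] in eventually_elim) (auto simp: indicator_def intro!: ennreal_leI)
    also have "\<dots> = ennreal (\<integral>\<eta>. 1 - indicator {\<eta>. r0 \<le> len y \<eta>} \<eta> * (1 - exp (- r0)) \<partial>law)"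
    proof (rule nn_integral_eq_integral)
      show "integrable law (\<lambda>\<eta>. 1 - indicator {\<eta>. r0 \<le> len y \<eta>} \<eta> * (1 - exp (- r0)))"
        using me by (intro Bochner_Integration.integrable_diff integrable_mult_left integrable_real_indicator) (auto simp: law.emeasure_eq_measure)
    qed (use e1 in \<open>simp add: indicator_def\<close>)
    also have "(\<integral>\<eta>. 1 - indicator {\<eta>. r0 \<le> len y \<eta>} \<eta> * (1 - exp (- r0)) \<partial>law) = 1 - measure law {\<eta>. r0 \<le> len y \<eta>} * (1 - exp (- r0))"
      using me by (subst Bochner_Integration.integral_diff) (auto simp: law.prob_space law.emeasure_eq_measure)
    also have "ennreal \<dots> \<le> ennreal r" unfolding r_def using pm[OF y] e1 by (intro ennreal_leI diff_left_mono mult_right_mono) auto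
    finally show ?thesis .
  qed
  have decay: "y \<in> Rt \<Longrightarrow> (\<integral>\<^sup>+\<eta>. ennreal (exp (- tm y \<eta> n)) \<partial>seqs) \<le> ennreal (r ^ n)" for y n
  proof (induction n arbitrary: y)
    case 0 then show ?case by (simp add: tm_def seqs.emeasure_space_1)
  next
    case (Suc n)
    have "(\<integral>\<^sup>+\<eta>. ennreal (exp (- tm y \<eta> (Suc n))) \<partial>seqs) =
       (\<integral>\<^sup>+a. (\<integral>\<^sup>+\<eta>. ennreal (exp (- tm y (case_nat a \<eta>) (Suc n))) \<partial>seqs) \<partial>law)"
      by (rule nn_integral_sequence_step[OF law_prob]) measurable
    also have "\<dots> \<le> (\<integral>\<^sup>+a. ennreal (exp (- len y a)) * ennreal (r ^ n) \<partial>law)"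
    proof (rule nn_integral_mono_AE, use step_AE[OF Suc.prems] in eventually_elim)
      case (elim a)
      have "(\<integral>\<^sup>+\<eta>. ennreal (exp (- tm y (case_nat a \<eta>) (Suc n))) \<partial>seqs) =
         (\<integral>\<^sup>+\<eta>. ennreal (exp (- len y a)) * ennreal (exp (- tm (nxt y a) \<eta> n)) \<partial>seqs)"
        by (intro nn_integral_cong) (simp add: tm_shift exp_add[symmetric] ennreal_mult[symmetric])
      also have "\<dots> = ennreal (exp (- len y a)) * (\<integral>\<^sup>+\<eta>. ennreal (exp (- tm (nxt y a) \<eta> n)) \<partial>seqs)"
        by (rule nn_integral_cmult) measurable
      also have "\<dots> \<le> ennreal (exp (- len y a)) * ennreal (r ^ n)"
        using elim by (intro mult_left_mono Suc.IH) auto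
      finally show ?case .
    qed
    also have "\<dots> = (\<integral>\<^sup>+a. ennreal (exp (- len y a)) \<partial>law) * ennreal (r ^ n)" by (rule nn_integral_multc) measurable
    also have "\<dots> \<le> ennreal r * ennreal (r ^ n)" by (intro mult_right_mono one Suc.prems) simp
    finally show ?case using r by (simp add: ennreal_mult)
  qed
  define B where "B = {\<eta> \<in> space seqs. \<not> (\<exists>n. c < tm x \<eta> n)}"
  have B: "B \<in> sets seqs" unfolding B_def by measurable
  have "ennreal (exp (- c)) * emeasure seqs B \<le> ennreal (r ^ n)" for n
  proof -
    have "ennreal (exp (- c)) * emeasure seqs B = (\<integral>\<^sup>+\<eta>. ennreal (exp (- c)) * indicator B \<eta> \<partial>seqs)"
      using B by (simp add: nn_integral_cmult_indicator)
    also have "\<dots> \<le> (\<integral>\<^sup>+\<eta>. ennreal (exp (- tm x \<eta> n)) \<partial>seqs)"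
      by (intro nn_integral_mono) (auto simp: B_def indicator_def not_less intro!: ennreal_leI)
    also have "\<dots> \<le> ennreal (r ^ n)" by (rule decay[OF x])
    finally show ?thesis .
  qed
  moreover have "(\<lambda>n. ennreal (r ^ n)) \<longlonglongrightarrow> ennreal 0" using r by (intro tendsto_ennrealI LIMSEQ_power_zero) auto
  ultimately have "ennreal (exp (- c)) * emeasure seqs B \<le> ennreal 0" by (intro LIMSEQ_le_const) auto
  then have "emeasure seqs B = 0" by (simp add: seqs.emeasure_eq_measure ennreal_mult[symmetric] mult_le_0_iff)
  then show ?thesis using AE_iff_measurable[OF B, of "\<lambda>\<eta>. \<exists>n. c < tm x \<eta> n"] by (simp add: B_def)
qed

lemma good_path_AE:
  assumes x: "x \<in> Rt" shows "AE \<eta> in seqs. good_path x \<eta>"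
proof -
  have "AE \<eta> in seqs. \<forall>n. good (pt x \<eta> n) (\<eta> n)" using good_pt_AE[OF x] by (simp add: AE_all_countable)
  moreover have "AE \<eta> in seqs. \<forall>c::nat. \<exists>n. c < tm x \<eta> n" using tm_unbounded_AE[OF x] by (simp add: AE_all_countable)
  ultimately show ?thesis by eventually_elim (simp add: good_path_def)
qed

lemma good_path_leg:
  assumes g: "good_path x \<eta>" and t: "0 \<le> t"
  shows "\<exists>!n. at_leg x \<eta> t n"
proof -
  have sm: "strict_mono (tm x \<eta>)"
    using g by (intro strict_mono_Suc_iff[THEN iffD2]) (auto simp: tm_def good_path_def good_def)
  obtain c :: nat where "t \<le> c" using real_arch_simple by blast
  moreover obtain N where "c < tm x \<eta> N" using g by (auto simp: good_path_def)
  ultimately have N: "t < tm x \<eta> N" by linarith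
  define m where "m = (LEAST m. t < tm x \<eta> m)"
  have m: "t < tm x \<eta> m" unfolding m_def using N by (rule LeastI)
  have m': "\<not> t < tm x \<eta> k" if "k < m" for k using that unfolding m_def by (rule not_less_Least)
  have "m \<noteq> 0"
  proof
    assume "m = 0"
    then have "tm x \<eta> m = 0" by (simp add: tm_def)
    then show False using m t by simp
  qed
  then obtain n where n: "m = Suc n" by (cases m) auto
  then have "at_leg x \<eta> t n" using m m'[of n] by (auto simp: at_leg_def not_less)
  moreover have "n1 = n2" if "at_leg x \<eta> t n1" "at_leg x \<eta> t n2" for n1 n2
  proof -
    have "tm x \<eta> n1 < tm x \<eta> (Suc n2)" "tm x \<eta> n2 < tm x \<eta> (Suc n1)" using that by (auto simp: at_leg_def)
    then show ?thesis using strict_mono_less[OF sm] by simp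
  qed
  ultimately show ?thesis by blast
qed

lemma good_path_traj:
  assumes g: "good_path x \<eta>" and t: "0 \<le> t" and n: "at_leg x \<eta> t n"
  shows "traj x \<eta> t = (pt x \<eta> n + (t - tm x \<eta> n) *\<^sub>R V (pt x \<eta> n) (\<eta> n), V (pt x \<eta> n) (\<eta> n))"
proof -
  have "(LEAST n. at_leg x \<eta> t n) = n" using good_path_leg[OF g t] n by (metis LeastI)
  then show ?thesis using n by (auto simp: traj_def)
qed

lemma good_inside:
  assumes g: "good x \<eta>" and t: "0 < t" "t < len x \<eta>"
  shows "x + t *\<^sub>R V x \<eta> \<in> D"
proof (rule ccontr)
  assume nD: "x + t *\<^sub>R V x \<eta> \<notin> D"
  let ?h = "len x \<eta> / 2"
  have h: "0 < ?h" "?h < len x \<eta>" using t by auto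
  define S where "S = closed_segment (x + ?h *\<^sub>R V x \<eta>) (x + t *\<^sub>R V x \<eta>)"
  have "S \<inter> frontier D \<noteq> {}"
    unfolding S_def using g nD by (intro connected_Int_frontier) (auto simp: good_def)
  then obtain z where z: "z \<in> S" "z \<in> frontier D" by blast
  then obtain \<theta> where \<theta>: "0 \<le> \<theta>" "\<theta> \<le> 1" "z = (1 - \<theta>) *\<^sub>R (x + ?h *\<^sub>R V x \<eta>) + \<theta> *\<^sub>R (x + t *\<^sub>R V x \<eta>)"
    by (auto simp: S_def closed_segment_def)
  define r where "r = (1 - \<theta>) * ?h + \<theta> * t"
  have zr: "z = x + r *\<^sub>R V x \<eta>" unfolding \<theta>(3) r_def by (simp add: algebra_simps)
  have "r \<in> {0<..<len x \<eta>}" unfolding r_def using \<theta> h t convexD_alt[of "{0<..<len x \<eta>}" ?h t \<theta>] by (simp add: convex_real_interval)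
  then have "len x \<eta> \<le> r" unfolding len_def hit_time_def using z zr by (intro cInf_lower) (auto intro!: bdd_belowI[of _ 0])
  then show False using \<open>r \<in> _\<close> by simp
qed

lemma good_path_traj_inside:
  assumes g: "good_path x \<eta>" and t: "0 \<le> t" and nt: "\<And>n. tm x \<eta> n \<noteq> t"
  shows "traj x \<eta> t \<in> D \<times> sphere 0 1"
proof -
  obtain n where n: "at_leg x \<eta> t n" using good_path_leg[OF g t] by blast
  have gn: "good (pt x \<eta> n) (\<eta> n)" using g by (simp add: good_path_def)
  have "0 < t - tm x \<eta> n" "t - tm x \<eta> n < len (pt x \<eta> n) (\<eta> n)"
    using n nt[of n] by (auto simp: at_leg_def tm_def)
  then show ?thesis using good_inside[OF gn] gn good_path_traj[OF g t n] by (simp add: good_def)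
qed

text \<open>
  At a time that is not an atom of any reflection time the particle is almost surely inside \<open>D\<close>;
  the limit law has to be taken along such times.
\<close>

lemma generic_time:
  assumes x: "x \<in> Rt" and c: "0 \<le> c"
  obtains s where "c \<le> s" "measure (traj_law x s) (D \<times> sphere 0 1) = 1"
proof -
  define At where "At n = {t. measure (distr seqs borel (\<lambda>\<eta>. tm x \<eta> n)) {t} \<noteq> 0}" for n
  have "countable (At n)" for n
  proof -
    interpret d: prob_space "distr seqs borel (\<lambda>\<eta>. tm x \<eta> n)" by (rule seqs.prob_space_distr) measurable
    show ?thesis unfolding At_def by (rule d.countable_support)
  qed
  then have "countable (\<Union>n. At n)" by simp
  moreover have "uncountable {c<..<c + 1}" by (simp add: uncountable_open_interval)
  ultimately obtain s where s: "s \<in> {c<..<c + 1}" "s \<notin> (\<Union>n. At n)" by (meson countable_subset subsetI)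
  have ne: "AE \<eta> in seqs. tm x \<eta> n \<noteq> s" for n
  proof -
    have m: "{\<eta> \<in> space seqs. tm x \<eta> n = s} \<in> sets seqs" by measurable
    have "measure (distr seqs borel (\<lambda>\<eta>. tm x \<eta> n)) {s} = 0" using s by (auto simp: At_def)
    then have "measure seqs ((\<lambda>\<eta>. tm x \<eta> n) -` {s} \<inter> space seqs) = 0" by (subst (asm) measure_distr) auto
    also have "(\<lambda>\<eta>. tm x \<eta> n) -` {s} \<inter> space seqs = {\<eta> \<in> space seqs. tm x \<eta> n = s}" by auto
    finally show ?thesis using m by (subst AE_iff_measurable[OF m]) (auto simp: seqs.emeasure_eq_measure)
  qed
  then have "AE \<eta> in seqs. \<forall>n. tm x \<eta> n \<noteq> s" by (simp add: AE_all_countable)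
  then have ae: "AE \<eta> in seqs. traj x \<eta> s \<in> D \<times> sphere 0 1"
    using good_path_AE[OF x] by eventually_elim (use s c in \<open>intro good_path_traj_inside; auto\<close>)
  have Ds: "D \<times> (sphere 0 1 :: 'a set) \<in> sets borel"
    by (intro borel_Times D_borel borel_closed closed_sphere)
  interpret t: prob_space "traj_law x s" by (rule prob_traj_law)
  have "AE y in traj_law x s. y \<in> D \<times> sphere 0 1"
    unfolding traj_law_def using ae Ds by (subst AE_distr_iff) auto
  then have "measure (traj_law x s) (D \<times> sphere 0 1) = 1"
    using Ds by (subst t.prob_eq_1) (auto simp: traj_law_def)
  then show ?thesis using s by (intro that[of s]) auto
qed

text \<open>The law is the limit along times \<open>s k\<close> that are at least
  \<open>k * T0\<close> and at which the particle is almost surely inside \<open>D\<close>, so that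
  the limit gives full mass to \<open>D \<times> sphere 0 1\<close>. Uniformity in the set then
  turns closeness to \<open>traj_law z (s l)\<close> into closeness to the limit.\<close>

lemma stationary_law:
  obtains \<nu> T0 q where "prob_space \<nu>" "sets \<nu> = sets borel" "emeasure \<nu> (D \<times> sphere 0 1) = 1"
    "0 < T0" "0 < q" "q < 1"
    "\<And>x s (k::nat) A. x \<in> Rt \<Longrightarrow> real k * T0 \<le> s \<Longrightarrow> A \<in> sets borel \<Longrightarrow> \<bar>measure (traj_law x s) A - measure \<nu> A\<bar> \<le> (1 - q) ^ k"
proof -
  obtain T0 q where T0: "0 < T0" "0 < q" "q < 1"
    and con: "\<And>f (k::nat) x y (s::real) (t::real). harm f \<Longrightarrow> x \<in> Rt \<Longrightarrow> y \<in> Rt \<Longrightarrow> real k * T0 \<le> s \<Longrightarrow> real k * T0 \<le> t \<Longrightarrow> \<bar>f x s - f y t\<bar> \<le> (1 - q) ^ k"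
    by (rule harm_forgets) (rule that)
  \<comment> \<open>Called for a regular starting point \<open>z\<close> only.\<close>
  obtain z \<epsilon> lam \<alpha> \<beta> c where x0: "z \<in> Rt" by (rule loop_minorization) (rule that)
  have "\<exists>s. real k * T0 \<le> s \<and> measure (traj_law z s) (D \<times> sphere 0 1) = 1" for k :: nat
    by (rule generic_time[OF x0, of "real k * T0"]) (use T0 in auto)
  then obtain s where s: "\<And>k::nat. real k * T0 \<le> s k" "\<And>k. measure (traj_law z (s k)) (D \<times> sphere 0 1) = 1" by metis
  have Ds: "D \<times> (sphere 0 1 :: 'a set) \<in> sets borel" by (intro borel_Times D_borel borel_closed closed_sphere)
  have q0: "(\<lambda>k. (1 - q) ^ k) \<longlonglongrightarrow> 0" using T0 by (intro LIMSEQ_power_zero) auto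
  have mono: "real k * T0 \<le> s l" if "k \<le> l" for k l
  proof -
    have "real k * T0 \<le> real l * T0" using that T0 by (intro mult_right_mono) auto
    then show ?thesis using s(1)[of l] by linarith
  qed
  have cl: "\<bar>measure (traj_law z (s k)) A - measure (traj_law z (s l)) A\<bar> \<le> (1 - q) ^ k" if "A \<in> sets borel" "k \<le> l" for k l A
    by (rule con[OF harm_traj_law[OF that(1)] x0 x0 mono[OF le_refl] mono[OF that(2)]])
  have sl: "sets (traj_law z (s k)) = sets borel" for k by (simp add: traj_law_def)
  obtain \<nu> where \<nu>: "prob_space \<nu>" "sets \<nu> = sets borel"
      "\<And>A. A \<in> sets borel \<Longrightarrow> (\<lambda>k. measure (traj_law z (s k)) A) \<longlonglongrightarrow> measure \<nu> A"
    by (rule limit_prob_space[of "\<lambda>k. traj_law z (s k)" borel "\<lambda>k. (1 - q) ^ k", OF prob_traj_law sl cl q0]) (assumption+, rule that)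
  interpret \<nu>: prob_space \<nu> by fact
  show ?thesis
  proof (rule that[OF \<nu>(1,2) _ T0])
    have "measure \<nu> (D \<times> sphere 0 1) = 1" using \<nu>(3)[OF Ds] by (simp add: s(2) LIMSEQ_const_iff)
    then show "emeasure \<nu> (D \<times> sphere 0 1) = 1" by (simp add: \<nu>.emeasure_eq_measure)
    fix x t and k :: nat and A :: "('a \<times> 'a) set" assume x: "x \<in> Rt" and t: "real k * T0 \<le> t" and A: "A \<in> sets borel"
    have "(\<lambda>l. \<bar>measure (traj_law x t) A - measure (traj_law z (s l)) A\<bar>) \<longlonglongrightarrow> \<bar>measure (traj_law x t) A - measure \<nu> A\<bar>"
      by (intro tendsto_intros \<nu>(3) A)
    moreover have "\<bar>measure (traj_law x t) A - measure (traj_law z (s l)) A\<bar> \<le> (1 - q) ^ k" if "k \<le> l" for l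
      by (rule con[OF harm_traj_law[OF A] x x0 t mono[OF that]])
    ultimately show "\<bar>measure (traj_law x t) A - measure \<nu> A\<bar> \<le> (1 - q) ^ k"
      by (intro LIMSEQ_le_const2) auto
  qed
qed

end

section \<open>The stochastic billiard\<close>

text \<open>The billiard path is defined by descriptions with unspecified values off a null set, and
  \<open>g\<close> stands for it. Agreement almost everywhere with a Borel \<open>Y\<close> makes
  \<open>g\<close> measurable for the completion and fixes its law.\<close>

lemma distr_completion_eq_distr:
  assumes Y: "Y \<in> borel_measurable M" and ae: "AE x in M. g x = Y x"
  shows "distr (completion M) borel g = distr M borel Y"
proof -
  from AE_E[OF ae] obtain N where N: "{x \<in> space M. g x \<noteq> Y x} \<subseteq> N" "emeasure M N = 0" "N \<in> sets M" .
  have Ys: "Y -` A \<inter> space M \<in> sets M" if "A \<in> sets borel" for A using measurable_sets[OF Y that] .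
  have gs: "g -` A \<inter> space M \<in> sets (completion M)" if A: "A \<in> sets borel" for A
  proof (rule sets_completionI)
    show "g -` A \<inter> space M = (Y -` A \<inter> space M - N) \<union> (g -` A \<inter> space M \<inter> N)" using N(1) by auto
    show "N \<in> null_sets M" using N by auto
  qed (use Ys[OF A] N(3) in auto)
  have g: "g \<in> borel_measurable (completion M)" by (rule measurableI) (auto simp: gs)
  show ?thesis
  proof (rule measure_eqI)
    fix A assume "A \<in> sets (distr (completion M) borel g)"
    then have A: "A \<in> sets borel" by simp
    have "emeasure (completion M) (g -` A \<inter> space M) = emeasure (completion M) (Y -` A \<inter> space M)"
    proof (rule emeasure_eq_AE)
      show "AE x in completion M. x \<in> g -` A \<inter> space M \<longleftrightarrow> x \<in> Y -` A \<inter> space M"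
        using AE_completion[OF ae] by eventually_elim auto
    qed (use gs[OF A] Ys[OF A] in auto)
    then show "emeasure (distr (completion M) borel g) A = emeasure (distr M borel Y) A"
      using A g Y Ys[OF A] by (simp add: emeasure_distr)
  qed simp
qed

text \<open>No measurability of \<open>g\<close> is assumed: otherwise the image measure is the null measure.\<close>

lemma distr_subprob:
  assumes "prob_space M" shows "emeasure (distr M N g) A \<le> 1"
proof -
  interpret prob_space M by fact
  show ?thesis
    unfolding distr_def emeasure_measure_of_conv by (simp add: measure_le_1 emeasure_le_1)
qed

text \<open>Group the cells of a partition by the sign of the difference: the sum of absolute values
  is the difference on one union minus that on the other, each at most \<open>\<epsilon>\<close> in
  absolute value.\<close>

lemma total_variation_norm_le:
  assumes m: "finite_measure m1" "finite_measure m2" "sets m1 = sets M" "sets m2 = sets M"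
    and le: "\<And>A. A \<in> sets M \<Longrightarrow> \<bar>measure m1 A - measure m2 A\<bar> \<le> \<epsilon>"
  shows "total_variation_norm M (\<lambda>A. measure m1 A - measure m2 A) \<le> 2 * \<epsilon>"
  unfolding total_variation_norm_def
proof (rule cSUP_least)
  show "{P. finite P \<and> P \<subseteq> sets M \<and> disjoint P \<and> \<Union>P = space M} \<noteq> {}"
    by (auto intro!: exI[of _ "{space M}"] simp: disjoint_def)
  fix P assume "P \<in> {P. finite P \<and> P \<subseteq> sets M \<and> disjoint P \<and> \<Union>P = space M}"
  then have P: "finite P" "P \<subseteq> sets M" "disjoint P" by auto
  interpret m1: finite_measure m1 by fact
  interpret m2: finite_measure m2 by fact
  define f where "f A = measure m1 A - measure m2 A" for A
  have sum: "(\<Sum>B\<in>Q. f B) = f (\<Union>Q)" if Q: "Q \<subseteq> P" for Q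
  proof -
    have fin: "finite Q" "Q \<subseteq> sets M" using P Q by (auto intro: finite_subset)
    have d: "disjoint_family_on (\<lambda>B. B) Q" using P(3) Q by (auto simp: disjoint_family_on_def disjoint_def)
    have "measure m1 (\<Union>B\<in>Q. B) = (\<Sum>B\<in>Q. measure m1 B)" using fin d m by (intro m1.finite_measure_finite_Union) auto
    moreover have "measure m2 (\<Union>B\<in>Q. B) = (\<Sum>B\<in>Q. measure m2 B)" using fin d m by (intro m2.finite_measure_finite_Union) auto
    ultimately show ?thesis by (simp add: f_def sum_subtractf)
  qed
  have le': "\<bar>f (\<Union>Q)\<bar> \<le> \<epsilon>" if "Q \<subseteq> P" for Q
    unfolding f_def using P that by (intro le sets.finite_Union) (auto intro: finite_subset)
  let ?p = "{B \<in> P. 0 \<le> f B}"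
  have "(\<Sum>B\<in>P. \<bar>f B\<bar>) = (\<Sum>B\<in>?p. \<bar>f B\<bar>) + (\<Sum>B\<in>P - ?p. \<bar>f B\<bar>)"
    using P(1) by (subst sum.subset_diff[of ?p P]) auto
  also have "(\<Sum>B\<in>?p. \<bar>f B\<bar>) = f (\<Union>?p)" by (subst sum[symmetric]) (auto intro: sum.cong)
  also have "(\<Sum>B\<in>P - ?p. \<bar>f B\<bar>) = - (\<Sum>B\<in>P - ?p. f B)" unfolding sum_negf[symmetric] by (intro sum.cong) auto
  also have "(\<Sum>B\<in>P - ?p. f B) = f (\<Union>(P - ?p))" by (rule sum) auto
  finally show "(\<Sum>B\<in>P. \<bar>measure m1 B - measure m2 B\<bar>) \<le> 2 * \<epsilon>"
    using le'[of ?p] le'[of "P - ?p"] unfolding f_def by auto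
qed

section \<open>From the given data to a stochastic table\<close>

locale reflected_billiard =
  fixes D Rt :: "'m::finite space set" and e :: "'m space" and \<gamma> :: "'m space \<Rightarrow> real"
    and U :: "'m space \<Rightarrow> 'm space \<Rightarrow>\<^sub>L 'm space"
  assumes dom: "billiard_domain D Rt" and bdd: "bounded D"
    and dens: "reflection_density e \<gamma>" and frame: "reflection_frame D Rt e \<gamma> U"
begin

text \<open>The value 0 off the boundary makes the map Borel on the whole space, as \<open>U\<close>
  is measurable only on the boundary.\<close>

definition refl :: "'m space \<Rightarrow> 'm space \<Rightarrow> 'm space" where
  "refl x \<eta> = (if x \<in> frontier D then blinfun_apply (U x) \<eta> else 0)"

lemma half_sphere_borel: "half_sphere e \<in> sets borel"
proof -
  have "half_sphere e = {w. norm w = 1} \<inter> {w. 0 < e \<bullet> w}" by (auto simp: half_sphere_def)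
  also have "\<dots> \<in> sets borel" by measurable
  finally show ?thesis .
qed

lemma density_meas: "(\<lambda>u. ennreal (\<gamma> u) * indicator (half_sphere e) u) \<in> borel_measurable borel"
proof -
  have "\<gamma> \<in> borel_measurable (restrict_space borel (half_sphere e))" using dens by (simp add: reflection_density_def)
  then have "(\<lambda>u. ennreal (\<gamma> u)) \<in> borel_measurable (restrict_space borel (half_sphere e))" by measurable
  then show ?thesis using half_sphere_borel by (subst (asm) borel_measurable_restrict_space_iff_ennreal) auto
qed

lemma nn_integral_reflection_measure:
  assumes "g \<in> borel_measurable borel"
  shows "(\<integral>\<^sup>+\<eta>. g \<eta> \<partial>reflection_measure e \<gamma>) = (\<integral>\<^sup>+\<eta>. ennreal (\<gamma> \<eta>) * indicator (half_sphere e) \<eta> * g \<eta> \<partial>sphere_measure)"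
  unfolding reflection_measure_def using assms density_meas by (intro nn_integral_density) (auto simp: measurable_def sets_eq_imp_space_eq[OF sets_sphere_measure])

lemma refl_orthogonal: "x \<in> Rt \<Longrightarrow> orthogonal_transformation (refl x)"
  and refl_e: "x \<in> Rt \<Longrightarrow> refl x e = inner_normal D x"
proof -
  assume x: "x \<in> Rt"
  interpret billiard_table D Rt "inner_normal D" by (rule billiard_domain_imp_table[OF dom bdd])
  have xf: "x \<in> frontier D" using x Rt_sub by auto
  then have "refl x = blinfun_apply (U x)" by (auto simp: refl_def)
  then show "orthogonal_transformation (refl x)" "refl x e = inner_normal D x"
    using frame x xf by (auto simp: reflection_frame_def)
qed

lemma refl_meas: "(\<lambda>p. refl (fst p) (snd p)) \<in> borel_measurable (borel \<Otimes>\<^sub>M borel)"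
proof -
  have "U \<in> borel_measurable (restrict_space borel (frontier D))" using frame by (simp add: reflection_frame_def)
  then have U: "(\<lambda>x. if x \<in> frontier D then U x else 0) \<in> borel_measurable borel"
    by (subst (asm) measurable_restrict_space_iff[where c=0]) auto
  have b: "(\<lambda>x. refl x b) \<in> borel_measurable borel" for b
  proof -
    have "continuous_on UNIV (\<lambda>F :: 'm space \<Rightarrow>\<^sub>L 'm space. blinfun_apply F b)" by (intro continuous_intros)
    from measurable_compose[OF U borel_measurable_continuous_onI[OF this]]
    have "(\<lambda>x. blinfun_apply (if x \<in> frontier D then U x else 0) b) \<in> borel_measurable borel" .
    moreover have "blinfun_apply (if x \<in> frontier D then U x else 0) b = refl x b" for x by (simp add: refl_def)
    ultimately show ?thesis by simp
  qed
  \<comment> \<open>Linearity in \<open>\<eta>\<close> reduces joint measurability to measurability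
    in \<open>x\<close> for finitely many basis vectors.\<close>
  have "refl x \<eta> = (\<Sum>b\<in>Basis. (\<eta> \<bullet> b) *\<^sub>R refl x b)" for x \<eta>
  proof (cases "x \<in> frontier D")
    case True
    have "blinfun_apply (U x) \<eta> = blinfun_apply (U x) (\<Sum>b\<in>Basis. (\<eta> \<bullet> b) *\<^sub>R b)" by (simp only: euclidean_representation)
    also have "\<dots> = (\<Sum>b\<in>Basis. (\<eta> \<bullet> b) *\<^sub>R blinfun_apply (U x) b)" by (simp only: blinfun.sum_right blinfun.scaleR_right)
    finally show ?thesis using True by (simp add: refl_def)
  qed (simp add: refl_def)
  then have "(\<lambda>p. refl (fst p) (snd p)) = (\<lambda>p. \<Sum>b\<in>Basis. (snd p \<bullet> b) *\<^sub>R refl (fst p) b)" by (rule ext)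
  moreover have "(\<lambda>p. \<Sum>b\<in>Basis. (snd p \<bullet> b) *\<^sub>R refl (fst p) b) \<in> borel_measurable (borel \<Otimes>\<^sub>M borel)"
    by (intro borel_measurable_sum borel_measurable_scaleR measurable_compose[OF measurable_fst b]) measurable
  ultimately show ?thesis by simp
qed

lemma AE_reflection_measure:
  assumes "AE \<eta> in sphere_measure. \<eta> \<in> half_sphere e \<longrightarrow> P \<eta>"
  shows "AE \<eta> in reflection_measure e \<gamma>. P \<eta>"
  unfolding reflection_measure_def
proof (subst AE_density)
  show "(\<lambda>u. ennreal (\<gamma> u) * indicator (half_sphere e) u) \<in> borel_measurable sphere_measure"
    using density_meas by (simp cong: measurable_cong_sets)
  show "AE x in sphere_measure. 0 < ennreal (\<gamma> x) * indicator (half_sphere e) x \<longrightarrow> P x"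
    using assms by eventually_elim (auto simp: indicator_def)
qed

lemma reflection_lower_bound:
  assumes c: "0 < c"
  obtains k where "0 < k" "\<And>\<eta>. norm \<eta> = 1 \<Longrightarrow> c \<le> e \<bullet> \<eta> \<Longrightarrow> k \<le> \<gamma> \<eta>"
proof -
  define B where "B = sphere 0 1 \<inter> {\<eta>. c \<le> e \<bullet> \<eta>}"
  have "compact B" unfolding B_def
    by (intro compact_Int_closed compact_sphere closed_Collect_le continuous_intros)
  moreover have Bh: "B \<subseteq> half_sphere e" using c by (auto simp: B_def half_sphere_def)
  ultimately have pos: "B \<noteq> {} \<Longrightarrow> 0 < (INF u\<in>B. \<gamma> u)" using dens by (simp add: reflection_density_def)
  have bb: "bdd_below (\<gamma> ` B)" using dens Bh by (auto simp: reflection_density_def intro!: bdd_belowI2[of _ 0])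
  show ?thesis
  proof (cases "B = {}")
    case True
    \<comment> \<open>The cap is empty once \<open>c\<close> exceeds the norm of \<open>e\<close>;
      any positive constant then works.\<close>
    then show ?thesis by (intro that[of 1]) (auto simp: B_def)
  next
    case False
    show ?thesis by (rule that[OF pos[OF False]], rule cINF_lower[OF bb]) (simp add: B_def)
  qed
qed

text \<open>As \<open>refl x\<close> is orthogonal and sends \<open>e\<close> to the inner normal,
  the normal component of \<open>refl x \<eta>\<close> is \<open>e \<bullet> \<eta>\<close>. So the
  cap of directions away from the tangent plane at \<open>x\<close> pulls back to one compact cap
  around \<open>e\<close>, the same for all \<open>x\<close>, where \<open>\<gamma>\<close> is
  bounded below; and rotation invariance of surface measure transfers null sets.\<close>

lemma stochastic_table: "stochastic_table D Rt (inner_normal D) refl (reflection_measure e \<gamma>)"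
proof -
  interpret billiard_table D Rt "inner_normal D" by (rule billiard_domain_imp_table[OF dom bdd])
  have sl[measurable_cong]: "sets (reflection_measure e \<gamma>) = sets borel" by (simp add: reflection_measure_def)
  have refl1[measurable]: "refl x \<in> borel_measurable borel" for x
  proof -
    have "(\<lambda>y. (x, y)) \<in> measurable borel (borel \<Otimes>\<^sub>M borel)" by measurable
    from measurable_compose[OF this refl_meas] show ?thesis unfolding fst_conv snd_conv .
  qed
  have ip: "inner_normal D x \<bullet> refl x \<eta> = e \<bullet> \<eta>" if x: "x \<in> Rt" for x \<eta>
    using refl_orthogonal[OF x] unfolding refl_e[OF x, symmetric] orthogonal_transformation_def by blast
  have nm: "norm (refl x \<eta>) = norm \<eta>" if x: "x \<in> Rt" for x \<eta>
    using refl_orthogonal[OF x] by (rule orthogonal_transformation_norm)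
  show ?thesis
  proof (rule stochastic_table.intro, rule billiard_domain_imp_table[OF dom bdd], rule stochastic_table_axioms.intro)
    have "emeasure (reflection_measure e \<gamma>) (space (reflection_measure e \<gamma>)) = (\<integral>\<^sup>+\<eta>. 1 \<partial>reflection_measure e \<gamma>)" by simp
    also have "\<dots> = 1" using dens by (subst nn_integral_reflection_measure) (auto simp: reflection_density_def)
    finally show "prob_space (reflection_measure e \<gamma>)" by (rule prob_spaceI)
    show "sets (reflection_measure e \<gamma>) = sets borel" by (rule sl)
    show "(\<lambda>p. refl (fst p) (snd p)) \<in> borel_measurable (borel \<Otimes>\<^sub>M borel)" by (rule refl_meas)
    fix x assume x: "x \<in> Rt"
    show "AE \<eta> in reflection_measure e \<gamma>. norm (refl x \<eta>) = 1 \<and> 0 < inner_normal D x \<bullet> refl x \<eta>"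
      by (rule AE_reflection_measure) (auto simp: ip[OF x] nm[OF x] half_sphere_def)
    fix P :: "'m space \<Rightarrow> bool" assume "AE u in sphere_measure. P u"
    from AE_E[OF this] obtain N where N: "{u \<in> space sphere_measure. \<not> P u} \<subseteq> N" "emeasure sphere_measure N = 0" "N \<in> sets sphere_measure" .
    have Nb[measurable]: "N \<in> sets borel" using N(3) by simp
    have "(\<integral>\<^sup>+u. indicator N (refl x u) \<partial>sphere_measure) = (\<integral>\<^sup>+u. indicator N u \<partial>sphere_measure)"
      by (rule nn_integral_sphere_measure_orthogonal[OF _ refl_orthogonal[OF x]]) measurable
    also have "\<dots> = 0" using N by simp
    finally have "AE u in sphere_measure. (indicator N (refl x u) :: ennreal) = 0"
      by (subst (asm) nn_integral_0_iff_AE) measurable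
    then have "AE u in sphere_measure. P (refl x u)"
      by eventually_elim (use N(1) in \<open>auto simp: indicator_def sets_eq_imp_space_eq[OF sets_sphere_measure] split: if_splits\<close>)
    then show "AE \<eta> in reflection_measure e \<gamma>. P (refl x \<eta>)" by (intro AE_reflection_measure) auto
  next
    fix c :: real assume "0 < c"
    then obtain k where k: "0 < k" "\<And>\<eta>. norm \<eta> = 1 \<Longrightarrow> c \<le> e \<bullet> \<eta> \<Longrightarrow> k \<le> \<gamma> \<eta>" by (rule reflection_lower_bound) (rule that)
    have "ennreal k * (\<integral>\<^sup>+u. g u * indicator {u. norm u = 1 \<and> c \<le> inner_normal D x \<bullet> u} u \<partial>sphere_measure) \<le> (\<integral>\<^sup>+\<eta>. g (refl x \<eta>) \<partial>reflection_measure e \<gamma>)"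
      if x: "x \<in> Rt" and g[measurable]: "g \<in> borel_measurable borel" for x g
    proof -
      have "(\<integral>\<^sup>+u. g u * indicator {u. norm u = 1 \<and> c \<le> inner_normal D x \<bullet> u} u \<partial>sphere_measure) =
         (\<integral>\<^sup>+u. g (refl x u) * indicator {u. norm u = 1 \<and> c \<le> inner_normal D x \<bullet> u} (refl x u) \<partial>sphere_measure)"
        by (rule nn_integral_sphere_measure_orthogonal[OF _ refl_orthogonal[OF x], symmetric]) measurable
      then have "ennreal k * (\<integral>\<^sup>+u. g u * indicator {u. norm u = 1 \<and> c \<le> inner_normal D x \<bullet> u} u \<partial>sphere_measure) =
         (\<integral>\<^sup>+u. ennreal k * (g (refl x u) * indicator {u. norm u = 1 \<and> c \<le> inner_normal D x \<bullet> u} (refl x u)) \<partial>sphere_measure)"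
        by (simp only:) (rule nn_integral_cmult[symmetric], measurable)
      also have "\<dots> \<le> (\<integral>\<^sup>+u. ennreal (\<gamma> u) * indicator (half_sphere e) u * g (refl x u) \<partial>sphere_measure)"
      proof (rule nn_integral_mono)
        fix u
        show "ennreal k * (g (refl x u) * indicator {u. norm u = 1 \<and> c \<le> inner_normal D x \<bullet> u} (refl x u)) \<le> ennreal (\<gamma> u) * indicator (half_sphere e) u * g (refl x u)"
        proof (cases "norm u = 1 \<and> c \<le> e \<bullet> u")
          case True
          then have "u \<in> half_sphere e" using \<open>0 < c\<close> by (auto simp: half_sphere_def)
          then show ?thesis using True k(2)[of u] by (simp add: ip[OF x] nm[OF x] mult_right_mono ennreal_leI)
        qed (auto simp: ip[OF x] nm[OF x] indicator_def)
      qed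
      also have "\<dots> = (\<integral>\<^sup>+\<eta>. g (refl x \<eta>) \<partial>reflection_measure e \<gamma>)"
        by (rule nn_integral_reflection_measure[symmetric]) measurable
      finally show ?thesis .
    qed
    then show "\<exists>k>0. \<forall>x\<in>Rt. \<forall>g\<in>borel_measurable borel. ennreal k * (\<integral>\<^sup>+u. g u * indicator {u. norm u = 1 \<and> c \<le> inner_normal D x \<bullet> u} u \<partial>sphere_measure) \<le> (\<integral>\<^sup>+\<eta>. g (refl x \<eta>) \<partial>reflection_measure e \<gamma>)"
      using k(1) by blast
  qed
qed

sublocale stochastic_table D Rt "inner_normal D" refl "reflection_measure e \<gamma>"
  by (rule stochastic_table)

lemma boundary_billiard_eq_traj:
  assumes g: "good_path x \<eta>" and t: "0 \<le> t"
  shows "boundary_billiard D U x \<eta> t = traj x \<eta> t"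
proof -
  have f: "pt x \<eta> n \<in> frontier D" for n using g Rt_sub by (auto simp: good_path_def good_def)
  have u: "blinfun_apply (U (pt x \<eta> n)) (\<eta> n) = refl (pt x \<eta> n) (\<eta> n)" for n
    unfolding refl_def[of "pt x \<eta> n" "\<eta> n"] using f by (rule if_P[symmetric])
  have p: "bounce_point D U x \<eta> n = pt x \<eta> n" for n
    by (induction n) (simp_all add: nxt_def u)
  have d: "bounce_dir D U x \<eta> n = refl (pt x \<eta> n) (\<eta> n)" for n by (simp add: bounce_dir_def p u)
  have tm: "bounce_time D U x \<eta> n = tm x \<eta> n" for n by (simp add: bounce_time_def tm_def p d len_def)
  obtain n where n: "at_leg x \<eta> t n" using good_path_leg[OF g t] by blast
  have "(THE n. bounce_time D U x \<eta> n \<le> t \<and> t < bounce_time D U x \<eta> (Suc n)) = n"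
    unfolding tm at_leg_def[symmetric] using good_path_leg[OF g t] n by (rule the1_equality)
  then show ?thesis using good_path_traj[OF g t n] by (simp add: boundary_billiard_def p d tm Let_def)
qed

section \<open>Arbitrary initial laws and the exponential rate\<close>

lemma first_time_bounds:
  assumes "fst s \<in> D \<and> norm (snd s) = 1 \<or> fst s \<in> frontier D"
  shows "0 \<le> first_time D s" "first_time D s \<le> diam"
proof -
  have "0 \<le> first_time D s \<and> first_time D s \<le> diam"
  proof (cases "fst s \<in> D")
    case True
    then have u: "norm (snd s) = 1" using assms frontier_not_D[of "fst s"] by blast
    obtain \<delta> where \<delta>: "0 < \<delta>" "ball (fst s) \<delta> \<subseteq> D" using D_open True by (auto simp: open_contains_ball)
    have st: "fst s + t *\<^sub>R snd s \<in> D" if "0 < t" "t < \<delta>" for t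
      using that \<delta> u by (intro subsetD[OF \<delta>(2)]) (auto simp: dist_norm)
    obtain T where T: "0 < T" "fst s + T *\<^sub>R snd s \<notin> D" using exit_ex[OF u] .
    note h = hit_time_props[OF D_open \<delta>(1) st T]
    have pos: "0 < hit_time D (fst s) (snd s)" using h(1) \<delta> by simp
    have "dist (fst s) (hit_point D (fst s) (snd s)) = hit_time D (fst s) (snd s)"
      using u pos by (simp add: hit_point_def dist_norm)
    moreover have "fst s \<in> closure D" "hit_point D (fst s) (snd s) \<in> closure D"
      using True closure_subset h(3) by (auto simp: frontier_def)
    ultimately have "hit_time D (fst s) (snd s) \<le> diam" using dist_le_diam by metis
    then show ?thesis using True pos by (simp add: first_time_def)
  qed (use diam_pos in \<open>simp add: first_time_def\<close>)
  then show "0 \<le> first_time D s" "first_time D s \<le> diam" by auto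
qed

text \<open>Conditioning on the initial state. From time \<open>diam\<close> on the initial flight
  is over, so the law is a mixture of laws of boundary trajectories with reduced time.\<close>

lemma billiard_law_mixture:
  assumes \<mu>: "initial_law D Rt \<mu>" and t: "diam \<le> t" and A: "A \<in> sets borel"
  shows "ennreal (measure (billiard_law D e \<gamma> U \<mu> t) A) =
    (\<integral>\<^sup>+s. ennreal (measure (traj_law (first_point D s) (t - first_time D s)) A) \<partial>\<mu>)"
    and "(\<lambda>s. measure (traj_law (first_point D s) (t - first_time D s)) A) \<in> borel_measurable \<mu>"
proof -
  have "prob_space \<mu>" and s\<mu>: "sets \<mu> = sets borel" using \<mu> by (auto simp: initial_law_def)
  then have sm[measurable_cong]: "sets \<mu> = sets (borel \<Otimes>\<^sub>M borel)" by (simp only: borel_prod)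
  interpret \<mu>: prob_space \<mu> by fact
  interpret pair_prob_space \<mu> seqs ..
  have ft[measurable]: "first_time D \<in> borel_measurable \<mu>" unfolding first_time_def by measurable
  have fp[measurable]: "first_point D \<in> borel_measurable \<mu>" unfolding first_point_def by measurable
  have comp: "(\<lambda>p. snd p n) \<in> borel_measurable (\<mu> \<Otimes>\<^sub>M seqs)" for n
    by (rule measurable_compose[OF measurable_snd seq_component])
  define Y where "Y p = traj (first_point D (fst p)) (snd p) (t - first_time D (fst p))" for p
  have Y: "Y \<in> borel_measurable (\<mu> \<Otimes>\<^sub>M seqs)"
    unfolding Y_def
    apply (rule traj_meas)
    subgoal by measurable
    subgoal by (rule comp)
    subgoal by measurable
    done
  define G where "G p \<longleftrightarrow> 0 \<le> first_time D (fst p) \<and> first_time D (fst p) \<le> diam \<and> good_path (first_point D (fst p)) (snd p)" for p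
  have gp: "Measurable.pred (\<mu> \<Otimes>\<^sub>M seqs) (\<lambda>p. good_path (first_point D (fst p)) (snd p))"
    by (rule good_path_meas[OF _ comp]) measurable
  then have G: "Measurable.pred (\<mu> \<Otimes>\<^sub>M seqs) G" unfolding G_def by measurable
  have "AE s in \<mu>. (fst s \<in> D \<and> norm (snd s) = 1 \<or> fst s \<in> frontier D) \<and> first_point D s \<in> Rt"
    using \<mu> by (simp add: initial_law_def)
  then have "AE s in \<mu>. AE \<eta> in seqs. G (s, \<eta>)"
  proof eventually_elim
    case (elim s)
    then show ?case using good_path_AE[of "first_point D s"] first_time_bounds[of s] by (simp add: G_def)
  qed
  then have "AE p in \<mu> \<Otimes>\<^sub>M seqs. G p" using G by (intro AE_pair_measure) (auto simp: pred_def)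
  then have "AE p in \<mu> \<Otimes>\<^sub>M seqs. (case p of (s, \<eta>) \<Rightarrow> billiard D U s \<eta> t) = Y p"
  proof eventually_elim
    case (elim p)
    have "boundary_billiard D U (first_point D (fst p)) (snd p) (t - first_time D (fst p)) = Y p"
      unfolding Y_def using elim t by (intro boundary_billiard_eq_traj) (auto simp: G_def)
    then show ?case using elim t by (simp add: G_def billiard_def split_beta')
  qed
  from distr_completion_eq_distr[OF Y this]
  have eq: "billiard_law D e \<gamma> U \<mu> t = distr (\<mu> \<Otimes>\<^sub>M seqs) borel Y" by (simp add: billiard_law_def)
  interpret d: prob_space "distr (\<mu> \<Otimes>\<^sub>M seqs) borel Y" by (rule prob_space_distr[OF Y])
  have AY: "(\<lambda>p. indicator A (Y p) :: ennreal) \<in> borel_measurable (\<mu> \<Otimes>\<^sub>M seqs)"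
    by (rule measurable_compose[OF Y borel_measurable_indicator[OF A]])
  have "ennreal (measure (billiard_law D e \<gamma> U \<mu> t) A) = (\<integral>\<^sup>+y. indicator A y \<partial>distr (\<mu> \<Otimes>\<^sub>M seqs) borel Y)"
    unfolding eq using A by (simp add: d.emeasure_eq_measure)
  also have "\<dots> = (\<integral>\<^sup>+p. indicator A (Y p) \<partial>(\<mu> \<Otimes>\<^sub>M seqs))" using A Y by (intro nn_integral_distr) auto
  also have "\<dots> = (\<integral>\<^sup>+s. (\<integral>\<^sup>+\<eta>. indicator A (Y (s, \<eta>)) \<partial>seqs) \<partial>\<mu>)" by (rule seqs.nn_integral_fst[symmetric, OF AY])
  also have "\<dots> = (\<integral>\<^sup>+s. ennreal (measure (traj_law (first_point D s) (t - first_time D s)) A) \<partial>\<mu>)"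
    by (simp add: Y_def ennreal_traj_law[OF A])
  finally show "ennreal (measure (billiard_law D e \<gamma> U \<mu> t) A) =
    (\<integral>\<^sup>+s. ennreal (measure (traj_law (first_point D s) (t - first_time D s)) A) \<partial>\<mu>)" .
  show "(\<lambda>s. measure (traj_law (first_point D s) (t - first_time D s)) A) \<in> borel_measurable \<mu>"
    by (rule traj_law_meas[OF A fp]) measurable
qed

lemma exponential_ergodicity:
  "\<exists>\<nu> :: ('m space \<times> 'm space) measure. \<exists>\<beta>\<^sub>0 \<beta>\<^sub>1 :: real.
    prob_space \<nu> \<and> sets \<nu> = sets borel \<and> emeasure \<nu> (D \<times> sphere 0 1) = 1 \<and>
    0 < \<beta>\<^sub>0 \<and> 0 < \<beta>\<^sub>1 \<and>
    (\<forall>\<mu>. initial_law D Rt \<mu> \<longrightarrow>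
      (\<forall>t \<ge> 0.
        total_variation_norm borel (\<lambda>A. measure (billiard_law D e \<gamma> U \<mu> t) A - measure \<nu> A)
        \<le> \<beta>\<^sub>0 * exp (- \<beta>\<^sub>1 * t)))"
proof -
  obtain \<nu> T0 q where \<nu>: "prob_space \<nu>" "sets \<nu> = sets borel" "emeasure \<nu> (D \<times> sphere 0 1) = 1"
    and T0: "0 < T0" and q: "0 < q" "q < 1"
    and conv: "\<And>x s (k::nat) A. x \<in> Rt \<Longrightarrow> real k * T0 \<le> s \<Longrightarrow> A \<in> sets borel \<Longrightarrow> \<bar>measure (traj_law x s) A - measure \<nu> A\<bar> \<le> (1 - q) ^ k"
    by (rule stationary_law) (rule that)
  interpret \<nu>: prob_space \<nu> by fact
  \<comment> \<open>Chosen so that \<open>(1 - q) ^ k = exp (- \<beta>1 * (k * T0))\<close>.\<close>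
  define \<beta>1 where "\<beta>1 = - ln (1 - q) / T0"
  have \<beta>1: "0 < \<beta>1" using q T0 by (simp add: \<beta>1_def divide_neg_pos ln_less_zero)
  \<comment> \<open>The 2 comes from passing from single sets to total variation,
    \<open>diam\<close> from the initial flight, and \<open>T0\<close> from rounding the elapsed
    time down to a multiple of \<open>T0\<close>.\<close>
  define \<beta>0 where "\<beta>0 = 2 * exp (\<beta>1 * (diam + T0))"
  have "total_variation_norm borel (\<lambda>A. measure (billiard_law D e \<gamma> U \<mu> t) A - measure \<nu> A) \<le> \<beta>0 * exp (- \<beta>1 * t)"
    if \<mu>: "initial_law D Rt \<mu>" and t: "0 \<le> t" for \<mu> t
  proof -
    have "prob_space \<mu>" using \<mu> by (auto simp: initial_law_def)
    then interpret \<mu>: prob_space \<mu> .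
    interpret pair_prob_space \<mu> seqs ..
    let ?B = "billiard_law D e \<gamma> U \<mu> t"
    have sB: "sets ?B = sets borel" by (simp add: billiard_law_def)
    have "prob_space (completion (\<mu> \<Otimes>\<^sub>M seqs))" by (rule prob_space_completion)
    then have B1: "emeasure ?B A \<le> 1" for A unfolding billiard_law_def by (rule distr_subprob)
    have fB: "finite_measure ?B" using B1[of "space ?B"] by (intro finite_measureI) (auto simp: top_unique)
    interpret B: finite_measure ?B by (rule fB)
    have bound: "\<bar>measure ?B A - measure \<nu> A\<bar> \<le> exp (\<beta>1 * (diam + T0)) * exp (- \<beta>1 * t)" if A: "A \<in> sets borel" for A
    proof (cases "t < diam")
      \<comment> \<open>Measures of mass at most 1 differ by at most 1 on any set, and up to time
        \<open>diam\<close> the claimed bound is at least that.\<close>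
      case True
      have "measure ?B A \<le> 1" using B1[of A] by (simp add: B.emeasure_eq_measure)
      then have "\<bar>measure ?B A - measure \<nu> A\<bar> \<le> 1" using \<nu>.prob_le_1[of A] measure_nonneg[of "?B" A] measure_nonneg[of \<nu> A] by linarith
      also have "1 \<le> exp (\<beta>1 * (diam + T0 - t))" using True T0 \<beta>1 by simp
      also have "\<dots> = exp (\<beta>1 * (diam + T0)) * exp (- \<beta>1 * t)" by (simp add: exp_add[symmetric] algebra_simps)
      finally show ?thesis .
    next
      case False
      \<comment> \<open>The number of full periods \<open>T0\<close> certainly left after an initial
        flight of length at most \<open>diam\<close>.\<close>
      define k where "k = nat \<lfloor>(t - diam) / T0\<rfloor>"
      have fl: "real k \<le> (t - diam) / T0" "(t - diam) / T0 < real k + 1"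
        using False T0 by (auto simp: k_def of_nat_nat)
      have kT: "real k * T0 \<le> t - diam" using fl(1) T0 by (simp add: field_simps)
      define f where "f s = measure (traj_law (first_point D s) (t - first_time D s)) A" for s
      have f: "ennreal (measure ?B A) = (\<integral>\<^sup>+s. ennreal (f s) \<partial>\<mu>)" "f \<in> borel_measurable \<mu>"
        unfolding f_def using False by (auto intro!: billiard_law_mixture[OF \<mu> _ A])
      have f01: "0 \<le> f s" "f s \<le> 1" for s by (auto simp: f_def prob_space.prob_le_1[OF prob_traj_law])
      have fi: "integrable \<mu> f" using f(2) f01 by (intro \<mu>.integrable_const_bound[of _ 1]) auto
      have "ennreal (measure ?B A) = ennreal (\<integral>s. f s \<partial>\<mu>)" unfolding f(1) using fi f01 by (intro nn_integral_eq_integral) auto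
      then have Bf: "measure ?B A = (\<integral>s. f s \<partial>\<mu>)" using f01 by (simp add: integral_nonneg_AE)
      have "AE s in \<mu>. (fst s \<in> D \<and> norm (snd s) = 1 \<or> fst s \<in> frontier D) \<and> first_point D s \<in> Rt"
        using \<mu> by (simp add: initial_law_def)
      then have ae: "AE s in \<mu>. \<bar>f s - measure \<nu> A\<bar> \<le> (1 - q) ^ k"
      proof eventually_elim
        case (elim s)
        then show ?case unfolding f_def using first_time_bounds[of s] kT by (intro conv A) auto
      qed
      have "(\<integral>s. f s \<partial>\<mu>) \<le> measure \<nu> A + (1 - q) ^ k" using ae by (intro \<mu>.integral_le_const fi) (auto elim!: eventually_mono)
      moreover have "measure \<nu> A - (1 - q) ^ k \<le> (\<integral>s. f s \<partial>\<mu>)" using ae by (intro \<mu>.integral_ge_const fi) (auto elim!: eventually_mono)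
      ultimately have "\<bar>measure ?B A - measure \<nu> A\<bar> \<le> (1 - q) ^ k" unfolding Bf by linarith
      also have "(1 - q) ^ k = exp (k * ln (1 - q))" using q by (simp add: exp_of_nat_mult)
      also have "\<dots> \<le> exp (((t - diam) / T0 - 1) * ln (1 - q))"
        using fl(2) q by (simp add: mult_right_mono_neg less_imp_le)
      also have "((t - diam) / T0 - 1) * ln (1 - q) = \<beta>1 * (diam + T0) + - \<beta>1 * t"
        using T0 by (simp add: \<beta>1_def field_simps)
      finally show ?thesis by (simp only: exp_add)
    qed
    have "total_variation_norm borel (\<lambda>A. measure ?B A - measure \<nu> A) \<le> 2 * (exp (\<beta>1 * (diam + T0)) * exp (- \<beta>1 * t))"
      by (rule total_variation_norm_le[OF fB \<nu>.finite_measure_axioms sB \<nu>(2) bound])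
    then show ?thesis by (simp add: \<beta>0_def mult.assoc)
  qed
  then show ?thesis using \<nu> \<beta>1
    by (intro exI[of _ \<nu>] exI[of _ \<beta>0] exI[of _ \<beta>1]) (auto simp: \<beta>0_def)
qed

end

theorem theorem2p2:
  fixes D Rt :: "'m::finite space set"
    and i :: 'm
    and \<gamma> :: "'m space \<Rightarrow> real"
    and U :: "'m space \<Rightarrow> 'm space \<Rightarrow>\<^sub>L 'm space"
  assumes "billiard_domain D Rt"
    and "bounded D"
    and "reflection_density (e_vec i) \<gamma>"
    and "reflection_frame D Rt (e_vec i) \<gamma> U"
  shows "\<exists>\<nu> :: ('m space \<times> 'm space) measure. \<exists>\<beta>\<^sub>0 \<beta>\<^sub>1 :: real.
    prob_space \<nu> \<and> sets \<nu> = sets borel \<and> emeasure \<nu> (D \<times> sphere 0 1) = 1 \<and>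
    0 < \<beta>\<^sub>0 \<and> 0 < \<beta>\<^sub>1 \<and>
    (\<forall>\<mu>. initial_law D (regular_points D Rt (e_vec i) \<gamma> U) \<mu> \<longrightarrow>
      (\<forall>t \<ge> 0.
        total_variation_norm borel
          (\<lambda>A. measure (billiard_law D (e_vec i) \<gamma> U \<mu> t) A - measure \<nu> A)
        \<le> \<beta>\<^sub>0 * exp (- \<beta>\<^sub>1 * t)))"
proof -
  interpret reflected_billiard D Rt "e_vec i" \<gamma> U by unfold_locales fact+
  have "initial_law D Rt \<mu>" if "initial_law D (regular_points D Rt (e_vec i) \<gamma> U) \<mu>" for \<mu>
  proof -
    have sub: "regular_points D Rt (e_vec i) \<gamma> U \<subseteq> Rt" by (auto simp: regular_points_def)
    have "AE s in \<mu>. (fst s \<in> D \<and> norm (snd s) = 1 \<or> fst s \<in> frontier D) \<and> first_point D s \<in> regular_points D Rt (e_vec i) \<gamma> U"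
      using that by (simp add: initial_law_def)
    then have "AE s in \<mu>. (fst s \<in> D \<and> norm (snd s) = 1 \<or> fst s \<in> frontier D) \<and> first_point D s \<in> Rt"
      by eventually_elim (use sub in blast)
    then show ?thesis using that by (simp add: initial_law_def)
  qed
  then show ?thesis using exponential_ergodicity by meson
qed

end
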